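(* Let $S^2,T^2\subset\mathbb{R}^3$ be the standard embedded sphere and torus, and let $p\in\mathbb{R}^3$ be a point lying neither on $S^2$ or $T^2$ nor in the regions they bound, and such that $f_1^p:S^2\to\mathbb{R}$, $x\mapsto\|x-p\|^2$ and $f_2^p:T^2\to\mathbb{R}$, $y\mapsto\|y-p\|^2$ are Morse functions. Let $X_1,X_2$ be pseudo-gradients adapted to $f_1^p,f_2^p$ satisfying the Smale condition, and equip $S^2\times T^2$ with the function $f_1^p+f_2^p$, $(x,y)\mapsto\|x-p\|^2+\|y-p\|^2$, and the pseudo-gradient $(X_1,X_2)$. Then the Morse homology of $S^2\times T^2$ with integer coefficients is $$HM_k(S^2\times T^2,f_1^p+f_2^p,\mathbb{Z})\cong\begin{cases}\mathbb{Z}\otimes\mathbb{Z} & k\in\{0,4\},\\ (\mathbb{Z}\otimes\mathbb{Z})\oplus(\mathbb{Z}\otimes\mathbb{Z}) & k\in\{1,2,3\},\\ 0&\text{otherwise.}\end{cases}$$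
   Context: For a Morse–Smale pair $(f,X)$ on a compact manifold $M$ ($f$ Morse, $X$ an adapted pseudo-gradient whose stable and unstable manifolds $W^s,W^u$ intersect transversally), choose an orientation of every unstable manifold. The Morse complex is $CM_k(M,f)=\bigoplus_{\xi\in\mathrm{Crit}_k(f)}\mathbb{Z}\,\xi$, where $\mathrm{Crit}_k(f)$ is the set of critical points of index $k$, with boundary operator $\partial_k\xi=\sum_{\gamma\in\mathrm{Crit}_{k-1}(f)}N(\xi,\gamma)\gamma$, $N(\xi,\gamma)=\sum_u n_u$. The sum is over the finitely many flow lines $u$ of $X$ from $\xi$ to $\gamma$ modulo time translation, and $n_u\in\{\pm1\}$ is the sign comparing the induced orientation of the component of $W^u(\xi)\cap W^s(\gamma)$ containing $u$ with the flow direction. The induced orientation is determined by $TW^u(\xi)|\cong T(W^u(\xi)\cap W^s(\gamma))\oplus NW^s(\gamma)|$, where $NW^s(\gamma)$ is oriented by $N_\gamma W^s(\gamma)\cong T_\gamma W^u(\gamma)$. Then $HM_k=\ker\partial_k/\mathrm{Im}\,\partial_{k+1}$. Tensor products are over $\mathbb{Z}$. *)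

theory Defs
  imports
    "HOL-Analysis.Analysis"
    "HOL-Algebra.Free_Abelian_Groups"
    "Jordan_Normal_Form.Determinant"
begin

no_notation vec_index (infixl \<open>$\<close> 100)

section \<open>Smooth maps, curves and tangent spaces\<close>

text \<open>
  Manifolds are embedded submanifolds of a Euclidean space \<^typ>\<open>'a\<close>, given as subsets.
  Functions and vector fields on a manifold \<open>M\<close> are functions on all of \<^typ>\<open>'a\<close>, of which
  only the values on \<open>M\<close> are used.
\<close>

text \<open>Meant for open \<open>U\<close>.\<close>

fun Ck_on :: "nat \<Rightarrow> 'a::euclidean_space set \<Rightarrow> ('a \<Rightarrow> 'b::euclidean_space) \<Rightarrow> bool" where
  "Ck_on 0 U f \<longleftrightarrow> continuous_on U f"
| "Ck_on (Suc k) U f \<longleftrightarrow>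
     (\<forall>x\<in>U. f differentiable (at x)) \<and> (\<forall>v. Ck_on k U (\<lambda>x. frechet_derivative f (at x) v))"

definition smooth_on :: "'a::euclidean_space set \<Rightarrow> ('a \<Rightarrow> 'b::euclidean_space) \<Rightarrow> bool" where
  "smooth_on U f \<longleftrightarrow> (\<forall>k. Ck_on k U f)"

text \<open>Smoothness on an arbitrary subset: local extendability to smooth maps on open sets.\<close>

definition smooth_map_on :: "'a::euclidean_space set \<Rightarrow> ('a \<Rightarrow> 'b::euclidean_space) \<Rightarrow> bool" where
  "smooth_map_on M f \<longleftrightarrow>
     (\<forall>x\<in>M. \<exists>U g. open U \<and> x \<in> U \<and> smooth_on U g \<and> (\<forall>y\<in>M \<inter> U. g y = f y))"

definition diffeomorphism ::
  "'a::euclidean_space set \<Rightarrow> 'b::euclidean_space set \<Rightarrow> ('a \<Rightarrow> 'b) \<Rightarrow> ('b \<Rightarrow> 'a) \<Rightarrow> bool" where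
  "diffeomorphism U V \<phi> \<psi> \<longleftrightarrow>
     open U \<and> open V \<and> homeomorphism U V \<phi> \<psi> \<and> smooth_on U \<phi> \<and> smooth_on V \<psi>"

text \<open>\<open>c\<close> is a germ at \<open>0\<close> of a smooth curve in \<open>M\<close> through \<open>x\<close> with velocity \<open>v\<close>.\<close>

definition curve_in :: "'a::euclidean_space set \<Rightarrow> 'a \<Rightarrow> 'a \<Rightarrow> (real \<Rightarrow> 'a) \<Rightarrow> bool" where
  "curve_in M x v c \<longleftrightarrow>
     (\<exists>e>0. smooth_on {-e<..<e} c \<and> c ` {-e<..<e} \<subseteq> M) \<and>
     c 0 = x \<and> (c has_vector_derivative v) (at 0)"

definition tangent_space :: "'a::euclidean_space set \<Rightarrow> 'a \<Rightarrow> 'a set" where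
  "tangent_space M x = {v. \<exists>c. curve_in M x v c}"

definition differential ::
  "'a::euclidean_space set \<Rightarrow> ('a \<Rightarrow> real) \<Rightarrow> 'a \<Rightarrow> 'a \<Rightarrow> real" where
  "differential M f x v =
     (THE d. \<exists>c. curve_in M x v c \<and> ((\<lambda>t. f (c t)) has_real_derivative d) (at 0))"

section \<open>Morse functions\<close>

definition critical_points :: "'a::euclidean_space set \<Rightarrow> ('a \<Rightarrow> real) \<Rightarrow> 'a set" where
  "critical_points M f = {x \<in> M. \<forall>v\<in>tangent_space M x. differential M f x v = 0}"

text \<open>
  The Hessian at a critical point, as the mixed second derivative of \<open>f \<circ> \<sigma>\<close> for a smooth
  \<open>\<sigma> : \<real>\<^sup>2 \<supseteq> U \<rightarrow> M\<close> with \<open>\<sigma>(0,0) = x\<close> and partial derivatives \<open>v\<close> and \<open>w\<close> at the origin. The value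
  does not depend on \<open>\<sigma>\<close> since \<open>x\<close> is critical.
\<close>

definition hessian ::
  "'a::euclidean_space set \<Rightarrow> ('a \<Rightarrow> real) \<Rightarrow> 'a \<Rightarrow> 'a \<Rightarrow> 'a \<Rightarrow> real" where
  "hessian M f x v w =
     (THE h. \<exists>(\<sigma> :: real \<times> real \<Rightarrow> 'a) U.
        open U \<and> (0, 0) \<in> U \<and> smooth_on U \<sigma> \<and> \<sigma> ` U \<subseteq> M \<and> \<sigma> (0, 0) = x \<and>
        frechet_derivative \<sigma> (at (0, 0)) (1, 0) = v \<and>
        frechet_derivative \<sigma> (at (0, 0)) (0, 1) = w \<and>
        h = deriv (\<lambda>s. deriv (\<lambda>t. f (\<sigma> (s, t))) 0) 0)"

definition nondegenerate_critical_point ::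
  "'a::euclidean_space set \<Rightarrow> ('a \<Rightarrow> real) \<Rightarrow> 'a \<Rightarrow> bool" where
  "nondegenerate_critical_point M f x \<longleftrightarrow>
     x \<in> critical_points M f \<and>
     (\<forall>v\<in>tangent_space M x. (\<forall>w\<in>tangent_space M x. hessian M f x v w = 0) \<longrightarrow> v = 0)"

definition morse_function :: "'a::euclidean_space set \<Rightarrow> ('a \<Rightarrow> real) \<Rightarrow> bool" where
  "morse_function M f \<longleftrightarrow>
     smooth_map_on M f \<and> (\<forall>x\<in>critical_points M f. nondegenerate_critical_point M f x)"

definition morse_index :: "'a::euclidean_space set \<Rightarrow> ('a \<Rightarrow> real) \<Rightarrow> 'a \<Rightarrow> nat" where
  "morse_index M f x =
     Max (dim ` {E. subspace E \<and> E \<subseteq> tangent_space M x \<and> (\<forall>v\<in>E - {0}. hessian M f x v v < 0)})"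

text \<open>The degree is an integer so that there is no special case for \<open>Crit\<^sub>k\<^sub>-\<^sub>1\<close> at \<open>k = 0\<close>.\<close>

definition crit_index :: "'a::euclidean_space set \<Rightarrow> ('a \<Rightarrow> real) \<Rightarrow> int \<Rightarrow> 'a set" where
  "crit_index M f k = {x \<in> critical_points M f. int (morse_index M f x) = k}"

section \<open>Pseudo-gradients and the Smale condition\<close>

text \<open>
  A pseudo-gradient adapted to \<open>f\<close>: \<open>df(X) \<le> 0\<close> with equality exactly at the critical points,
  and near each critical point there is a Morse chart, i.e. coordinates with
  \<open>f = f(a) - |u|\<^sup>2 + |v|\<^sup>2\<close>, in which \<open>X\<close> is the negative gradient \<open>(2u, -2v)\<close> for the
  canonical metric. Coordinates on \<open>M\<close> near \<open>a\<close> are given by a diffeomorphism \<open>\<psi>\<close> of open subsets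
  of the ambient space which maps an open part of a linear subspace \<open>E\<^sub>- \<oplus> E\<^sub>+\<close> onto an open part
  of \<open>M\<close>.
\<close>

definition morse_chart ::
  "'a::euclidean_space set \<Rightarrow> ('a \<Rightarrow> real) \<Rightarrow> 'a \<Rightarrow> 'a set \<Rightarrow> 'a set \<Rightarrow> 'a set \<Rightarrow> ('a \<Rightarrow> 'a) \<Rightarrow> bool" where
  "morse_chart M f a V Em Ep \<psi> \<longleftrightarrow>
     (\<exists>U \<phi>. diffeomorphism V U \<psi> \<phi> \<and> \<psi> ` (V \<inter> {u + v |u v. u \<in> Em \<and> v \<in> Ep}) = U \<inter> M) \<and>
     0 \<in> V \<and> \<psi> 0 = a \<and>
     subspace Em \<and> subspace Ep \<and> (\<forall>u\<in>Em. \<forall>v\<in>Ep. inner u v = 0) \<and>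
     (\<forall>u\<in>Em. \<forall>v\<in>Ep. u + v \<in> V \<longrightarrow> f (\<psi> (u + v)) = f a - (norm u)\<^sup>2 + (norm v)\<^sup>2)"

definition adapted_pseudo_gradient ::
  "'a::euclidean_space set \<Rightarrow> ('a \<Rightarrow> real) \<Rightarrow> ('a \<Rightarrow> 'a) \<Rightarrow> bool" where
  "adapted_pseudo_gradient M f X \<longleftrightarrow>
     smooth_map_on M X \<and>
     (\<forall>x\<in>M. X x \<in> tangent_space M x) \<and>
     (\<forall>x\<in>M. differential M f x (X x) \<le> 0) \<and>
     (\<forall>x\<in>M. differential M f x (X x) = 0 \<longleftrightarrow> x \<in> critical_points M f) \<and>
     (\<forall>a\<in>critical_points M f. \<exists>V Em Ep \<psi>. morse_chart M f a V Em Ep \<psi> \<and>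
        (\<forall>u\<in>Em. \<forall>v\<in>Ep. u + v \<in> V \<longrightarrow>
           X (\<psi> (u + v)) = frechet_derivative \<psi> (at (u + v)) (2 *\<^sub>R u - 2 *\<^sub>R v)))"

definition integral_curve ::
  "'a::euclidean_space set \<Rightarrow> ('a \<Rightarrow> 'a) \<Rightarrow> (real \<Rightarrow> 'a) \<Rightarrow> bool" where
  "integral_curve M X u \<longleftrightarrow> (\<forall>t. u t \<in> M \<and> (u has_vector_derivative X (u t)) (at t))"

definition unstable_manifold :: "'a::euclidean_space set \<Rightarrow> ('a \<Rightarrow> 'a) \<Rightarrow> 'a \<Rightarrow> 'a set" where
  "unstable_manifold M X a = {x. \<exists>u. integral_curve M X u \<and> u 0 = x \<and> (u \<longlongrightarrow> a) at_bot}"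

definition stable_manifold :: "'a::euclidean_space set \<Rightarrow> ('a \<Rightarrow> 'a) \<Rightarrow> 'a \<Rightarrow> 'a set" where
  "stable_manifold M X a = {x. \<exists>u. integral_curve M X u \<and> u 0 = x \<and> (u \<longlongrightarrow> a) at_top}"

definition smale_condition ::
  "'a::euclidean_space set \<Rightarrow> ('a \<Rightarrow> real) \<Rightarrow> ('a \<Rightarrow> 'a) \<Rightarrow> bool" where
  "smale_condition M f X \<longleftrightarrow>
     (\<forall>a\<in>critical_points M f. \<forall>b\<in>critical_points M f.
      \<forall>x\<in>unstable_manifold M X a \<inter> stable_manifold M X b.
        {v + w |v w. v \<in> tangent_space (unstable_manifold M X a) x \<and>
                     w \<in> tangent_space (stable_manifold M X b) x} = tangent_space M x)"

section \<open>Orientations\<close>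

text \<open>\<open>bs\<close> is a list of vectors of \<open>V\<close> whose classes form an ordered basis of the quotient \<open>V/W\<close>.\<close>

definition basis_mod :: "'a::euclidean_space set \<Rightarrow> 'a set \<Rightarrow> 'a list \<Rightarrow> bool" where
  "basis_mod V W bs \<longleftrightarrow>
     set bs \<subseteq> V \<and>
     (\<forall>v\<in>V. \<exists>!c. length c = length bs \<and> v - sum_list (map2 (*\<^sub>R) c bs) \<in> W)"

text \<open>
  An orientation of \<open>V/W\<close> gives a sign to every ordered basis, and changes by the sign of the
  determinant under a change of basis. As a zero-dimensional space has the empty list as its only
  basis, it has exactly the two orientations \<open>\<plusminus>1\<close>.
\<close>

definition orientation_mod ::
  "'a::euclidean_space set \<Rightarrow> 'a set \<Rightarrow> ('a list \<Rightarrow> int) \<Rightarrow> bool" where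
  "orientation_mod V W \<omega> \<longleftrightarrow>
     (\<forall>bs. basis_mod V W bs \<longrightarrow> \<omega> bs \<in> {1, -1}) \<and>
     (\<forall>bs cs. \<forall>A\<in>carrier_mat (length bs) (length bs).
        basis_mod V W bs \<and> basis_mod V W cs \<and>
        (\<forall>j<length bs. cs ! j - (\<Sum>i<length bs. A $$ (i, j) *\<^sub>R bs ! i) \<in> W) \<longrightarrow>
        real_of_int (\<omega> cs) = sgn (Determinant.det A) * real_of_int (\<omega> bs))"

text \<open>Orientation of the quotient bundle with fibre \<open>V x/W x\<close> over \<open>x \<in> S\<close>.\<close>

definition bundle_orientation ::
  "'a::euclidean_space set \<Rightarrow> ('a \<Rightarrow> 'a set) \<Rightarrow> ('a \<Rightarrow> 'a set) \<Rightarrow> ('a \<Rightarrow> 'a list \<Rightarrow> int) \<Rightarrow> bool" where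
  "bundle_orientation S V W \<omega> \<longleftrightarrow>
     (\<forall>x\<in>S. orientation_mod (V x) (W x) (\<omega> x)) \<and>
     (\<forall>x\<in>S. \<exists>U es. open U \<and> x \<in> U \<and> (\<forall>e\<in>set es. continuous_on (S \<inter> U) e) \<and>
        (\<forall>y\<in>S \<inter> U. basis_mod (V y) (W y) (map (\<lambda>e. e y) es) \<and>
           \<omega> y (map (\<lambda>e. e y) es) = \<omega> x (map (\<lambda>e. e x) es)))"

definition manifold_orientation :: "'a::euclidean_space set \<Rightarrow> ('a \<Rightarrow> 'a list \<Rightarrow> int) \<Rightarrow> bool" where
  "manifold_orientation S \<omega> \<longleftrightarrow> bundle_orientation S (tangent_space S) (\<lambda>_. {0}) \<omega>"

text \<open>
  From here on, \<open>\<omega> \<xi> x\<close> is the chosen orientation of the tangent space at \<open>x\<close> of the unstable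
  manifold of the critical point \<open>\<xi>\<close>.

  The orientation of the normal bundle of the stable manifold of \<open>\<gamma>\<close> extends the one given at \<open>\<gamma>\<close>
  by \<open>N\<^sub>\<gamma> W\<^sup>s(\<gamma>) \<cong> T\<^sub>\<gamma> W\<^sup>u(\<gamma>)\<close>. It is unique on bases of the normal spaces, as \<open>W\<^sup>s(\<gamma>)\<close> is connected.
\<close>

definition stable_normal_orientation ::
  "'a::euclidean_space set \<Rightarrow> ('a \<Rightarrow> 'a) \<Rightarrow> ('a \<Rightarrow> 'a \<Rightarrow> 'a list \<Rightarrow> int) \<Rightarrow> 'a \<Rightarrow> 'a \<Rightarrow> 'a list \<Rightarrow> int"
  where
  "stable_normal_orientation M X \<omega> \<gamma> =
     (SOME \<nu>. bundle_orientation (stable_manifold M X \<gamma>)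
                (tangent_space M) (tangent_space (stable_manifold M X \<gamma>)) \<nu> \<and>
              (\<forall>bs. basis_mod (tangent_space (unstable_manifold M X \<gamma>) \<gamma>) {0} bs \<longrightarrow>
                    \<nu> \<gamma> bs = \<omega> \<gamma> \<gamma> bs))"

text \<open>
  The orientation of \<open>W\<^sup>u(\<xi>) \<inter> W\<^sup>s(\<gamma>)\<close> at \<open>x\<close> determined by
  \<open>T W\<^sup>u(\<xi>) \<cong> T (W\<^sup>u(\<xi>) \<inter> W\<^sup>s(\<gamma>)) \<oplus> N W\<^sup>s(\<gamma>)\<close>: here \<open>ws\<close> is a basis of the first summand, and \<open>bs\<close>
  consists of vectors of \<open>T W\<^sup>u(\<xi>)\<close> that represent a basis of the second.
\<close>

definition induced_orientation ::
  "'a::euclidean_space set \<Rightarrow> ('a \<Rightarrow> 'a) \<Rightarrow> ('a \<Rightarrow> 'a \<Rightarrow> 'a list \<Rightarrow> int) \<Rightarrow> 'a \<Rightarrow> 'a \<Rightarrow> 'a \<Rightarrow> 'a list \<Rightarrow> int"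
  where
  "induced_orientation M X \<omega> \<xi> \<gamma> x ws =
     (THE s. \<exists>bs. set bs \<subseteq> tangent_space (unstable_manifold M X \<xi>) x \<and>
        basis_mod (tangent_space M x) (tangent_space (stable_manifold M X \<gamma>) x) bs \<and>
        s = \<omega> \<xi> x (ws @ bs) * stable_normal_orientation M X \<omega> \<gamma> x bs)"

section \<open>The Morse complex\<close>

definition flow_lines ::
  "'a::euclidean_space set \<Rightarrow> ('a \<Rightarrow> 'a) \<Rightarrow> 'a \<Rightarrow> 'a \<Rightarrow> (real \<Rightarrow> 'a) set" where
  "flow_lines M X \<xi> \<gamma> =
     {u. integral_curve M X u \<and> (u \<longlongrightarrow> \<xi>) at_bot \<and> (u \<longlongrightarrow> \<gamma>) at_top}"

definition time_translation :: "(real \<Rightarrow> 'a) set \<Rightarrow> ((real \<Rightarrow> 'a) \<times> (real \<Rightarrow> 'a)) set" where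
  "time_translation F = {(u, w). u \<in> F \<and> w \<in> F \<and> (\<exists>s. \<forall>t. w t = u (t + s))}"

text \<open>The induced orientation compared with the flow direction, given by the basis \<open>X\<close>.\<close>

definition flow_line_sign ::
  "'a::euclidean_space set \<Rightarrow> ('a \<Rightarrow> 'a) \<Rightarrow> ('a \<Rightarrow> 'a \<Rightarrow> 'a list \<Rightarrow> int) \<Rightarrow> 'a \<Rightarrow> 'a \<Rightarrow> (real \<Rightarrow> 'a) \<Rightarrow> int"
  where
  "flow_line_sign M X \<omega> \<xi> \<gamma> u = induced_orientation M X \<omega> \<xi> \<gamma> (u 0) [X (u 0)]"

text \<open>The sign is the same for all flow lines in a class \<open>C\<close>.\<close>

definition flow_line_count ::
  "'a::euclidean_space set \<Rightarrow> ('a \<Rightarrow> 'a) \<Rightarrow> ('a \<Rightarrow> 'a \<Rightarrow> 'a list \<Rightarrow> int) \<Rightarrow> 'a \<Rightarrow> 'a \<Rightarrow> int" where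
  "flow_line_count M X \<omega> \<xi> \<gamma> =
     (\<Sum>C \<in> flow_lines M X \<xi> \<gamma> // time_translation (flow_lines M X \<xi> \<gamma>).
        the_elem (flow_line_sign M X \<omega> \<xi> \<gamma> ` C))"

definition morse_chain_group ::
  "'a::euclidean_space set \<Rightarrow> ('a \<Rightarrow> real) \<Rightarrow> int \<Rightarrow> ('a \<Rightarrow>\<^sub>0 int) monoid" where
  "morse_chain_group M f k = free_Abelian_group (crit_index M f k)"

definition morse_boundary ::
  "'a::euclidean_space set \<Rightarrow> ('a \<Rightarrow> real) \<Rightarrow> ('a \<Rightarrow> 'a) \<Rightarrow> ('a \<Rightarrow> 'a \<Rightarrow> 'a list \<Rightarrow> int) \<Rightarrow>
   int \<Rightarrow> ('a \<Rightarrow>\<^sub>0 int) \<Rightarrow> ('a \<Rightarrow>\<^sub>0 int)" where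
  "morse_boundary M f X \<omega> k =
     frag_extend (\<lambda>\<xi>. \<Sum>\<gamma> \<in> crit_index M f (k - 1).
       frag_cmul (flow_line_count M X \<omega> \<xi> \<gamma>) (frag_of \<gamma>))"

definition morse_homology ::
  "'a::euclidean_space set \<Rightarrow> ('a \<Rightarrow> real) \<Rightarrow> ('a \<Rightarrow> 'a) \<Rightarrow> ('a \<Rightarrow> 'a \<Rightarrow> 'a list \<Rightarrow> int) \<Rightarrow>
   int \<Rightarrow> ('a \<Rightarrow>\<^sub>0 int) set monoid" where
  "morse_homology M f X \<omega> k =
     (morse_chain_group M f k)
       \<lparr>carrier := kernel (morse_chain_group M f k) (morse_chain_group M f (k - 1))
                     (morse_boundary M f X \<omega> k)\<rparr>
     Mod (morse_boundary M f X \<omega> (k + 1) ` carrier (morse_chain_group M f (k + 1)))"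

section \<open>Tensor product of abelian groups\<close>

definition tensor_relations ::
  "('a, 'm) monoid_scheme \<Rightarrow> ('b, 'n) monoid_scheme \<Rightarrow> ('a \<times> 'b \<Rightarrow>\<^sub>0 int) set" where
  "tensor_relations G H =
     {frag_of (x \<otimes>\<^bsub>G\<^esub> x', y) - frag_of (x, y) - frag_of (x', y) |x x' y.
        x \<in> carrier G \<and> x' \<in> carrier G \<and> y \<in> carrier H} \<union>
     {frag_of (x, y \<otimes>\<^bsub>H\<^esub> y') - frag_of (x, y) - frag_of (x, y') |x y y'.
        x \<in> carrier G \<and> y \<in> carrier H \<and> y' \<in> carrier H}"

definition tensor_product ::
  "('a, 'm) monoid_scheme \<Rightarrow> ('b, 'n) monoid_scheme \<Rightarrow> ('a \<times> 'b \<Rightarrow>\<^sub>0 int) set monoid" where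
  "tensor_product G H =
     free_Abelian_group (carrier G \<times> carrier H) Mod
     generate (free_Abelian_group (carrier G \<times> carrier H)) (tensor_relations G H)"

section \<open>The standard sphere and torus\<close>

definition standard_sphere :: "(real ^ 3) set" where
  "standard_sphere = sphere 0 1"

text \<open>The torus of revolution about the third axis, for \<open>0 < r < R\<close>.\<close>

definition standard_torus :: "real \<Rightarrow> real \<Rightarrow> (real ^ 3) set" where
  "standard_torus R r = {x. (sqrt ((x $ 1)\<^sup>2 + (x $ 2)\<^sup>2) - R)\<^sup>2 + (x $ 3)\<^sup>2 = r\<^sup>2}"

end

theory Submission
  imports Defs "HOL-Analysis.Cross3"
begin

text \<open>
  All boundary operators vanish, so \<open>HM\<^sub>k\<close> is free on the critical points of index \<open>k\<close>. The distance
  function has a minimum and a maximum on the sphere, and a minimum, two saddles and a maximum on the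
  torus; this gives \<open>1, 2, 2, 2, 1\<close> critical points of index \<open>0, \<dots>, 4\<close> on the product.

  If the indices of two critical points of the product differ by one and the points are joined by flow
  lines, then these lines are constant in the sphere and join a saddle of the torus to an extremum. By
  the Smale condition there are exactly two of them up to time translation, the branches of the stable
  or the unstable manifold of the saddle. This curve has a continuous unit tangent field through the
  saddle, which points along \<open>X\<close> on one branch and against \<open>X\<close> on the other. All orientations in the
  definition of the sign of a flow line can be written as determinants with respect to frames that are
  continuous along the curve, so the two signs are opposite and cancel.
\<close>

section \<open>Smooth maps\<close>

lemma Ck_on_subset: "Ck_on k U f \<Longrightarrow> V \<subseteq> U \<Longrightarrow> Ck_on k V f"
  by (induction k arbitrary: f) (auto intro: continuous_on_subset)

lemma Ck_on_cong:
  assumes "open U" "\<And>x. x \<in> U \<Longrightarrow> f x = g x" "Ck_on k U f"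
  shows "Ck_on k U g"
  using assms(2,3)
proof (induction k arbitrary: f g)
  case 0
  then show ?case by (auto cong: continuous_on_cong)
next
  case (Suc k)
  have d: "(g has_derivative frechet_derivative f (at x)) (at x)" if "x \<in> U" for x
  proof -
    have "(f has_derivative frechet_derivative f (at x)) (at x)"
      using Suc.prems(2) that frechet_derivative_works by auto
    then show ?thesis
      by (rule has_derivative_transform_within_open[OF _ assms(1) that]) (use Suc.prems in auto)
  qed
  have e: "frechet_derivative g (at x) = frechet_derivative f (at x)" if "x \<in> U" for x
    using frechet_derivative_at[OF d[OF that]] by simp
  have "Ck_on k U (\<lambda>x. frechet_derivative g (at x) v)" for v
    by (rule Suc.IH[of "\<lambda>x. frechet_derivative f (at x) v"]) (use Suc.prems e in auto)
  with d show ?case by (auto simp: differentiable_def)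
qed

lemma Ck_on_SucI:
  assumes "open U" "\<And>x. x \<in> U \<Longrightarrow> (f has_derivative f' x) (at x)"
    and "\<And>v. Ck_on k U (\<lambda>x. f' x v)"
  shows "Ck_on (Suc k) U f"
proof -
  have "frechet_derivative f (at x) = f' x" if "x \<in> U" for x
    using frechet_derivative_at[OF assms(2)[OF that]] by simp
  then have "Ck_on k U (\<lambda>x. frechet_derivative f (at x) v)" for v
    using Ck_on_cong[OF assms(1) _ assms(3)[of v]] by auto
  then show ?thesis using assms(2) by (auto simp: differentiable_def)
qed

lemma Ck_on_continuous:
  assumes "Ck_on k U f"
  shows "continuous_on U f"
proof (cases k)
  case (Suc n)
  then have "f differentiable (at x)" if "x \<in> U" for x
    using assms that by auto
  then show ?thesis
    by (simp add: continuous_at_imp_continuous_on differentiable_imp_continuous_within)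
qed (use assms in auto)

lemma Ck_on_SucD: "Ck_on (Suc k) U f \<Longrightarrow> Ck_on k U f"
proof (induction k arbitrary: f)
  case 0
  show ?case using Ck_on_continuous[OF 0] by simp
next
  case (Suc k)
  then show ?case by (metis Ck_on.simps(2))
qed

lemma Ck_on_const: "open U \<Longrightarrow> Ck_on k U (\<lambda>x. c)"
  by (induction k arbitrary: c) (auto intro: Ck_on_SucI[where f' = "\<lambda>_ _. 0"] has_derivative_const)

lemma Ck_on_linear:
  assumes "bounded_linear L" "open U" "Ck_on k U f"
  shows "Ck_on k U (\<lambda>x. L (f x))"
  using assms(3)
proof (induction k arbitrary: f)
  case 0
  then show ?case using assms bounded_linear.continuous_on by auto
next
  case (Suc k)
  then show ?case
    by (intro Ck_on_SucI[where f' = "\<lambda>x v. L (frechet_derivative f (at x) v)"] assms(2)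
        bounded_linear.has_derivative[OF assms(1)])
      (auto simp: frechet_derivative_works[symmetric])
qed

lemma Ck_on_add:
  assumes "open U" "Ck_on k U f" "Ck_on k U g"
  shows "Ck_on k U (\<lambda>x. f x + g x)"
  using assms(2,3)
proof (induction k arbitrary: f g)
  case 0
  then show ?case by (auto intro: continuous_intros)
next
  case (Suc k)
  then show ?case
    by (intro Ck_on_SucI[where f' = "\<lambda>x v. frechet_derivative f (at x) v + frechet_derivative g (at x) v"] 
        assms(1) has_derivative_add) (auto simp: frechet_derivative_works[symmetric])
qed

lemma Ck_on_sum:
  assumes "open U" "\<And>i. i \<in> I \<Longrightarrow> Ck_on k U (f i)"
  shows "Ck_on k U (\<lambda>x. \<Sum>i\<in>I. f i x)"
  using assms(2)
  by (induction I rule: infinite_finite_induct) (auto intro: Ck_on_add Ck_on_const assms(1))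

lemma Ck_on_bilinear:
  assumes "bounded_bilinear B" "open U" "Ck_on k U f" "Ck_on k U g"
  shows "Ck_on k U (\<lambda>x. B (f x) (g x))"
  using assms(3,4)
proof (induction k arbitrary: f g)
  case 0
  then show ?case by (auto intro: bounded_bilinear.continuous_on[OF assms(1)])
next
  case (Suc k)
  have "Ck_on k U f" "Ck_on k U g" using Suc.prems Ck_on_SucD by blast+
  with Suc show ?case
    by (intro Ck_on_SucI[where f' = "\<lambda>x v. B (f x) (frechet_derivative g (at x) v) + B (frechet_derivative f (at x) v) (g x)"] 
        assms(2) bounded_bilinear.FDERIV[OF assms(1)] Ck_on_add) (auto simp: frechet_derivative_works[symmetric])
qed

lemma Ck_on_compose:
  assumes "open U" "open V" "f ` U \<subseteq> V" "Ck_on k U f" "Ck_on k V g"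
  shows "Ck_on k U (\<lambda>x. g (f x))"
  using assms(4,5)
proof (induction k arbitrary: g)
  case 0
  then show ?case using assms(3) continuous_on_compose2 by auto
next
  case (Suc k)
  let ?f' = "\<lambda>x. frechet_derivative f (at x)" and ?g' = "\<lambda>x. frechet_derivative g (at x)"
  have f: "(f has_derivative ?f' x) (at x)" if "x \<in> U" for x
    using Suc.prems that by (auto simp: frechet_derivative_works[symmetric])
  have g: "(g has_derivative ?g' y) (at y)" if "y \<in> V" for y
    using Suc.prems that by (auto simp: frechet_derivative_works[symmetric])
  have eq: "?g' (f x) (?f' x v) = (\<Sum>b\<in>Basis. (?f' x v \<bullet> b) *\<^sub>R ?g' (f x) b)" if "x \<in> U" for x v
  proof -
    have "linear (?g' (f x))" using g assms(3) that has_derivative_linear by blast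
    then have "?g' (f x) (\<Sum>b\<in>Basis. (?f' x v \<bullet> b) *\<^sub>R b) = (\<Sum>b\<in>Basis. (?f' x v \<bullet> b) *\<^sub>R ?g' (f x) b)"
      by (simp add: linear_sum linear_scale)
    then show ?thesis by (simp add: euclidean_representation)
  qed
  show ?case
  proof (rule Ck_on_SucI[OF assms(1)])
    show "((\<lambda>x. g (f x)) has_derivative (\<lambda>v. ?g' (f x) (?f' x v))) (at x)" if "x \<in> U" for x
      using has_derivative_compose[OF f[OF that] g] assms(3) that by (auto simp: o_def)
    have "Ck_on k U (\<lambda>x. \<Sum>b\<in>Basis. (?f' x v \<bullet> b) *\<^sub>R ?g' (f x) b)" for v
      using Suc.prems Ck_on_SucD[OF Suc.prems(1)]
      by (intro Ck_on_sum assms(1) Ck_on_bilinear[OF bounded_bilinear_scaleR]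
          Ck_on_linear[OF bounded_linear_inner_left] Suc.IH[where g = "\<lambda>y. ?g' y _"]) auto
    then show "Ck_on k U (\<lambda>x. ?g' (f x) (?f' x v))" for v
      by (rule Ck_on_cong[OF assms(1), rotated]) (simp add: eq)
  qed
qed

lemma smooth_on_subset: "smooth_on U f \<Longrightarrow> V \<subseteq> U \<Longrightarrow> smooth_on V f"
  unfolding smooth_on_def using Ck_on_subset by blast

lemma smooth_on_continuous: "smooth_on U f \<Longrightarrow> continuous_on U f"
  unfolding smooth_on_def using Ck_on_continuous by blast

lemma smooth_on_has_derivative:
  "smooth_on U f \<Longrightarrow> x \<in> U \<Longrightarrow> (f has_derivative frechet_derivative f (at x)) (at x)"
  unfolding smooth_on_def using Ck_on.simps(2)[of 0 U f] frechet_derivative_works by blast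

lemma smooth_on_derivative: "smooth_on U f \<Longrightarrow> smooth_on U (\<lambda>x. frechet_derivative f (at x) v)"
  unfolding smooth_on_def using Ck_on.simps(2)[of _ U f] by blast

lemma smooth_on_const: "open U \<Longrightarrow> smooth_on U (\<lambda>x. c)"
  unfolding smooth_on_def using Ck_on_const by blast

lemma Ck_on_id: "open U \<Longrightarrow> Ck_on k U (\<lambda>x. x)"
proof (cases k)
  case (Suc n)
  then show "open U \<Longrightarrow> ?thesis"
    by (simp only:, intro Ck_on_SucI[where f' = "\<lambda>_ v. v"]) (auto intro: has_derivative_ident Ck_on_const)
qed auto

lemma smooth_on_linear: "bounded_linear L \<Longrightarrow> open U \<Longrightarrow> smooth_on U f \<Longrightarrow> smooth_on U (\<lambda>x. L (f x))"
  unfolding smooth_on_def using Ck_on_linear by blast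

lemma smooth_on_id: "open U \<Longrightarrow> smooth_on U (\<lambda>x. x)"
  unfolding smooth_on_def using Ck_on_id by blast

lemma smooth_on_bounded_linear: "bounded_linear L \<Longrightarrow> open U \<Longrightarrow> smooth_on U L"
  using smooth_on_linear smooth_on_id by blast

lemma smooth_on_add:
  "open U \<Longrightarrow> smooth_on U f \<Longrightarrow> smooth_on U g \<Longrightarrow> smooth_on U (\<lambda>x. f x + g x)"
  unfolding smooth_on_def using Ck_on_add by blast

lemma smooth_on_bilinear:
  "bounded_bilinear B \<Longrightarrow> open U \<Longrightarrow> smooth_on U f \<Longrightarrow> smooth_on U g \<Longrightarrow> smooth_on U (\<lambda>x. B (f x) (g x))"
  unfolding smooth_on_def using Ck_on_bilinear by blast

lemmas smooth_on_scaleR = smooth_on_bilinear[OF bounded_bilinear_scaleR]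
lemmas smooth_on_mult = smooth_on_bilinear[OF bounded_bilinear_mult, where ?'a2 = real]

lemma smooth_on_compose:
  "open U \<Longrightarrow> open V \<Longrightarrow> f ` U \<subseteq> V \<Longrightarrow> smooth_on U f \<Longrightarrow> smooth_on V g \<Longrightarrow> smooth_on U (\<lambda>x. g (f x))"
  unfolding smooth_on_def using Ck_on_compose by blast

lemma smooth_on_Pair:
  assumes "open U" "smooth_on U f" "smooth_on U g"
  shows "smooth_on U (\<lambda>x. (f x, g x))"
proof -
  have "smooth_on U (\<lambda>x. (f x, 0) + (0, g x))"
    by (intro smooth_on_add smooth_on_linear[of "\<lambda>x. (x, 0)"] smooth_on_linear[of "\<lambda>x. (0, x)"] assms
        bounded_linear_Pair bounded_linear_ident bounded_linear_zero)
  then show ?thesis by simp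
qed

lemma smooth_on_sin_cos: "smooth_on UNIV (sin :: real \<Rightarrow> real)" "smooth_on UNIV (cos :: real \<Rightarrow> real)"
proof -
  have "Ck_on k UNIV (sin :: real \<Rightarrow> real) \<and> Ck_on k UNIV (cos :: real \<Rightarrow> real)" for k
  proof (induction k)
    case 0
    show ?case by (simp add: continuous_on_sin continuous_on_cos)
  next
    case (Suc k)
    have "Ck_on (Suc k) UNIV (sin :: real \<Rightarrow> real)"
      using Suc by (intro Ck_on_SucI[where f' = "\<lambda>x v. v * cos x"])
        (auto intro!: derivative_eq_intros Ck_on_linear[OF bounded_linear_mult_right])
    moreover have "Ck_on (Suc k) UNIV (cos :: real \<Rightarrow> real)"
      using Suc Ck_on_linear[OF bounded_linear_mult_right[of "- v" for v], of UNIV k sin]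
      by (intro Ck_on_SucI[where f' = "\<lambda>x v. (- v) * sin x"])
        (auto intro!: DERIV_cos[THEN has_field_derivative_imp_has_derivative, THEN has_derivative_eq_rhs])
    ultimately show ?case ..
  qed
  then show "smooth_on UNIV (sin :: real \<Rightarrow> real)" "smooth_on UNIV (cos :: real \<Rightarrow> real)"
    by (auto simp: smooth_on_def)
qed

section \<open>Tangent spaces\<close>

lemma curve_in_mono: "curve_in M x v c \<Longrightarrow> M \<subseteq> M' \<Longrightarrow> curve_in M' x v c"
  unfolding curve_in_def by blast

lemma tangent_space_mono: "M \<subseteq> M' \<Longrightarrow> tangent_space M x \<subseteq> tangent_space M' x"
  unfolding tangent_space_def using curve_in_mono by blast

lemma curve_in_continuous: "curve_in M x v c \<Longrightarrow> (c \<longlongrightarrow> x) (at 0)"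
  unfolding curve_in_def using has_vector_derivative_continuous
  by (metis continuous_within)

lemma curve_in_eventually:
  assumes "curve_in M x v c"
  shows "\<forall>\<^sub>F t in nhds 0. c t \<in> M"
proof -
  obtain e where "e > 0" "c ` {-e<..<e} \<subseteq> M" using assms unfolding curve_in_def by blast
  then show ?thesis
    by (intro eventually_nhds[THEN iffD2] exI[of _ "{-e<..<e}"]) auto
qed

lemma curve_in_image:
  fixes g :: "'a::euclidean_space \<Rightarrow> 'b::euclidean_space"
  assumes c: "curve_in M x v c" and U: "open U" "x \<in> U" and g: "smooth_on U g" "g ` (M \<inter> U) \<subseteq> M'"
  shows "curve_in M' (g x) (frechet_derivative g (at x) v) (\<lambda>t. g (c t))"
proof -
  obtain e where e: "e > 0" "smooth_on {-e<..<e} c" "c ` {-e<..<e} \<subseteq> M"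
    and c0: "c 0 = x" "(c has_vector_derivative v) (at 0)"
    using c unfolding curve_in_def by blast
  have "continuous_on {-e<..<e} c" using e smooth_on_continuous by blast
  then have "open (c -` U \<inter> {-e<..<e})"
    using continuous_open_preimage[of "{-e<..<e}" c U] U(1) by (simp add: Int_commute)
  moreover have "0 \<in> c -` U \<inter> {-e<..<e}" using e c0 U by auto
  ultimately obtain d where d: "d > 0" "ball 0 d \<subseteq> c -` U \<inter> {-e<..<e}"
    using open_contains_ball by blast
  have bd: "ball 0 d = {-d<..<d}" by (auto simp: dist_real_def)
  then have dU: "c ` {-d<..<d} \<subseteq> U" "{-d<..<d} \<subseteq> {-e<..<e}" using d by auto
  have "smooth_on {-d<..<d} (\<lambda>t. g (c t))"
    by (rule smooth_on_compose[OF _ U(1) dU(1) _ g(1)]) (use smooth_on_subset e dU in auto)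
  moreover have "(\<lambda>t. g (c t)) ` {-d<..<d} \<subseteq> M'" using dU e g by blast
  moreover have "((\<lambda>t. g (c t)) has_vector_derivative frechet_derivative g (at x) v) (at 0)"
  proof -
    have "(g has_derivative frechet_derivative g (at x)) (at (c 0))"
      using smooth_on_has_derivative[OF g(1) U(2)] c0 by simp
    from vector_derivative_diff_chain_within[OF c0(2) has_derivative_at_withinI[OF this]]
    show ?thesis by (simp add: o_def)
  qed
  ultimately show ?thesis unfolding curve_in_def using d c0 by auto
qed

lemma tangent_space_image:
  fixes g :: "'a::euclidean_space \<Rightarrow> 'b::euclidean_space"
  assumes "v \<in> tangent_space M x" "open U" "x \<in> U" "smooth_on U g" "g ` (M \<inter> U) \<subseteq> M'"
  shows "frechet_derivative g (at x) v \<in> tangent_space M' (g x)"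
  using curve_in_image[OF _ assms(2-5)] assms(1) unfolding tangent_space_def by blast

lemma tangent_space_Int_open:
  assumes "open U" "x \<in> U"
  shows "tangent_space (M \<inter> U) x = tangent_space M x"
proof
  show "tangent_space M x \<subseteq> tangent_space (M \<inter> U) x"
    using tangent_space_image[OF _ assms smooth_on_id[OF assms(1)], of _ M "M \<inter> U"] by auto
qed (simp add: tangent_space_mono)

lemma tangent_space_singleton: "tangent_space {a} a = {0}"
proof -
  have "curve_in {a} a 0 (\<lambda>_. a)" unfolding curve_in_def
    by (auto intro!: exI[of _ 1] smooth_on_const)
  moreover have "v = 0" if "curve_in {a} a v c" for v c
  proof -
    from that obtain e where e: "e > 0" "c ` {-e<..<e} \<subseteq> {a}" unfolding curve_in_def by blast
    then have "(c has_vector_derivative 0) (at 0)"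
      by (intro has_vector_derivative_transform_within_open[OF has_vector_derivative_const, of "{-e<..<e}" _ a])
        (auto simp: image_subset_iff)
    with that show ?thesis unfolding curve_in_def using vector_derivative_unique_at by blast
  qed
  ultimately show ?thesis unfolding tangent_space_def by blast
qed

lemma zero_in_tangent_space: "x \<in> M \<Longrightarrow> 0 \<in> tangent_space M x"
  using tangent_space_mono[of "{x}" M x] tangent_space_singleton by blast

lemma tangent_space_kernel:
  assumes "v \<in> tangent_space M x" "(g has_derivative g') (at x)" "\<And>y. y \<in> M \<Longrightarrow> g y = (0::real)"
  shows "g' v = 0"
proof -
  obtain c where c: "curve_in M x v c" using assms(1) unfolding tangent_space_def by blast
  then have "(g has_derivative g') (at (c 0))" "(c has_vector_derivative v) (at 0)"
    using assms(2) unfolding curve_in_def by auto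
  then have "((g \<circ> c) has_vector_derivative g' v) (at 0)"
    by (intro vector_derivative_diff_chain_within) (auto intro: has_derivative_at_withinI)
  moreover have "((g \<circ> c) has_vector_derivative 0) (at 0)"
  proof -
    obtain e where e: "e > 0" "c ` {-e<..<e} \<subseteq> M" using c unfolding curve_in_def by blast
    show ?thesis
      by (rule has_vector_derivative_transform_within_open[OF has_vector_derivative_const, of "{-e<..<e}"])
        (use e in \<open>auto simp: image_subset_iff assms(3)\<close>)
  qed
  ultimately show ?thesis by (rule vector_derivative_unique_at)
qed

lemma differential_eq:
  assumes "(f has_derivative f') (at x)" "v \<in> tangent_space M x"
  shows "differential M f x v = f' v"
proof -
  have d: "((\<lambda>t. f (c t)) has_real_derivative f' v) (at 0)" if c: "curve_in M x v c" for c
  proof -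
    have "(f has_derivative f') (at (c 0))" "(c has_vector_derivative v) (at 0)"
      using assms(1) c unfolding curve_in_def by auto
    then have "((f \<circ> c) has_vector_derivative f' v) (at 0)"
      by (intro vector_derivative_diff_chain_within) (auto intro: has_derivative_at_withinI)
    then show ?thesis by (simp add: has_real_derivative_iff_has_vector_derivative o_def)
  qed
  obtain c where "curve_in M x v c" using assms(2) unfolding tangent_space_def by blast
  with d show ?thesis unfolding differential_def
    by (intro the_equality) (blast intro: DERIV_unique)+
qed

lemma tangent_space_Times:
  "tangent_space (A \<times> B) (x, y) = tangent_space A x \<times> tangent_space B y"
proof (intro equalityI subsetI)
  fix p assume p: "p \<in> tangent_space (A \<times> B) (x, y)"
  have "frechet_derivative fst (at (x,y)) p \<in> tangent_space A (fst (x,y))"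
    by (rule tangent_space_image[OF p open_UNIV]) (auto intro: smooth_on_bounded_linear bounded_linear_fst)
  moreover have "frechet_derivative snd (at (x,y)) p \<in> tangent_space B (snd (x,y))"
    by (rule tangent_space_image[OF p open_UNIV]) (auto intro: smooth_on_bounded_linear bounded_linear_snd)
  moreover have "frechet_derivative fst (at (x,y)) p = fst p" "frechet_derivative snd (at (x,y)) p = snd p"
    using frechet_derivative_at[OF bounded_linear_imp_has_derivative[OF bounded_linear_fst]]
      frechet_derivative_at[OF bounded_linear_imp_has_derivative[OF bounded_linear_snd]] by metis+
  ultimately show "p \<in> tangent_space A x \<times> tangent_space B y" by (cases p) simp
next
  fix p assume "p \<in> tangent_space A x \<times> tangent_space B y"
  then obtain v w c d where p: "p = (v, w)" and c: "curve_in A x v c" and d: "curve_in B y w d"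
    unfolding tangent_space_def by auto
  obtain e where e: "e > 0" "smooth_on {-e<..<e} c" "c ` {-e<..<e} \<subseteq> A" "c 0 = x" "(c has_vector_derivative v) (at 0)"
    using c unfolding curve_in_def by blast
  obtain e' where e': "e' > 0" "smooth_on {-e'<..<e'} d" "d ` {-e'<..<e'} \<subseteq> B" "d 0 = y" "(d has_vector_derivative w) (at 0)"
    using d unfolding curve_in_def by blast
  have "curve_in (A \<times> B) (x, y) (v, w) (\<lambda>t. (c t, d t))"
    unfolding curve_in_def
  proof (intro conjI exI[of _ "min e e'"])
    show "smooth_on {- min e e'<..<min e e'} (\<lambda>t. (c t, d t))"
      by (intro smooth_on_Pair smooth_on_subset[OF e(2)] smooth_on_subset[OF e'(2)]) auto
    show "((\<lambda>t. (c t, d t)) has_vector_derivative (v, w)) (at 0)"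
      using e(5) e'(5) by (rule has_vector_derivative_Pair)
  qed (use e e' in \<open>auto simp: image_subset_iff\<close>)
  then show "p \<in> tangent_space (A \<times> B) (x, y)" unfolding tangent_space_def p by blast
qed

lemma diffeomorphism_sym: "diffeomorphism U V \<phi> \<psi> \<Longrightarrow> diffeomorphism V U \<psi> \<phi>"
  unfolding diffeomorphism_def using homeomorphism_sym by blast

lemma diffeomorphism_derivative_inverse:
  assumes "diffeomorphism U V \<phi> \<psi>" "x \<in> U"
  shows "frechet_derivative \<psi> (at (\<phi> x)) (frechet_derivative \<phi> (at x) v) = v"
proof -
  have U: "open U" "\<phi> x \<in> V" "smooth_on U \<phi>" "smooth_on V \<psi>" "\<And>y. y \<in> U \<Longrightarrow> \<psi> (\<phi> y) = y"
    using assms unfolding diffeomorphism_def homeomorphism_def by auto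
  have "((\<lambda>y. \<psi> (\<phi> y)) has_derivative (\<lambda>v. frechet_derivative \<psi> (at (\<phi> x)) (frechet_derivative \<phi> (at x) v))) (at x)"
    using has_derivative_compose[OF smooth_on_has_derivative[OF U(3) assms(2)]]
      smooth_on_has_derivative[OF U(4,2)] by auto
  moreover have "((\<lambda>y. \<psi> (\<phi> y)) has_derivative (\<lambda>v. v)) (at x)"
    by (rule has_derivative_transform_within_open[OF has_derivative_ident U(1) assms(2)]) (use U in auto)
  ultimately show ?thesis using has_derivative_unique by metis
qed

lemma tangent_space_subspace:
  assumes "subspace E" "open V" "x \<in> V" "x \<in> E"
  shows "tangent_space (V \<inter> E) x = E"
proof -
  have "v \<in> tangent_space E x" if "v \<in> E" for v
  proof -
    have "curve_in E x v (\<lambda>t. x + t *\<^sub>R v)" unfolding curve_in_def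
    proof (intro conjI exI[of _ 1])
      show "smooth_on {- 1<..<1::real} (\<lambda>t. x + t *\<^sub>R v)"
        by (intro smooth_on_add smooth_on_const smooth_on_bounded_linear bounded_linear_scaleR_left) auto
      show "((\<lambda>t. x + t *\<^sub>R v) has_vector_derivative v) (at 0)"
        by (auto intro!: derivative_eq_intros)
      show "(\<lambda>t. x + t *\<^sub>R v) ` {- 1<..<1} \<subseteq> E"
        using subspace_add[OF assms(1) assms(4) subspace_scale[OF assms(1) that]] by blast
    qed simp_all
    then show ?thesis unfolding tangent_space_def by blast
  qed
  moreover have "v \<in> E" if v: "v \<in> tangent_space E x" for v
  proof -
    have "inner w v = 0" if "\<And>y. y \<in> E \<Longrightarrow> inner w y = 0" for w
      by (rule tangent_space_kernel[OF v bounded_linear_imp_has_derivative[OF bounded_linear_inner_right]])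
        (rule that)
    moreover obtain y z where "y \<in> span E" "\<And>w. w \<in> span E \<Longrightarrow> Linear_Algebra.orthogonal z w" "v = y + z"
      using orthogonal_subspace_decomp_exists[of E v] by blast
    moreover have "span E = E" using assms(1) by (simp add: span_eq_iff)
    ultimately have "inner z v = 0" "inner z y = 0" "v = y + z" "y \<in> E" by (auto simp: Linear_Algebra.orthogonal_def)
    then show ?thesis by (simp add: inner_add_right)
  qed
  ultimately have "tangent_space E x = E" by blast
  then show ?thesis using tangent_space_Int_open[OF assms(2,3), of E] by (simp add: Int_commute)
qed

section \<open>Morse charts\<close>

lemma orthogonal_projection_exists:
  fixes S :: "'a::euclidean_space set"
  assumes "subspace S"
  obtains P where "bounded_linear P" "\<And>v. v \<in> S \<Longrightarrow> P v = v"
    "\<And>u. (\<And>v. v \<in> S \<Longrightarrow> inner u v = 0) \<Longrightarrow> P u = 0" "\<And>x y. inner x (P y) = inner y (P x)"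
proof -
  obtain B where B: "B \<subseteq> S" "pairwise Linear_Algebra.orthogonal B" "\<And>x. x \<in> B \<Longrightarrow> norm x = 1" "independent B" "span B = S"
    by (rule orthonormal_basis_subspace[OF assms]) auto
  have fB: "finite B" using B independent_imp_finite by blast
  define P where "P x = (\<Sum>b\<in>B. inner x b *\<^sub>R b)" for x
  show thesis
  proof
    show "bounded_linear P" unfolding P_def
      by (intro bounded_linear_sum bounded_linear_scaleR_const bounded_linear_inner_left)
    show "P u = 0" if "\<And>v. v \<in> S \<Longrightarrow> inner u v = 0" for u
      unfolding P_def using that B by (intro sum.neutral) auto
    show "inner x (P y) = inner y (P x)" for x y
      unfolding P_def by (auto simp: inner_sum_right intro!: sum.cong)
    show "P v = v" if "v \<in> S" for v
    proof -
      have l: "linear P" unfolding P_def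
        by (intro linear_compose_sum) (auto simp: linear_iff inner_add_left scaleR_add_left)
      have "P b = b" if b: "b \<in> B" for b
      proof -
        have "P b = (\<Sum>c\<in>B. if c = b then b else 0)" unfolding P_def
        proof (rule sum.cong[OF refl])
          fix c assume c: "c \<in> B"
          have "inner b b = 1" using B(3)[OF b] by (simp add: dot_square_norm)
          then show "inner b c *\<^sub>R c = (if c = b then b else 0)"
            using B(2) b c by (auto simp: pairwise_def Linear_Algebra.orthogonal_def)
        qed
        then show ?thesis using fB b by simp
      qed
      then have "P v = id v" using linear_eq_on[OF l linear_id, of v B] that B by auto
      then show ?thesis by simp
    qed
  qed
qed

locale morse_chart_at =
  fixes M :: "'a::euclidean_space set" and f :: "'a \<Rightarrow> real" and a V Em Ep \<psi> U \<phi>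
  assumes diffeo: "diffeomorphism V U \<psi> \<phi>"
    and image: "\<psi> ` (V \<inter> {u + v |u v. u \<in> Em \<and> v \<in> Ep}) = U \<inter> M"
    and zero: "0 \<in> V" "\<psi> 0 = a"
    and sub: "subspace Em" "subspace Ep" 
    and orth: "\<And>u v. u \<in> Em \<Longrightarrow> v \<in> Ep \<Longrightarrow> inner u v = 0"
    and f_chart: "\<And>u v. u \<in> Em \<Longrightarrow> v \<in> Ep \<Longrightarrow> u + v \<in> V \<Longrightarrow> f (\<psi> (u + v)) = f a - (norm u)\<^sup>2 + (norm v)\<^sup>2"
begin

definition E where "E = {u + v |u v. u \<in> Em \<and> v \<in> Ep}"

abbreviation D where "D z \<equiv> frechet_derivative \<psi> (at z)"

abbreviation D' where "D' x \<equiv> frechet_derivative \<phi> (at x)"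

lemma subspace_E: "subspace E"
  unfolding E_def using subspace_sums[OF sub] by simp

lemma Em_sub: "Em \<subseteq> E" and Ep_sub: "Ep \<subseteq> E"
  unfolding E_def using sub subspace_0 by force+

lemma opens: "open V" "open U"
  using diffeo unfolding diffeomorphism_def by auto

lemma smooths: "smooth_on V \<psi>" "smooth_on U \<phi>"
  using diffeo unfolding diffeomorphism_def by auto

lemma inverses: "z \<in> V \<Longrightarrow> \<phi> (\<psi> z) = z" "x \<in> U \<Longrightarrow> \<psi> (\<phi> x) = x" "z \<in> V \<Longrightarrow> \<psi> z \<in> U" "x \<in> U \<Longrightarrow> \<phi> x \<in> V"
  using diffeo unfolding diffeomorphism_def homeomorphism_def by auto

lemma a_in: "a \<in> U" "a \<in> M" "\<phi> a = 0"
  using zero inverses image subspace_0[OF subspace_E] unfolding E_def by (metis, blast, metis)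

lemma psi_in_M: "z \<in> V \<Longrightarrow> z \<in> E \<Longrightarrow> \<psi> z \<in> M"
  using image unfolding E_def by blast

lemma phi_in_E: "x \<in> U \<Longrightarrow> x \<in> M \<Longrightarrow> \<phi> x \<in> E"
  using image inverses unfolding E_def by (smt (verit, best) IntD1 IntD2 IntI image_iff)

lemma derivatives: "z \<in> V \<Longrightarrow> (\<psi> has_derivative D z) (at z)" "x \<in> U \<Longrightarrow> (\<phi> has_derivative D' x) (at x)"
  using smooths smooth_on_has_derivative by auto

lemma D'_D: "z \<in> V \<Longrightarrow> D' (\<psi> z) (D z v) = v"
  using diffeomorphism_derivative_inverse[OF diffeo] .

lemma D_D': "x \<in> U \<Longrightarrow> D (\<phi> x) (D' x v) = v"
  using diffeomorphism_derivative_inverse[OF diffeomorphism_sym[OF diffeo]] .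

lemma linear_D: "z \<in> V \<Longrightarrow> linear (D z)" and linear_D': "x \<in> U \<Longrightarrow> linear (D' x)"
  using derivatives has_derivative_linear by blast+

lemma inj_D: "z \<in> V \<Longrightarrow> inj (D z)"
  using D'_D by (metis injI)

lemma tangent_space_chart:
  assumes S: "subspace S" and z: "z \<in> V'" "z \<in> S" and V': "open V'" "V' \<subseteq> V" "\<psi> ` (V' \<inter> S) \<subseteq> W"
    and U': "open U'" "U' \<subseteq> U" "\<psi> z \<in> U'" "\<phi> ` (W \<inter> U') \<subseteq> S"
  shows "tangent_space W (\<psi> z) = D z ` S"
proof -
  have zV: "z \<in> V" using z V' by blast
  have 1: "D z v \<in> tangent_space W (\<psi> z)" if "v \<in> S" for v
  proof (rule tangent_space_image)
    show "v \<in> tangent_space (V' \<inter> S) z" using tangent_space_subspace[OF S V'(1) z] that by simp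
    show "smooth_on V' \<psi>" using smooths(1) V'(2) smooth_on_subset by blast
    show "\<psi> ` (V' \<inter> S \<inter> V') \<subseteq> W" using V'(3) by blast
  qed (fact V' z)+
  have "v \<in> D z ` S" if v: "v \<in> tangent_space W (\<psi> z)" for v
  proof -
    have "D' (\<psi> z) v \<in> tangent_space S (\<phi> (\<psi> z))"
      using smooth_on_subset[OF smooths(2) U'(2)] by (rule tangent_space_image[OF v U'(1,3) _ U'(4)])
    then have "D' (\<psi> z) v \<in> S"
      using tangent_space_subspace[OF S open_UNIV] inverses(1)[OF zV] z by simp
    then show ?thesis using D_D'[of "\<psi> z" v] inverses zV by (metis imageI)
  qed
  with 1 show ?thesis by blast
qed

lemma tangent_eq:
  assumes "z \<in> V" "z \<in> E"
  shows "tangent_space M (\<psi> z) = D z ` E"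
  using assms inverses(3) opens phi_in_E psi_in_M
  by (intro tangent_space_chart[OF subspace_E, of _ V _ U]) auto

lemma dim_tangent: "z \<in> V \<Longrightarrow> z \<in> E \<Longrightarrow> dim (tangent_space M (\<psi> z)) = dim Em + dim Ep"
proof -
  assume z: "z \<in> V" "z \<in> E"
  have "Em \<inter> Ep = {0}" using orth sub by (auto simp: subspace_0) (metis inner_eq_zero_iff)
  then have "dim E = dim Em + dim Ep"
    using dim_sums_Int[OF sub] unfolding E_def by simp
  then show ?thesis using tangent_eq[OF z] dim_image_eq[OF linear_D[OF z(1)], of E] inj_D[OF z(1)]
    by (simp add: inj_on_subset)
qed

lemma hessian_eq:
  assumes u: "u1 \<in> Em" "u2 \<in> Em" and v: "v1 \<in> Ep" "v2 \<in> Ep"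
  shows "hessian M f a (D 0 (u1 + v1)) (D 0 (u2 + v2)) = 2 * inner v1 v2 - 2 * inner u1 u2"
proof -
  obtain P where P: "bounded_linear P" "\<And>v. v \<in> Ep \<Longrightarrow> P v = v"
    "\<And>u. (\<And>v. v \<in> Ep \<Longrightarrow> inner u v = 0) \<Longrightarrow> P u = 0" "\<And>x y. inner x (P y) = inner y (P x)"
    by (rule orthogonal_projection_exists[OF sub(2)]) auto
  define B where "B z = 2 *\<^sub>R P z - z" for z
  have B: "bounded_linear B" unfolding B_def
    using bounded_linear_sub[OF bounded_linear_compose[OF bounded_linear_scaleR_right P(1)] bounded_linear_ident, of 2] .
  have Bsym: "inner x (B y) = inner y (B x)" for x y
    unfolding B_def by (simp add: inner_diff_right P(4) inner_commute)
  have Buv: "B (u + v) = v - u" if "u \<in> Em" "v \<in> Ep" for u v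
    unfolding B_def using that P(2) P(3)[of u] orth
    by (simp add: linear_add[OF bounded_linear.linear[OF P(1)]] scaleR_2)
  have fB: "f (\<psi> z) = f a + inner z (B z)" if "z \<in> E" "z \<in> V" for z
  proof -
    obtain u v where "z = u + v" "u \<in> Em" "v \<in> Ep" using \<open>z \<in> E\<close> unfolding E_def by blast
    then show ?thesis using f_chart[of u v] that orth[of u v]
      by (simp add: Buv inner_add_left inner_diff_left inner_add_right inner_diff_right inner_commute power2_norm_eq_inner)
  qed
  have claim: "deriv (\<lambda>s. deriv (\<lambda>t. f (\<sigma> (s, t))) 0) 0 = 2 * inner v1 v2 - 2 * inner u1 u2"
    if W0: "open W" "(0,0) \<in> W" and \<sigma>: "smooth_on W \<sigma>" "\<sigma> ` W \<subseteq> M" "\<sigma> (0,0) = a"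
      "frechet_derivative \<sigma> (at (0, 0)) (1, 0) = D 0 (u1 + v1)"
      "frechet_derivative \<sigma> (at (0, 0)) (0, 1) = D 0 (u2 + v2)" for \<sigma> and W :: "(real \<times> real) set"
  proof -
    define W' where "W' = W \<inter> \<sigma> -` U"
    have W': "open W'" unfolding W'_def
      using continuous_open_preimage[OF smooth_on_continuous[OF \<sigma>(1)] W0(1) opens(2)] .
    have 0: "(0,0) \<in> W'" unfolding W'_def using W0 \<sigma> a_in by auto
    define g where "g = (\<lambda>p. \<phi> (\<sigma> p))"
    have sg: "smooth_on W' g" unfolding g_def
      by (rule smooth_on_compose[OF W' opens(2) _ smooth_on_subset[OF \<sigma>(1)] smooths(2)]) (auto simp: W'_def)
    have gE: "g p \<in> E" "g p \<in> V" "\<psi> (g p) = \<sigma> p" if "p \<in> W'" for p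
      using that phi_in_E inverses \<sigma>(2) unfolding g_def W'_def by auto
    have fs: "f (\<sigma> p) = f a + inner (g p) (B (g p))" if "p \<in> W'" for p
      using fB[OF gE(1,2)[OF that]] gE(3)[OF that] by simp
    define g1 where "g1 p = frechet_derivative g (at p) (1,0)" for p
    define g2 where "g2 p = frechet_derivative g (at p) (0,1)" for p
    have dg: "(g has_derivative frechet_derivative g (at p)) (at p)" if "p \<in> W'" for p
      using smooth_on_has_derivative[OF sg that] .
    have sg2: "smooth_on W' g2" unfolding g2_def using smooth_on_derivative[OF sg] .
    have g0: "frechet_derivative g (at (0,0)) w = D' a (frechet_derivative \<sigma> (at (0,0)) w)" for w
    proof -
      have "(\<sigma> has_derivative frechet_derivative \<sigma> (at (0,0))) (at (0,0))"
        using smooth_on_has_derivative[OF \<sigma>(1) W0(2)] .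
      moreover have "(\<phi> has_derivative D' a) (at (\<sigma> (0,0)))" using derivatives(2) a_in \<sigma>(3) by simp
      ultimately have "(g has_derivative (\<lambda>w. D' a (frechet_derivative \<sigma> (at (0,0)) w))) (at (0,0))"
        unfolding g_def by (rule has_derivative_compose)
      then show ?thesis using frechet_derivative_at by metis
    qed
    have g12: "g1 (0,0) = u1 + v1" "g2 (0,0) = u2 + v2" "g (0,0) = 0"
      unfolding g1_def g2_def using g0 \<sigma> D'_D[OF zero(1)] zero a_in by (auto simp: g_def)
    have part: "((\<lambda>t. g (s, t)) has_derivative (\<lambda>h. h *\<^sub>R g2 (s,t))) (at t)" if "(s,t) \<in> W'" for s t
    proof -
      have "((\<lambda>t. (s, t)) has_derivative (\<lambda>h. (0, h))) (at t)" by (auto intro!: derivative_eq_intros)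
      from has_derivative_compose[OF this dg[OF that]]
      have "((\<lambda>t. g (s, t)) has_derivative (\<lambda>h. frechet_derivative g (at (s,t)) (0,h))) (at t)" .
      moreover have "frechet_derivative g (at (s,t)) (0,h) = h *\<^sub>R g2 (s,t)" for h
        using linear_scale[OF has_derivative_linear[OF dg[OF that]], of h "(0,1)"] by (simp add: g2_def)
      ultimately show ?thesis by simp
    qed
    have d1: "deriv (\<lambda>t. f (\<sigma> (s, t))) 0 = 2 * inner (g2 (s,0)) (B (g (s,0)))" if s: "(s,0) \<in> W'" for s
    proof (rule DERIV_imp_deriv)
      have "((\<lambda>t. f a + inner (g (s,t)) (B (g (s,t)))) has_derivative
          (\<lambda>h. inner (g (s,0)) (B (h *\<^sub>R g2 (s,0))) + inner (h *\<^sub>R g2 (s,0)) (B (g (s,0))))) (at 0)"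
        by (rule derivative_eq_intros part[OF s] bounded_linear.has_derivative[OF B] refl)+ simp
      also have "(\<lambda>h. inner (g (s,0)) (B (h *\<^sub>R g2 (s,0))) + inner (h *\<^sub>R g2 (s,0)) (B (g (s,0)))) =
         (\<lambda>h. h * (2 * inner (g2 (s,0)) (B (g (s,0)))))"
        by (auto simp: linear_scale[OF bounded_linear.linear[OF B]] Bsym[of "g (s,0)"] algebra_simps)
      finally have "((\<lambda>t. f a + inner (g (s,t)) (B (g (s,t)))) has_real_derivative 
          (2 * inner (g2 (s,0)) (B (g (s,0))))) (at 0)"
        by (rule has_derivative_imp_has_field_derivative) simp
      moreover have "open ((\<lambda>t. (s,t)) -` W')" using W' by (intro open_vimage) (auto intro!: continuous_intros)
      ultimately show "((\<lambda>t. f (\<sigma> (s, t))) has_real_derivative (2 * inner (g2 (s,0)) (B (g (s,0))))) (at 0)"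
        by (rule has_field_derivative_transform_within_open) (use s fs in auto)
    qed
    show ?thesis
    proof (rule DERIV_imp_deriv)
      have i: "((\<lambda>s. (s, 0::real)) has_derivative (\<lambda>h. (h, 0))) (at 0)" by (auto intro!: derivative_eq_intros)
      have i1: "((\<lambda>s. g (s, 0)) has_derivative (\<lambda>h. frechet_derivative g (at (0,0)) (h, 0))) (at 0)"
        using has_derivative_compose[OF i dg[OF 0]] .
      have i2: "((\<lambda>s. g2 (s, 0)) has_derivative (\<lambda>h. frechet_derivative g2 (at (0,0)) (h, 0))) (at 0)"
        using has_derivative_compose[OF i smooth_on_has_derivative[OF sg2 0]] .
      have "((\<lambda>s. 2 * inner (g2 (s,0)) (B (g (s,0)))) has_derivative
         (\<lambda>h. 2 * (inner (g2 (0,0)) (B (frechet_derivative g (at (0,0)) (h, 0))) +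
            inner (frechet_derivative g2 (at (0,0)) (h, 0)) (B (g (0,0)))))) (at 0)"
        by (rule derivative_eq_intros i1 i2 bounded_linear.has_derivative[OF B] refl)+ simp
      also have "(\<lambda>h. 2 * (inner (g2 (0,0)) (B (frechet_derivative g (at (0,0)) (h, 0))) +
            inner (frechet_derivative g2 (at (0,0)) (h, 0)) (B (g (0,0))))) =
          (\<lambda>h. h * (2 * inner v1 v2 - 2 * inner u1 u2))"
      proof
        fix h :: real
        have "frechet_derivative g (at (0,0)) (h, 0) = h *\<^sub>R g1 (0,0)"
          using linear_scale[OF has_derivative_linear[OF dg[OF 0]], of h "(1,0)"] by (simp add: g1_def)
        then show "2 * (inner (g2 (0,0)) (B (frechet_derivative g (at (0,0)) (h, 0))) +
            inner (frechet_derivative g2 (at (0,0)) (h, 0)) (B (g (0,0)))) = h * (2 * inner v1 v2 - 2 * inner u1 u2)"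
          using g12 u v orth[of u1 v2] orth[of u2 v1]
          by (simp add: linear_0[OF bounded_linear.linear[OF B]] linear_scale[OF bounded_linear.linear[OF B]]
              Buv inner_add_left inner_diff_left inner_add_right inner_diff_right inner_commute
              right_diff_distrib del: scaleR_add_right)
      qed
      finally have "((\<lambda>s. 2 * inner (g2 (s,0)) (B (g (s,0)))) has_real_derivative (2 * inner v1 v2 - 2 * inner u1 u2)) (at 0)"
        by (rule has_derivative_imp_has_field_derivative) simp
      moreover have "open ((\<lambda>s. (s,0)) -` W')" using W' by (intro open_vimage) (auto intro!: continuous_intros)
      ultimately show "((\<lambda>s. deriv (\<lambda>t. f (\<sigma> (s, t))) 0) has_real_derivative (2 * inner v1 v2 - 2 * inner u1 u2)) (at 0)"
        by (rule has_field_derivative_transform_within_open) (use 0 d1 in auto)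
    qed
  qed
  define l where "l = (\<lambda>p::real\<times>real. fst p *\<^sub>R (u1 + v1) + snd p *\<^sub>R (u2 + v2))"
  have l: "bounded_linear l" unfolding l_def
    by (intro bounded_linear_add bounded_linear_scaleR_const bounded_linear_fst bounded_linear_snd)
  have lE: "l p \<in> E" for p unfolding l_def using u v subspace_E Em_sub Ep_sub
    by (auto intro!: subspace_add subspace_scale)
  define W where "W = l -` V"
  have W: "open W" unfolding W_def using opens(1) l by (intro open_vimage) (auto intro: linear_continuous_on)
  have W0: "(0,0) \<in> W" unfolding W_def l_def using zero by simp
  have dl: "frechet_derivative (\<lambda>p. \<psi> (l p)) (at (0,0)) w = D 0 (l w)" for w
  proof -
    have "(l has_derivative l) (at (0,0))" using l by (rule bounded_linear_imp_has_derivative)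
    moreover have "(\<psi> has_derivative D 0) (at (l (0,0)))" using derivatives zero by (simp add: l_def)
    ultimately have "((\<lambda>p. \<psi> (l p)) has_derivative (\<lambda>w. D 0 (l w))) (at (0,0))"
      by (rule has_derivative_compose)
    then show ?thesis using frechet_derivative_at by metis
  qed
  have ex: "open W \<and> (0, 0) \<in> W \<and> smooth_on W (\<lambda>p. \<psi> (l p)) \<and> (\<lambda>p. \<psi> (l p)) ` W \<subseteq> M \<and> \<psi> (l (0, 0)) = a \<and>
        frechet_derivative (\<lambda>p. \<psi> (l p)) (at (0, 0)) (1, 0) = D 0 (u1 + v1) \<and>
        frechet_derivative (\<lambda>p. \<psi> (l p)) (at (0, 0)) (0, 1) = D 0 (u2 + v2)"
  proof (intro conjI)
    show "smooth_on W (\<lambda>p. \<psi> (l p))"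
      by (rule smooth_on_compose[OF W opens(1) _ smooth_on_bounded_linear[OF l W] smooths(1)]) (auto simp: W_def)
    show "(\<lambda>p. \<psi> (l p)) ` W \<subseteq> M" using psi_in_M lE by (auto simp: W_def)
  qed (use W W0 zero dl in \<open>auto simp: l_def\<close>)
  show ?thesis unfolding hessian_def
  proof (rule the_equality)
    show "\<exists>\<sigma> U. open U \<and> (0, 0) \<in> U \<and> smooth_on U \<sigma> \<and> \<sigma> ` U \<subseteq> M \<and> \<sigma> (0, 0) = a \<and>
        frechet_derivative \<sigma> (at (0, 0)) (1, 0) = D 0 (u1 + v1) \<and>
        frechet_derivative \<sigma> (at (0, 0)) (0, 1) = D 0 (u2 + v2) \<and>
        2 * inner v1 v2 - 2 * inner u1 u2 = deriv (\<lambda>s. deriv (\<lambda>t. f (\<sigma> (s, t))) 0) 0"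
      using ex claim[of W "\<lambda>p. \<psi> (l p)"] by (intro exI[of _ "\<lambda>p. \<psi> (l p)"] exI[of _ W]) auto
  qed (use claim in blast)
qed

lemma morse_index_eq: "morse_index M f a = dim Em"
proof -
  let ?S = "{F. subspace F \<and> F \<subseteq> tangent_space M a \<and> (\<forall>v\<in>F - {0}. hessian M f a v v < 0)}"
  have T: "tangent_space M a = D 0 ` E"
    using tangent_eq[OF zero(1)] subspace_0[OF subspace_E] zero(2) by simp
  have H: "hessian M f a (D 0 (u + v)) (D 0 (u + v)) = 2 * (norm v)\<^sup>2 - 2 * (norm u)\<^sup>2" if "u \<in> Em" "v \<in> Ep" for u v
    using hessian_eq[of u u v v] that by (simp add: power2_norm_eq_inner)
  have lin: "linear (D 0)" and inj: "inj (D 0)" using linear_D inj_D zero by auto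
  have "finite (dim ` ?S)"
    by (rule finite_subset[of _ "{..DIM('a)}"]) (auto intro: dim_subset_UNIV)
  moreover have "dim F \<le> dim Em" if F: "F \<in> ?S" for F
  proof -
    define G where "G = E \<inter> D 0 -` F"
    have G: "subspace G" unfolding G_def using F subspace_E lin
      by (simp add: subspace_inter linear_subspace_vimage)
    have FG: "F = D 0 ` G" unfolding G_def using F T by auto
    have "dim F = dim G" unfolding FG using dim_image_eq[OF lin] inj inj_on_subset by blast
    moreover have "G \<inter> Ep = {0}"
    proof -
      have "v = 0" if "v \<in> G" "v \<in> Ep" for v
      proof (rule ccontr)
        assume "v \<noteq> 0"
        then have "D 0 v \<noteq> 0" using inj lin by (metis linear_injective_0)
        then have "hessian M f a (D 0 v) (D 0 v) < 0" using F that unfolding G_def by auto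
        then show False using H[of 0 v] that sub by (auto simp: subspace_0)
      qed
      then show ?thesis using G sub subspace_0 by blast
    qed
    then have "dim {x + y |x y. x \<in> G \<and> y \<in> Ep} = dim G + dim Ep"
      using dim_sums_Int[OF G sub(2)] by simp
    moreover have "{x + y |x y. x \<in> G \<and> y \<in> Ep} \<subseteq> E"
      using subspace_E Ep_sub G_def by (auto intro: subspace_add)
    then have "dim {x + y |x y. x \<in> G \<and> y \<in> Ep} \<le> dim E" by (rule dim_subset)
    moreover have "dim E = dim Em + dim Ep"
      using dim_tangent[OF zero(1)] T subspace_0[OF subspace_E] zero dim_image_eq[OF lin, of E] inj
      by (simp add: inj_on_subset)
    ultimately show ?thesis by simp
  qed
  moreover have "dim Em \<in> dim ` ?S"
  proof
    show "dim Em = dim (D 0 ` Em)" using dim_image_eq[OF lin] inj inj_on_subset by (metis subset_UNIV)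
    have "hessian M f a (D 0 u) (D 0 u) < 0" if "u \<in> Em" "D 0 u \<noteq> 0" for u
      using H[of u 0] that sub linear_0[OF lin] by (auto simp: subspace_0)
    then show "D 0 ` Em \<in> ?S" using T Em_sub sub lin by (auto intro: linear_subspace_image)
  qed
  ultimately show ?thesis unfolding morse_index_def by (intro Max_eqI) auto
qed

lemma local_min_Em:
  assumes "\<And>x. x \<in> M \<Longrightarrow> f a \<le> f x"
  shows "Em = {0}"
proof -
  have "u = 0" if "u \<in> Em" for u
  proof -
    obtain e where e: "e > 0" "ball 0 e \<subseteq> V" using opens zero open_contains_ball by blast
    define w where "w = (e / (2 * (norm u + 1))) *\<^sub>R u"
    have nn: "0 < norm u + 1" by (simp add: add_nonneg_pos)
    have "norm w = e * norm u / (2 * (norm u + 1))" using e unfolding w_def by (simp add: abs_of_pos)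
    also have "\<dots> < e" using e nn by (simp add: divide_less_eq)
    finally have wV: "w \<in> V" using e by auto
    have wE: "w \<in> Em" unfolding w_def using that sub by (simp add: subspace_scale)
    have "f (\<psi> w) = f a - (norm w)\<^sup>2" using f_chart[of w 0] wE wV sub by (simp add: subspace_0)
    moreover have "f a \<le> f (\<psi> w)" using assms psi_in_M wV wE Em_sub by auto
    ultimately have "w = 0" by simp
    then show "u = 0" using e nn by (auto simp: w_def)
  qed
  then show ?thesis using sub subspace_0 by blast
qed

lemma higher_points_Ep:
  assumes "\<And>e. e > 0 \<Longrightarrow> \<exists>x\<in>M. dist x a < e \<and> f x > f a"
  shows "Ep \<noteq> {0}"
proof
  assume Ep: "Ep = {0}"
  obtain e where e: "e > 0" "ball a e \<subseteq> U" using opens a_in open_contains_ball by blast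
  obtain x where x: "x \<in> M" "dist x a < e" "f x > f a" using assms[OF e(1)] by blast
  then have "x \<in> U" using e by (auto simp: dist_commute)
  then have "\<phi> x \<in> E" "\<psi> (\<phi> x) = x" "\<phi> x \<in> V" using phi_in_E x inverses by auto
  moreover from this obtain u v where "\<phi> x = u + v" "u \<in> Em" "v \<in> Ep" unfolding E_def by blast
  ultimately have "f x = f a - (norm (\<phi> x))\<^sup>2" using f_chart[of "\<phi> x" 0] Ep by auto
  then show False using x by simp
qed

end

lemma morse_chart_iff: "morse_chart M f a V Em Ep \<psi> \<longleftrightarrow> (\<exists>U \<phi>. morse_chart_at M f a V Em Ep \<psi> U \<phi>)"
  unfolding morse_chart_def morse_chart_at_def by blast

lemma morse_chart_at_uminus:
  assumes "morse_chart_at M f a V Em Ep \<psi> U \<phi>"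
  shows "morse_chart_at M (\<lambda>x. - f x) a V Ep Em \<psi> U \<phi>"
proof -
  interpret morse_chart_at M f a V Em Ep \<psi> U \<phi> by fact
  have E': "{u + v |u v. u \<in> Ep \<and> v \<in> Em} = {u + v |u v. u \<in> Em \<and> v \<in> Ep}"
    by (intro Collect_cong) (blast intro: add.commute)
  show ?thesis
  proof (rule morse_chart_at.intro)
    show "\<psi> ` (V \<inter> {u + v |u v. u \<in> Ep \<and> v \<in> Em}) = U \<inter> M" unfolding E' by (rule image)
    show "inner u v = 0" if "u \<in> Ep" "v \<in> Em" for u v
      using orth[OF that(2,1)] by (simp add: inner_commute)
    show "- f (\<psi> (u + v)) = - f a - (norm u)\<^sup>2 + (norm v)\<^sup>2" if "u \<in> Ep" "v \<in> Em" "u + v \<in> V" for u v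
      using f_chart[OF that(2,1)] that(3) by (simp add: add.commute[of u v])
  qed (fact diffeo zero sub)+
qed

lemma smooth_on_map_prod:
  assumes "open A" "open B" "smooth_on A g" "smooth_on B h"
  shows "smooth_on (A \<times> B) (map_prod g h)"
  unfolding map_prod_def case_prod_beta
  by (intro smooth_on_Pair smooth_on_compose[OF _ assms(1) _ _ assms(3)] smooth_on_compose[OF _ assms(2) _ _ assms(4)])
    (auto intro: open_Times assms smooth_on_bounded_linear bounded_linear_fst bounded_linear_snd)

lemma diffeomorphism_map_prod:
  assumes "diffeomorphism U V \<phi> \<psi>" "diffeomorphism U' V' \<phi>' \<psi>'"
  shows "diffeomorphism (U \<times> U') (V \<times> V') (map_prod \<phi> \<phi>') (map_prod \<psi> \<psi>')"
proof -
  have s: "smooth_on (U \<times> U') (map_prod \<phi> \<phi>')" "smooth_on (V \<times> V') (map_prod \<psi> \<psi>')"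
    using assms unfolding diffeomorphism_def by (auto intro: smooth_on_map_prod)
  then have "homeomorphism (U \<times> U') (V \<times> V') (map_prod \<phi> \<phi>') (map_prod \<psi> \<psi>')"
    using assms s[THEN smooth_on_continuous] unfolding diffeomorphism_def homeomorphism_def
    by (auto simp: map_prod_surj_on)
  then show ?thesis using assms s unfolding diffeomorphism_def by (auto intro: open_Times)
qed

lemma morse_chart_Times:
  assumes "morse_chart_at M f a V Em Ep \<psi> U \<phi>" "morse_chart_at M' f' a' V' Em' Ep' \<psi>' U' \<phi>'"
  shows "morse_chart_at (M \<times> M') (\<lambda>(x, y). f x + f' y) (a, a') (V \<times> V') (Em \<times> Em') (Ep \<times> Ep')
     (map_prod \<psi> \<psi>') (U \<times> U') (map_prod \<phi> \<phi>')"
proof -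
  interpret A: morse_chart_at M f a V Em Ep \<psi> U \<phi> by fact
  interpret B: morse_chart_at M' f' a' V' Em' Ep' \<psi>' U' \<phi>' by fact
  have E: "{u + v |u v. u \<in> Em \<times> Em' \<and> v \<in> Ep \<times> Ep'} = A.E \<times> B.E"
    unfolding A.E_def B.E_def by force
  show ?thesis
  proof
    show "map_prod \<psi> \<psi>' ` (V \<times> V' \<inter> {u + v |u v. u \<in> Em \<times> Em' \<and> v \<in> Ep \<times> Ep'}) = U \<times> U' \<inter> M \<times> M'"
      unfolding E Times_Int_Times[symmetric] using A.image B.image
      unfolding A.E_def[symmetric] B.E_def[symmetric] by (simp add: Times_Int_Times map_prod_surj_on)
    fix u v assume uv: "u \<in> Em \<times> Em'" "v \<in> Ep \<times> Ep'"
    show "inner u v = 0" using uv A.orth B.orth by auto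
    show "(case map_prod \<psi> \<psi>' (u + v) of (x, y) \<Rightarrow> f x + f' y) =
      (case (a, a') of (x, y) \<Rightarrow> f x + f' y) - (norm u)\<^sup>2 + (norm v)\<^sup>2" if "u + v \<in> V \<times> V'"
      using uv that A.f_chart[of "fst u" "fst v"] B.f_chart[of "snd u" "snd v"]
      by (auto simp: norm_Pair)
  qed (use A.zero B.zero A.sub B.sub diffeomorphism_map_prod[OF A.diffeo B.diffeo] in
      \<open>auto intro: subspace_Times simp: zero_prod_def\<close>)
qed

section \<open>Integral curves of Lipschitz vector fields\<close>

lemma lipschitz_curves_dist:
  fixes u w :: "real \<Rightarrow> 'a::real_inner"
  assumes T: "0 \<le> T"
    and u: "\<And>t. t \<in> {0..T} \<Longrightarrow> (u has_vector_derivative X (u t)) (at t within {0..T})"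
    and w: "\<And>t. t \<in> {0..T} \<Longrightarrow> (w has_vector_derivative X (w t)) (at t within {0..T})"
    and L: "\<And>t. t \<in> {0..T} \<Longrightarrow> norm (X (u t) - X (w t)) \<le> L * norm (u t - w t)"
  shows "norm (u T - w T) \<le> exp (L * T) * norm (u 0 - w 0)"
proof -
  define g where "g t = exp (- 2 * L * t) * inner (u t - w t) (u t - w t)" for t
  have d: "((\<lambda>t. u t - w t) has_derivative (\<lambda>h. h *\<^sub>R (X (u t) - X (w t)))) (at t within {0..T})"
    if "t \<in> {0..T}" for t
    using has_vector_derivative_diff[OF u w, OF that that] by (simp add: has_vector_derivative_def)
  have g': "(g has_derivative (\<lambda>h. h * (exp (- 2 * L * t) *
      (2 * inner (u t - w t) (X (u t) - X (w t)) - 2 * L * inner (u t - w t) (u t - w t))))) (at t within {0..T})"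
    if "t \<in> {0..T}" for t
    unfolding g_def
    by (rule has_derivative_eq_rhs, (rule derivative_eq_intros d[OF that] refl)+)
      (auto simp: fun_eq_iff algebra_simps inner_commute)
  have "g T \<le> g 0"
  proof (rule DERIV_nonpos_imp_decreasing_open[OF T])
    show "continuous_on {0..T} g"
      using g' has_derivative_continuous continuous_on_eq_continuous_within by blast
    fix t assume t: "0 < t" "t < T"
    let ?c = "exp (- 2 * L * t) *
      (2 * inner (u t - w t) (X (u t) - X (w t)) - 2 * L * inner (u t - w t) (u t - w t))"
    have "at t within {0..T} = at t" using t by (intro at_within_interior) auto
    then have "(g has_real_derivative ?c) (at t)"
      using g'[of t] t by (intro has_derivative_imp_has_field_derivative[of _ "\<lambda>h. h * ?c"]) auto
    moreover have "inner (u t - w t) (X (u t) - X (w t)) \<le> norm (u t - w t) * norm (X (u t) - X (w t))"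
      by (rule norm_cauchy_schwarz)
    then have "inner (u t - w t) (X (u t) - X (w t)) \<le> norm (u t - w t) * (L * norm (u t - w t))"
      using mult_left_mono[OF L[of t], of "norm (u t - w t)"] t by auto
    then have "?c \<le> 0"
      by (intro mult_nonneg_nonpos) (simp_all add: power2_norm_eq_inner[symmetric] power2_eq_square algebra_simps)
    ultimately show "\<exists>y. (g has_real_derivative y) (at t) \<and> y \<le> 0" by blast
  qed
  then have "exp (- 2 * L * T) * (norm (u T - w T))\<^sup>2 \<le> (norm (u 0 - w 0))\<^sup>2"
    by (simp add: g_def power2_norm_eq_inner)
  then have "exp (2 * L * T) * (exp (- 2 * L * T) * (norm (u T - w T))\<^sup>2) \<le> exp (2 * L * T) * (norm (u 0 - w 0))\<^sup>2"
    by (intro mult_left_mono) auto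
  then have "(norm (u T - w T))\<^sup>2 \<le> exp (2 * L * T) * (norm (u 0 - w 0))\<^sup>2"
    by (simp add: mult.assoc[symmetric] exp_add[symmetric])
  also have "\<dots> = (exp (L * T) * norm (u 0 - w 0))\<^sup>2"
    by (simp add: power_mult_distrib exp_double[symmetric] mult.assoc)
  finally show ?thesis by (rule power2_le_imp_le) simp
qed

lemma integral_exp_le:
  fixes K s C :: real
  assumes "K > 0" "0 \<le> s" "0 \<le> C"
  shows "integral {0..s} (\<lambda>r. C * exp (K * r)) \<le> C * exp (K * s) / K"
proof -
  have "((\<lambda>r. C * exp (K * r)) has_integral (C * exp (K * s) / K - C * exp (K * 0) / K)) {0..s}"
    using assms by (intro fundamental_theorem_of_calculus)
      (auto intro!: derivative_eq_intros simp: has_real_derivative_iff_has_vector_derivative[symmetric])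
  from integral_unique[OF this] have "integral {0..s} (\<lambda>r. C * exp (K * r)) = C * exp (K * s) / K - C / K"
    by simp
  also have "\<dots> \<le> C * exp (K * s) / K" using assms by simp
  finally show ?thesis .
qed

lemma picard_forward:
  fixes F :: "'a::euclidean_space \<Rightarrow> 'a"
  assumes Lip: "\<And>x y. norm (F x - F y) \<le> L * norm (x - y)"
  shows "\<exists>u. u 0 = x0 \<and> (\<forall>t\<ge>0. (u has_vector_derivative F (u t)) (at t within {0..}))"
proof -
  define K where "K = 2 * (\<bar>L\<bar> + 1)"
  have K: "K > 0" unfolding K_def by simp
  have Lip': "norm (F x - F y) \<le> K / 2 * norm (x - y)" for x y
  proof -
    have "L * norm (x - y) \<le> K / 2 * norm (x - y)" unfolding K_def by (intro mult_right_mono) auto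
    then show ?thesis using Lip order_trans by blast
  qed
  have contF: "continuous_on S F" for S
  proof (rule continuous_on_subset[OF lipschitz_on_continuous_on])
    show "(K / 2)-lipschitz_on UNIV F" using Lip' K by (intro lipschitz_onI) (auto simp: dist_norm)
  qed auto
  define G where "G v r = F (x0 + exp (K * r) *\<^sub>R apply_bcontfun v r)" for v :: "real \<Rightarrow>\<^sub>C 'a" and r
  define I where "I v t = integral {0..max 0 t} (G v)" for v t
  define H where "H v t = exp (- K * max 0 t) *\<^sub>R I v t" for v t
  have contG: "continuous_on S (G v)" for S v
    unfolding G_def by (intro continuous_on_compose2[OF contF[of UNIV]] continuous_intros) auto
  have intG: "G v integrable_on {0..t}" for v t
    by (intro integrable_continuous_real contG)
  have contI: "continuous_on UNIV (I v)" for v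
  proof -
    have "continuous_on {..<real n} (I v)" for n
      unfolding I_def
      by (rule continuous_on_compose2[OF indefinite_integral_continuous_1[OF intG[of v "real n"]], of _ "\<lambda>t. max 0 t"])
        (auto intro!: continuous_intros)
    then have "continuous_on (\<Union>n. {..<real n}) (I v)" by (intro continuous_on_open_UN) auto
    moreover have "(\<Union>n. {..<real n}) = UNIV" using reals_Archimedean2 by blast
    ultimately show ?thesis by simp
  qed
  have contH: "continuous_on UNIV (H v)" for v
    unfolding H_def by (intro continuous_intros contI)
  have HK: "norm (exp (- K * max 0 t) *\<^sub>R J) \<le> C / K" if "norm J \<le> C * exp (K * max 0 t) / K" for C t and J :: 'a
  proof -
    have "exp (- K * max 0 t) * norm J \<le> exp (- K * max 0 t) * (C * exp (K * max 0 t) / K)"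
      using that by (intro mult_left_mono) auto
    also have "\<dots> = C / K" by (simp add: exp_minus field_simps)
    finally show ?thesis by simp
  qed
  have bdH: "norm (H v t) \<le> (norm (F x0) + K / 2 * norm v) / K" for v t
    unfolding H_def
  proof (rule HK)
    let ?C = "norm (F x0) + K / 2 * norm v"
    have "norm (I v t) \<le> integral {0..max 0 t} (\<lambda>r. ?C * exp (K * r))"
      unfolding I_def
    proof (rule Henstock_Kurzweil_Integration.integral_norm_bound_integral[OF intG])
      show "(\<lambda>r. ?C * exp (K * r)) integrable_on {0..max 0 t}"
        by (intro integrable_continuous_real continuous_intros)
      fix r assume r: "r \<in> {0..max 0 t}"
      have "norm (G v r) \<le> norm (F x0) + norm (G v r - F x0)" by (metis add.commute norm_triangle_sub)
      also have "norm (G v r - F x0) \<le> K / 2 * (exp (K * r) * norm v)"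
        using Lip'[of "x0 + exp (K * r) *\<^sub>R v r" x0] K norm_bounded[of v r] unfolding G_def
        by (auto intro: order_trans mult_left_mono)
      also have "norm (F x0) + K / 2 * (exp (K * r) * norm v) \<le> ?C * exp (K * r)"
      proof -
        have "1 \<le> exp (K * r)" using K r by simp
        then have "norm (F x0) * 1 \<le> norm (F x0) * exp (K * r)" by (intro mult_left_mono) auto
        then show ?thesis by (simp add: algebra_simps)
      qed
      finally show "norm (G v r) \<le> ?C * exp (K * r)" by simp
    qed
    also have "\<dots> \<le> ?C * exp (K * max 0 t) / K"
      using K by (intro integral_exp_le) auto
    finally show "norm (I v t) \<le> ?C * exp (K * max 0 t) / K" .
  qed
  define \<Phi> where "\<Phi> v = Bcontfun (H v)" for v
  have \<Phi>: "apply_bcontfun (\<Phi> v) = H v" for v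
    unfolding \<Phi>_def by (rule Bcontfun_inverse) (rule bcontfun_normI[OF contH bdH])
  have "dist (\<Phi> v) (\<Phi> w) \<le> 1/2 * dist v w" for v w
  proof (rule dist_bound)
    fix t
    have "norm (I v t - I w t) \<le> integral {0..max 0 t} (\<lambda>r. (K / 2 * dist v w) * exp (K * r))"
      unfolding I_def Henstock_Kurzweil_Integration.integral_diff[OF intG intG, symmetric]
    proof (rule Henstock_Kurzweil_Integration.integral_norm_bound_integral[OF integrable_diff[OF intG intG]])
      show "(\<lambda>r. (K / 2 * dist v w) * exp (K * r)) integrable_on {0..max 0 t}"
        by (intro integrable_continuous_real continuous_intros)
      fix r
      have "norm (G v r - G w r) \<le> K / 2 * (exp (K * r) * norm (v r - w r))"
        using Lip'[of "x0 + exp (K * r) *\<^sub>R v r" "x0 + exp (K * r) *\<^sub>R w r"] unfolding G_def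
        by (simp add: scaleR_diff_right[symmetric])
      also have "\<dots> \<le> K / 2 * (exp (K * r) * dist v w)"
        using dist_bounded[of v r w] K by (intro mult_left_mono) (auto simp: dist_norm)
      finally show "norm (G v r - G w r) \<le> (K / 2 * dist v w) * exp (K * r)" by (simp add: algebra_simps)
    qed
    also have "\<dots> \<le> (K / 2 * dist v w) * exp (K * max 0 t) / K"
      using K by (intro integral_exp_le) auto
    finally have "norm (exp (- K * max 0 t) *\<^sub>R (I v t - I w t)) \<le> (K / 2 * dist v w) / K" by (rule HK)
    then show "dist (\<Phi> v t) (\<Phi> w t) \<le> 1/2 * dist v w"
      using K by (simp add: \<Phi> H_def dist_norm scaleR_diff_right)
  qed
  then obtain v where v: "\<Phi> v = v" using banach_fix_type[of "1/2" \<Phi>] by auto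
  define u where "u t = x0 + exp (K * t) *\<^sub>R apply_bcontfun v t" for t
  have u: "u t = x0 + integral {0..t} (\<lambda>r. F (u r))" if "t \<ge> 0" for t
  proof -
    have "apply_bcontfun v t = H v t" using \<Phi>[of v] v by simp
    also have "\<dots> = exp (- K * t) *\<^sub>R integral {0..t} (\<lambda>r. F (u r))"
      using that by (simp add: H_def I_def G_def[abs_def] u_def[abs_def])
    finally show ?thesis unfolding u_def[of t] by (simp add: exp_add[symmetric])
  qed
  have contu: "continuous_on S (\<lambda>r. F (u r))" for S
    unfolding u_def by (intro continuous_on_compose2[OF contF[of UNIV]] continuous_intros) auto
  have "(u has_vector_derivative F (u t)) (at t within {0..})" if t: "t \<ge> 0" for t
  proof -
    have "((\<lambda>t. x0 + integral {0..t} (\<lambda>r. F (u r))) has_vector_derivative F (u t)) (at t within {0..t + 1})"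
      using integral_has_vector_derivative[OF contu, of t 0 "t + 1"] t
      by (auto intro!: derivative_eq_intros)
    then have "(u has_vector_derivative F (u t)) (at t within {0..t + 1})"
      by (rule has_vector_derivative_transform[rotated 2]) (use t u in auto)
    moreover have "at t within {0..t + 1} = at t within {0..}"
      by (rule at_within_nhd[of _ "{..<t+1}"]) auto
    ultimately show ?thesis by simp
  qed
  moreover have "u 0 = x0" using u[of 0] by simp
  ultimately show ?thesis by blast
qed

lemma picard_lindelof:
  fixes F :: "'a::euclidean_space \<Rightarrow> 'a"
  assumes Lip: "\<And>x y. norm (F x - F y) \<le> L * norm (x - y)"
  shows "\<exists>u. u 0 = x0 \<and> (\<forall>t. (u has_vector_derivative F (u t)) (at t))"
proof -
  obtain p where p: "p 0 = x0" "\<And>t. t \<ge> 0 \<Longrightarrow> (p has_vector_derivative F (p t)) (at t within {0..})"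
    using picard_forward[of F L x0] Lip by blast
  have "norm (- F x - - F y) \<le> L * norm (x - y)" for x y using Lip[of x y] by (simp add: norm_minus_commute)
  then obtain q where q: "q 0 = x0" "\<And>t. t \<ge> 0 \<Longrightarrow> (q has_vector_derivative - F (q t)) (at t within {0..})"
    using picard_forward[of "\<lambda>x. - F x" L x0] by blast
  define u where "u t = (if t \<in> {0..} then p t else q (- t))" for t :: real
  have q': "((\<lambda>t. q (- t)) has_vector_derivative F (q (- t))) (at t within {..0})" if "t \<le> 0" for t
  proof -
    have "(uminus has_vector_derivative - 1) (at t within {..0::real})"
      by (auto intro!: derivative_eq_intros)
    moreover have "(q has_vector_derivative - F (q (- t))) (at (- t) within uminus ` {..0})"
      using q(2)[of "- t"] that by simp
    ultimately have "(q \<circ> uminus has_vector_derivative - 1 *\<^sub>R - F (q (- t))) (at t within {..0})"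
      by (rule vector_diff_chain_within)
    then show ?thesis by (simp add: o_def)
  qed
  have "(u has_vector_derivative (if t \<in> {0..} then F (p t) else F (q (- t)))) (at t within UNIV)" for t
    unfolding u_def
    by (rule has_vector_derivative_If_within_closures[where T = "{..0}"])
      (use p q q' in \<open>auto simp: insert_absorb\<close>)
  then have "(u has_vector_derivative F (u t)) (at t)" for t by (simp add: u_def if_distrib)
  then show ?thesis using p by (intro exI[of _ u]) (auto simp: u_def)
qed

lemma integral_curve_derivative: "integral_curve M X u \<Longrightarrow> (u has_vector_derivative X (u t)) (at t within S)"
  unfolding integral_curve_def by (blast intro: has_vector_derivative_at_within)

lemma integral_curve_in: "integral_curve M X u \<Longrightarrow> u t \<in> M"
  unfolding integral_curve_def by blast

lemma integral_curve_continuous: "integral_curve M X u \<Longrightarrow> continuous_on S u"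
  using integral_curve_derivative has_vector_derivative_continuous
  by (metis continuous_on_eq_continuous_within)

lemma integral_curve_const: "x \<in> M \<Longrightarrow> X x = 0 \<Longrightarrow> integral_curve M X (\<lambda>_. x)"
  unfolding integral_curve_def by simp

lemma integral_curve_affine:
  assumes "integral_curve M X u"
  shows "integral_curve M (\<lambda>x. c *\<^sub>R X x) (\<lambda>t. u (s + c * t))"
  unfolding integral_curve_def
proof (intro allI conjI)
  fix t
  have "((\<lambda>t. s + c * t) has_vector_derivative c) (at t)" by (auto intro!: derivative_eq_intros)
  from vector_diff_chain_at[OF this integral_curve_derivative[OF assms]]
  show "((\<lambda>t. u (s + c * t)) has_vector_derivative c *\<^sub>R X (u (s + c * t))) (at t)" by (simp add: o_def)
qed (use assms integral_curve_in in blast)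

lemma integral_curve_shift: "integral_curve M X u \<Longrightarrow> integral_curve M X (\<lambda>t. u (s + t))"
  using integral_curve_affine[of M X u 1 s] by simp

lemma integral_curve_reverse: "integral_curve M X u \<Longrightarrow> integral_curve M (\<lambda>x. - X x) (\<lambda>t. u (- t))"
  using integral_curve_affine[of M X u "- 1" 0] by simp

lemma integral_curve_reverse_iff:
  "integral_curve M (\<lambda>x. - X x) (\<lambda>t. u (- t)) \<longleftrightarrow> integral_curve M X u"
  using integral_curve_reverse[of M X u] integral_curve_reverse[of M "\<lambda>x. - X x" "\<lambda>t. u (- t)"] by auto

lemma unstable_manifold_reverse:
  "unstable_manifold M X a = stable_manifold M (\<lambda>x. - X x) a"
proof -
  have "(\<exists>u. P u) \<longleftrightarrow> (\<exists>u. P (\<lambda>t::real. u (- t)))" for P :: "(real \<Rightarrow> 'a) \<Rightarrow> bool"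
  proof
    assume "\<exists>u. P u"
    then obtain u where "P u" by blast
    then show "\<exists>u. P (\<lambda>t. u (- t))" by (intro exI[of _ "\<lambda>t. u (- t)"]) simp
  qed blast
  from this[of "\<lambda>u. integral_curve M (\<lambda>x. - X x) u \<and> u 0 = _ \<and> (u \<longlongrightarrow> a) at_top"]
  show ?thesis unfolding unstable_manifold_def stable_manifold_def
    by (simp add: integral_curve_reverse_iff filterlim_at_bot_mirror)
qed

lemma stable_manifold_reverse:
  "stable_manifold M X a = unstable_manifold M (\<lambda>x. - X x) a"
  by (simp add: unstable_manifold_reverse)

lemma stable_manifoldI: "integral_curve M X u \<Longrightarrow> (u \<longlongrightarrow> a) at_top \<Longrightarrow> u t \<in> stable_manifold M X a"
proof -
  assume u: "integral_curve M X u" "(u \<longlongrightarrow> a) at_top"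
  have "((\<lambda>s. u (t + s)) \<longlongrightarrow> a) at_top"
    by (rule filterlim_compose[OF u(2)]) (simp add: filterlim_tendsto_add_at_top[OF tendsto_const filterlim_ident])
  then show ?thesis unfolding stable_manifold_def using integral_curve_shift[OF u(1), of t]
    by (intro CollectI exI[of _ "\<lambda>s. u (t + s)"]) auto
qed

lemma unstable_manifoldI: "integral_curve M X u \<Longrightarrow> (u \<longlongrightarrow> a) at_bot \<Longrightarrow> u t \<in> unstable_manifold M X a"
  using stable_manifoldI[of M "\<lambda>x. - X x" "\<lambda>t. u (- t)" a "- t"]
  by (simp add: unstable_manifold_reverse integral_curve_reverse_iff filterlim_at_bot_mirror)

locale lipschitz_field =
  fixes M :: "'a::euclidean_space set" and X :: "'a \<Rightarrow> 'a" and L :: real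
  assumes lipschitz: "\<And>x y. x \<in> M \<Longrightarrow> y \<in> M \<Longrightarrow> norm (X x - X y) \<le> L * norm (x - y)"
begin

lemma dist_forward:
  assumes "integral_curve M X u" "integral_curve M X w" "t \<ge> 0"
  shows "norm (u t - w t) \<le> exp (L * t) * norm (u 0 - w 0)"
  using assms by (intro lipschitz_curves_dist[where X = X]) (auto intro: integral_curve_derivative lipschitz integral_curve_in)

lemma reverse: "lipschitz_field M (\<lambda>x. - X x) L"
  by unfold_locales (metis lipschitz minus_diff_minus norm_minus_cancel)

lemma dist_flow:
  assumes "integral_curve M X u" "integral_curve M X w"
  shows "norm (u t - w t) \<le> exp (L * \<bar>t\<bar>) * norm (u 0 - w 0)"
proof (cases "t \<ge> 0")
  case True
  then show ?thesis using dist_forward[OF assms] by simp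
next
  case False
  then show ?thesis using lipschitz_field.dist_forward[OF reverse assms[THEN integral_curve_reverse], of "- t"] by simp
qed

lemma unique:
  assumes "integral_curve M X u" "integral_curve M X w" "u s = w s"
  shows "u t = w t"
  using dist_flow[OF assms(1,2)[THEN integral_curve_shift[where s = s]], of "t - s"] assms(3) by simp

lemma unique_shift:
  assumes "integral_curve M X u" "integral_curve M X w" "u s = w r"
  shows "u (s + t) = w (r + t)"
  using unique[OF integral_curve_shift[OF assms(1), of s] integral_curve_shift[OF assms(2), of r], of 0 t] assms(3) by simp

lemma unique_forward:
  assumes "integral_curve M X u" and w: "\<And>t. t \<ge> 0 \<Longrightarrow> w t \<in> M \<and> (w has_vector_derivative X (w t)) (at t)"
    and "u 0 = w 0" "t \<ge> 0"
  shows "u t = w t"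
proof -
  have "norm (u t - w t) \<le> exp (L * t) * norm (u 0 - w 0)"
    using assms by (intro lipschitz_curves_dist[where X = X])
      (auto intro: integral_curve_derivative lipschitz integral_curve_in has_vector_derivative_at_within)
  then show ?thesis using assms(3) by simp
qed

lemma flow_continuous:
  assumes "integral_curve M X u" "e > 0"
  obtains d where "d > 0" "\<And>w. integral_curve M X w \<Longrightarrow> dist (w 0) (u 0) < d \<Longrightarrow> dist (w t) (u t) < e"
proof
  let ?d = "e / exp (L * \<bar>t\<bar>)"
  show "?d > 0" using assms by simp
  fix w assume w: "integral_curve M X w" "dist (w 0) (u 0) < ?d"
  have "dist (w t) (u t) \<le> exp (L * \<bar>t\<bar>) * dist (w 0) (u 0)"
    using dist_flow[OF w(1) assms(1)] by (simp add: dist_norm)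
  also have "\<dots> < e" using w(2) by (simp add: field_simps)
  finally show "dist (w t) (u t) < e" .
qed

end

lemma smooth_map_onE:
  assumes "smooth_map_on M f" "x \<in> M"
  obtains U g where "open U" "x \<in> U" "smooth_on U g" "\<And>y. y \<in> M \<Longrightarrow> y \<in> U \<Longrightarrow> g y = f y"
proof -
  from assms have "\<exists>U g. open U \<and> x \<in> U \<and> smooth_on U g \<and> (\<forall>y\<in>M \<inter> U. g y = f y)"
    unfolding smooth_map_on_def by (rule bspec)
  then obtain U g where "open U \<and> x \<in> U \<and> smooth_on U g \<and> (\<forall>y\<in>M \<inter> U. g y = f y)"
    by (elim exE)
  then show thesis by (intro that[of U g]) simp_all
qed

lemma lipschitz_on_compact:
  fixes M :: "'a::euclidean_space set" and X :: "'a \<Rightarrow> 'b::euclidean_space"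
  assumes "compact M" "smooth_map_on M X"
  obtains L where "L \<ge> 0" "\<And>x y. x \<in> M \<Longrightarrow> y \<in> M \<Longrightarrow> norm (X x - X y) \<le> L * norm (x - y)"
proof -
  have contX: "continuous_on M X"
  proof (unfold continuous_on_eq_continuous_within, intro ballI)
    fix x assume x: "x \<in> M"
    obtain U g where g: "open U" "x \<in> U" "smooth_on U g" "\<And>y. y \<in> M \<Longrightarrow> y \<in> U \<Longrightarrow> g y = X y"
      using smooth_map_onE[OF assms(2) x] by metis
    have c: "continuous (at x within M) g"
      by (rule continuous_at_imp_continuous_at_within)
        (use smooth_on_continuous[OF g(3)] g(1,2) in \<open>simp add: continuous_on_eq_continuous_at\<close>)
    obtain d where d: "d > 0" "ball x d \<subseteq> U" using g open_contains_ball by blast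
    show "continuous (at x within M) X"
    proof (rule continuous_transform_within[OF c d(1) x])
      fix y assume y: "y \<in> M" "dist y x < d"
      then have "y \<in> ball x d" by (simp add: dist_commute)
      then show "g y = X y" using d(2) g(4) y(1) by blast
    qed
  qed
  have loc: "\<exists>d>0. \<exists>K\<ge>0. \<forall>y\<in>M. \<forall>z\<in>M. dist y x < d \<longrightarrow> dist z x < d \<longrightarrow> norm (X y - X z) \<le> K * norm (y - z)"
    if x: "x \<in> M" for x
  proof -
    obtain U g where g: "open U" "x \<in> U" "smooth_on U g" "\<And>y. y \<in> M \<Longrightarrow> y \<in> U \<Longrightarrow> g y = X y"
      using smooth_map_onE[OF assms(2) x] by metis
    obtain d where d: "d > 0" "cball x d \<subseteq> U" using g open_contains_cball by blast
    have "continuous_on (cball x d) (\<lambda>y. \<Sum>b\<in>Basis. norm (frechet_derivative g (at y) b))"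
      by (intro continuous_on_sum continuous_on_norm d(2)
          continuous_on_subset[OF smooth_on_continuous[OF smooth_on_derivative[OF g(3)]]])
    then have "bounded ((\<lambda>y. \<Sum>b\<in>Basis. norm (frechet_derivative g (at y) b)) ` cball x d)"
      by (intro compact_imp_bounded compact_continuous_image) auto
    then obtain K where "\<forall>s\<in>(\<lambda>y. \<Sum>b\<in>Basis. norm (frechet_derivative g (at y) b)) ` cball x d. norm s \<le> K"
      unfolding bounded_iff by blast
    then have K: "norm (\<Sum>b\<in>Basis. norm (frechet_derivative g (at y) b)) \<le> K" if "y \<in> cball x d" for y
      using that by blast
    have on: "onorm (frechet_derivative g (at y)) \<le> K" if y: "y \<in> cball x d" for y
    proof (rule onorm_le)
      fix v
      have lin: "linear (frechet_derivative g (at y))"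
        using smooth_on_has_derivative[OF g(3)] d y has_derivative_linear by blast
      have "frechet_derivative g (at y) v = frechet_derivative g (at y) (\<Sum>b\<in>Basis. inner v b *\<^sub>R b)"
        by (simp add: euclidean_representation)
      also have "\<dots> = (\<Sum>b\<in>Basis. inner v b *\<^sub>R frechet_derivative g (at y) b)"
        using lin by (simp add: linear_sum linear_scale)
      also have "norm \<dots> \<le> (\<Sum>b\<in>Basis. norm v * norm (frechet_derivative g (at y) b))"
        by (intro sum_norm_le) (auto intro!: mult_right_mono Basis_le_norm)
      also have "\<dots> = norm v * (\<Sum>b\<in>Basis. norm (frechet_derivative g (at y) b))"
        by (simp add: sum_distrib_left)
      also have "\<dots> \<le> norm v * K"
        by (rule mult_left_mono) (use K[OF y] in \<open>simp_all add: abs_le_iff\<close>)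
      also have "\<dots> = K * norm v" by simp
      finally show "norm (frechet_derivative g (at y) v) \<le> K * norm v" .
    qed
    have "norm (X y - X z) \<le> K * norm (y - z)" if yz: "y \<in> M" "z \<in> M" "dist y x < d" "dist z x < d" for y z
    proof -
      have in': "y \<in> cball x d" "z \<in> cball x d" using yz by (auto simp: dist_commute)
      have "norm (g y - g z) \<le> K * norm (y - z)"
      proof (rule differentiable_bound[OF convex_cball _ on in'])
        fix w assume "w \<in> cball x d"
        then have "w \<in> U" using d by blast
        then show "(g has_derivative frechet_derivative g (at w)) (at w within cball x d)"
          using smooth_on_has_derivative[OF g(3)] has_derivative_at_withinI by blast
      qed
      moreover have "g y = X y" "g z = X z" using g(4) yz d in' by blast+
      ultimately show ?thesis by simp
    qed
    moreover have "K \<ge> 0" using order_trans[OF norm_ge_zero K[of x]] d by simp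
    ultimately show ?thesis using d by blast
  qed
  obtain C where "\<forall>y\<in>X ` M. norm y \<le> C"
    using compact_imp_bounded[OF compact_continuous_image[OF contX assms(1)]] unfolding bounded_iff by blast
  then have C: "norm (X x) \<le> C" if "x \<in> M" for x using that by blast
  define Q where "Q x d K \<longleftrightarrow> d > 0 \<and> K \<ge> 0 \<and>
      (\<forall>y\<in>M. \<forall>z\<in>M. dist y x < d \<longrightarrow> dist z x < d \<longrightarrow> norm (X y - X z) \<le> K * norm (y - z))" for x d K
  have "\<forall>x\<in>M. \<exists>p. Q x (fst p) (snd p)"
  proof
    fix x assume "x \<in> M"
    from loc[OF this] obtain d K where "Q x d K" unfolding Q_def by blast
    then show "\<exists>p. Q x (fst p) (snd p)" by (intro exI[of _ "(d, K)"]) simp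
  qed
  then obtain p where "\<forall>x\<in>M. Q x (fst (p x)) (snd (p x))" by (rule bchoice[THEN exE])
  moreover define d where "d x = fst (p x)" for x
  moreover define K where "K x = snd (p x)" for x
  ultimately have dK: "d x > 0 \<and> K x \<ge> 0 \<and>
      (\<forall>y\<in>M. \<forall>z\<in>M. dist y x < d x \<longrightarrow> dist z x < d x \<longrightarrow> norm (X y - X z) \<le> K x * norm (y - z))" if "x \<in> M" for x
    using that unfolding Q_def by simp
  have dpos: "d x > 0" and Kpos: "K x \<ge> 0" if "x \<in> M" for x
    using dK[OF that] by blast+
  have dLip: "norm (X y - X z) \<le> K x * norm (y - z)"
    if "x \<in> M" "y \<in> M" "z \<in> M" "dist y x < d x" "dist z x < d x" for x y z
    using dK[OF that(1)] that by blast
  obtain S where S: "S \<subseteq> M" "finite S" "M \<subseteq> (\<Union>x\<in>S. ball x (d x / 2))"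
  proof (rule compactE_image[OF assms(1), of M "\<lambda>x. ball x (d x / 2)"])
    show "M \<subseteq> (\<Union>x\<in>M. ball x (d x / 2))" using dpos by force
  qed auto
  define e where "e = Min (insert 1 ((\<lambda>x. d x / 2) ` S))"
  define L where "L = (\<Sum>x\<in>S. K x) + 2 * \<bar>C\<bar> / e"
  have e: "e > 0" unfolding e_def using S(1,2) dpos by (subst Min_gr_iff) auto
  have e_le: "e \<le> d x / 2" if "x \<in> S" for x
    unfolding e_def using S(2) that by (intro Min_le) auto
  have sum0: "0 \<le> (\<Sum>x\<in>S. K x)" using S(1) Kpos by (intro sum_nonneg) blast
  have Ksum: "K x \<le> L" if "x \<in> S" for x
  proof -
    have "K x \<le> (\<Sum>x\<in>S. K x)" using S(1,2) Kpos that by (intro member_le_sum) auto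
    then show ?thesis unfolding L_def using e by (simp add: add_increasing2)
  qed
  show thesis
  proof
    show "L \<ge> 0" unfolding L_def using sum0 e by simp
    fix y z assume yz: "y \<in> M" "z \<in> M"
    show "norm (X y - X z) \<le> L * norm (y - z)"
    proof (cases "dist y z < e")
      case True
      obtain x where x: "x \<in> S" "dist x y < d x / 2" using S(3) yz(1) by auto
      have "dist z x \<le> dist z y + dist y x" by (rule dist_triangle)
      moreover have xM: "x \<in> M" using x(1) S(1) by blast
      ultimately have "dist y x < d x" "dist z x < d x"
        using x(2) e_le[OF x(1)] True dpos[OF xM] dist_commute[of x y] dist_commute[of y z] by linarith+
      then have "norm (X y - X z) \<le> K x * norm (y - z)" using dLip xM yz by blast
      also have "\<dots> \<le> L * norm (y - z)" using Ksum[OF x(1)] by (intro mult_right_mono) auto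
      finally show ?thesis .
    next
      case False
      have "norm (X y - X z) \<le> norm (X y) + norm (X z)" by (rule norm_triangle_ineq4)
      also have "\<dots> \<le> 2 * \<bar>C\<bar>" using C[OF yz(1)] C[OF yz(2)] by linarith
      also have "\<dots> = 2 * \<bar>C\<bar> / e * e" using e by simp
      also have "\<dots> \<le> L * norm (y - z)" unfolding L_def using False e sum0
        by (intro mult_mono) (auto simp: dist_norm)
      finally show ?thesis .
    qed
  qed
qed

section \<open>Gradient-like flows on compact sets\<close>

locale flow_chart = morse_chart_at M f a V Em Ep \<psi> U \<phi>
  for M :: "'a::euclidean_space set" and f X a V Em Ep \<psi> U \<phi> +
  assumes X_chart: "\<And>u v. u \<in> Em \<Longrightarrow> v \<in> Ep \<Longrightarrow> u + v \<in> V \<Longrightarrow>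
    X (\<psi> (u + v)) = frechet_derivative \<psi> (at (u + v)) (2 *\<^sub>R u - 2 *\<^sub>R v)"

lemma flow_chart_uminus:
  assumes "flow_chart M f X a V Em Ep \<psi> U \<phi>"
  shows "flow_chart M (\<lambda>x. - f x) (\<lambda>x. - X x) a V Ep Em \<psi> U \<phi>"
proof -
  interpret flow_chart M f X a V Em Ep \<psi> U \<phi> by fact
  show ?thesis
  proof (rule flow_chart.intro[OF morse_chart_at_uminus[OF morse_chart_at_axioms] flow_chart_axioms.intro])
    fix u v assume *: "u \<in> Ep" "v \<in> Em" "u + v \<in> V"
    have "X (\<psi> (u + v)) = D (u + v) (2 *\<^sub>R v - 2 *\<^sub>R u)"
      using X_chart[OF *(2,1)] *(3) by (simp add: add.commute[of u v])
    then show "- X (\<psi> (u + v)) = D (u + v) (2 *\<^sub>R u - 2 *\<^sub>R v)"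
      using linear_neg[OF linear_D[OF *(3)], of "2 *\<^sub>R v - 2 *\<^sub>R u"] by simp
  qed
qed

locale gradient_flow =
  fixes M :: "'a::euclidean_space set" and f :: "'a \<Rightarrow> real" and f' X :: "'a \<Rightarrow> 'a"
  assumes compact: "compact M"
    and smooth_X: "smooth_map_on M X"
    and f_derivative: "\<And>x. (f has_derivative inner (f' x)) (at x)"
    and f_decreasing: "\<And>x. x \<in> M \<Longrightarrow> inner (f' x) (X x) \<le> 0"
    and f_strict: "\<And>x. x \<in> M \<Longrightarrow> inner (f' x) (X x) = 0 \<Longrightarrow> X x = 0"
    and finite_zeros: "finite {x \<in> M. X x = 0}"
    and curve_exists: "\<And>x. x \<in> M \<Longrightarrow> \<exists>u. integral_curve M X u \<and> u 0 = x"
    and chart_exists: "\<And>x. x \<in> M \<Longrightarrow> X x = 0 \<Longrightarrow> \<exists>(V :: 'a set) Em Ep \<psi> U \<phi>. flow_chart M f X x V Em Ep \<psi> U \<phi>"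
begin

definition Lip where "Lip = (SOME L. lipschitz_field M X L)"

lemma lipschitz_field_Lip: "lipschitz_field M X Lip"
proof -
  obtain L where "\<And>x y. x \<in> M \<Longrightarrow> y \<in> M \<Longrightarrow> norm (X x - X y) \<le> L * norm (x - y)"
    using lipschitz_on_compact[OF compact smooth_X] by metis
  then have "lipschitz_field M X L" by unfold_locales
  then show ?thesis unfolding Lip_def by (rule someI)
qed

sublocale lipschitz_field M X Lip by (rule lipschitz_field_Lip)

lemma continuous_X: "continuous_on M X"
proof (rule lipschitz_on_continuous_on)
  have "norm (X x - X y) \<le> \<bar>Lip\<bar> * norm (x - y)" if "x \<in> M" "y \<in> M" for x y
    using lipschitz[OF that] mult_right_mono[OF abs_ge_self[of Lip] norm_ge_zero[of "x - y"]] by linarith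
  then show "\<bar>Lip\<bar>-lipschitz_on M X" by (intro lipschitz_onI) (auto simp: dist_norm)
qed

lemma continuous_f: "continuous_on S f"
  using f_derivative has_derivative_continuous by (metis continuous_at_imp_continuous_on)

lemma isCont_f: "isCont f x"
  using f_derivative has_derivative_continuous by metis

definition flow where "flow x = (SOME u. integral_curve M X u \<and> u 0 = x)"

lemma flow: assumes "x \<in> M" shows "integral_curve M X (flow x)" "flow x 0 = x"
  using someI_ex[OF curve_exists[OF assms]] unfolding flow_def by auto

lemma flow_eq: "integral_curve M X u \<Longrightarrow> flow (u s) t = u (s + t)"
  using unique_shift[OF flow(1), of "u s" u 0 s t] flow(2)[of "u s"] integral_curve_in[of M X u] by simp

lemma flow_in: "x \<in> M \<Longrightarrow> flow x t \<in> M"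
  using flow integral_curve_in by blast

lemma continuous_flow: "continuous_on M (\<lambda>x. flow x t)"
proof (rule continuous_onI)
  fix x and e :: real assume x: "x \<in> M" and e: "e > 0"
  obtain d where d: "d > 0" "\<And>w. integral_curve M X w \<Longrightarrow> dist (w 0) (flow x 0) < d \<Longrightarrow> dist (w t) (flow x t) < e"
    using flow_continuous[OF flow(1)[OF x] e] by metis
  have "dist (flow y t) (flow x t) \<le> e" if "y \<in> M" "dist y x < d" for y
    using d(2)[OF flow(1)[OF that(1)]] that flow(2) x by (simp add: less_imp_le)
  with d(1) show "\<exists>d>0. \<forall>y\<in>M. dist y x < d \<longrightarrow> dist (flow y t) (flow x t) \<le> e" by blast
qed

lemma f_curve_derivative:
  assumes "integral_curve M X u"
  shows "((\<lambda>t. f (u t)) has_real_derivative inner (f' (u t)) (X (u t))) (at t)"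
proof -
  have "((f \<circ> u) has_vector_derivative inner (f' (u t)) (X (u t))) (at t)"
    using integral_curve_derivative[OF assms] f_derivative
    by (intro vector_derivative_diff_chain_within) (auto intro: has_derivative_at_withinI)
  then show ?thesis by (simp add: has_real_derivative_iff_has_vector_derivative o_def)
qed

lemma f_curve_antimono:
  assumes "integral_curve M X u" "s \<le> t"
  shows "f (u t) \<le> f (u s)"
  using f_curve_derivative[OF assms(1)] f_decreasing integral_curve_in[OF assms(1)]
  by (intro DERIV_nonpos_imp_nonincreasing[OF assms(2)]) blast

lemma X_curve_nonzero:
  assumes "integral_curve M X u" "X (u s) \<noteq> 0"
  shows "X (u t) \<noteq> 0"
proof
  assume "X (u t) = 0"
  then have "integral_curve M X (\<lambda>_. u t)"
    using assms(1) integral_curve_in by (intro integral_curve_const) auto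
  from unique[OF assms(1) this, of t s] have "u s = u t" by simp
  with assms \<open>X (u t) = 0\<close> show False by simp
qed

lemma zero_curve_const:
  assumes "integral_curve M X u" "X (u s) = 0"
  shows "u t = u s"
proof -
  have "integral_curve M X (\<lambda>_. u s)" using assms integral_curve_in by (intro integral_curve_const) auto
  from unique[OF assms(1) this, of s t] show ?thesis by simp
qed

lemma f_curve_strict:
  assumes "integral_curve M X u" "X (u r) \<noteq> 0" "s < t"
  shows "f (u t) < f (u s)"
proof (rule DERIV_neg_imp_decreasing[OF assms(3)])
  fix x
  have "inner (f' (u x)) (X (u x)) < 0"
    using f_decreasing f_strict X_curve_nonzero[OF assms(1,2)] integral_curve_in[OF assms(1)]
    by (metis less_eq_real_def)
  then show "\<exists>y. ((\<lambda>t. f (u t)) has_real_derivative y) (at x) \<and> y < 0"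
    using f_curve_derivative[OF assms(1)] by blast
qed

lemma f_limit_le:
  assumes u: "integral_curve M X u" and b: "(u \<longlongrightarrow> b) at_top"
  shows "f b \<le> f (u t)"
proof (rule tendsto_upperbound)
  show "((\<lambda>t. f (u t)) \<longlongrightarrow> f b) at_top" using isCont_tendsto_compose[OF isCont_f b] .
  show "\<forall>\<^sub>F s in at_top. f (u s) \<le> f (u t)"
    using eventually_ge_at_top[of t] by eventually_elim (rule f_curve_antimono[OF u])
qed simp

lemma f_limit_less:
  assumes "integral_curve M X u" "(u \<longlongrightarrow> b) at_top" "X (u s) \<noteq> 0"
  shows "f b < f (u t)"
  using f_limit_le[OF assms(1,2), of "t + 1"] f_curve_strict[OF assms(1,3), of t "t + 1"] by simp

lemma eventually_near_zeros:
  assumes u: "integral_curve M X u" and S: "open S" "{x \<in> M. X x = 0} \<subseteq> S"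
  shows "\<forall>\<^sub>F t in at_top. u t \<in> S"
proof -
  have loc: "\<exists>e>0. \<forall>\<^sub>F t in at_top. u t \<notin> ball z e" if z: "z \<in> M" "X z \<noteq> 0" for z
  proof (rule ccontr)
    assume "\<not> ?thesis"
    then have freq: "\<exists>\<^sub>F t in at_top. u t \<in> ball z e" if "e > 0" for e
      using that unfolding frequently_def by auto
    define \<delta> where "\<delta> = f z - f (flow z 1)"
    have \<delta>: "\<delta> > 0" using f_curve_strict[OF flow(1)[OF z(1)], of 0 0 1] flow(2)[OF z(1)] z by (simp add: \<delta>_def)
    have "continuous_on M (\<lambda>x. f (flow x 1))"
      using continuous_on_compose2[OF continuous_f continuous_flow] by blast
    then obtain d1 where d1: "d1 > 0" "\<And>x. x \<in> M \<Longrightarrow> dist x z < d1 \<Longrightarrow> dist (f (flow x 1)) (f (flow z 1)) < \<delta> / 2"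
      using z(1) \<delta> unfolding continuous_on_iff by (metis half_gt_zero)
    obtain d2 where d2: "d2 > 0" "\<And>x. dist x z < d2 \<Longrightarrow> dist (f x) (f z) < \<delta> / 2"
      using isCont_f[of z] \<delta> unfolding continuous_at_eps_delta by (metis half_gt_zero)
    obtain t where t: "u t \<in> ball z d1" using frequently_ex[OF freq[OF d1(1)]] by blast
    then have "\<bar>f (flow (u t) 1) - f (flow z 1)\<bar> < \<delta> / 2"
      using d1(2)[OF integral_curve_in[OF u]] by (simp add: dist_real_def dist_commute)
    then have "f (flow (u t) 1) - f (flow z 1) < \<delta> / 2" by (rule abs_less_iff[THEN iffD1, THEN conjunct1])
    then have "f (flow (u t) 1) < f z - \<delta> / 2" by (simp add: \<delta>_def field_simps)
    then have a: "f (u (t + 1)) < f z - \<delta> / 2" by (simp add: flow_eq[OF u])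
    have "\<exists>\<^sub>F s in at_top. u s \<in> ball z d2 \<and> s \<ge> t + 1"
      using frequently_eventually_frequently[OF freq[OF d2(1)] eventually_ge_at_top[of "t + 1"]] by simp
    then obtain s where s: "u s \<in> ball z d2" "s \<ge> t + 1" using frequently_ex by blast
    then have "\<bar>f (u s) - f z\<bar> < \<delta> / 2" using d2(2) by (simp add: dist_real_def dist_commute)
    then have "f z - \<delta> / 2 < f (u s)" by linarith
    with a f_curve_antimono[OF u s(2)] show False by simp
  qed
  have "\<forall>z\<in>M - S. \<exists>e. e > 0 \<and> (\<forall>\<^sub>F t in at_top. u t \<notin> ball z e)"
    using loc S by blast
  then obtain e where e: "\<forall>z\<in>M - S. e z > 0 \<and> (\<forall>\<^sub>F t in at_top. u t \<notin> ball z (e z))"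
    by (rule bchoice[THEN exE])
  have "compact (M - S)" using compact S(1) by (rule compact_diff)
  then obtain K where K: "K \<subseteq> M - S" "finite K" "M - S \<subseteq> (\<Union>z\<in>K. ball z (e z))"
  proof (rule compactE_image[of "M - S" "M - S" "\<lambda>z. ball z (e z)"])
    show "M - S \<subseteq> (\<Union>z\<in>M - S. ball z (e z))" using e by force
  qed auto
  have "\<forall>\<^sub>F t in at_top. \<forall>z\<in>K. u t \<notin> ball z (e z)"
    using K e by (intro eventually_ball_finite) auto
  then show ?thesis
  proof eventually_elim
    case (elim t)
    then have "u t \<notin> M - S" using K(3) by blast
    then show ?case using integral_curve_in[OF u] by blast
  qed
qed

lemma finite_separation:
  assumes "finite (Z :: 'a set)"
  obtains e where "e > 0" "\<And>x y. x \<in> Z \<Longrightarrow> y \<in> Z \<Longrightarrow> x \<noteq> y \<Longrightarrow> 2 * e \<le> dist x y"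
proof
  define D where "D = (\<lambda>(x, y). dist x y / 2) ` {p \<in> Z \<times> Z. fst p \<noteq> snd p}"
  have fin: "finite (insert 1 D)" unfolding D_def using assms by auto
  show "Min (insert 1 D) > 0" using fin by (subst Min_gr_iff) (auto simp: D_def)
  fix x y assume "x \<in> Z" "y \<in> Z" "x \<noteq> y"
  then have "dist x y / 2 \<in> insert 1 D" unfolding D_def by (auto intro!: image_eqI[of _ _ "(x, y)"])
  then have "Min (insert 1 D) \<le> dist x y / 2" using fin by (rule Min_le[rotated])
  then show "2 * Min (insert 1 D) \<le> dist x y" by simp
qed

lemma curve_converges:
  assumes u: "integral_curve M X u"
  obtains b where "(u \<longlongrightarrow> b) at_top" "b \<in> M" "X b = 0"
proof -
  define Z where "Z = {x \<in> M. X x = 0}"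
  obtain e0 where e0: "e0 > 0" "\<And>x y. x \<in> Z \<Longrightarrow> y \<in> Z \<Longrightarrow> x \<noteq> y \<Longrightarrow> 2 * e0 \<le> dist x y"
    using finite_separation[OF finite_zeros] unfolding Z_def by blast
  have near: "\<forall>\<^sub>F t in at_top. u t \<in> (\<Union>z\<in>Z. ball z e)" if "e > 0" for e
  proof (rule eventually_near_zeros[OF u])
    show "{x \<in> M. X x = 0} \<subseteq> (\<Union>z\<in>Z. ball z e)"
      unfolding Z_def[symmetric] using centre_in_ball that by blast
  qed (intro open_UN ballI open_ball)
  obtain T where T: "\<And>t. t \<ge> T \<Longrightarrow> u t \<in> (\<Union>z\<in>Z. ball z e0)"
    using near[OF e0(1)] unfolding eventually_at_top_linorder by blast
  obtain b where b: "b \<in> Z" "u T \<in> ball b e0" using T[of T] by auto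
  have disj: "z = b" if "z \<in> Z" "x \<in> ball z e" "x \<in> ball b e0" "e \<le> e0" for z x e
  proof (rule ccontr)
    assume "z \<noteq> b"
    then have "2 * e0 \<le> dist z b" using e0(2) that b by blast
    also have "\<dots> \<le> dist z x + dist x b" by (rule dist_triangle)
    finally show False using that by (simp add: dist_commute)
  qed
  have "ball b e0 \<inter> u ` {T..} = {} \<or> (\<Union>z\<in>Z - {b}. ball z e0) \<inter> u ` {T..} = {}"
  proof (rule connectedD)
    show "connected (u ` {T..})" by (intro connected_continuous_image integral_curve_continuous[OF u]) simp
    have "x \<notin> ball z e0" if "x \<in> ball b e0" "z \<in> Z - {b}" for x z
      using disj[of z x e0] that by auto
    then show "ball b e0 \<inter> (\<Union>z\<in>Z - {b}. ball z e0) \<inter> u ` {T..} = {}" by blast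
    show "u ` {T..} \<subseteq> ball b e0 \<union> (\<Union>z\<in>Z - {b}. ball z e0)"
    proof
      fix x assume "x \<in> u ` {T..}"
      then obtain t where "x = u t" "t \<ge> T" by auto
      then obtain z where "z \<in> Z" "x \<in> ball z e0" using T by blast
      then show "x \<in> ball b e0 \<union> (\<Union>z\<in>Z - {b}. ball z e0)" by (cases "z = b") auto
    qed
  qed auto
  then have inb: "u t \<in> ball b e0" if "t \<ge> T" for t
    using T[OF that] b(2) that by blast
  have "(u \<longlongrightarrow> b) at_top"
  proof (rule tendstoI)
    fix e :: real assume "e > 0"
    then have "\<forall>\<^sub>F t in at_top. u t \<in> (\<Union>z\<in>Z. ball z (min e e0))" using e0 by (intro near) simp
    then show "\<forall>\<^sub>F t in at_top. dist (u t) b < e" using eventually_ge_at_top[of T]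
    proof eventually_elim
      case (elim t)
      then obtain z where z: "z \<in> Z" "u t \<in> ball z (min e e0)" by blast
      then have "z = b" using disj[OF z inb[OF elim(2)]] by simp
      then show ?case using z by (simp add: dist_commute)
    qed
  qed
  then show thesis using that b by (auto simp: Z_def)
qed

lemma reverse_flow: "gradient_flow M (\<lambda>x. - f x) (\<lambda>x. - f' x) (\<lambda>x. - X x)"
proof
  show "compact M" by (rule compact)
  show "smooth_map_on M (\<lambda>x. - X x)"
    unfolding smooth_map_on_def
  proof
    fix x assume "x \<in> M"
    then obtain U g where "open U" "x \<in> U" "smooth_on U g" "\<And>y. y \<in> M \<Longrightarrow> y \<in> U \<Longrightarrow> g y = X y"
      using smooth_map_onE[OF smooth_X] by metis
    then show "\<exists>U g. open U \<and> x \<in> U \<and> smooth_on U g \<and> (\<forall>y\<in>M \<inter> U. g y = - X y)"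
      using smooth_on_linear[of uminus U g] by (intro exI[of _ U] exI[of _ "\<lambda>x. - g x"]) (auto simp: bounded_linear_minus bounded_linear_ident)
  qed
  show "((\<lambda>x. - f x) has_derivative inner (- f' x)) (at x)" for x
  proof -
    have "inner (- f' x) = (\<lambda>v. - inner (f' x) v)" by (simp add: fun_eq_iff)
    then show ?thesis using has_derivative_minus[OF f_derivative[of x]] by (simp only:)
  qed
  show "\<exists>u. integral_curve M (\<lambda>x. - X x) u \<and> u 0 = x" if "x \<in> M" for x
    using integral_curve_reverse[OF flow(1)[OF that]] flow(2)[OF that] by (intro exI[of _ "\<lambda>t. flow x (- t)"]) simp
  show "\<exists>(V :: 'a set) Em Ep \<psi> U \<phi>. flow_chart M (\<lambda>x. - f x) (\<lambda>x. - X x) x V Em Ep \<psi> U \<phi>" if x: "x \<in> M" "- X x = 0" for x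
  proof -
    obtain V :: "'a set" and Em Ep \<psi> U \<phi> where "flow_chart M f X x V Em Ep \<psi> U \<phi>"
      using chart_exists[OF x(1)] x(2) by auto
    from flow_chart_uminus[OF this] show ?thesis by (intro exI)
  qed
qed (use f_decreasing f_strict finite_zeros in auto)

end

lemma integral_curve_smooth:
  assumes u: "integral_curve M X u" and X: "smooth_map_on M X"
  shows "\<exists>e>0. smooth_on {t - e<..<t + e} u"
proof -
  obtain U g where g: "open U" "u t \<in> U" "smooth_on U g" "\<And>y. y \<in> M \<Longrightarrow> y \<in> U \<Longrightarrow> g y = X y"
    using smooth_map_onE[OF X integral_curve_in[OF u]] by metis
  have "open (u -` U)" using integral_curve_continuous[OF u] g(1) by (rule open_vimage[rotated])
  then obtain e where e: "e > 0" "ball t e \<subseteq> u -` U" using g(2) open_contains_ball by (metis vimageI)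
  define I where "I = {t - e<..<t + e}"
  have "I = ball t e" unfolding I_def by (auto simp: dist_real_def)
  then have I: "open I" "u ` I \<subseteq> U" using e by auto
  have "Ck_on k I u" for k
  proof (induction k)
    case 0
    show ?case using integral_curve_continuous[OF u] by simp
  next
    case (Suc k)
    show ?case
    proof (rule Ck_on_SucI[OF I(1)])
      show "(u has_derivative (\<lambda>h. h *\<^sub>R X (u s))) (at s)" for s
        using integral_curve_derivative[OF u] by (simp add: has_vector_derivative_def)
      fix v
      have "Ck_on k I (\<lambda>s. g (u s))"
        using Ck_on_compose[OF I(1) g(1) I(2) Suc] g(3) unfolding smooth_on_def by blast
      then have "Ck_on k I (\<lambda>s. v *\<^sub>R g (u s))" by (rule Ck_on_linear[OF bounded_linear_scaleR_right I(1)])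
      moreover have "v *\<^sub>R g (u s) = v *\<^sub>R X (u s)" if "s \<in> I" for s
        using g(4) integral_curve_in[OF u] I(2) that by auto
      ultimately show "Ck_on k I (\<lambda>s. v *\<^sub>R X (u s))" by (rule Ck_on_cong[OF I(1), rotated])
    qed
  qed
  then show ?thesis using e(1) unfolding I_def smooth_on_def by blast
qed

lemma integral_curve_tangent:
  assumes u: "integral_curve M X u" and X: "smooth_map_on M X" and W: "\<And>s. u s \<in> W"
  shows "c *\<^sub>R X (u t) \<in> tangent_space W (u t)"
proof -
  obtain e where e: "e > 0" "smooth_on {t - e<..<t + e} u" using integral_curve_smooth[OF u X] by blast
  define d where "d = e / (\<bar>c\<bar> + 1)"
  have d: "d > 0" "\<bar>c\<bar> * d \<le> e" unfolding d_def using e by (auto simp: field_simps)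
  have "curve_in W (u t) (c *\<^sub>R X (u t)) (\<lambda>s. u (t + c * s))"
    unfolding curve_in_def
  proof (intro conjI exI[of _ d])
    show "((\<lambda>s. u (t + c * s)) has_vector_derivative c *\<^sub>R X (u t)) (at 0)"
      using integral_curve_derivative[OF integral_curve_affine[OF u, of c t], of 0] by simp
    show "smooth_on {- d<..<d} (\<lambda>s. u (t + c * s))"
    proof (rule smooth_on_compose[OF _ _ _ _ e(2)])
      show "smooth_on {- d<..<d} (\<lambda>s. t + c * s)"
        by (intro smooth_on_add smooth_on_const smooth_on_bounded_linear bounded_linear_mult_right) auto
      show "(\<lambda>s. t + c * s) ` {- d<..<d} \<subseteq> {t - e<..<t + e}"
      proof
        fix x assume "x \<in> (\<lambda>s. t + c * s) ` {- d<..<d}"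
        then obtain s where s: "x = t + c * s" "s \<in> {- d<..<d}" by blast
        then have sd: "\<bar>s\<bar> < d" by (simp add: abs_less_iff)
        have "\<bar>c * s\<bar> < e"
        proof (cases "c = 0")
          case False
          then have "\<bar>c * s\<bar> < \<bar>c\<bar> * d" using sd by (simp add: abs_mult)
          then show ?thesis using d(2) by simp
        qed (use e in simp)
        then show "x \<in> {t - e<..<t + e}" using s(1) by (simp add: abs_less_iff)
      qed
    qed auto
  qed (use d W in auto)
  then show ?thesis unfolding tangent_space_def by blast
qed

locale gradient_chart = gradient_flow M f f' X + flow_chart M f X a V Em Ep \<psi> U \<phi>
  for M :: "'a::euclidean_space set" and f f' X a and V :: "'a set" and Em Ep \<psi> U \<phi>
begin

lemma X_psi_Ep: "v \<in> Ep \<Longrightarrow> v \<in> V \<Longrightarrow> X (\<psi> v) = D v (- 2 *\<^sub>R v)"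
  using X_chart[of 0 v] sub(1) by (simp add: subspace_0)

lemma X_a: "X a = 0"
  using X_psi_Ep[of 0] sub(2) zero linear_0[OF linear_D[OF zero(1)]] by (simp add: subspace_0)

lemma reverse_chart: "gradient_chart M (\<lambda>x. - f x) (\<lambda>x. - f' x) (\<lambda>x. - X x) a V Ep Em \<psi> U \<phi>"
  using reverse_flow flow_chart_uminus[OF flow_chart_axioms] by (rule gradient_chart.intro)

lemma curve_in_Ep:
  assumes u: "integral_curve M X u" and "u 0 = \<psi> v" and v: "v \<in> Ep" "\<And>h. 0 \<le> h \<Longrightarrow> h \<le> 1 \<Longrightarrow> h *\<^sub>R v \<in> V"
    and t: "t \<ge> 0"
  shows "u t = \<psi> (exp (- 2 * t) *\<^sub>R v)"
proof (rule unique_forward[OF u _ _ t])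
  fix t :: real assume t: "t \<ge> 0"
  have z: "exp (- 2 * t) *\<^sub>R v \<in> V" "exp (- 2 * t) *\<^sub>R v \<in> Ep" using v sub(2) t by (auto simp: subspace_scale)
  have "((\<lambda>t. exp (- 2 * t) *\<^sub>R v) has_vector_derivative - 2 *\<^sub>R (exp (- 2 * t) *\<^sub>R v)) (at t)"
    by (auto intro!: derivative_eq_intros)
  from vector_derivative_diff_chain_within[OF this has_derivative_at_withinI[OF derivatives(1)[OF z(1)]]]
  show "\<psi> (exp (- 2 * t) *\<^sub>R v) \<in> M \<and>
      ((\<lambda>t. \<psi> (exp (- 2 * t) *\<^sub>R v)) has_vector_derivative X (\<psi> (exp (- 2 * t) *\<^sub>R v))) (at t)"
    using X_psi_Ep[OF z(2,1)] psi_in_M[OF z(1)] z Ep_sub by (auto simp: o_def)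
qed (use assms in simp)

lemma curve_in_Ep_limit:
  assumes u: "integral_curve M X u" and "u 0 = \<psi> v" and v: "v \<in> Ep" "\<And>h. 0 \<le> h \<Longrightarrow> h \<le> 1 \<Longrightarrow> h *\<^sub>R v \<in> V"
  shows "(u \<longlongrightarrow> a) at_top"
proof -
  have "((\<lambda>t::real. exp (- 2 * t) *\<^sub>R v) \<longlongrightarrow> 0 *\<^sub>R v) at_top"
  proof (intro tendsto_scaleR tendsto_const filterlim_compose[OF exp_at_bot])
    have "filterlim (\<lambda>t::real. 2 * t) at_top at_top"
      by (rule filterlim_tendsto_pos_mult_at_top[OF tendsto_const _ filterlim_ident]) simp
    then show "filterlim (\<lambda>t::real. - 2 * t) at_bot at_top"
      by (simp add: filterlim_uminus_at_bot)
  qed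
  then have "((\<lambda>t::real. exp (- 2 * t) *\<^sub>R v) \<longlongrightarrow> 0) at_top" by simp
  then have "((\<lambda>t. \<psi> (exp (- 2 * t) *\<^sub>R v)) \<longlongrightarrow> \<psi> 0) at_top"
    by (rule isCont_tendsto_compose[OF has_derivative_continuous[OF derivatives(1)[OF zero(1)]]])
  moreover have "\<forall>\<^sub>F t in at_top. \<psi> (exp (- 2 * t) *\<^sub>R v) = u t"
    using eventually_ge_at_top[of 0] by eventually_elim (rule curve_in_Ep[OF assms, symmetric])
  ultimately show ?thesis using Lim_transform_eventually zero by metis
qed

lemma convergent_curve_enters_Ep:
  assumes u: "integral_curve M X u" and lim: "(u \<longlongrightarrow> a) at_top" and r: "r > 0"
  obtains T v where "v \<in> Ep" "norm v < r" "v \<in> V" "u T = \<psi> v"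
proof -
  have "\<forall>\<^sub>F t in at_top. u t \<in> U" using lim opens(2) a_in(1) topological_tendstoD by blast
  moreover have phi: "((\<lambda>t. \<phi> (u t)) \<longlongrightarrow> 0) at_top"
    using isCont_tendsto_compose[OF has_derivative_continuous[OF derivatives(2)[OF a_in(1)]] lim] a_in(3) by simp
  then have "\<forall>\<^sub>F t in at_top. norm (\<phi> (u t)) < r" using r by (simp add: tendsto_iff)
  ultimately have "\<forall>\<^sub>F t in at_top. u t \<in> U \<and> norm (\<phi> (u t)) < r" by eventually_elim simp
  then obtain T where T: "\<And>t. t \<ge> T \<Longrightarrow> u t \<in> U" "\<And>t. t \<ge> T \<Longrightarrow> norm (\<phi> (u t)) < r"
    unfolding eventually_at_top_linorder by blast
  have zE: "\<phi> (u t) \<in> E" "\<phi> (u t) \<in> V" "\<psi> (\<phi> (u t)) = u t" if "t \<ge> T" for t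
    using T(1)[OF that] phi_in_E integral_curve_in[OF u] inverses by auto
  have orth0: "inner (\<phi> (u T)) e = 0" if e: "e \<in> Em" for e
  proof -
    define g where "g t = exp (- 2 * t) * inner (\<phi> (u t)) e" for t
    have g': "(g has_real_derivative 0) (at t)" if t: "t \<ge> T" for t
    proof -
      obtain p q where pq: "\<phi> (u t) = p + q" "p \<in> Em" "q \<in> Ep" using zE(1)[OF t] unfolding E_def by blast
      have "((\<phi> \<circ> u) has_vector_derivative D' (u t) (X (u t))) (at t)"
        using integral_curve_derivative[OF u] derivatives(2)[OF T(1)[OF t]]
        by (intro vector_derivative_diff_chain_within) (auto intro: has_derivative_at_withinI)
      moreover have "D' (u t) (X (u t)) = 2 *\<^sub>R p - 2 *\<^sub>R q"
        using X_chart[OF pq(2,3)] zE(2,3)[OF t] D'_D[OF zE(2)[OF t]] pq(1) by simp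
      ultimately have d: "((\<lambda>t. \<phi> (u t)) has_derivative (\<lambda>h. h *\<^sub>R (2 *\<^sub>R p - 2 *\<^sub>R q))) (at t)"
        by (simp add: has_vector_derivative_def o_def)
      have "inner q e = 0" using orth[OF e pq(3)] by (simp add: inner_commute)
      moreover have "(g has_derivative (\<lambda>h. exp (- 2 * t) * inner (h *\<^sub>R (2 *\<^sub>R p - 2 *\<^sub>R q)) e +
          (h * (- 2)) * exp (- 2 * t) * inner (\<phi> (u t)) e)) (at t)"
        unfolding g_def by (rule has_derivative_eq_rhs, (rule derivative_eq_intros d refl)+) (simp add: fun_eq_iff)
      ultimately have "(g has_derivative (\<lambda>h. 0)) (at t)"
        by (simp add: pq(1) inner_add_left inner_diff_left algebra_simps)
      then show ?thesis by (rule has_derivative_imp_has_field_derivative) simp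
    qed
    have "g t = g T" if "t \<ge> T" for t
    proof (rule antisym)
      show "g t \<le> g T" using g' by (intro DERIV_nonpos_imp_nonincreasing[OF that]) blast
      show "g T \<le> g t" using g' by (intro DERIV_nonneg_imp_nondecreasing[OF that]) blast
    qed
    then have "\<forall>\<^sub>F t in at_top. g t = g T" unfolding eventually_at_top_linorder by blast
    then have "(g \<longlongrightarrow> g T) at_top" by (rule tendsto_eventually)
    moreover have "(g \<longlongrightarrow> 0 * inner 0 e) at_top"
      unfolding g_def
    proof (intro tendsto_mult tendsto_inner phi tendsto_const filterlim_compose[OF exp_at_bot])
      have "filterlim (\<lambda>t::real. 2 * t) at_top at_top"
        by (rule filterlim_tendsto_pos_mult_at_top[OF tendsto_const _ filterlim_ident]) simp
      then show "filterlim (\<lambda>t::real. - 2 * t) at_bot at_top"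
        by (simp add: filterlim_uminus_at_bot)
    qed
    ultimately have "g T = 0" using tendsto_unique[of at_top g] by simp
    then show ?thesis by (simp add: g_def)
  qed
  obtain p q where pq: "\<phi> (u T) = p + q" "p \<in> Em" "q \<in> Ep" using zE(1)[of T] unfolding E_def by blast
  have "inner (p + q) p = 0" using orth0[OF pq(2)] pq(1) by simp
  moreover have "inner q p = 0" using orth[OF pq(2,3)] by (subst inner_commute)
  ultimately have "inner p p = 0" by (simp add: inner_add_left)
  then have "\<phi> (u T) \<in> Ep" using pq by simp
  then show thesis using that[of "\<phi> (u T)" T] T(2)[of T] zE[of T] by simp
qed

lemma stable_manifold_in_M: "stable_manifold M X a \<subseteq> M"
  unfolding stable_manifold_def using integral_curve_in by blast

lemma a_stable: "a \<in> stable_manifold M X a"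
proof -
  have "integral_curve M X (\<lambda>_. a)" using a_in(2) X_a by (rule integral_curve_const)
  from stable_manifoldI[OF this tendsto_const] show ?thesis .
qed

lemma ball_in_V: obtains r where "r > 0" "ball 0 r \<subseteq> V"
  using opens(1) zero(1) open_contains_ball by blast

lemma stable_trivial:
  assumes "Ep = {0}" "integral_curve M X u" "(u \<longlongrightarrow> a) at_top"
  shows "u t = a"
proof -
  obtain T v where "v \<in> Ep" "u T = \<psi> v"
    by (rule convergent_curve_enters_Ep[OF assms(2,3), of 1]) simp_all
  then have "u T = a" using assms(1) zero(2) by simp
  then show ?thesis using zero_curve_const[OF assms(2), of T t] X_a by simp
qed

lemma stable_manifold_trivial: "Ep = {0} \<Longrightarrow> stable_manifold M X a = {a}"
  using stable_trivial a_stable unfolding stable_manifold_def by blast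

lemma stable_manifold_flow:
  assumes "x \<in> M" "flow x T \<in> stable_manifold M X a"
  shows "x \<in> stable_manifold M X a"
proof -
  obtain w where w: "integral_curve M X w" "w 0 = flow x T" "(w \<longlongrightarrow> a) at_top"
    using assms(2) unfolding stable_manifold_def by blast
  then have "w (- T) = flow x 0"
    using unique_shift[OF w(1) flow(1)[OF assms(1)], of 0 T "- T"] by simp
  then show ?thesis using stable_manifoldI[OF w(1,3), of "- T"] flow(2)[OF assms(1)] by simp
qed

lemma stable_manifold_flow':
  assumes "x \<in> stable_manifold M X a"
  shows "(flow x \<longlongrightarrow> a) at_top" "flow x T \<in> stable_manifold M X a"
proof -
  obtain w where w: "integral_curve M X w" "w 0 = x" "(w \<longlongrightarrow> a) at_top"
    using assms unfolding stable_manifold_def by blast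
  then have "flow x = w" using flow_eq[OF w(1), of 0] by auto
  then show "(flow x \<longlongrightarrow> a) at_top" "flow x T \<in> stable_manifold M X a"
    using w stable_manifoldI[OF w(1,3)] by auto
qed

lemma stable_manifold_open:
  assumes Em: "Em = {0}" and x: "x \<in> stable_manifold M X a"
  obtains S where "open S" "x \<in> S" "S \<inter> M \<subseteq> stable_manifold M X a"
proof -
  obtain r where r: "r > 0" "ball 0 r \<subseteq> V" by (rule ball_in_V)
  define S0 where "S0 = U \<inter> \<phi> -` ball 0 r"
  have S0: "open S0" unfolding S0_def
    by (rule continuous_open_preimage[OF smooth_on_continuous[OF smooths(2)] opens(2) open_ball])
  have S0s: "y \<in> stable_manifold M X a" if y: "y \<in> S0" "y \<in> M" for y
  proof -
    have "y \<in> U" and zr: "norm (\<phi> y) < r" using y by (auto simp: S0_def)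
    then obtain p where "p \<in> Em" "\<phi> y - p \<in> Ep" using phi_in_E[of y] y(2) unfolding E_def by auto
    then have z: "\<phi> y \<in> Ep" "\<psi> (\<phi> y) = y" "norm (\<phi> y) < r"
      using Em inverses(2)[OF \<open>y \<in> U\<close>] zr by auto
    have hV: "h *\<^sub>R \<phi> y \<in> V" if "0 \<le> h" "h \<le> 1" for h
    proof -
      have "norm (h *\<^sub>R \<phi> y) \<le> norm (\<phi> y)" using that by (simp add: mult_left_le_one_le)
      then show ?thesis using r(2) z(3) by (auto simp: subset_eq)
    qed
    have "(flow y \<longlongrightarrow> a) at_top"
      by (rule curve_in_Ep_limit[OF flow(1)[OF y(2)] _ z(1) hV]) (simp_all add: flow(2)[OF y(2)] z(2))
    then show ?thesis using stable_manifoldI[OF flow(1)[OF y(2)], of a 0] flow(2)[OF y(2)] by simp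
  qed
  have xM: "x \<in> M" using x stable_manifold_in_M by blast
  have "\<forall>\<^sub>F t in at_top. flow x t \<in> S0"
    using a_in(1,3) r(1) by (intro topological_tendstoD[OF stable_manifold_flow'(1)[OF x] S0]) (simp add: S0_def)
  then obtain T where T: "flow x T \<in> S0" unfolding eventually_at_top_linorder by blast
  obtain S where S: "open S" "S \<inter> M = (\<lambda>x. flow x T) -` S0 \<inter> M"
    using continuous_flow S0 unfolding continuous_on_open_invariant by metis
  show thesis
  proof (rule that[OF S(1)])
    show "x \<in> S" using S(2) T xM by blast
    show "S \<inter> M \<subseteq> stable_manifold M X a"
    proof
      fix y assume y: "y \<in> S \<inter> M"
      then have "flow y T \<in> S0" "y \<in> M" using S(2) by blast+
      then show "y \<in> stable_manifold M X a" using stable_manifold_flow S0s flow_in by blast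
    qed
  qed
qed

lemma tangent_space_stable_open:
  assumes "Em = {0}" "x \<in> stable_manifold M X a"
  shows "tangent_space (stable_manifold M X a) x = tangent_space M x"
proof -
  obtain S where S: "open S" "x \<in> S" "S \<inter> M \<subseteq> stable_manifold M X a"
    by (rule stable_manifold_open[OF assms])
  have "stable_manifold M X a \<inter> S = M \<inter> S" using S stable_manifold_in_M by blast
  then show ?thesis using tangent_space_Int_open[OF S(1,2)] by metis
qed

end

locale stable_branch = gradient_chart M f f' X a V Em Ep \<psi> U \<phi>
  for M :: "'a::euclidean_space set" and f f' X a and V :: "'a set" and Em Ep \<psi> U \<phi> +
  fixes v :: 'a
  assumes Ep_span: "Ep = span {v}" and v_nonzero: "v \<noteq> 0"
    and segment: "\<And>h. \<bar>h\<bar> \<le> 1 \<Longrightarrow> h *\<^sub>R v \<in> V"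

lemma (in gradient_chart) stable_branch_exists:
  assumes "dim Ep = 1"
  obtains v where "stable_branch M f f' X a V Em Ep \<psi> U \<phi> v"
proof -
  obtain B where B: "B \<subseteq> Ep" "independent B" "Ep \<subseteq> span B" "card B = 1"
    using basis_exists[of Ep] assms by metis
  then obtain w where w: "B = {w}" using card_1_singletonE by metis
  then have w0: "w \<noteq> 0" using B(2) dependent_zero by blast
  obtain r where r: "r > 0" "ball 0 r \<subseteq> V" by (rule ball_in_V)
  define c where "c = r / (2 * norm w)"
  have c: "c > 0" "norm (c *\<^sub>R w) < r" unfolding c_def using r w0 by auto
  have "stable_branch M f f' X a V Em Ep \<psi> U \<phi> (c *\<^sub>R w)"
  proof
    have "span B = Ep" using B sub(2) by (simp add: span_subspace)
    moreover have "span {c *\<^sub>R w} = span {w}"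
      using c(1) span_singleton[of w] span_singleton[of "c *\<^sub>R w"]
      by (auto simp: image_iff) (metis divide_self_if less_irrefl mult.commute scaleR_scaleR times_divide_eq_left mult_1)
    ultimately show "Ep = span {c *\<^sub>R w}" using w by simp
    show "c *\<^sub>R w \<noteq> 0" using c w0 by simp
    fix h :: real assume "\<bar>h\<bar> \<le> 1"
    then have "norm (h *\<^sub>R c *\<^sub>R w) \<le> norm (c *\<^sub>R w)"
      using mult_right_mono[of "\<bar>h\<bar>" 1 "norm (c *\<^sub>R w)"] by (simp only: norm_scaleR[of h]) simp
    then show "h *\<^sub>R c *\<^sub>R w \<in> V" using c(2) r(2) by (auto simp: subset_eq)
  qed
  then show thesis by (rule that)
qed

context stable_branch
begin

definition up where "up = flow (\<psi> v)"

definition um where "um = flow (\<psi> (- v))"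

lemma uminus_branch: "stable_branch M f f' X a V Em Ep \<psi> U \<phi> (- v)"
proof
  have "span {- v} = span {v}"
    using span_neg[of v "{v}"] span_neg[of "- v" "{- v}"]
    by (intro span_eq[THEN iffD2]) (auto intro: span_base)
  then show "Ep = span {- v}" using Ep_span by simp
  show "h *\<^sub>R - v \<in> V" if "\<bar>h\<bar> \<le> 1" for h using segment[of "- h"] that by simp
qed (use v_nonzero in simp)

lemma um_uminus: "um = stable_branch.up M X \<psi> (- v)" and up_uminus: "up = stable_branch.um M X \<psi> (- v)"
  unfolding stable_branch.up_def[OF uminus_branch] stable_branch.um_def[OF uminus_branch] um_def up_def by simp_all

lemma hv_in: "\<bar>h\<bar> \<le> 1 \<Longrightarrow> h *\<^sub>R v \<in> V" "h *\<^sub>R v \<in> Ep" "h *\<^sub>R v \<in> E"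
  using segment Ep_sub unfolding Ep_span by (auto intro: span_scale span_base)

lemma v_in: "v \<in> V" "v \<in> Ep"
  using hv_in[of 1] by simp_all

lemma psi_hv_in_M: "\<bar>h\<bar> \<le> 1 \<Longrightarrow> \<psi> (h *\<^sub>R v) \<in> M"
  using psi_in_M hv_in by blast

lemma curve_up: "integral_curve M X up" and up_0: "up 0 = \<psi> v"
  unfolding up_def using flow[of "\<psi> v"] psi_hv_in_M[of 1] by simp_all

lemma up_eq: "t \<ge> 0 \<Longrightarrow> up t = \<psi> (exp (- 2 * t) *\<^sub>R v)"
  using curve_in_Ep[OF curve_up up_0 v_in(2)] segment by simp

lemma up_limit: "(up \<longlongrightarrow> a) at_top"
  using curve_in_Ep_limit[OF curve_up up_0 v_in(2)] segment by simp

lemma up_in_stable: "up t \<in> stable_manifold M X a"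
  by (rule stable_manifoldI[OF curve_up up_limit])

lemma psi_hv_eq_up:
  assumes "0 < h" "h \<le> 1"
  obtains s where "s \<ge> 0" "\<psi> (h *\<^sub>R v) = up s" 
proof
  show "- ln h / 2 \<ge> 0" using assms by simp
  then show "\<psi> (h *\<^sub>R v) = up (- ln h / 2)" using assms by (simp add: up_eq)
qed

lemma X_up: "X (up t) \<noteq> 0"
proof (rule X_curve_nonzero[OF curve_up])
  have "X (up 0) = D v (- 2 *\<^sub>R v)" using X_psi_Ep v_in up_0 by simp
  moreover have "D v (- 2 *\<^sub>R v) \<noteq> 0"
    using inj_D[OF v_in(1)] v_nonzero
    unfolding linear_injective_0[OF linear_D[OF v_in(1)]] by (metis neg_0_equal_iff_equal scaleR_eq_0_iff zero_neq_numeral)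
  ultimately show "X (up 0) \<noteq> 0" by simp
qed

lemma up_neq_a: "up t \<noteq> a"
  using X_up X_a by metis

lemmas curve_um = stable_branch.curve_up[OF uminus_branch, folded um_uminus]
  and um_0 = stable_branch.up_0[OF uminus_branch, folded um_uminus]
  and um_eq' = stable_branch.up_eq[OF uminus_branch, folded um_uminus]
  and um_limit = stable_branch.up_limit[OF uminus_branch, folded um_uminus]
  and um_in_stable = stable_branch.up_in_stable[OF uminus_branch, folded um_uminus]
  and X_um = stable_branch.X_up[OF uminus_branch, folded um_uminus]
  and psi_hv_eq_um = stable_branch.psi_hv_eq_up[OF uminus_branch, folded um_uminus]
  and um_neq_a = stable_branch.up_neq_a[OF uminus_branch, folded um_uminus]

lemma um_eq: "t \<ge> 0 \<Longrightarrow> um t = \<psi> ((- exp (- 2 * t)) *\<^sub>R v)"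
  using um_eq' by simp

lemma psi_inj: "z \<in> V \<Longrightarrow> w \<in> V \<Longrightarrow> \<psi> z = \<psi> w \<Longrightarrow> z = w"
  using inverses(1) by metis

lemma up_neq_um: "up s \<noteq> um t"
proof
  assume "up s = um t"
  then have *: "up (s + r) = um (t + r)" for r by (rule unique_shift[OF curve_up curve_um])
  define r where "r = \<bar>s\<bar> + \<bar>t\<bar>"
  have "s + r \<ge> 0" "t + r \<ge> 0" unfolding r_def by auto
  then have "\<psi> (exp (- 2 * (s + r)) *\<^sub>R v) = \<psi> ((- exp (- 2 * (t + r))) *\<^sub>R v)"
    using *[of r] up_eq um_eq by simp
  then have "exp (- 2 * (s + r)) *\<^sub>R v = (- exp (- 2 * (t + r))) *\<^sub>R v"
  proof (rule psi_inj[rotated 2])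
    show "exp (- 2 * (s + r)) *\<^sub>R v \<in> V" using \<open>s + r \<ge> 0\<close> by (intro hv_in) simp
    show "(- exp (- 2 * (t + r))) *\<^sub>R v \<in> V" using \<open>t + r \<ge> 0\<close> by (intro hv_in) simp
  qed
  then have "exp (- 2 * (s + r)) = - exp (- 2 * (t + r))"
    using v_nonzero unfolding scaleR_cancel_right by blast
  then show False using exp_gt_zero[of "- 2 * (s + r)"] exp_gt_zero[of "- 2 * (t + r)"] by linarith
qed

lemma convergent_curve_cases:
  assumes u: "integral_curve M X u" and lim: "(u \<longlongrightarrow> a) at_top"
  shows "(\<forall>t. u t = a) \<or> (\<exists>s. \<forall>t. u t = up (s + t)) \<or> (\<exists>s. \<forall>t. u t = um (s + t))"
proof -
  obtain T w where w: "w \<in> Ep" "norm w < norm v" "w \<in> V" "u T = \<psi> w"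
    by (rule convergent_curve_enters_Ep[OF u lim, of "norm v"]) (use v_nonzero in simp_all)
  obtain h where h: "w = h *\<^sub>R v" using w(1) unfolding Ep_span span_singleton by blast
  have h1: "\<bar>h\<bar> < 1" using w(2) v_nonzero unfolding h by simp
  consider "h = 0" | "h > 0" | "h < 0" by linarith
  then show ?thesis
  proof cases
    case 1
    then have "u T = a" using w(4) zero h by simp
    then show ?thesis using zero_curve_const[OF u, of T] X_a by simp
  next
    case 2
    then obtain s where "u T = up s" using psi_hv_eq_up[of h] h1 w(4) h by auto
    from unique_shift[OF u curve_up this, of "_ - T"] have "u t = up (s - T + t)" for t
      by (simp add: algebra_simps)
    then show ?thesis by blast
  next
    case 3
    then obtain s where "u T = um s" using psi_hv_eq_um[of "- h"] h1 w(4) h by auto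
    from unique_shift[OF u curve_um this, of "_ - T"] have "u t = um (s - T + t)" for t
      by (simp add: algebra_simps)
    then show ?thesis by blast
  qed
qed

lemma stable_manifold_eq: "stable_manifold M X a = insert a (range up \<union> range um)"
proof
  show "stable_manifold M X a \<subseteq> insert a (range up \<union> range um)"
  proof
    fix x assume "x \<in> stable_manifold M X a"
    then obtain u where u: "integral_curve M X u" "u 0 = x" "(u \<longlongrightarrow> a) at_top"
      unfolding stable_manifold_def by blast
    from convergent_curve_cases[OF u(1,3)] u(2) show "x \<in> insert a (range up \<union> range um)" by blast
  qed
qed (use a_stable up_in_stable um_in_stable in blast)

lemma f_psi_hv: "\<bar>h\<bar> \<le> 1 \<Longrightarrow> f (\<psi> (h *\<^sub>R v)) = f a + (norm (h *\<^sub>R v))\<^sup>2"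
  using f_chart[of 0 "h *\<^sub>R v"] hv_in sub(1) by (simp add: subspace_0)

lemma up_low: 
  assumes "f (up t) < f a + (norm v)\<^sup>2"
  obtains h where "0 < h" "h < 1" "up t = \<psi> (h *\<^sub>R v)"
proof -
  have "t > 0"
  proof (rule ccontr)
    assume "\<not> t > 0"
    then have "f (up 0) \<le> f (up t)" by (intro f_curve_antimono[OF curve_up]) simp
    then show False using assms f_psi_hv[of 1] up_0 by simp
  qed
  then show thesis using that[of "exp (- 2 * t)"] up_eq[of t] by simp
qed

lemmas um_low = stable_branch.up_low[OF uminus_branch, folded um_uminus]

lemma stable_low:
  assumes "y \<in> stable_manifold M X a" "f y < f a + (norm v)\<^sup>2"
  obtains h where "\<bar>h\<bar> < 1" "y = \<psi> (h *\<^sub>R v)"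
proof -
  from assms(1) consider "y = a" | t where "y = up t" | t where "y = um t"
    unfolding stable_manifold_eq by blast
  then show thesis
  proof cases
    case 1
    then show ?thesis using that[of 0] zero by simp
  next
    case 2
    then obtain h where "0 < h" "h < 1" "y = \<psi> (h *\<^sub>R v)" using up_low[of t] assms(2) by metis
    then show ?thesis using that[of h] by simp
  next
    case 3
    then obtain h where "0 < h" "h < 1" "y = \<psi> (h *\<^sub>R - v)" using um_low[of t] assms(2) by auto
    then show ?thesis using that[of "- h"] by simp
  qed
qed

lemma up_open:
  obtains S where "open S" "up t \<in> S" "S \<inter> stable_manifold M X a \<subseteq> range up"
proof -
  define T where "T = \<bar>t\<bar> + 1"
  define S0 where "S0 = (U \<inter> {x. f x < f a + (norm v)\<^sup>2}) \<inter> (\<lambda>x. inner (\<phi> x) v) -` {0<..}"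
  have "open (U \<inter> {x. f x < f a + (norm v)\<^sup>2})"
    by (intro open_Int opens open_Collect_less continuous_on_const continuous_f)
  then have S0: "open S0" unfolding S0_def
    by (intro continuous_open_preimage continuous_intros continuous_on_subset[OF smooth_on_continuous[OF smooths(2)]]) auto
  have mem: "x \<in> range up" if x: "x \<in> S0" "x \<in> stable_manifold M X a" for x
  proof -
    obtain h where h: "\<bar>h\<bar> < 1" "x = \<psi> (h *\<^sub>R v)" using stable_low[OF x(2)] x(1) unfolding S0_def by auto
    then have "\<phi> x = h *\<^sub>R v" using inverses(1)[OF hv_in(1)[of h]] by simp
    moreover have "inner (\<phi> x) v > 0" using x(1) unfolding S0_def by simp
    ultimately have "h * inner v v > 0" by simp
    then have "h > 0" using inner_ge_zero[of v] by (meson not_less zero_less_mult_pos2 mult_nonpos_nonneg)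
    then show ?thesis using psi_hv_eq_up[of h] h by (metis less_eq_real_def abs_of_pos rangeI)
  qed
  have "up (t + T) \<in> S0"
  proof -
    let ?h = "exp (- 2 * (t + T))"
    have h: "up (t + T) = \<psi> (?h *\<^sub>R v)" "?h < 1" "?h > 0" using up_eq[of "t + T"] unfolding T_def by auto
    then have "\<phi> (up (t + T)) = ?h *\<^sub>R v" "up (t + T) \<in> U" using inverses hv_in(1)[of ?h] by auto
    moreover have "f (up (t + T)) < f a + (norm v)\<^sup>2"
    proof -
      have "norm (?h *\<^sub>R v) < norm v" using h(2) v_nonzero by simp
      then have "(norm (?h *\<^sub>R v))\<^sup>2 < (norm v)\<^sup>2" by (intro power_strict_mono) auto
      then show ?thesis using f_psi_hv[of ?h] h by simp
    qed
    ultimately show ?thesis using v_nonzero h(3) unfolding S0_def by simp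
  qed
  then have upt: "flow (up t) T \<in> S0" using flow_eq[OF curve_up] by simp
  obtain S where S: "open S" "S \<inter> M = (\<lambda>x. flow x T) -` S0 \<inter> M"
    using continuous_flow S0 unfolding continuous_on_open_invariant by metis
  show thesis
  proof (rule that[OF S(1)])
    show "up t \<in> S" using S(2) upt integral_curve_in[OF curve_up, of t] by blast
    show "S \<inter> stable_manifold M X a \<subseteq> range up"
    proof
      fix y assume y: "y \<in> S \<inter> stable_manifold M X a"
      then have yM: "y \<in> M" using stable_manifold_in_M by blast
      then have "flow y T \<in> S0" using y S(2) by blast
      then obtain s where "flow y T = up s" using mem stable_manifold_flow'(2) y by blast
      from unique_shift[OF flow(1)[OF yM] curve_up this, of "- T"]
      have "y = up (s - T)" using flow(2)[OF yM] by simp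
      then show "y \<in> range up" by blast
    qed
  qed
qed

end

lemma continuous_on_locally:
  fixes g :: "'a::t2_space \<Rightarrow> 'b::topological_space"
  assumes "\<And>x. x \<in> W \<Longrightarrow> \<exists>S. open S \<and> x \<in> S \<and> continuous_on (W \<inter> S) g"
  shows "continuous_on W g"
proof (unfold continuous_on_eq_continuous_within, intro ballI)
  fix x assume x: "x \<in> W"
  obtain S where S: "open S" "x \<in> S" "continuous_on (W \<inter> S) g" using assms[OF x] by blast
  then have "continuous (at x within W \<inter> S) g" using x by (auto simp: continuous_on_eq_continuous_within)
  moreover have "at x within W \<inter> S = at x within W" by (rule at_within_nhd[OF S(2,1)]) blast
  ultimately show "continuous (at x within W) g" by simp
qed

context gradient_flow
begin

lemma tangent_along_curve:
  assumes u: "integral_curve M X u" "X (u 0) \<noteq> 0"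
    and S: "open S" "u 0 \<in> S" "S \<inter> W \<subseteq> range u" and v: "v \<in> tangent_space W (u 0)"
  shows "v \<in> span {X (u 0)}"
proof -
  obtain c where c: "curve_in W (u 0) v c" using v unfolding tangent_space_def by blast
  have c0: "c 0 = u 0" "(c has_vector_derivative v) (at 0)" using c unfolding curve_in_def by auto
  define F where "F t = f (u t)" for t
  define \<gamma> where "\<gamma> = inner (f' (u 0)) (X (u 0))"
  have dF: "(F has_real_derivative \<gamma>) (at 0)" unfolding F_def \<gamma>_def by (rule f_curve_derivative[OF u(1)])
  have \<gamma>: "\<gamma> \<noteq> 0" unfolding \<gamma>_def using f_strict integral_curve_in[OF u(1)] u(2) by blast
  have contF: "isCont F t" for t
    unfolding F_def using f_curve_derivative[OF u(1)] DERIV_isCont by blast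
  have less: "F t < F s" if "s < t" for s t unfolding F_def by (rule f_curve_strict[OF u that])
  have inj: "inj F" by (rule injI) (metis less less_irrefl linorder_neqE_linordered_idom)
  define G where "G = inv_into UNIV F"
  have GF: "G (F t) = t" for t unfolding G_def by (rule inv_into_f_f[OF inj UNIV_I])
  have "isCont G (F 0)"
    by (rule isCont_inverse_function[of 1]) (use contF GF in auto)
  moreover have "F (G y) = y" if "F 1 < y" "y < F (- 1)" for y
  proof -
    have "\<exists>x\<ge>- 1. x \<le> 1 \<and> F x = y"
      by (rule IVT2) (use that contF in auto)
    then show ?thesis unfolding G_def by (metis f_inv_into_f rangeI)
  qed
  ultimately have dG: "(G has_real_derivative inverse \<gamma>) (at (F 0))"
    using dF \<gamma> GF[of 0] less[of 0 1] less[of "- 1" 0]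
    by (intro DERIV_inverse_function[where f = F and a = "F 1" and b = "F (- 1)"]) auto
  have "((f \<circ> c) has_vector_derivative inner (f' (c 0)) v) (at 0)"
    using f_derivative by (intro vector_derivative_diff_chain_within c0) (auto intro: has_derivative_at_withinI)
  then have "((\<lambda>t. f (c t)) has_real_derivative inner (f' (c 0)) v) (at 0)"
    by (simp add: has_real_derivative_iff_has_vector_derivative o_def)
  from DERIV_chain2[OF _ this, of "G"] dG
  have d: "((\<lambda>t. G (f (c t))) has_real_derivative inverse \<gamma> * inner (f' (c 0)) v) (at 0)"
    by (simp add: c0 F_def)
  have "G (f (c 0)) = 0" using GF[of 0] by (simp add: F_def c0)
  then have "((u \<circ> (\<lambda>t. G (f (c t)))) has_vector_derivative (inverse \<gamma> * inner (f' (c 0)) v) *\<^sub>R X (u 0)) (at 0)"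
    using integral_curve_derivative[OF u(1), of 0 UNIV] d
    by (intro vector_diff_chain_within)
      (auto simp: has_real_derivative_iff_has_vector_derivative intro: has_vector_derivative_within_subset)
  then have e: "((\<lambda>t. u (G (f (c t)))) has_vector_derivative (inverse \<gamma> * inner (f' (c 0)) v) *\<^sub>R X (u 0)) (at 0)"
    by (simp add: o_def)
  have "\<forall>\<^sub>F t in at 0. c t \<in> S" using topological_tendstoD[OF curve_in_continuous[OF c] S(1,2)] .
  moreover have "\<forall>\<^sub>F t in at 0. c t \<in> W"
    using curve_in_eventually[OF c] by (simp add: eventually_nhds_conv_at)
  ultimately have ev: "\<forall>\<^sub>F t in at 0. u (G (f (c t))) = c t"
  proof eventually_elim
    case (elim t)
    then obtain s where s: "c t = u s" using S(3) by blast
    then have "f (c t) = F s" by (simp add: F_def)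
    then show ?case using s GF by simp
  qed
  have "(c has_vector_derivative (inverse \<gamma> * inner (f' (c 0)) v) *\<^sub>R X (u 0)) (at 0)"
    unfolding has_vector_derivative_def
    by (rule has_derivative_transform_eventually[OF e[unfolded has_vector_derivative_def] ev])
      (use \<open>G (f (c 0)) = 0\<close> c0 in simp_all)
  from vector_derivative_unique_at[OF c0(2) this] show ?thesis by (metis span_scale span_base singletonI)
qed

end

context stable_branch
begin

lemma stable_cases:
  assumes "y \<in> stable_manifold M X a"
  obtains "y = a" | t where "y = up t" | t where "y = um t"
  using assms unfolding stable_manifold_eq by blast

lemma tangent_up: "tangent_space (stable_manifold M X a) (up t) = span {X (up t)}"
proof
  show "span {X (up t)} \<subseteq> tangent_space (stable_manifold M X a) (up t)"
    using integral_curve_tangent[OF curve_up smooth_X up_in_stable, of _ t] by (auto simp: span_singleton)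
  obtain S where S: "open S" "up t \<in> S" "S \<inter> stable_manifold M X a \<subseteq> range up" by (rule up_open)
  show "tangent_space (stable_manifold M X a) (up t) \<subseteq> span {X (up t)}"
  proof
    fix w assume w: "w \<in> tangent_space (stable_manifold M X a) (up t)"
    have r: "range up \<subseteq> range (\<lambda>s. up (t + s))"
    proof
      fix x assume "x \<in> range up"
      then obtain s where "x = up (t + (s - t))" by auto
      then show "x \<in> range (\<lambda>s. up (t + s))" by blast
    qed
    have "w \<in> span {X (up (t + 0))}"
      by (rule tangent_along_curve[OF integral_curve_shift[OF curve_up], of t S "stable_manifold M X a"])
        (use X_up S r w in auto)
    then show "w \<in> span {X (up t)}" by simp
  qed
qed

lemmas tangent_um = stable_branch.tangent_up[OF uminus_branch, folded um_uminus]

lemma U_low: "open (U \<inter> {x. f x < f a + (norm v)\<^sup>2})" "a \<in> U \<inter> {x. f x < f a + (norm v)\<^sup>2}"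
  using opens a_in v_nonzero by (auto intro!: open_Int open_Collect_less continuous_on_const continuous_f)

lemma tangent_a: "tangent_space (stable_manifold M X a) a = span {D 0 v}"
proof -
  have "tangent_space (stable_manifold M X a) (\<psi> 0) = D 0 ` Ep"
  proof (rule tangent_space_chart[OF sub(2)])
    show "open (V \<inter> ball 0 (norm v))" "0 \<in> V \<inter> ball 0 (norm v)" "0 \<in> Ep" "V \<inter> ball 0 (norm v) \<subseteq> V"
      using opens zero v_nonzero sub(2) by (auto simp: subspace_0)
    show "\<psi> ` (V \<inter> ball 0 (norm v) \<inter> Ep) \<subseteq> stable_manifold M X a"
    proof
      fix x assume "x \<in> \<psi> ` (V \<inter> ball 0 (norm v) \<inter> Ep)"
      then obtain h where h: "x = \<psi> (h *\<^sub>R v)" "norm (h *\<^sub>R v) < norm v"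
        unfolding Ep_span span_singleton by auto
      then have h1: "\<bar>h\<bar> < 1" using v_nonzero by simp
      consider "h = 0" | "h > 0" | "h < 0" by linarith
      then show "x \<in> stable_manifold M X a"
      proof cases
        case 1
        then show ?thesis using h zero a_stable by simp
      next
        case 2
        then show ?thesis using psi_hv_eq_up[of h] h1 h up_in_stable by (metis abs_of_pos less_eq_real_def)
      next
        case 3
        then obtain s where "\<psi> ((- h) *\<^sub>R - v) = um s" using psi_hv_eq_um[of "- h"] h1 by auto
        then show ?thesis using h um_in_stable by simp
      qed
    qed
    show "open (U \<inter> {x. f x < f a + (norm v)\<^sup>2})" "U \<inter> {x. f x < f a + (norm v)\<^sup>2} \<subseteq> U"
       "\<psi> 0 \<in> U \<inter> {x. f x < f a + (norm v)\<^sup>2}" using U_low zero by auto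
    show "\<phi> ` (stable_manifold M X a \<inter> (U \<inter> {x. f x < f a + (norm v)\<^sup>2})) \<subseteq> Ep"
    proof
      fix z assume "z \<in> \<phi> ` (stable_manifold M X a \<inter> (U \<inter> {x. f x < f a + (norm v)\<^sup>2}))"
      then obtain x where x: "z = \<phi> x" "x \<in> stable_manifold M X a" "f x < f a + (norm v)\<^sup>2" by auto
      obtain h where h: "\<bar>h\<bar> < 1" "x = \<psi> (h *\<^sub>R v)" by (rule stable_low[OF x(2,3)])
      then show "z \<in> Ep" using x inverses(1) hv_in by simp
    qed
  qed
  then show ?thesis
    unfolding zero Ep_span using linear_span_image[OF linear_D[OF zero(1)], of "{v}"] by simp
qed

text \<open>\<open>X\<close> points towards \<open>a\<close> on both branches, so its direction has to be reversed on one of them to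
  extend continuously through \<open>a\<close>.\<close>

definition dir where "dir y = (if y = a then D 0 v else if y \<in> range up then - X y else X y)"

definition tang where "tang y = inverse (norm (dir y)) *\<^sub>R dir y"

lemma dir_a: "dir a = D 0 v"
  by (simp add: dir_def)

lemma dir_up: "dir (up t) = - X (up t)"
  unfolding dir_def using up_neq_a by simp

lemma dir_um: "dir (um t) = X (um t)"
  unfolding dir_def using um_neq_a up_neq_um by (auto simp: image_iff) metis

lemma D_v_nonzero: "z \<in> V \<Longrightarrow> D z v \<noteq> 0"
  using inj_D[of z] linear_D[of z] v_nonzero linear_injective_0 by blast

lemma dir_nonzero: "y \<in> stable_manifold M X a \<Longrightarrow> dir y \<noteq> 0"
  by (cases rule: stable_cases) (auto simp: dir_up dir_um X_up X_um dir_a D_v_nonzero zero)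

lemma norm_tang: "y \<in> stable_manifold M X a \<Longrightarrow> norm (tang y) = 1"
  using dir_nonzero unfolding tang_def by simp

lemma tangent_stable: "y \<in> stable_manifold M X a \<Longrightarrow> tangent_space (stable_manifold M X a) y = span {tang y}"
proof -
  assume y: "y \<in> stable_manifold M X a"
  have sp: "span {c *\<^sub>R x} = span {x}" if "c \<noteq> 0" for c and x :: 'a
  proof (rule span_eq[THEN iffD2])
    have "inverse c *\<^sub>R c *\<^sub>R x \<in> span {c *\<^sub>R x}" by (intro span_scale span_base) simp
    then show "{c *\<^sub>R x} \<subseteq> span {x} \<and> {x} \<subseteq> span {c *\<^sub>R x}"
      using that by (simp add: span_scale span_base)
  qed
  have "span {tang y} = span {dir y}" unfolding tang_def using dir_nonzero[OF y] by (intro sp) simp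
  moreover have "tangent_space (stable_manifold M X a) y = span {dir y}"
    using y
  proof (cases rule: stable_cases)
    case 1
    then show ?thesis using tangent_a by (simp add: dir_a)
  next
    case (2 t)
    then show ?thesis using tangent_up[of t] sp[of "- 1" "X (up t)"] by (simp add: dir_up)
  next
    case (3 t)
    then show ?thesis using tangent_um[of t] by (simp add: dir_um)
  qed
  ultimately show ?thesis by simp
qed

lemma X_tang_up: "X (up t) = - norm (X (up t)) *\<^sub>R tang (up t)"
  unfolding tang_def dir_up using X_up by simp

lemma X_tang_um: "X (um t) = norm (X (um t)) *\<^sub>R tang (um t)"
  unfolding tang_def dir_um using X_um by simp

lemma tang_near_a:
  assumes "y \<in> stable_manifold M X a" "f y < f a + (norm v)\<^sup>2"
  shows "tang y = inverse (norm (D (\<phi> y) v)) *\<^sub>R D (\<phi> y) v"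
proof -
  obtain h where h: "\<bar>h\<bar> < 1" "y = \<psi> (h *\<^sub>R v)" by (rule stable_low[OF assms])
  have hV: "h *\<^sub>R v \<in> V" "h *\<^sub>R v \<in> Ep" using hv_in h by auto
  have phi: "\<phi> y = h *\<^sub>R v" using inverses(1)[OF hV(1)] h by simp
  have X: "X y = (- 2 * h) *\<^sub>R D (\<phi> y) v"
    using X_psi_Ep[OF hV(2,1)] linear_scale[OF linear_D[OF hV(1)], of "- 2 * h" v] by (simp add: phi flip: h(2))
  have "\<exists>c>0. dir y = c *\<^sub>R D (\<phi> y) v"
  proof -
    consider "h = 0" | "h > 0" | "h < 0" by linarith
    then show ?thesis
    proof cases
      case 1
      then show ?thesis using h phi zero by (intro exI[of _ 1]) (simp add: dir_def)
    next
      case 2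
      then obtain s where "y = up s" using psi_hv_eq_up[of h] h by auto
      then show ?thesis using 2 X by (intro exI[of _ "2 * h"]) (simp add: dir_up)
    next
      case 3
      then obtain s where "y = um s" using psi_hv_eq_um[of "- h"] h by auto
      then show ?thesis using 3 X by (intro exI[of _ "- 2 * h"]) (simp add: dir_um)
    qed
  qed
  then obtain c where c: "c > 0" "dir y = c *\<^sub>R D (\<phi> y) v" by blast
  then show ?thesis unfolding tang_def by simp
qed

lemma continuous_tang_near_up: 
  obtains S where "open S" "up t \<in> S" "continuous_on (stable_manifold M X a \<inter> S) tang"
proof -
  obtain S where S: "open S" "up t \<in> S" "S \<inter> stable_manifold M X a \<subseteq> range up" by (rule up_open)
  have "continuous_on (range up) (\<lambda>y. inverse (norm (- X y)) *\<^sub>R - X y)"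
    using continuous_on_subset[OF continuous_X, of "range up"] integral_curve_in[OF curve_up] X_up
    by (intro continuous_intros) auto
  moreover have "tang y = inverse (norm (- X y)) *\<^sub>R - X y" if "y \<in> range up" for y
    using that dir_up unfolding tang_def by auto
  ultimately have "continuous_on (range up) tang" by (simp cong: continuous_on_cong)
  then show thesis using that[OF S(1,2)] S(3) continuous_on_subset by (metis Int_commute)
qed

lemma tang_uminus: "y \<in> stable_manifold M X a \<Longrightarrow> stable_branch.tang M X a \<psi> (- v) y = - tang y"
proof -
  interpret N: stable_branch M f f' X a V Em Ep \<psi> U \<phi> "- v" by (rule uminus_branch)
  assume "y \<in> stable_manifold M X a"
  then have "N.dir y = - dir y"
  proof (cases rule: stable_cases)
    case 1
    then show ?thesis by (simp add: N.dir_a dir_a linear_neg[OF linear_D[OF zero(1)]])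
  next
    case (2 t)
    then show ?thesis using N.dir_um[of t] dir_up[of t] unfolding up_uminus[symmetric] by simp
  next
    case (3 t)
    then show ?thesis using N.dir_up[of t] dir_um[of t] unfolding um_uminus[symmetric] by simp
  qed
  then show ?thesis unfolding N.tang_def tang_def by simp
qed

lemma continuous_tang: "continuous_on (stable_manifold M X a) tang"
proof (rule continuous_on_locally)
  fix y assume "y \<in> stable_manifold M X a"
  then show "\<exists>S. open S \<and> y \<in> S \<and> continuous_on (stable_manifold M X a \<inter> S) tang"
  proof (cases rule: stable_cases)
    case 1
    let ?S = "U \<inter> {x. f x < f a + (norm v)\<^sup>2}"
    have "continuous_on V (\<lambda>z. D z v)" by (rule smooth_on_continuous[OF smooth_on_derivative[OF smooths(1)]])
    then have "continuous_on U (\<lambda>y. D (\<phi> y) v)"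
      by (rule continuous_on_compose2[OF _ smooth_on_continuous[OF smooths(2)]]) (use inverses(4) in auto)
    then have "continuous_on U (\<lambda>y. inverse (norm (D (\<phi> y) v)) *\<^sub>R D (\<phi> y) v)"
      using D_v_nonzero inverses(4) by (intro continuous_intros) auto
    then have "continuous_on (stable_manifold M X a \<inter> ?S) (\<lambda>y. inverse (norm (D (\<phi> y) v)) *\<^sub>R D (\<phi> y) v)"
      by (rule continuous_on_subset) auto
    then have "continuous_on (stable_manifold M X a \<inter> ?S) tang"
      using tang_near_a by (subst continuous_on_cong[OF refl]) auto
    then show ?thesis using U_low 1 by blast
  next
    case (2 t)
    then show ?thesis using continuous_tang_near_up[of t] by metis
  next
    case (3 t)
    obtain S where S: "open S" "y \<in> S" "continuous_on (stable_manifold M X a \<inter> S) (stable_branch.tang M X a \<psi> (- v))"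
      using stable_branch.continuous_tang_near_up[OF uminus_branch, folded um_uminus, of t] 3 by metis
    have "continuous_on (stable_manifold M X a \<inter> S) (\<lambda>y. - stable_branch.tang M X a \<psi> (- v) y)"
      by (intro continuous_intros S)
    then have "continuous_on (stable_manifold M X a \<inter> S) tang"
      using tang_uminus by (subst continuous_on_cong[OF refl]) auto
    then show ?thesis using S by blast
  qed
qed

end

section \<open>Orthonormal frames of quotient spaces and orientations\<close>

text \<open>The list \<open>F\<close> is an orthonormal basis of the orthogonal complement of \<open>W\<close> in \<open>V\<close>.\<close>

definition onframe :: "'a::euclidean_space set \<Rightarrow> 'a set \<Rightarrow> 'a list \<Rightarrow> bool" where
  "onframe V W F \<longleftrightarrow> subspace V \<and> set F \<subseteq> V \<and>
     (\<forall>i<length F. \<forall>j<length F. inner (F ! i) (F ! j) = (if i = j then 1 else 0)) \<and>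
     (\<forall>v\<in>V. v \<in> W \<longleftrightarrow> (\<forall>i<length F. inner (F ! i) v = 0))"

definition cmat :: "'a::euclidean_space list \<Rightarrow> 'a list \<Rightarrow> real mat" where
  "cmat F bs = Matrix.mat (length F) (length bs) (\<lambda>(i, j). inner (F ! i) (bs ! j))"

definition isgn :: "real \<Rightarrow> int" where
  "isgn x = (if x > 0 then 1 else if x < 0 then -1 else 0)"

lemma of_int_isgn: "real_of_int (isgn x) = sgn x"
  by (auto simp: isgn_def sgn_if)

lemma isgn_mult: "isgn (x * y) = isgn x * isgn y"
  by (auto simp: isgn_def zero_less_mult_iff mult_less_0_iff)

lemma isgn_nonzero: "x \<noteq> 0 \<Longrightarrow> isgn x \<in> {1, - 1}"
  by (auto simp: isgn_def)

lemma isgn_square: "x \<noteq> 0 \<Longrightarrow> isgn x * isgn x = 1"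
  by (auto simp: isgn_def)

lemma isgn_1: "isgn 1 = 1"
  by (simp add: isgn_def)

lemma sum_list_map2_scaleR:
  "length c = length bs \<Longrightarrow> sum_list (map2 (*\<^sub>R) c bs) = (\<Sum>j<length bs. c ! j *\<^sub>R bs ! j)"
  by (simp add: sum_list_sum_nth atLeast0LessThan)

lemma cmat_carrier: "cmat F bs \<in> carrier_mat (length F) (length bs)"
  by (simp add: cmat_def)

lemma cmat_index: "i < length F \<Longrightarrow> j < length bs \<Longrightarrow> cmat F bs $$ (i, j) = inner (F ! i) (bs ! j)"
  by (simp add: cmat_def)

lemma det_non_zero_inverse:
  assumes "(A :: real mat) \<in> carrier_mat n n" "Determinant.det A \<noteq> 0"
  obtains B where "B \<in> carrier_mat n n" "A * B = 1\<^sub>m n" "B * A = 1\<^sub>m n"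
  using det_non_zero_imp_unit[OF assms, of "()"] unfolding Units_def ring_mat_def by auto

lemma onframe_combination:
  assumes F: "onframe V W F" and bs: "set bs \<subseteq> V" and v: "v \<in> V"
  shows "v - (\<Sum>j<length bs. g j *\<^sub>R bs ! j) \<in> W \<longleftrightarrow>
    (\<forall>i<length F. inner (F ! i) v = (\<Sum>j<length bs. inner (F ! i) (bs ! j) * g j))"
proof -
  have "bs ! j \<in> V" if "j < length bs" for j using bs that by auto
  then have "v - (\<Sum>j<length bs. g j *\<^sub>R bs ! j) \<in> V"
    using F v unfolding onframe_def by (intro subspace_diff subspace_sum subspace_scale) auto
  then show ?thesis using F unfolding onframe_def
    by (auto simp: inner_diff_right inner_sum_right mult.commute)
qed

lemma onframe_basis_modD:
  assumes F: "onframe V W F" and bs: "basis_mod V W bs"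
  shows "length bs = length F" "Determinant.det (cmat F bs) \<noteq> 0" "set bs \<subseteq> V"
proof -
  let ?n = "length F" and ?m = "length bs"
  let ?A = "\<lambda>i j. inner (F ! i) (bs ! j)"
  show bsV: "set bs \<subseteq> V" using bs unfolding basis_mod_def by blast
  have V: "subspace V" using F unfolding onframe_def by blast
  have ex1: "\<exists>!c. length c = ?m \<and> v - sum_list (map2 (*\<^sub>R) c bs) \<in> W" if "v \<in> V" for v
    using bs that unfolding basis_mod_def by blast
  have comb: "v - sum_list (map2 (*\<^sub>R) c bs) \<in> W \<longleftrightarrow>
      (\<forall>i<?n. inner (F ! i) v = (\<Sum>j<?m. ?A i j * c ! j))" if "length c = ?m" "v \<in> V" for c v
    using onframe_combination[OF F bsV that(2), of "\<lambda>j. c ! j"] sum_list_map2_scaleR[OF that(1)] by simp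
  have FV: "F ! i \<in> V" if "i < ?n" for i using F that unfolding onframe_def by auto
  define B where "B i = (THE c. length c = ?m \<and> F ! i - sum_list (map2 (*\<^sub>R) c bs) \<in> W)" for i
  have B: "length (B i) = ?m" "F ! i - sum_list (map2 (*\<^sub>R) (B i) bs) \<in> W" if "i < ?n" for i
    using theI'[OF ex1[OF FV[OF that]]] unfolding B_def by auto
  have AB: "(\<Sum>j<?m. ?A k j * B i ! j) = (if k = i then 1 else 0)" if "i < ?n" "k < ?n" for i k
    using B[OF that(1)] comb[OF B(1)[OF that(1)] FV[OF that(1)]] that F unfolding onframe_def by auto
  have BA: "(\<Sum>i<?n. B i ! j * ?A i k) = (if j = k then 1 else 0)" if jk: "j < ?m" "k < ?m" for j k
  proof -
    have bV: "bs ! k \<in> V" using bsV jk by auto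
    define c where "c = map (\<lambda>j. \<Sum>i<?n. B i ! j * ?A i k) [0..<?m]"
    define d where "d = map (\<lambda>j. if j = k then 1 else 0 :: real) [0..<?m]"
    have "bs ! k - sum_list (map2 (*\<^sub>R) c bs) \<in> W"
    proof (subst comb[OF _ bV], goal_cases)
      case 2
      show ?case
      proof (intro allI impI)
        fix l assume l: "l < ?n"
        have "(\<Sum>j<?m. ?A l j * c ! j) = (\<Sum>j<?m. \<Sum>i<?n. ?A l j * (B i ! j * ?A i k))"
          by (intro sum.cong) (auto simp: c_def sum_distrib_left)
        also have "\<dots> = (\<Sum>i<?n. \<Sum>j<?m. ?A l j * (B i ! j * ?A i k))" by (rule sum.swap)
        also have "\<dots> = (\<Sum>i<?n. (\<Sum>j<?m. ?A l j * B i ! j) * ?A i k)"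
          by (simp add: sum_distrib_right mult.assoc)
        also have "\<dots> = (\<Sum>i<?n. (if l = i then 1 else 0) * ?A i k)"
          using AB l by (intro sum.cong) auto
        also have "\<dots> = (\<Sum>i<?n. if i = l then ?A l k else 0)"
          by (intro sum.cong) auto
        also have "\<dots> = ?A l k" using l by simp
        finally show "inner (F ! l) (bs ! k) = (\<Sum>j<?m. ?A l j * c ! j)" by simp
      qed
    qed (simp add: c_def)
    moreover have "bs ! k - sum_list (map2 (*\<^sub>R) d bs) \<in> W"
    proof (subst comb[OF _ bV], goal_cases)
      case 2
      have "(\<Sum>j<?m. ?A i j * d ! j) = (\<Sum>j<?m. if j = k then ?A i k else 0)" for i
        by (intro sum.cong) (auto simp: d_def)
      then show ?case using jk by simp
    qed (simp add: d_def)
    moreover have "length c = ?m" "length d = ?m" by (simp_all add: c_def d_def)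
    ultimately have "c = d" using ex1[OF bV] by blast
    then have "c ! j = d ! j" by simp
    then show ?thesis using jk by (simp add: c_def d_def)
  qed
  have "real ?n = (\<Sum>i<?n. \<Sum>j<?m. ?A i j * B i ! j)" using AB by simp
  also have "\<dots> = (\<Sum>j<?m. \<Sum>i<?n. B i ! j * ?A i j)" by (subst sum.swap) (simp add: mult.commute)
  also have "\<dots> = real ?m" using BA by simp
  finally show len: "length bs = length F" by simp
  define BM where "BM = Matrix.mat ?n ?n (\<lambda>(j, i). B i ! j)"
  have carr: "cmat F bs \<in> carrier_mat ?n ?n" "BM \<in> carrier_mat ?n ?n"
    using cmat_carrier[of F bs] len by (auto simp: BM_def)
  have "cmat F bs * BM = 1\<^sub>m ?n"
  proof (rule eq_matI)
    fix i j assume "i < dim_row (1\<^sub>m ?n)" "j < dim_col (1\<^sub>m ?n)"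
    then show "(cmat F bs * BM) $$ (i, j) = 1\<^sub>m ?n $$ (i, j)"
      using AB[of j i] carr len by (simp add: scalar_prod_def cmat_index BM_def atLeast0LessThan)
  qed (use carr in auto)
  then have "Determinant.det (cmat F bs) * Determinant.det BM = 1"
    using det_mult[OF carr] by simp
  then show "Determinant.det (cmat F bs) \<noteq> 0" by auto
qed

lemma onframe_basis_modI:
  assumes F: "onframe V W F" and bs: "length bs = length F" "Determinant.det (cmat F bs) \<noteq> 0" "set bs \<subseteq> V"
  shows "basis_mod V W bs"
  unfolding basis_mod_def
proof (intro conjI ballI bs(3))
  let ?n = "length F"
  let ?A = "\<lambda>i j. inner (F ! i) (bs ! j)"
  fix v assume v: "v \<in> V"
  have comb: "v - sum_list (map2 (*\<^sub>R) c bs) \<in> W \<longleftrightarrow>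
      (\<forall>i<?n. inner (F ! i) v = (\<Sum>j<?n. ?A i j * c ! j))" if "length c = ?n" for c
    using onframe_combination[OF F bs(3) v, of "\<lambda>j. c ! j"] sum_list_map2_scaleR[of c bs] that bs(1) by simp
  have carr: "cmat F bs \<in> carrier_mat ?n ?n" using cmat_carrier[of F bs] bs(1) by simp
  obtain B where B: "B \<in> carrier_mat ?n ?n" "cmat F bs * B = 1\<^sub>m ?n" "B * cmat F bs = 1\<^sub>m ?n"
    by (rule det_non_zero_inverse[OF carr bs(2)])
  have AB: "(\<Sum>j<?n. ?A i j * B $$ (j, k)) = (if i = k then 1 else 0)" if "i < ?n" "k < ?n" for i k
    using arg_cong[OF B(2), of "\<lambda>M. M $$ (i, k)"] that carr B(1) bs(1)
    by (simp add: scalar_prod_def cmat_index atLeast0LessThan)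
  have BA: "(\<Sum>j<?n. B $$ (i, j) * ?A j k) = (if i = k then 1 else 0)" if "i < ?n" "k < ?n" for i k
    using arg_cong[OF B(3), of "\<lambda>M. M $$ (i, k)"] that carr B(1) bs(1)
    by (simp add: scalar_prod_def cmat_index atLeast0LessThan)
  define c where "c = map (\<lambda>j. \<Sum>k<?n. B $$ (j, k) * inner (F ! k) v) [0..<?n]"
  have len: "length c = ?n" by (simp add: c_def)
  show "\<exists>!c. length c = length bs \<and> v - sum_list (map2 (*\<^sub>R) c bs) \<in> W"
    unfolding bs(1)
  proof (rule ex1I[of _ c], intro conjI len)
    show "v - sum_list (map2 (*\<^sub>R) c bs) \<in> W" unfolding comb[OF len]
    proof (intro allI impI)
      fix i assume i: "i < ?n"
      have "(\<Sum>j<?n. ?A i j * c ! j) = (\<Sum>j<?n. \<Sum>k<?n. ?A i j * (B $$ (j, k) * inner (F ! k) v))"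
        by (intro sum.cong) (auto simp: c_def sum_distrib_left)
      also have "\<dots> = (\<Sum>k<?n. (\<Sum>j<?n. ?A i j * B $$ (j, k)) * inner (F ! k) v)"
        by (subst sum.swap) (simp add: sum_distrib_right mult.assoc)
      also have "\<dots> = (\<Sum>k<?n. if k = i then inner (F ! i) v else 0)"
        using AB i by (intro sum.cong) auto
      also have "\<dots> = inner (F ! i) v" using i by simp
      finally show "inner (F ! i) v = (\<Sum>j<?n. ?A i j * c ! j)" by simp
    qed
    fix d assume d: "length d = ?n \<and> v - sum_list (map2 (*\<^sub>R) d bs) \<in> W"
    show "d = c"
    proof (rule nth_equalityI)
      fix j assume j: "j < length d"
      have "c ! j = (\<Sum>k<?n. B $$ (j, k) * (\<Sum>l<?n. ?A k l * d ! l))"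
        using d comb[of d] j by (simp add: c_def)
      also have "\<dots> = (\<Sum>l<?n. (\<Sum>k<?n. B $$ (j, k) * ?A k l) * d ! l)"
        by (simp add: sum_distrib_left sum_distrib_right mult.assoc) (rule sum.swap)
      also have "\<dots> = (\<Sum>l<?n. if l = j then d ! j else 0)"
        using BA d j by (intro sum.cong) auto
      also have "\<dots> = d ! j" using j d by simp
      finally show "d ! j = c ! j" by simp
    qed (use d len in simp)
  qed
qed

lemma cmat_self: "onframe V W F \<Longrightarrow> cmat F F = 1\<^sub>m (length F)"
  by (rule eq_matI) (auto simp: cmat_def onframe_def)

lemma onframe_basis_mod: "onframe V W F \<Longrightarrow> basis_mod V W F"
proof (rule onframe_basis_modI)
  show "Determinant.det (cmat F F) \<noteq> 0" if "onframe V W F" using cmat_self[OF that] by simp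
qed (simp_all add: onframe_def)

lemma orientation_modD:
  assumes \<omega>: "orientation_mod V W \<omega>" and b: "basis_mod V W bs" "basis_mod V W cs"
    and A: "A \<in> carrier_mat (length bs) (length bs)"
    and W: "\<And>j. j < length bs \<Longrightarrow> cs ! j - (\<Sum>i<length bs. A $$ (i, j) *\<^sub>R bs ! i) \<in> W"
  shows "\<omega> cs = isgn (Determinant.det A) * \<omega> bs"
proof -
  have "\<forall>bs cs. \<forall>A\<in>carrier_mat (length bs) (length bs).
        basis_mod V W bs \<and> basis_mod V W cs \<and>
        (\<forall>j<length bs. cs ! j - (\<Sum>i<length bs. A $$ (i, j) *\<^sub>R bs ! i) \<in> W) \<longrightarrow>
        real_of_int (\<omega> cs) = sgn (Determinant.det A) * real_of_int (\<omega> bs)"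
    using \<omega> unfolding orientation_mod_def by (rule conjunct2)
  from this[rule_format, of A bs cs] have "real_of_int (\<omega> cs) = real_of_int (isgn (Determinant.det A) * \<omega> bs)"
    using assms(2-) by (simp add: of_int_isgn)
  then show ?thesis by (rule of_int_eq_iff[THEN iffD1])
qed

lemma onframe_orientation:
  assumes F: "onframe V W F" and \<omega>: "orientation_mod V W \<omega>" and bs: "basis_mod V W bs"
  shows "\<omega> bs = isgn (Determinant.det (cmat F bs)) * \<omega> F"
proof -
  note D = onframe_basis_modD[OF F bs]
  have "bs ! j - (\<Sum>i<length F. cmat F bs $$ (i, j) *\<^sub>R F ! i) \<in> W" if j: "j < length F" for j
  proof (subst onframe_combination[OF F])
    show "set F \<subseteq> V" "bs ! j \<in> V" using F D j by (auto simp: onframe_def)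
    show "\<forall>i<length F. inner (F ! i) (bs ! j) = (\<Sum>k<length F. inner (F ! i) (F ! k) * cmat F bs $$ (k, j))"
    proof (intro allI impI)
      fix i assume i: "i < length F"
      have "(\<Sum>k<length F. inner (F ! i) (F ! k) * cmat F bs $$ (k, j)) =
          (\<Sum>k<length F. if k = i then inner (F ! i) (bs ! j) else 0)"
        using F i j D(1) by (intro sum.cong) (auto simp: onframe_def cmat_index)
      then show "inner (F ! i) (bs ! j) = (\<Sum>k<length F. inner (F ! i) (F ! k) * cmat F bs $$ (k, j))"
        using i by simp
    qed
  qed
  moreover have "cmat F bs \<in> carrier_mat (length F) (length F)" using cmat_carrier[of F bs] D by simp
  ultimately show ?thesis by (intro orientation_modD[OF \<omega> onframe_basis_mod[OF F] bs])
qed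

lemma cmat_change:
  assumes F: "onframe V W F" and bs: "length bs = length F" "set bs \<subseteq> V" and cs: "length cs = length F" "set cs \<subseteq> V"
    and A: "A \<in> carrier_mat (length F) (length F)"
    and W: "\<forall>j<length F. cs ! j - (\<Sum>i<length F. A $$ (i, j) *\<^sub>R bs ! i) \<in> W"
  shows "cmat F cs = cmat F bs * A"
proof (rule eq_matI)
  fix i j assume "i < dim_row (cmat F bs * A)" "j < dim_col (cmat F bs * A)"
  then have ij: "i < length F" "j < length F" using A by (auto simp: cmat_def)
  have "cs ! j \<in> V" using cs ij by auto
  from onframe_combination[OF F bs(2) this, of "\<lambda>i. A $$ (i, j)"]
  have "inner (F ! i) (cs ! j) = (\<Sum>k<length F. inner (F ! i) (bs ! k) * A $$ (k, j))"
    using W ij bs(1) by simp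
  then show "cmat F cs $$ (i, j) = (cmat F bs * A) $$ (i, j)"
    using ij bs(1) cs(1) A cmat_carrier[of F bs] by (simp add: cmat_index scalar_prod_def atLeast0LessThan)
qed (use A cs in \<open>auto simp: cmat_def\<close>)

lemma onframe_orientation_mod:
  assumes F: "onframe V W F" and s: "s \<in> {1, - 1}"
  shows "orientation_mod V W (\<lambda>bs. s * isgn (Determinant.det (cmat F bs)))"
  unfolding orientation_mod_def
proof (intro conjI allI impI ballI)
  show "s * isgn (Determinant.det (cmat F bs)) \<in> {1, - 1}" if "basis_mod V W bs" for bs
    using isgn_nonzero[OF onframe_basis_modD(2)[OF F that]] s by auto
  fix bs cs and A :: "real mat"
  assume A: "A \<in> carrier_mat (length bs) (length bs)"
    and *: "basis_mod V W bs \<and> basis_mod V W cs \<and>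
      (\<forall>j<length bs. cs ! j - (\<Sum>i<length bs. A $$ (i, j) *\<^sub>R bs ! i) \<in> W)"
  note D = onframe_basis_modD[OF F, of bs] onframe_basis_modD[OF F, of cs]
  have "cmat F cs = cmat F bs * A" using * A D by (intro cmat_change[OF F]) auto
  then have "Determinant.det (cmat F cs) = Determinant.det (cmat F bs) * Determinant.det A"
    using det_mult[of "cmat F bs" "length F" A] A D * cmat_carrier[of F bs] by simp
  then show "real_of_int (s * isgn (Determinant.det (cmat F cs))) =
      sgn (Determinant.det A) * real_of_int (s * isgn (Determinant.det (cmat F bs)))"
    by (simp add: of_int_isgn sgn_mult)
qed

lemma complement_orientation:
  assumes F: "onframe V W F" and \<omega>: "orientation_mod U {0} \<omega>"
    and UV: "U \<subseteq> V" "subspace U" "subspace W" "V \<subseteq> {u + w |u w. u \<in> U \<and> w \<in> W}" "U \<inter> W \<subseteq> {0}"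
  obtains s where "s \<in> {1, - 1}" "\<And>bs. basis_mod U {0} bs \<Longrightarrow> \<omega> bs = s * isgn (Determinant.det (cmat F bs))"
proof (cases "\<exists>bs. basis_mod U {0} bs")
  case False
  then show ?thesis using that[of 1] by simp
next
  case True
  have bm: "basis_mod V W bs" if bs: "basis_mod U {0} bs" for bs
    unfolding basis_mod_def
  proof (intro conjI ballI)
    have bsU: "set bs \<subseteq> U" using bs unfolding basis_mod_def by blast
    then show "set bs \<subseteq> V" using UV by blast
    fix v assume "v \<in> V"
    then obtain u w where v: "v = u + w" "u \<in> U" "w \<in> W" using UV by blast
    have "v - sum_list (map2 (*\<^sub>R) c bs) \<in> W \<longleftrightarrow> u - sum_list (map2 (*\<^sub>R) c bs) \<in> {0}" if "length c = length bs" for c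
    proof -
      let ?S = "sum_list (map2 (*\<^sub>R) c bs)"
      have "?S \<in> U" unfolding sum_list_map2_scaleR[OF that]
        using bsU UV(2) by (intro subspace_sum subspace_scale) auto
      then have uS: "u - ?S \<in> U" using v UV(2) by (intro subspace_diff)
      have eq: "v - ?S = (u - ?S) + w" using v by simp
      show ?thesis
      proof
        assume "v - ?S \<in> W"
        then have "(v - ?S) - w \<in> W" using v(3) by (rule subspace_diff[OF UV(3)])
        then show "u - ?S \<in> {0}" using uS UV(5) unfolding eq by auto
      next
        assume "u - ?S \<in> {0}"
        then show "v - ?S \<in> W" unfolding eq using v by simp
      qed
    qed
    then have "(length c = length bs \<and> v - sum_list (map2 (*\<^sub>R) c bs) \<in> W) \<longleftrightarrow>
        (length c = length bs \<and> u - sum_list (map2 (*\<^sub>R) c bs) \<in> {0})" for c by blast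
    then show "\<exists>!c. length c = length bs \<and> v - sum_list (map2 (*\<^sub>R) c bs) \<in> W"
      using bs v(2) unfolding basis_mod_def by simp
  qed
  from True obtain bs0 where bs0: "basis_mod U {0} bs0" by blast
  note D0 = onframe_basis_modD[OF F bm[OF bs0]]
  define d0 where "d0 = isgn (Determinant.det (cmat F bs0))"
  have w0: "\<omega> bs0 \<in> {1, - 1}" using \<omega> bs0 unfolding orientation_mod_def by blast
  show ?thesis
  proof (rule that[of "\<omega> bs0 * d0"])
    show "\<omega> bs0 * d0 \<in> {1, - 1}" using w0 isgn_nonzero[OF D0(2)] unfolding d0_def by auto
    fix bs assume bs: "basis_mod U {0} bs"
    note D = onframe_basis_modD[OF F bm[OF bs]]
    have "\<forall>j<length F. \<exists>c. length c = length bs0 \<and> bs ! j - sum_list (map2 (*\<^sub>R) c bs0) \<in> {0}"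
    proof (intro allI impI)
      fix j assume "j < length F"
      then have "bs ! j \<in> U" using D(1) bs unfolding basis_mod_def by auto
      then show "\<exists>c. length c = length bs0 \<and> bs ! j - sum_list (map2 (*\<^sub>R) c bs0) \<in> {0}"
        using bs0 unfolding basis_mod_def by blast
    qed
    then obtain c where c: "\<And>j. j < length F \<Longrightarrow> length (c j) = length bs0 \<and> bs ! j - sum_list (map2 (*\<^sub>R) (c j) bs0) \<in> {0}"
      by metis
    define A where "A = Matrix.mat (length F) (length F) (\<lambda>(i, j). c j ! i)"
    have A: "A \<in> carrier_mat (length F) (length F)" by (simp add: A_def)
    have rel: "bs ! j - (\<Sum>i<length F. A $$ (i, j) *\<^sub>R bs0 ! i) \<in> {0}" if "j < length F" for j
      using c[OF that] sum_list_map2_scaleR[of "c j" bs0] D0(1) that by (simp add: A_def)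
    have "cmat F bs = cmat F bs0 * A"
      using rel UV(3) D D0 A by (intro cmat_change[OF F]) (auto simp: subspace_0)
    then have "isgn (Determinant.det (cmat F bs)) = d0 * isgn (Determinant.det A)"
      using det_mult[of "cmat F bs0" "length F" A] A D0 cmat_carrier[of F bs0] by (simp add: d0_def isgn_mult)
    moreover have "\<omega> bs = isgn (Determinant.det A) * \<omega> bs0"
      using A rel D0(1) by (intro orientation_modD[OF \<omega> bs0 bs]) auto
    moreover have "d0 * d0 = 1" unfolding d0_def by (rule isgn_square[OF D0(2)])
    ultimately show "\<omega> bs = \<omega> bs0 * d0 * isgn (Determinant.det (cmat F bs))"
      by (simp add: mult.assoc mult.commute mult.left_commute)
  qed
qed

lemma continuous_on_det:
  assumes "\<And>i j. i < n \<Longrightarrow> j < n \<Longrightarrow> continuous_on S (\<lambda>y. g y i j)"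
  shows "continuous_on S (\<lambda>y. Determinant.det (Matrix.mat n n (\<lambda>(i, j). g y i j)) :: real)"
proof -
  have "continuous_on S (\<lambda>y. \<Sum>p\<in>{p. p permutes {0..<n}}. signof p * (\<Prod>i = 0..<n. g y i (p i)))"
    using assms by (intro continuous_intros) (auto dest: permutes_in_image)
  moreover have "(\<Sum>p\<in>{p. p permutes {0..<n}}. signof p * (\<Prod>i = 0..<n. g y i (p i))) =
     Determinant.det (Matrix.mat n n (\<lambda>(i, j). g y i j))" for y
    unfolding det_def
    by (auto intro!: sum.cong prod.cong arg_cong2[where f = "(*)"] dest: permutes_in_image)
  ultimately show ?thesis by simp
qed

lemma bundle_orientationE:
  assumes "bundle_orientation S V W \<omega>" "x \<in> S"
  obtains U es where "open U" "x \<in> U" "\<And>e. e \<in> set es \<Longrightarrow> continuous_on (S \<inter> U) e"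
    "\<And>y. y \<in> S \<inter> U \<Longrightarrow> basis_mod (V y) (W y) (map (\<lambda>e. e y) es)"
    "\<And>y. y \<in> S \<inter> U \<Longrightarrow> \<omega> y (map (\<lambda>e. e y) es) = \<omega> x (map (\<lambda>e. e x) es)"
proof -
  have "\<forall>x\<in>S. \<exists>U es. open U \<and> x \<in> U \<and> (\<forall>e\<in>set es. continuous_on (S \<inter> U) e) \<and>
        (\<forall>y\<in>S \<inter> U. basis_mod (V y) (W y) (map (\<lambda>e. e y) es) \<and>
           \<omega> y (map (\<lambda>e. e y) es) = \<omega> x (map (\<lambda>e. e x) es))"
    using assms(1) unfolding bundle_orientation_def by (rule conjunct2)
  from bspec[OF this assms(2)] obtain U es where
    "open U \<and> x \<in> U \<and> (\<forall>e\<in>set es. continuous_on (S \<inter> U) e) \<and>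
        (\<forall>y\<in>S \<inter> U. basis_mod (V y) (W y) (map (\<lambda>e. e y) es) \<and>
           \<omega> y (map (\<lambda>e. e y) es) = \<omega> x (map (\<lambda>e. e x) es))"
    by (elim exE)
  then show thesis by (intro that[of U es]) simp_all
qed

lemma bundle_orientation_locally_constant:
  fixes Fs :: "('a::euclidean_space \<Rightarrow> 'a) list"
  assumes \<omega>: "bundle_orientation S V W \<omega>" and T: "T \<subseteq> S"
    and F: "\<And>y. y \<in> T \<Longrightarrow> onframe (V y) (W y) (map (\<lambda>e. e y) Fs)"
    and cont: "\<And>e. e \<in> set Fs \<Longrightarrow> continuous_on T e" and x: "x \<in> T"
  obtains U where "open U" "x \<in> U" "\<And>y. y \<in> T \<inter> U \<Longrightarrow> \<omega> y (map (\<lambda>e. e y) Fs) = \<omega> x (map (\<lambda>e. e x) Fs)"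
proof -
  obtain U es where U: "open U" "x \<in> U" "\<And>e. e \<in> set es \<Longrightarrow> continuous_on (S \<inter> U) e"
    "\<And>y. y \<in> S \<inter> U \<Longrightarrow> basis_mod (V y) (W y) (map (\<lambda>e. e y) es)"
    "\<And>y. y \<in> S \<inter> U \<Longrightarrow> \<omega> y (map (\<lambda>e. e y) es) = \<omega> x (map (\<lambda>e. e x) es)"
  proof (rule bundle_orientationE[OF \<omega> subsetD[OF T x]], goal_cases)
    case prems: (1 U es)
    show ?case by (rule prems(1)[OF prems(2-6)])
  qed
  let ?F = "\<lambda>y. map (\<lambda>e. e y) Fs" and ?e = "\<lambda>y. map (\<lambda>e. e y) es"
  define d where "d y = Determinant.det (cmat (?F y) (?e y))" for y
  have len: "length es = length Fs"
    using onframe_basis_modD(1)[OF F[OF x] U(4)[of x]] U(2) x T by auto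
  have d0: "d y \<noteq> 0" if "y \<in> T \<inter> U" for y
    unfolding d_def using onframe_basis_modD(2)[OF F U(4)] that T by blast
  have "continuous_on (T \<inter> U) d"
  proof -
    have "continuous_on (T \<inter> U) (\<lambda>y. Determinant.det (Matrix.mat (length Fs) (length Fs) (\<lambda>(i, j). inner ((Fs ! i) y) ((es ! j) y))))"
    proof (rule continuous_on_det)
      fix i j assume "i < length Fs" "j < length Fs"
      then have "continuous_on T (Fs ! i)" "continuous_on (S \<inter> U) (es ! j)" using cont U(3) len by auto
      then show "continuous_on (T \<inter> U) (\<lambda>y. inner ((Fs ! i) y) ((es ! j) y))"
        using T by (intro continuous_on_inner) (auto intro: continuous_on_subset)
    qed
    moreover have "cmat (?F y) (?e y) = Matrix.mat (length Fs) (length Fs) (\<lambda>(i, j). inner ((Fs ! i) y) ((es ! j) y))" for y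
      using len by (auto simp: cmat_def intro!: eq_matI)
    ultimately show ?thesis unfolding d_def by simp
  qed
  then have "openin (top_of_set (T \<inter> U)) ((T \<inter> U) \<inter> (\<lambda>y. d x * d y) -` {0<..})"
    by (intro continuous_openin_preimage_gen continuous_intros) auto
  then obtain U' where U': "open U'" "(T \<inter> U) \<inter> (\<lambda>y. d x * d y) -` {0<..} = (T \<inter> U) \<inter> U'"
    unfolding openin_open by blast
  have rel: "\<omega> y (?F y) = isgn (d y) * \<omega> x (?e x)" if y: "y \<in> T \<inter> U" for y
  proof -
    have "orientation_mod (V y) (W y) (\<omega> y)" using \<omega> T y unfolding bundle_orientation_def by blast
    then have "\<omega> y (?e y) = isgn (d y) * \<omega> y (?F y)"
      unfolding d_def using onframe_orientation[OF F _ U(4)] T y by blast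
    then have "isgn (d y) * \<omega> y (?e y) = (isgn (d y) * isgn (d y)) * \<omega> y (?F y)" by simp
    then show ?thesis using isgn_square[OF d0[OF y]] U(5)[of y] T y by auto
  qed
  show thesis
  proof (rule that[of "U \<inter> U'"])
    have xx: "x \<in> T \<inter> U" using x U by blast
    then have "d x * d x > 0" using d0[of x] by (metis not_real_square_gt_zero)
    then show "x \<in> U \<inter> U'" using xx U' by blast
    fix y assume y: "y \<in> T \<inter> (U \<inter> U')"
    then have "d x * d y > 0" using U' by blast
    then have "isgn (d x) = isgn (d y)" by (auto simp: isgn_def zero_less_mult_iff)
    then show "\<omega> y (?F y) = \<omega> x (?F x)" using rel y xx by auto
  qed (use U U' in auto)
qed

lemma bundle_orientation_exists:
  fixes Fs :: "('a::euclidean_space \<Rightarrow> 'a) list"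
  assumes F: "\<And>y. y \<in> S \<Longrightarrow> onframe (V y) (W y) (map (\<lambda>e. e y) Fs)"
    and cont: "\<And>e. e \<in> set Fs \<Longrightarrow> continuous_on S e" and s: "s \<in> {1, - 1}"
  shows "bundle_orientation S V W (\<lambda>y bs. s * isgn (Determinant.det (cmat (map (\<lambda>e. e y) Fs) bs)))"
  unfolding bundle_orientation_def
proof (intro conjI ballI)
  fix x assume x: "x \<in> S"
  show "orientation_mod (V x) (W x) (\<lambda>bs. s * isgn (Determinant.det (cmat (map (\<lambda>e. e x) Fs) bs)))"
    by (rule onframe_orientation_mod[OF F[OF x] s])
  show "\<exists>U es. open U \<and> x \<in> U \<and> (\<forall>e\<in>set es. continuous_on (S \<inter> U) e) \<and>
        (\<forall>y\<in>S \<inter> U. basis_mod (V y) (W y) (map (\<lambda>e. e y) es) \<and>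
           s * isgn (Determinant.det (cmat (map (\<lambda>e. e y) Fs) (map (\<lambda>e. e y) es))) =
           s * isgn (Determinant.det (cmat (map (\<lambda>e. e x) Fs) (map (\<lambda>e. e x) es))))"
    using onframe_basis_mod[OF F] cmat_self[OF F] x cont
    by (intro exI[of _ UNIV] exI[of _ Fs]) auto
qed

lemma det_cmat_Cons:
  assumes "length bs = length F" "\<And>i. i < length F \<Longrightarrow> inner (F ! i) x = 0"
  shows "Determinant.det (cmat (f # F) (x # bs)) = inner f x * Determinant.det (cmat F bs)"
proof -
  let ?n = "length F"
  have "cmat (f # F) (x # bs) =
    four_block_mat (Matrix.mat 1 1 (\<lambda>_. inner f x)) (Matrix.mat 1 ?n (\<lambda>(i, j). inner f (bs ! j))) (0\<^sub>m ?n 1) (cmat F bs)"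
    using assms by (intro eq_matI) (auto simp: cmat_def nth_Cons')
  moreover have "Determinant.det (Matrix.mat 1 1 (\<lambda>_. inner f x)) = inner f x"
    by (subst det_def') (auto simp: permutes_sing)
  ultimately show ?thesis
    using det_four_block_mat_lower_left_zero_col[of "Matrix.mat 1 1 (\<lambda>_. inner f x)" "Matrix.mat 1 ?n (\<lambda>(i, j). inner f (bs ! j))" ?n "0\<^sub>m ?n 1" "cmat F bs"]
      cmat_carrier[of F bs] assms(1) by simp
qed

lemma onframe_ConsD:
  assumes "onframe V W (f # F)" "i < length F"
  shows "inner (F ! i) f = 0" "inner f f = 1"
proof -
  have o: "inner ((f # F) ! k) ((f # F) ! l) = (if k = l then 1 else 0)" if "k < Suc (length F)" "l < Suc (length F)" for k l
    using assms(1) that unfolding onframe_def by simp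
  show "inner (F ! i) f = 0" "inner f f = 1" using o[of "Suc i" 0] o[of 0 0] assms(2) by simp_all
qed

section \<open>Signs of flow lines\<close>

lemma onframe_Cons_inner: "onframe V W (f # F) \<Longrightarrow> inner f f = 1"
  unfolding onframe_def by (elim conjE) (metis length_Cons nth_Cons_0 zero_less_Suc)

lemma induced_orientation_eq:
  assumes \<omega>: "orientation_mod (tangent_space (unstable_manifold M X \<xi>) x) {0} (\<omega> \<xi> x)"
    and \<nu>: "orientation_mod (tangent_space M x) (tangent_space (stable_manifold M X \<gamma>) x)
      (stable_normal_orientation M X \<omega> \<gamma> x)"
    and F: "onframe (tangent_space M x) (tangent_space (stable_manifold M X \<gamma>) x) F"
    and fF: "onframe (tangent_space (unstable_manifold M X \<xi>) x) {0} (f # F)" and c: "c \<noteq> 0"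
  shows "induced_orientation M X \<omega> \<xi> \<gamma> x [c *\<^sub>R f] =
    isgn c * \<omega> \<xi> x (f # F) * stable_normal_orientation M X \<omega> \<gamma> x F"
proof -
  let ?U = "tangent_space (unstable_manifold M X \<xi>) x" and ?V = "tangent_space M x"
    and ?W = "tangent_space (stable_manifold M X \<gamma>) x" and ?\<nu> = "stable_normal_orientation M X \<omega> \<gamma> x"
  have U: "subspace ?U" "set (f # F) \<subseteq> ?U" using fF unfolding onframe_def by blast+
  have val: "\<omega> \<xi> x ([c *\<^sub>R f] @ bs) * ?\<nu> bs = isgn c * \<omega> \<xi> x (f # F) * ?\<nu> F"
    if bs: "set bs \<subseteq> ?U" "basis_mod ?V ?W bs" for bs
  proof -
    note D = onframe_basis_modD[OF F bs(2)]
    have det: "Determinant.det (cmat (f # F) (c *\<^sub>R f # bs)) = c * Determinant.det (cmat F bs)"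
      using det_cmat_Cons[OF D(1), of "c *\<^sub>R f" f] onframe_ConsD(1)[OF fF] onframe_Cons_inner[OF fF] by simp
    have "basis_mod ?U {0} (c *\<^sub>R f # bs)"
      using det c D bs U by (intro onframe_basis_modI[OF fF]) (auto simp: subspace_scale)
    from onframe_orientation[OF fF \<omega> this]
    have "\<omega> \<xi> x (c *\<^sub>R f # bs) = isgn c * isgn (Determinant.det (cmat F bs)) * \<omega> \<xi> x (f # F)"
      by (simp only: det isgn_mult)
    moreover have "?\<nu> bs = isgn (Determinant.det (cmat F bs)) * ?\<nu> F"
      by (rule onframe_orientation[OF F \<nu> bs(2)])
    moreover have "isgn (Determinant.det (cmat F bs)) * isgn (Determinant.det (cmat F bs)) = 1"
      by (rule isgn_square[OF D(2)])
    ultimately show ?thesis by simp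
  qed
  show ?thesis unfolding induced_orientation_def
  proof (rule the_equality)
    show "\<exists>bs. set bs \<subseteq> ?U \<and> basis_mod ?V ?W bs \<and>
        isgn c * \<omega> \<xi> x (f # F) * ?\<nu> F = \<omega> \<xi> x ([c *\<^sub>R f] @ bs) * ?\<nu> bs"
      using val[of F] U(2) onframe_basis_mod[OF F] by (intro exI[of _ F]) auto
  qed (use val in auto)
qed

lemma stable_normal_orientation_bundle:
  fixes M :: "'a::euclidean_space set" and X :: "'a \<Rightarrow> 'a" and \<gamma> :: 'a and Fs :: "('a \<Rightarrow> 'a) list"
  defines "S \<equiv> stable_manifold M X \<gamma>" and "U \<equiv> tangent_space (unstable_manifold M X \<gamma>) \<gamma>"
  assumes F: "\<And>y. y \<in> S \<Longrightarrow> onframe (tangent_space M y) (tangent_space S y) (map (\<lambda>e. e y) Fs)"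
    and cont: "\<And>e. e \<in> set Fs \<Longrightarrow> continuous_on S e" and \<gamma>: "\<gamma> \<in> S"
    and \<omega>: "orientation_mod U {0} (\<omega> \<gamma> \<gamma>)"
    and compl: "U \<subseteq> tangent_space M \<gamma>" "subspace U" "subspace (tangent_space S \<gamma>)"
      "tangent_space M \<gamma> \<subseteq> {u + w |u w. u \<in> U \<and> w \<in> tangent_space S \<gamma>}" "U \<inter> tangent_space S \<gamma> \<subseteq> {0}"
  shows "bundle_orientation S (tangent_space M) (tangent_space S) (stable_normal_orientation M X \<omega> \<gamma>)"
proof -
  obtain s where s: "s \<in> {1, - 1}"
    "\<And>bs. basis_mod U {0} bs \<Longrightarrow> \<omega> \<gamma> \<gamma> bs = s * isgn (Determinant.det (cmat (map (\<lambda>e. e \<gamma>) Fs) bs))"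
  proof (rule complement_orientation[OF F[OF \<gamma>] \<omega> compl], goal_cases)
    case prems: (1 s)
    show ?case by (rule prems(1)[OF prems(2,3)])
  qed
  have "\<exists>\<nu>. bundle_orientation S (tangent_space M) (tangent_space S) \<nu> \<and>
      (\<forall>bs. basis_mod U {0} bs \<longrightarrow> \<nu> \<gamma> bs = \<omega> \<gamma> \<gamma> bs)"
  proof (intro exI conjI allI impI)
    show "bundle_orientation S (tangent_space M) (tangent_space S)
        (\<lambda>y bs. s * isgn (Determinant.det (cmat (map (\<lambda>e. e y) Fs) bs)))"
      by (rule bundle_orientation_exists[OF F cont s(1)])
  qed (use s(2) in simp)
  from someI_ex[OF this] show ?thesis
    unfolding stable_normal_orientation_def S_def U_def by blast
qed

lemma locally_constant_limit:
  fixes h :: "'a::metric_space \<Rightarrow> 'b" and u :: "real \<Rightarrow> 'a"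
  assumes u: "continuous_on UNIV u" "range u \<subseteq> T" "b \<in> T" "(u \<longlongrightarrow> b) F" "F \<noteq> bot"
    and h: "\<And>x. x \<in> T \<Longrightarrow> \<exists>U. open U \<and> x \<in> U \<and> (\<forall>y\<in>T \<inter> U. h y = h x)"
  shows "h (u t) = h b"
proof -
  have const: "h (u s) = h (u t)" for s t
  proof -
    have "\<forall>r\<in>UNIV. \<forall>\<^sub>F q in at r within UNIV. h (u r) = h (u q)"
    proof
      fix r
      obtain U where U: "open U" "u r \<in> U" "\<forall>y\<in>T \<inter> U. h y = h (u r)" using h[of "u r"] u(2) by blast
      have "(u \<longlongrightarrow> u r) (at r)" using u(1) by (simp add: continuous_on_def)
      then have "\<forall>\<^sub>F q in at r. u q \<in> U" using U(1,2) topological_tendstoD by blast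
      then show "\<forall>\<^sub>F q in at r within UNIV. h (u r) = h (u q)"
        by eventually_elim (use U(3) u(2) in force)
    qed
    from connected_local_const[OF connected_UNIV UNIV_I UNIV_I this] show ?thesis by metis
  qed
  obtain U where U: "open U" "b \<in> U" "\<forall>y\<in>T \<inter> U. h y = h b" using h[OF u(3)] by blast
  have "\<forall>\<^sub>F s in F. u s \<in> U" using topological_tendstoD[OF u(4) U(1,2)] .
  then obtain s where "u s \<in> U" using eventually_happens[of _ F] u(5) by blast
  then have "h (u s) = h b" using U(3) u(2) by blast
  then show ?thesis using const by metis
qed

lemma flow_line_count_zero:
  assumes uw: "u \<in> flow_lines M X \<xi> \<gamma>" "w' \<in> flow_lines M X \<xi> \<gamma>"
    and cases: "\<And>w. w \<in> flow_lines M X \<xi> \<gamma> \<Longrightarrow> (\<exists>s. w = (\<lambda>t. u (s + t))) \<or> (\<exists>s. w = (\<lambda>t. w' (s + t)))"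
    and shift: "\<And>s. (\<lambda>t. u (s + t)) \<in> flow_lines M X \<xi> \<gamma>" "\<And>s. (\<lambda>t. w' (s + t)) \<in> flow_lines M X \<xi> \<gamma>"
    and disj: "\<And>s t. u s \<noteq> w' t"
    and sign: "\<And>s. flow_line_sign M X \<omega> \<xi> \<gamma> (\<lambda>t. u (s + t)) = \<kappa>"
      "\<And>s. flow_line_sign M X \<omega> \<xi> \<gamma> (\<lambda>t. w' (s + t)) = - \<kappa>"
  shows "flow_line_count M X \<omega> \<xi> \<gamma> = 0"
proof -
  let ?L = "flow_lines M X \<xi> \<gamma>" and ?r = "time_translation (flow_lines M X \<xi> \<gamma>)"
  define C1 where "C1 = range (\<lambda>s t. u (s + t))"
  define C2 where "C2 = range (\<lambda>s t. w' (s + t))"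
  have im: "?r `` {\<lambda>t. v (s + t)} = range (\<lambda>s t. v (s + t))"
    if v: "\<And>s. (\<lambda>t. v (s + t)) \<in> ?L" for v s
  proof (intro equalityI subsetI)
    fix w assume "w \<in> ?r `` {\<lambda>t. v (s + t)}"
    then obtain r where "\<forall>t. w t = v (s + (t + r))" unfolding time_translation_def by auto
    then have "w = (\<lambda>t. v ((s + r) + t))" by (auto simp: algebra_simps)
    then show "w \<in> range (\<lambda>s t. v (s + t))" by blast
  next
    fix w assume "w \<in> range (\<lambda>s t. v (s + t))"
    then obtain r where w: "w = (\<lambda>t. v (r + t))" by blast
    then have "\<exists>q. \<forall>t. w t = v (s + (t + q))" by (intro exI[of _ "r - s"]) (simp add: algebra_simps)
    moreover have "w \<in> ?L" unfolding w by (rule v)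
    ultimately show "w \<in> ?r `` {\<lambda>t. v (s + t)}" unfolding time_translation_def using v by blast
  qed
  have i1: "?r `` {\<lambda>t. u (s + t)} = C1" and i2: "?r `` {\<lambda>t. w' (s + t)} = C2" for s
    unfolding C1_def C2_def using im[of u] im[of w'] shift by auto
  have "?L // ?r = {C1, C2}"
  proof (intro equalityI subsetI)
    fix C assume "C \<in> ?L // ?r"
    then obtain w where "w \<in> ?L" "C = ?r `` {w}" by (auto elim: quotientE)
    then show "C \<in> {C1, C2}" using cases[of w] i1 i2 by blast
  next
    fix C assume "C \<in> {C1, C2}"
    then show "C \<in> ?L // ?r" using quotientI[OF shift(1)[of 0], of ?r] quotientI[OF shift(2)[of 0], of ?r] i1[of 0] i2[of 0] by auto
  qed
  moreover have "C1 \<noteq> C2"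
  proof
    assume "C1 = C2"
    then obtain s where "(\<lambda>t. u (0 + t)) = (\<lambda>t. w' (s + t))" unfolding C1_def C2_def by blast
    from fun_cong[OF this, of 0] disj show False by simp
  qed
  moreover have "flow_line_sign M X \<omega> \<xi> \<gamma> ` C1 = {\<kappa>}" "flow_line_sign M X \<omega> \<xi> \<gamma> ` C2 = {- \<kappa>}"
    unfolding C1_def C2_def image_image using sign by auto
  ultimately show ?thesis unfolding flow_line_count_def by simp
qed

lemma det_cmat_append:
  assumes "length bs = length F" "length B = length A" "\<And>x y. x \<in> set A \<Longrightarrow> y \<in> set bs \<Longrightarrow> inner x y = 0"
  shows "Determinant.det (cmat (F @ A) (bs @ B)) = Determinant.det (cmat F bs) * Determinant.det (cmat A B)"
proof -
  let ?n = "length F" and ?m = "length A"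
  have "cmat (F @ A) (bs @ B) =
    four_block_mat (cmat F bs) (cmat F B) (0\<^sub>m ?m ?n) (cmat A B)"
    using assms by (intro eq_matI) (auto simp: cmat_def nth_append)
  then show ?thesis
    using det_four_block_mat_lower_left_zero[of "cmat F bs" ?n "cmat F B" ?m "0\<^sub>m ?m ?n" "cmat A B"]
      cmat_carrier[of F bs] cmat_carrier[of F B] cmat_carrier[of A B] assms(1,2) by simp
qed

lemma det_cmat_2:
  "Determinant.det (cmat [e1, e2] [f1, f2]) = inner e1 f1 * inner e2 f2 - inner e1 f2 * inner e2 f1"
proof -
  let ?m = "\<lambda>x. Matrix.mat 1 1 (\<lambda>_. x :: real)"
  have "cmat [e1, e2] [f1, f2] =
    four_block_mat (?m (inner e1 f1)) (?m (inner e1 f2)) (?m (inner e2 f1)) (?m (inner e2 f2))"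
    by (intro eq_matI) (auto simp: cmat_def less_Suc_eq)
  then have "Determinant.det (cmat [e1, e2] [f1, f2]) =
      Determinant.det (?m (inner e1 f1) * ?m (inner e2 f2) - ?m (inner e1 f2) * ?m (inner e2 f1))"
    by (simp only:) (rule det_four_block_mat, auto simp: scalar_prod_def intro!: eq_matI)
  also have "\<dots> = inner e1 f1 * inner e2 f2 - inner e1 f2 * inner e2 f1"
    by (subst det_single) (auto simp: scalar_prod_def)
  finally show ?thesis .
qed

lemma onframe_Times:
  assumes F1: "onframe V1 W1 F1" and F2: "onframe V2 W2 F2"
  shows "onframe (V1 \<times> V2) (W1 \<times> W2) (map (Pair 0) F2 @ map (\<lambda>a. (a, 0)) F1)"
proof -
  let ?n = "length F2"
  have s: "subspace V1" "subspace V2" using F1 F2 unfolding onframe_def by auto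
  have nth: "(map (Pair 0) F2 @ map (\<lambda>a. (a, 0)) F1) ! i =
      (if i < ?n then (0, F2 ! i) else (F1 ! (i - ?n), 0))" if "i < ?n + length F1" for i
    using that by (auto simp: nth_append)
  have mem: "v \<in> W1 \<longleftrightarrow> (\<forall>i<length F1. inner (F1 ! i) v = 0)" if "v \<in> V1" for v
    using F1 that unfolding onframe_def by blast
  have mem': "v \<in> W2 \<longleftrightarrow> (\<forall>i<length F2. inner (F2 ! i) v = 0)" if "v \<in> V2" for v
    using F2 that unfolding onframe_def by blast
  show ?thesis unfolding onframe_def
  proof (intro conjI allI impI ballI)
    show "subspace (V1 \<times> V2)" using s by (rule subspace_Times)
    show "set (map (Pair 0) F2 @ map (\<lambda>a. (a, 0)) F1) \<subseteq> V1 \<times> V2"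
      using F1 F2 s by (auto simp: onframe_def subspace_0)
  next
    fix i j assume "i < length (map (Pair 0) F2 @ map (\<lambda>a. (a, 0)) F1)" "j < length (map (Pair 0) F2 @ map (\<lambda>a. (a, 0)) F1)"
    then have ij: "i < ?n + length F1" "j < ?n + length F1" by auto
    have o1: "inner (F1 ! i) (F1 ! j) = (if i = j then 1 else 0)" if "i < length F1" "j < length F1" for i j
      using F1 that unfolding onframe_def by blast
    have o2: "inner (F2 ! i) (F2 ! j) = (if i = j then 1 else 0)" if "i < length F2" "j < length F2" for i j
      using F2 that unfolding onframe_def by blast
    show "inner ((map (Pair 0) F2 @ map (\<lambda>a. (a, 0)) F1) ! i) ((map (Pair 0) F2 @ map (\<lambda>a. (a, 0)) F1) ! j) =
        (if i = j then 1 else 0)"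
      using ij o1[of "i - ?n" "j - ?n"] o2[of i j] by (cases "i < ?n"; cases "j < ?n") (auto simp: nth)
  next
    fix v assume "v \<in> V1 \<times> V2"
    then obtain v1 v2 where v: "v = (v1, v2)" "v1 \<in> V1" "v2 \<in> V2" by blast
    have "(\<forall>i<?n + length F1. inner ((map (Pair 0) F2 @ map (\<lambda>a. (a, 0)) F1) ! i) v = 0) \<longleftrightarrow>
        (\<forall>i<?n. inner (F2 ! i) v2 = 0) \<and> (\<forall>i<length F1. inner (F1 ! i) v1 = 0)" (is "?L \<longleftrightarrow> ?R")
    proof
      assume L: ?L
      have "inner (F2 ! i) v2 = 0" if "i < ?n" for i
        using L[rule_format, of i] that by (simp add: nth v)
      moreover have "inner (F1 ! i) v1 = 0" if "i < length F1" for i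
        using L[rule_format, of "?n + i"] that by (simp add: nth v)
      ultimately show ?R by blast
    next
      assume ?R
      then show ?L by (auto simp: nth v)
    qed
    then show "v \<in> W1 \<times> W2 \<longleftrightarrow> (\<forall>i<length (map (Pair 0) F2 @ map (\<lambda>a. (a, 0)) F1).
        inner ((map (Pair 0) F2 @ map (\<lambda>a. (a, 0)) F1) ! i) v = 0)"
      using mem[OF v(2)] mem'[OF v(3)] v by auto
  qed
qed

section \<open>Products\<close>

lemma integral_curve_Times:
  "integral_curve (M1 \<times> M2) (\<lambda>(x, y). (X1 x, X2 y)) w \<longleftrightarrow>
    integral_curve M1 X1 (\<lambda>t. fst (w t)) \<and> integral_curve M2 X2 (\<lambda>t. snd (w t))"
proof
  assume w: "integral_curve (M1 \<times> M2) (\<lambda>(x, y). (X1 x, X2 y)) w"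
  have d: "(w has_vector_derivative (X1 (fst (w t)), X2 (snd (w t)))) (at t)" "w t \<in> M1 \<times> M2" for t
    using w unfolding integral_curve_def by (simp_all add: case_prod_beta)
  have "((\<lambda>t. fst (w t)) has_vector_derivative X1 (fst (w t))) (at t)"
    "((\<lambda>t. snd (w t)) has_vector_derivative X2 (snd (w t))) (at t)" for t
    using bounded_linear.has_vector_derivative[OF bounded_linear_fst d(1)[of t]]
      bounded_linear.has_vector_derivative[OF bounded_linear_snd d(1)[of t]] by simp_all
  moreover have "fst (w t) \<in> M1" "snd (w t) \<in> M2" for t using d(2)[of t] by auto
  ultimately show "integral_curve M1 X1 (\<lambda>t. fst (w t)) \<and> integral_curve M2 X2 (\<lambda>t. snd (w t))"
    unfolding integral_curve_def by blast
next
  assume w: "integral_curve M1 X1 (\<lambda>t. fst (w t)) \<and> integral_curve M2 X2 (\<lambda>t. snd (w t))"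
  then have "((\<lambda>t. (fst (w t), snd (w t))) has_vector_derivative (X1 (fst (w t)), X2 (snd (w t)))) (at t)" for t
    unfolding integral_curve_def by (intro has_vector_derivative_Pair) auto
  then show "integral_curve (M1 \<times> M2) (\<lambda>(x, y). (X1 x, X2 y)) w"
    using w unfolding integral_curve_def by (auto simp: case_prod_beta mem_Times_iff)
qed

lemma tendsto_Pair_iff:
  "(w \<longlongrightarrow> (a, b)) F \<longleftrightarrow> ((\<lambda>t. fst (w t)) \<longlongrightarrow> a) F \<and> ((\<lambda>t. snd (w t)) \<longlongrightarrow> b) F"
proof
  assume "(w \<longlongrightarrow> (a, b)) F"
  from tendsto_fst[OF this] tendsto_snd[OF this]
  show "((\<lambda>t. fst (w t)) \<longlongrightarrow> a) F \<and> ((\<lambda>t. snd (w t)) \<longlongrightarrow> b) F" by simp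
next
  assume "((\<lambda>t. fst (w t)) \<longlongrightarrow> a) F \<and> ((\<lambda>t. snd (w t)) \<longlongrightarrow> b) F"
  then show "(w \<longlongrightarrow> (a, b)) F" using tendsto_Pair[of "\<lambda>t. fst (w t)" a F "\<lambda>t. snd (w t)" b] by simp
qed

lemma unstable_manifold_Times:
  "unstable_manifold (M1 \<times> M2) (\<lambda>(x, y). (X1 x, X2 y)) (a, b) = unstable_manifold M1 X1 a \<times> unstable_manifold M2 X2 b"
proof (intro equalityI subsetI)
  fix p assume "p \<in> unstable_manifold M1 X1 a \<times> unstable_manifold M2 X2 b"
  then obtain u v where "integral_curve M1 X1 u" "integral_curve M2 X2 v" "u 0 = fst p" "v 0 = snd p"
    "(u \<longlongrightarrow> a) at_bot" "(v \<longlongrightarrow> b) at_bot" unfolding unstable_manifold_def by auto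
  then show "p \<in> unstable_manifold (M1 \<times> M2) (\<lambda>(x, y). (X1 x, X2 y)) (a, b)"
    unfolding unstable_manifold_def
    by (intro CollectI exI[of _ "\<lambda>t. (u t, v t)"]) (simp add: integral_curve_Times tendsto_Pair)
qed (auto simp: unstable_manifold_def integral_curve_Times tendsto_Pair_iff)

lemma stable_manifold_Times:
  "stable_manifold (M1 \<times> M2) (\<lambda>(x, y). (X1 x, X2 y)) (a, b) = stable_manifold M1 X1 a \<times> stable_manifold M2 X2 b"
proof -
  have "(\<lambda>p. - (case p of (x, y) \<Rightarrow> (X1 x, X2 y))) = (\<lambda>(x, y). (- X1 x, - X2 y))" by (auto simp: fun_eq_iff)
  then show ?thesis unfolding stable_manifold_reverse by (simp add: unstable_manifold_Times)
qed

lemma flow_lines_Times: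
  "w \<in> flow_lines (M1 \<times> M2) (\<lambda>(x, y). (X1 x, X2 y)) (a, b) (a', b') \<longleftrightarrow>
    (\<lambda>t. fst (w t)) \<in> flow_lines M1 X1 a a' \<and> (\<lambda>t. snd (w t)) \<in> flow_lines M2 X2 b b'"
  unfolding flow_lines_def by (auto simp: integral_curve_Times tendsto_Pair_iff)

definition lift_frame :: "('b \<Rightarrow> 'b) list \<Rightarrow> ('a \<Rightarrow> 'a) list \<Rightarrow> ('a::euclidean_space \<times> 'b::euclidean_space \<Rightarrow> 'a \<times> 'b) list"
  where "lift_frame Bs As = map (\<lambda>e p. (0, e (snd p))) Bs @ map (\<lambda>e p. (e (fst p), 0)) As"

lemma lift_frame_at:
  "map (\<lambda>e. e (x, y)) (lift_frame Bs As) = map (Pair 0) (map (\<lambda>e. e y) Bs) @ map (\<lambda>a. (a, 0)) (map (\<lambda>e. e x) As)"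
  by (simp add: lift_frame_def)

lemma lift_frame_continuous:
  assumes "\<And>e. e \<in> set Bs \<Longrightarrow> continuous_on T e" "\<And>e. e \<in> set As \<Longrightarrow> continuous_on S e" "e \<in> set (lift_frame Bs As)"
  shows "continuous_on (S \<times> T) e"
proof -
  from assms(3) consider g where "g \<in> set Bs" "e = (\<lambda>p. (0, g (snd p)))" | g where "g \<in> set As" "e = (\<lambda>p. (g (fst p), 0))"
    unfolding lift_frame_def by auto
  then show ?thesis
  proof cases
    case 1
    then show ?thesis using assms(1)[OF 1(1)]
      by (auto intro!: continuous_intros continuous_on_compose2[of T g])
  next
    case 2
    then show ?thesis using assms(2)[OF 2(1)]
      by (auto intro!: continuous_intros continuous_on_compose2[of S g])
  qed
qed

lemma cmat_Pair: "cmat (map (Pair 0) E) (map (Pair 0) L) = cmat E L"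
  by (intro eq_matI) (auto simp: cmat_def)

lemma cmat_Pair': "cmat (map (\<lambda>a. (a, 0)) E) (map (\<lambda>a. (a, 0)) L) = cmat E L"
  by (intro eq_matI) (auto simp: cmat_def)

lemma sums_Times:
  assumes "V1 \<subseteq> {u + w |u w. u \<in> U1 \<and> w \<in> W1}" "V2 \<subseteq> {u + w |u w. u \<in> U2 \<and> w \<in> W2}"
  shows "V1 \<times> V2 \<subseteq> {u + w |u w. u \<in> U1 \<times> U2 \<and> w \<in> W1 \<times> W2}"
proof
  fix p assume "p \<in> V1 \<times> V2"
  then have "fst p \<in> {u + w |u w. u \<in> U1 \<and> w \<in> W1}" "snd p \<in> {u + w |u w. u \<in> U2 \<and> w \<in> W2}"
    using assms by auto
  then obtain u1 w1 u2 w2 where "fst p = u1 + w1" "u1 \<in> U1" "w1 \<in> W1" "snd p = u2 + w2" "u2 \<in> U2" "w2 \<in> W2"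
    by blast
  then have "p = (u1, u2) + (w1, w2)" "(u1, u2) \<in> U1 \<times> U2" "(w1, w2) \<in> W1 \<times> W2" by (auto simp: prod_eq_iff)
  then show "p \<in> {u + w |u w. u \<in> U1 \<times> U2 \<and> w \<in> W1 \<times> W2}" by blast
qed

definition compl_in :: "'a::euclidean_space set \<Rightarrow> 'a set \<Rightarrow> 'a set \<Rightarrow> bool" where
  "compl_in V U W \<longleftrightarrow> subspace U \<and> subspace W \<and> U \<subseteq> V \<and> V \<subseteq> {u + w |u w. u \<in> U \<and> w \<in> W} \<and> U \<inter> W \<subseteq> {0}"

lemma product_count_zero:
  fixes M1 :: "'a::euclidean_space set" and M2 :: "'b::euclidean_space set"
    and X1 :: "'a \<Rightarrow> 'a" and X2 :: "'b \<Rightarrow> 'b" and a :: 'a and b b' :: 'b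
  defines "M \<equiv> M1 \<times> M2" and "X \<equiv> \<lambda>(x, y). (X1 x, X2 y)"
  defines "S1 \<equiv> stable_manifold M1 X1 a" and "U1 \<equiv> unstable_manifold M1 X1 a"
    and "S2 \<equiv> stable_manifold M2 X2 b'" and "U2 \<equiv> unstable_manifold M2 X2 b'" and "Ub \<equiv> unstable_manifold M2 X2 b"
  assumes \<omega>: "manifold_orientation (unstable_manifold M X (a, b)) (\<omega> (a, b))"
      "manifold_orientation (unstable_manifold M X (a, b')) (\<omega> (a, b'))"
    and a: "a \<in> M1" "X1 a = 0" "a \<in> S1" "a \<in> U1" "\<And>u. u \<in> flow_lines M1 X1 a a \<Longrightarrow> u = (\<lambda>_. a)"
    and As: "\<And>x. x \<in> S1 \<Longrightarrow> onframe (tangent_space M1 x) (tangent_space S1 x) (map (\<lambda>e. e x) As)"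
      "\<And>e. e \<in> set As \<Longrightarrow> continuous_on S1 e"
      "onframe (tangent_space U1 a) {0} (map (\<lambda>e. e a) As)"
    and compl1: "compl_in (tangent_space M1 a) (tangent_space U1 a) (tangent_space S1 a)"
    and b: "b \<in> Ub" "b' \<in> S2" "b' \<in> U2"
    and Bs: "\<And>y. y \<in> S2 \<Longrightarrow> onframe (tangent_space M2 y) (tangent_space S2 y) (map (\<lambda>e. e y) Bs)"
      "\<And>e. e \<in> set Bs \<Longrightarrow> continuous_on S2 e"
    and compl2: "compl_in (tangent_space M2 b') (tangent_space U2 b') (tangent_space S2 b')"
    and Es: "\<And>y. y \<in> Ub \<Longrightarrow> onframe (tangent_space Ub y) {0} (map (\<lambda>e. e y) Es)"
      "\<And>e. e \<in> set Es \<Longrightarrow> continuous_on Ub e"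
    and f: "\<And>y. y \<in> Ub \<inter> S2 \<Longrightarrow> onframe (tangent_space Ub y) {0} (f y # map (\<lambda>e. e y) Bs)"
      "\<And>y. y \<in> Ub \<inter> S2 \<Longrightarrow> Determinant.det (cmat (map (\<lambda>e. e y) Es) (f y # map (\<lambda>e. e y) Bs)) = 1"
    and u: "u1 \<in> flow_lines M2 X2 b b'" "u2 \<in> flow_lines M2 X2 b b'" "\<And>s t. u1 s \<noteq> u2 t"
      "\<And>w. w \<in> flow_lines M2 X2 b b' \<Longrightarrow> (\<exists>s. w = (\<lambda>t. u1 (s + t))) \<or> (\<exists>s. w = (\<lambda>t. u2 (s + t)))"
    and c: "\<And>t. c1 t < 0" "\<And>t. X2 (u1 t) = c1 t *\<^sub>R f (u1 t)" "\<And>t. c2 t > 0" "\<And>t. X2 (u2 t) = c2 t *\<^sub>R f (u2 t)"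
  shows "flow_line_count M X \<omega> (a, b) (a, b') = 0"
proof -
  have W: "unstable_manifold M X (a, b) = U1 \<times> Ub" "unstable_manifold M X (a, b') = U1 \<times> U2"
    "stable_manifold M X (a, b') = S1 \<times> S2"
    unfolding M_def X_def U1_def Ub_def U2_def S1_def S2_def
    by (rule unstable_manifold_Times stable_manifold_Times)+
  define \<nu> where "\<nu> = stable_normal_orientation M X \<omega> (a, b')"
  have zz: "{0} \<times> {0} = {0 :: 'a \<times> 'b}" by (auto simp: zero_prod_def)
  have \<nu>: "bundle_orientation (S1 \<times> S2) (tangent_space M) (tangent_space (S1 \<times> S2)) \<nu>"
    unfolding \<nu>_def W(3)[symmetric]
  proof (rule stable_normal_orientation_bundle[where Fs = "lift_frame Bs As"], unfold W)
    fix p assume "p \<in> S1 \<times> S2"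
    then obtain x y where p: "p = (x, y)" "x \<in> S1" "y \<in> S2" by blast
    show "onframe (tangent_space M p) (tangent_space (S1 \<times> S2) p) (map (\<lambda>e. e p) (lift_frame Bs As))"
      unfolding p M_def tangent_space_Times lift_frame_at using onframe_Times[OF As(1)[OF p(2)] Bs(1)[OF p(3)]] .
  next
    show "continuous_on (S1 \<times> S2) e" if "e \<in> set (lift_frame Bs As)" for e
      using lift_frame_continuous[OF Bs(2) As(2) that] .
    show "(a, b') \<in> S1 \<times> S2" using a b by blast
    show "orientation_mod (tangent_space (U1 \<times> U2) (a, b')) {0} (\<omega> (a, b') (a, b'))"
      using \<omega>(2) a b unfolding W manifold_orientation_def bundle_orientation_def by blast
    show "tangent_space (U1 \<times> U2) (a, b') \<subseteq> tangent_space M (a, b')"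
      "subspace (tangent_space (U1 \<times> U2) (a, b'))" "subspace (tangent_space (S1 \<times> S2) (a, b'))"
      "tangent_space (U1 \<times> U2) (a, b') \<inter> tangent_space (S1 \<times> S2) (a, b') \<subseteq> {0}"
      using compl1 compl2 unfolding M_def tangent_space_Times compl_in_def
      by (auto intro!: subspace_Times simp: zero_prod_def)
    show "tangent_space M (a, b') \<subseteq> {u + w |u w. u \<in> tangent_space (U1 \<times> U2) (a, b') \<and> w \<in> tangent_space (S1 \<times> S2) (a, b')}"
      unfolding M_def tangent_space_Times using compl1 compl2 unfolding compl_in_def by (intro sums_Times) blast+
  qed
  have uc: "integral_curve M2 X2 u1" "integral_curve M2 X2 u2" "(u1 \<longlongrightarrow> b) at_bot" "(u2 \<longlongrightarrow> b) at_bot"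
    "(u1 \<longlongrightarrow> b') at_top" "(u2 \<longlongrightarrow> b') at_top"
    using u(1,2) unfolding flow_lines_def by auto
  have in_US: "u1 t \<in> Ub" "u1 t \<in> S2" "u2 t \<in> Ub" "u2 t \<in> S2" for t
    unfolding Ub_def S2_def using unstable_manifoldI[OF uc(1,3)] unstable_manifoldI[OF uc(2,4)]
      stable_manifoldI[OF uc(1,5)] stable_manifoldI[OF uc(2,6)] by auto
  define k where "k p = \<nu> p (map (\<lambda>e. e p) (lift_frame Bs As))" for p
  define h where "h p = \<omega> (a, b) p (map (\<lambda>e. e p) (lift_frame Es As))" for p
  have kloc: "\<exists>U. open U \<and> p \<in> U \<and> (\<forall>q\<in>(S1 \<times> S2) \<inter> U. k q = k p)" if p: "p \<in> S1 \<times> S2" for p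
  proof -
    have "onframe (tangent_space M q) (tangent_space (S1 \<times> S2) q) (map (\<lambda>e. e q) (lift_frame Bs As))" if "q \<in> S1 \<times> S2" for q
    proof -
      obtain x y where q: "q = (x, y)" "x \<in> S1" "y \<in> S2" using \<open>q \<in> S1 \<times> S2\<close> by blast
      show ?thesis unfolding q M_def tangent_space_Times lift_frame_at using onframe_Times[OF As(1)[OF q(2)] Bs(1)[OF q(3)]] .
    qed
    note * = this
    have cont: "continuous_on (S1 \<times> S2) e" if "e \<in> set (lift_frame Bs As)" for e
      using lift_frame_continuous[OF Bs(2) As(2) that] .
    show ?thesis unfolding k_def
    proof (rule bundle_orientation_locally_constant[OF \<nu> subset_refl * cont p], goal_cases)
      case prems: (3 U)
      show ?case by (intro exI[of _ U] conjI ballI prems)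
    qed simp_all
  qed
  have Eframe: "onframe (tangent_space (U1 \<times> Ub) q) {0} (map (\<lambda>e. e q) (lift_frame Es As))" if qU: "q \<in> {a} \<times> Ub" for q
  proof -
    obtain y where q: "q = (a, y)" "y \<in> Ub" using qU by blast
    show ?thesis unfolding q tangent_space_Times lift_frame_at zz[symmetric] using onframe_Times[OF As(3) Es(1)[OF q(2)]] .
  qed
  have \<omega>b: "bundle_orientation (U1 \<times> Ub) (tangent_space (U1 \<times> Ub)) (\<lambda>_. {0}) (\<omega> (a, b))"
    using \<omega>(1) unfolding W manifold_orientation_def .
  have hloc: "\<exists>U. open U \<and> p \<in> U \<and> (\<forall>q\<in>({a} \<times> Ub) \<inter> U. h q = h p)" if p: "p \<in> {a} \<times> Ub" for p
  proof -
 have sub: "{a} \<times> Ub \<subseteq> U1 \<times> Ub" using a by blast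
    have cont: "continuous_on ({a} \<times> Ub) e" if "e \<in> set (lift_frame Es As)" for e
      by (rule lift_frame_continuous[OF Es(2) continuous_on_subset[OF As(2)] that]) (use a(3) in auto)
    show ?thesis unfolding h_def
    proof (rule bundle_orientation_locally_constant[OF \<omega>b sub Eframe cont p], goal_cases)
      case prems: (3 U)
      show ?case by (intro exI[of _ U] conjI ballI prems)
    qed simp_all
  qed
  have kconst: "k (a, v t) = k (a, b')" if v: "integral_curve M2 X2 v" "(v \<longlongrightarrow> b') at_top" for v t
  proof (rule locally_constant_limit[of "\<lambda>t. (a, v t)" "S1 \<times> S2" _ at_top])
    show "continuous_on UNIV (\<lambda>t. (a, v t))" by (intro continuous_intros integral_curve_continuous[OF v(1)])
    show "range (\<lambda>t. (a, v t)) \<subseteq> S1 \<times> S2" using a stable_manifoldI[OF v] unfolding S2_def by blast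
    show "((\<lambda>t. (a, v t)) \<longlongrightarrow> (a, b')) at_top" using v(2) by (intro tendsto_Pair tendsto_const)
  qed (use a b kloc in auto)
  have hconst: "h (a, v t) = h (a, b)" if v: "integral_curve M2 X2 v" "(v \<longlongrightarrow> b) at_bot" for v t
  proof (rule locally_constant_limit[of "\<lambda>t. (a, v t)" "{a} \<times> Ub" _ at_bot])
    show "continuous_on UNIV (\<lambda>t. (a, v t))" by (intro continuous_intros integral_curve_continuous[OF v(1)])
    show "range (\<lambda>t. (a, v t)) \<subseteq> {a} \<times> Ub" using unstable_manifoldI[OF v] unfolding Ub_def by blast
    show "((\<lambda>t. (a, v t)) \<longlongrightarrow> (a, b)) at_bot" using v(2) by (intro tendsto_Pair tendsto_const)
  qed (use b hloc in auto)
  have sign: "flow_line_sign M X \<omega> (a, b) (a, b') (\<lambda>t. (a, v (s + t))) = isgn c * (h (a, b) * k (a, b'))"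
    if v: "integral_curve M2 X2 v" "(v \<longlongrightarrow> b) at_bot" "(v \<longlongrightarrow> b') at_top"
      and c: "X2 (v s) = c *\<^sub>R f (v s)" "c \<noteq> 0" for v s c
  proof -
    let ?y = "v s" and ?p = "(a, v s)"
    let ?B = "map (\<lambda>e. e ?p) (lift_frame Bs As)" and ?E = "map (\<lambda>e. e ?p) (lift_frame Es As)"
    let ?A = "map (\<lambda>a. (a, 0 :: 'b)) (map (\<lambda>e. e a) As)"
    have y: "?y \<in> Ub" "?y \<in> S2" unfolding Ub_def S2_def using unstable_manifoldI[OF v(1,2)] stable_manifoldI[OF v(1,3)] by auto
    have X: "X ?p = c *\<^sub>R (0, f ?y)" unfolding X_def using a c by simp
    have F: "onframe (tangent_space M ?p) (tangent_space (S1 \<times> S2) ?p) ?B"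
      unfolding M_def tangent_space_Times lift_frame_at by (rule onframe_Times[OF As(1)[OF a(3)] Bs(1)[OF y(2)]])
    have fF: "onframe (tangent_space (U1 \<times> Ub) ?p) {0} ((0, f ?y) # ?B)"
      unfolding tangent_space_Times lift_frame_at zz[symmetric]
      using onframe_Times[OF As(3) f(1)[OF IntI[OF y]]] by simp
    have o1: "orientation_mod (tangent_space (U1 \<times> Ub) ?p) {0} (\<omega> (a, b) ?p)"
      using \<omega>b a y unfolding bundle_orientation_def by blast
    have o2: "orientation_mod (tangent_space M ?p) (tangent_space (S1 \<times> S2) ?p) (\<nu> ?p)"
      using \<nu> a y unfolding bundle_orientation_def by blast
    have "flow_line_sign M X \<omega> (a, b) (a, b') (\<lambda>t. (a, v (s + t))) =
        isgn c * \<omega> (a, b) ?p ((0, f ?y) # ?B) * k ?p"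
      using induced_orientation_eq[of M X "(a, b)" ?p \<omega> "(a, b')" ?B "(0, f ?y)" c,
          unfolded W, folded \<nu>_def, OF o1 o2 F fF c(2)]
      unfolding flow_line_sign_def k_def by (simp only: add_0_right X)
    moreover have "\<omega> (a, b) ?p ((0, f ?y) # ?B) = isgn (Determinant.det (cmat ?E ((0, f ?y) # ?B))) * h ?p"
      unfolding h_def
      by (rule onframe_orientation[OF Eframe o1 onframe_basis_mod[OF fF]]) (use y in simp)
    moreover have "Determinant.det (cmat ?E ((0, f ?y) # ?B)) = 1"
    proof -
      have len: "length (f ?y # map (\<lambda>e. e ?y) Bs) = length (map (\<lambda>e. e ?y) Es)"
        using onframe_basis_modD(1)[OF Es(1)[OF y(1)] onframe_basis_mod[OF f(1)[OF IntI[OF y]]]] .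
      have "(0, f ?y) # ?B = map (Pair (0::'a)) (f ?y # map (\<lambda>e. e ?y) Bs) @ ?A"
        unfolding lift_frame_at by simp
      moreover have "?E = map (Pair (0::'a)) (map (\<lambda>e. e ?y) Es) @ ?A" unfolding lift_frame_at by simp
      moreover have "Determinant.det (cmat (map (Pair (0::'a)) (map (\<lambda>e. e ?y) Es) @ ?A)
            (map (Pair (0::'a)) (f ?y # map (\<lambda>e. e ?y) Bs) @ ?A)) =
          Determinant.det (cmat (map (Pair (0::'a)) (map (\<lambda>e. e ?y) Es)) (map (Pair (0::'a)) (f ?y # map (\<lambda>e. e ?y) Bs))) *
          Determinant.det (cmat ?A ?A)"
        by (rule det_cmat_append) (use len in auto)
      ultimately have "Determinant.det (cmat ?E ((0, f ?y) # ?B)) =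
          Determinant.det (cmat (map (Pair (0::'a)) (map (\<lambda>e. e ?y) Es)) (map (Pair (0::'a)) (f ?y # map (\<lambda>e. e ?y) Bs))) *
          Determinant.det (cmat ?A ?A)"
        by (simp only:)
      also have "cmat ?A ?A = 1\<^sub>m (length As)"
        unfolding cmat_Pair' cmat_self[OF As(3)] by simp
      finally show ?thesis unfolding cmat_Pair f(2)[OF IntI[OF y]] by simp
    qed
    ultimately show ?thesis using kconst[OF v(1,3)] hconst[OF v(1,2)] by (simp add: isgn_1)
  qed
  have const: "(\<lambda>_. a) \<in> flow_lines M1 X1 a a"
    unfolding flow_lines_def using integral_curve_const[of a M1 X1] a by simp
  have shift: "(\<lambda>t. v (s + t)) \<in> flow_lines M2 X2 b b'" if "v \<in> flow_lines M2 X2 b b'" for v s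
  proof -
    have v: "integral_curve M2 X2 v" "(v \<longlongrightarrow> b) at_bot" "(v \<longlongrightarrow> b') at_top" using that unfolding flow_lines_def by auto
    have "((\<lambda>t. v (s + t)) \<longlongrightarrow> b') at_top"
      by (rule filterlim_compose[OF v(3)]) (rule filterlim_tendsto_add_at_top[OF tendsto_const filterlim_ident])
    moreover have "((\<lambda>t. v (s + t)) \<longlongrightarrow> b) at_bot"
      by (rule filterlim_compose[OF v(2)])
        (simp add: filterlim_tendsto_add_at_bot_iff[OF tendsto_const] filterlim_ident)
    ultimately show ?thesis using integral_curve_shift[OF v(1)] unfolding flow_lines_def by blast
  qed
  show ?thesis
  proof (rule flow_line_count_zero[where u = "\<lambda>t. (a, u1 t)" and w' = "\<lambda>t. (a, u2 t)" and \<kappa> = "- (h (a, b) * k (a, b'))"])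
    show "(\<lambda>t. (a, u1 t)) \<in> flow_lines M X (a, b) (a, b')" "(\<lambda>t. (a, u2 t)) \<in> flow_lines M X (a, b) (a, b')"
      "(\<lambda>t. (a, u1 (s + t))) \<in> flow_lines M X (a, b) (a, b')" "(\<lambda>t. (a, u2 (s + t))) \<in> flow_lines M X (a, b) (a, b')" for s
      unfolding M_def X_def flow_lines_Times using const u(1,2) shift by simp_all
    show "(a, u1 s) \<noteq> (a, u2 t)" for s t using u(3) by simp
    show "flow_line_sign M X \<omega> (a, b) (a, b') (\<lambda>t. (a, u1 (s + t))) = - (h (a, b) * k (a, b'))" for s
      using sign[OF uc(1,3,5) c(2)[of s]] c(1)[of s] by (simp add: isgn_def)
    show "flow_line_sign M X \<omega> (a, b) (a, b') (\<lambda>t. (a, u2 (s + t))) = - (- (h (a, b) * k (a, b')))" for s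
      using sign[OF uc(2,4,6) c(4)[of s]] c(3)[of s] by (simp add: isgn_def)
    fix w assume "w \<in> flow_lines M X (a, b) (a, b')"
    then have w: "(\<lambda>t. fst (w t)) \<in> flow_lines M1 X1 a a" "(\<lambda>t. snd (w t)) \<in> flow_lines M2 X2 b b'"
      unfolding M_def X_def flow_lines_Times by auto
    have "fst (w t) = a" for t using fun_cong[OF a(5)[OF w(1)]] .
    then have eq: "w = (\<lambda>t. (a, snd (w t)))" by (simp add: fun_eq_iff prod_eq_iff)
    from u(4)[OF w(2)] show "(\<exists>s. w = (\<lambda>t. (a, u1 (s + t)))) \<or> (\<exists>s. w = (\<lambda>t. (a, u2 (s + t))))"
    proof (elim disjE exE)
      fix s assume "(\<lambda>t. snd (w t)) = (\<lambda>t. u1 (s + t))"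
      from fun_cong[OF this] have "w = (\<lambda>t. (a, u1 (s + t)))" using eq by simp
      then show ?thesis by blast
    next
      fix s assume "(\<lambda>t. snd (w t)) = (\<lambda>t. u2 (s + t))"
      from fun_cong[OF this] have "w = (\<lambda>t. (a, u2 (s + t)))" using eq by simp
      then show ?thesis by blast
    qed
  qed
qed

section \<open>Flows on closed surfaces in space\<close>

lemma onframe_full: "subspace V \<Longrightarrow> onframe V V []"
  unfolding onframe_def by simp

lemma onframe_trivial: "onframe {0} {0} []"
  by (rule onframe_full) (simp add: subspace_def)

lemma onframe_single: "norm t = 1 \<Longrightarrow> onframe (span {t}) {0} [t]"
  unfolding onframe_def using span_base[of t "{t}"]
  by (auto simp: dot_square_norm) (auto simp: span_singleton dot_square_norm)

lemma orthonormal_frame_exists: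
  assumes "subspace (V :: 'a::euclidean_space set)"
  obtains A where "onframe V {0} A"
proof -
  obtain B where B: "B \<subseteq> V" "pairwise Linear_Algebra.orthogonal B" "\<And>x. x \<in> B \<Longrightarrow> norm x = 1" "independent B" "span B = V"
    by (rule orthonormal_basis_subspace[OF assms]) auto
  have "finite B" using B independent_imp_finite by blast
  then obtain A where A: "set A = B" "distinct A" using finite_distinct_list by blast
  have "inner (A ! i) (A ! j) = (if i = j then 1 else 0)" if ij: "i < length A" "j < length A" for i j
  proof (cases "i = j")
    case True
    then show ?thesis using B(3)[of "A ! i"] A ij by (auto simp: dot_square_norm)
  next
    case False
    then have "A ! i \<noteq> A ! j" using A(2) ij by (simp add: nth_eq_iff_index_eq)
    then show ?thesis using B(2) A(1) ij False unfolding pairwise_def Linear_Algebra.orthogonal_def by auto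
  qed
  moreover have "v = 0" if v: "v \<in> V" "\<forall>i<length A. inner (A ! i) v = 0" for v
  proof -
    have "Linear_Algebra.orthogonal v x" if "x \<in> B" for x
      using v(2) that A(1) by (auto simp: in_set_conv_nth Linear_Algebra.orthogonal_def inner_commute)
    then have "Linear_Algebra.orthogonal v v" using v(1) B(5) orthogonal_to_span by blast
    then show ?thesis by (simp add: Linear_Algebra.orthogonal_def)
  qed
  ultimately have "onframe V {0} A" unfolding onframe_def using assms A B(1) by auto
  then show thesis by (rule that)
qed

lemma orthogonal_complete:
  fixes n t v :: "real ^ 3"
  assumes "norm n = 1" "norm t = 1" "inner n t = 0" "inner n v = 0" "inner t v = 0" "inner (cross3 n t) v = 0"
  shows "v = 0"
proof -
  have "(norm (cross3 n t))\<^sup>2 = 1" using norm_cross_dot[of n t] assms by simp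
  then have w: "norm (cross3 n t) = 1" by (metis norm_ge_zero power2_eq_1_iff neg_0_le_iff_le not_one_le_zero)
  have "cross3 v (cross3 n t) = inner v t *\<^sub>R n - inner v n *\<^sub>R t" by (rule Lagrange)
  then have "cross3 v (cross3 n t) = 0" using assms by (simp add: inner_commute)
  then have "(norm v)\<^sup>2 = 0" using norm_cross_dot[of v "cross3 n t"] w assms(6) by (simp add: inner_commute)
  then show ?thesis by simp
qed

lemma plane_frame:
  fixes n t :: "real ^ 3"
  assumes nt: "norm n = 1" "norm t = 1" "inner n t = 0"
  shows "onframe {v. inner n v = 0} (span {t}) [cross3 n t]" "onframe {v. inner n v = 0} {0} [t, cross3 n t]"
    "inner n v = 0 \<Longrightarrow> v = inner v t *\<^sub>R t + inner v (cross3 n t) *\<^sub>R cross3 n t"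
proof -
  have "(norm (cross3 n t))\<^sup>2 = 1" using norm_cross_dot[of n t] nt by simp
  then have w: "inner (cross3 n t) (cross3 n t) = 1" by (simp add: power2_norm_eq_inner)
  have o: "inner n (cross3 n t) = 0" "inner t (cross3 n t) = 0" "inner (cross3 n t) t = 0" by (simp_all add: dot_cross_self)
  have t: "inner t t = 1" using nt(2) by (simp add: dot_square_norm)
  have sub: "subspace {v. inner n v = 0}" by (simp add: subspace_hyperplane)
  show ex: "v = inner v t *\<^sub>R t + inner v (cross3 n t) *\<^sub>R cross3 n t" if "inner n v = 0" for v
  proof -
    have "v - (inner v t *\<^sub>R t + inner v (cross3 n t) *\<^sub>R cross3 n t) = 0"
      by (rule orthogonal_complete[OF nt])
        (use that nt o w t in \<open>simp_all add: inner_diff_right inner_add_right inner_commute\<close>)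
    then show ?thesis by simp
  qed
  show "onframe {v. inner n v = 0} {0} [t, cross3 n t]"
    unfolding onframe_def using sub nt o w t orthogonal_complete[OF nt]
    by (auto simp: less_Suc_eq)
  show "onframe {v. inner n v = 0} (span {t}) [cross3 n t]"
    unfolding onframe_def
  proof (intro conjI ballI)
    fix v assume v: "v \<in> {v. inner n v = 0}"
    show "v \<in> span {t} \<longleftrightarrow> (\<forall>i<length [cross3 n t]. inner ([cross3 n t] ! i) v = 0)"
    proof
      assume "v \<in> span {t}"
      then show "\<forall>i<length [cross3 n t]. inner ([cross3 n t] ! i) v = 0"
        using o by (auto simp: span_singleton)
    next
      assume "\<forall>i<length [cross3 n t]. inner ([cross3 n t] ! i) v = 0"
      then have "v = inner v t *\<^sub>R t" using ex[of v] v by (simp add: inner_commute)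
      then show "v \<in> span {t}" by (metis span_scale span_base singletonI)
    qed
  qed (use sub o w in auto)
qed

lemma plane_dim:
  fixes n :: "real ^ 3"
  assumes "norm n = 1"
  shows "dim {v. inner n v = 0} = 2"
proof -
  have "n \<noteq> 0" using assms by auto
  from dim_hyperplane[OF this] show ?thesis by simp
qed

lemma plane_det:
  fixes n t e :: "real ^ 3"
  assumes "norm n = 1" "norm t = 1" "inner n t = 0" "norm e = 1" "inner n e = 0"
  shows "Determinant.det (cmat [e, cross3 n e] [t, cross3 n t]) = 1"
proof -
  have "(inner e t)\<^sup>2 + (inner e (cross3 n t))\<^sup>2 = inner e (inner e t *\<^sub>R t + inner e (cross3 n t) *\<^sub>R cross3 n t)"
    by (simp add: inner_add_right power2_eq_square)
  also have "\<dots> = 1" using plane_frame(3)[OF assms(1-3,5)] assms(4) by (metis dot_square_norm one_power2)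
  finally have 1: "(inner e t)\<^sup>2 + (inner e (cross3 n t))\<^sup>2 = 1" .
  have "inner (cross3 n e) (cross3 n t) = inner n n * inner e t - inner n t * inner e n"
    by (simp add: dot_cross)
  then have 2: "inner (cross3 n e) (cross3 n t) = inner e t" using assms by (simp add: dot_square_norm)
  have 3: "inner (cross3 n e) t = - inner e (cross3 n t)"
    by (simp add: cross3_simps)
  show ?thesis unfolding det_cmat_2 2 3 using 1 by (simp add: power2_eq_square)
qed

locale surface_flow = gradient_flow M f f' X for M :: "(real ^ 3) set" and f f' X +
  fixes N :: "real ^ 3 \<Rightarrow> real ^ 3"
  assumes normal_continuous: "continuous_on M N"
    and normal_unit: "\<And>x. x \<in> M \<Longrightarrow> norm (N x) = 1"
    and tangent_plane: "\<And>x. x \<in> M \<Longrightarrow> tangent_space M x = {v. inner (N x) v = 0}"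
    and smale: "\<And>a b x. a \<in> M \<Longrightarrow> X a = 0 \<Longrightarrow> b \<in> M \<Longrightarrow> X b = 0 \<Longrightarrow>
      x \<in> unstable_manifold M X a \<Longrightarrow> x \<in> stable_manifold M X b \<Longrightarrow>
      tangent_space M x \<subseteq> {v + w |v w. v \<in> tangent_space (unstable_manifold M X a) x \<and>
                     w \<in> tangent_space (stable_manifold M X b) x}"
begin

lemma reverse_surface: "surface_flow M (\<lambda>x. - f x) (\<lambda>x. - f' x) (\<lambda>x. - X x) N"
proof (rule surface_flow.intro[OF reverse_flow], unfold_locales)
  fix a b x assume "a \<in> M" "- X a = 0" "b \<in> M" "- X b = 0"
    "x \<in> unstable_manifold M (\<lambda>x. - X x) a" "x \<in> stable_manifold M (\<lambda>x. - X x) b"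
  then have "tangent_space M x \<subseteq> {v + w |v w. v \<in> tangent_space (unstable_manifold M X b) x \<and>
                     w \<in> tangent_space (stable_manifold M X a) x}"
    by (intro smale) (simp_all flip: stable_manifold_reverse unstable_manifold_reverse)
  also have "\<dots> \<subseteq> {v + w |v w. v \<in> tangent_space (stable_manifold M X a) x \<and>
                     w \<in> tangent_space (unstable_manifold M X b) x}"
    by (auto intro: add.commute)
  finally show "tangent_space M x \<subseteq> {v + w |v w. v \<in> tangent_space (unstable_manifold M (\<lambda>x. - X x) a) x \<and>
                     w \<in> tangent_space (stable_manifold M (\<lambda>x. - X x) b) x}"
    by (simp flip: stable_manifold_reverse unstable_manifold_reverse)
qed (fact normal_continuous normal_unit tangent_plane)+

lemma tangent_subspace: "x \<in> M \<Longrightarrow> subspace (tangent_space M x)"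
  by (simp add: tangent_plane subspace_hyperplane)

lemma tangent_dim: "x \<in> M \<Longrightarrow> dim (tangent_space M x) = 2"
  by (simp add: tangent_plane plane_dim normal_unit)

definition crit where "crit = {x \<in> M. X x = 0}"

lemma crit_chart:
  assumes "a \<in> crit"
  obtains V Em Ep \<psi> U \<phi> where "gradient_chart M f f' X a V Em Ep \<psi> U \<phi>" "dim Em = morse_index M f a" "dim Em + dim Ep = 2"
proof -
  obtain V :: "(real ^ 3) set" and Em Ep \<psi> U \<phi> where c: "flow_chart M f X a V Em Ep \<psi> U \<phi>"
    using chart_exists[of a] assms unfolding crit_def by blast
  interpret flow_chart M f X a V Em Ep \<psi> U \<phi> by fact
  show thesis
  proof (rule that[of V Em Ep \<psi> U \<phi>])
    show "gradient_chart M f f' X a V Em Ep \<psi> U \<phi>" by (rule gradient_chart.intro[OF gradient_flow_axioms c])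
    show "dim Em = morse_index M f a" using morse_index_eq by simp
    show "dim Em + dim Ep = 2"
      using dim_tangent[OF zero(1) subspace_0[OF subspace_E]] tangent_dim[OF a_in(2)] by (simp add: zero)
  qed
qed

lemma flow_lines_self: "u \<in> flow_lines M X a a \<Longrightarrow> u = (\<lambda>_. a)"
proof -
  assume "u \<in> flow_lines M X a a"
  then have u: "integral_curve M X u" "(u \<longlongrightarrow> a) at_bot" "(u \<longlongrightarrow> a) at_top" unfolding flow_lines_def by auto
  have "X (u 0) = 0"
  proof (rule ccontr)
    assume "X (u 0) \<noteq> 0"
    then have "f a < f (u 0)" using f_limit_less[OF u(1,3)] by blast
    moreover have "- f a < - f (u 0)"
      using gradient_flow.f_limit_less[OF reverse_flow integral_curve_reverse[OF u(1)], of a 0 0] u(2) \<open>X (u 0) \<noteq> 0\<close>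
      by (simp add: filterlim_at_bot_mirror)
    ultimately show False by simp
  qed
  then have eq: "u t = u 0" for t by (rule zero_curve_const[OF u(1)])
  have "(u \<longlongrightarrow> u 0) at_top" by (intro tendsto_eventually always_eventually allI) (rule eq)
  from tendsto_unique[OF _ this u(3)] have "u 0 = a" by simp
  then show ?thesis using eq by (intro ext) metis
qed

lemma index_le_2:
  assumes "a \<in> crit"
  shows "morse_index M f a \<le> 2"
proof -
  obtain V Em Ep \<psi> U \<phi> where "gradient_chart M f f' X a V Em Ep \<psi> U \<phi>" "dim Em = morse_index M f a" "dim Em + dim Ep = 2"
    by (rule crit_chart[OF assms])
  then show ?thesis by simp
qed

lemma reverse_index:
  assumes "a \<in> crit"
  shows "morse_index M (\<lambda>x. - f x) a = 2 - morse_index M f a"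
proof -
  obtain V Em Ep \<psi> U \<phi> where c: "gradient_chart M f f' X a V Em Ep \<psi> U \<phi>" "dim Em = morse_index M f a" "dim Em + dim Ep = 2"
    by (rule crit_chart[OF assms])
  interpret R: gradient_chart M "\<lambda>x. - f x" "\<lambda>x. - f' x" "\<lambda>x. - X x" a V Ep Em \<psi> U \<phi>
    by (rule gradient_chart.reverse_chart[OF c(1)])
  show ?thesis using R.morse_index_eq c by simp
qed

lemma reverse_crit: "surface_flow.crit M (\<lambda>x. - X x) = crit"
  unfolding surface_flow.crit_def[OF reverse_surface] crit_def by simp

lemma index_2_stable:
  assumes "a \<in> crit" "morse_index M f a = 2"
  shows "stable_manifold M X a = {a}" "integral_curve M X u \<Longrightarrow> (u \<longlongrightarrow> a) at_top \<Longrightarrow> u t = a"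
proof -
  obtain V Em Ep \<psi> U \<phi> where c: "gradient_chart M f f' X a V Em Ep \<psi> U \<phi>" "dim Em = morse_index M f a" "dim Em + dim Ep = 2"
    by (rule crit_chart[OF assms(1)])
  interpret gradient_chart M f f' X a V Em Ep \<psi> U \<phi> by fact
  have "Ep = {0}" using c assms(2) sub(2) by (simp add: dim_eq_0 subset_singleton_iff) (metis empty_iff subspace_0)
  then show "stable_manifold M X a = {a}" "integral_curve M X u \<Longrightarrow> (u \<longlongrightarrow> a) at_top \<Longrightarrow> u t = a"
    using stable_manifold_trivial stable_trivial by blast+
qed

lemma index_0_stable:
  assumes "a \<in> crit" "morse_index M f a = 0" "x \<in> stable_manifold M X a"
  shows "tangent_space (stable_manifold M X a) x = tangent_space M x"
proof -
  obtain V Em Ep \<psi> U \<phi> where c: "gradient_chart M f f' X a V Em Ep \<psi> U \<phi>" "dim Em = morse_index M f a" "dim Em + dim Ep = 2"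
    by (rule crit_chart[OF assms(1)])
  interpret gradient_chart M f f' X a V Em Ep \<psi> U \<phi> by fact
  have "Em = {0}" using c assms(2) sub(1) by (simp add: dim_eq_0 subset_singleton_iff) (metis empty_iff subspace_0)
  then show ?thesis using tangent_space_stable_open assms(3) by blast
qed

lemma crit_in_stable: "a \<in> crit \<Longrightarrow> a \<in> stable_manifold M X a"
proof -
  assume "a \<in> crit"
  then have "integral_curve M X (\<lambda>_. a)" unfolding crit_def by (intro integral_curve_const) auto
  from stable_manifoldI[OF this tendsto_const] show ?thesis .
qed

lemma crit_in_unstable: "a \<in> crit \<Longrightarrow> a \<in> unstable_manifold M X a"
  using surface_flow.crit_in_stable[OF reverse_surface] reverse_crit by (simp add: unstable_manifold_reverse)

lemma index_0_unstable:
  assumes "a \<in> crit" "morse_index M f a = 0"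
  shows "unstable_manifold M X a = {a}" "integral_curve M X u \<Longrightarrow> (u \<longlongrightarrow> a) at_bot \<Longrightarrow> u t = a"
proof -
  have a: "a \<in> surface_flow.crit M (\<lambda>x. - X x)" "morse_index M (\<lambda>x. - f x) a = 2"
    using assms reverse_crit reverse_index by auto
  show "unstable_manifold M X a = {a}"
    using surface_flow.index_2_stable(1)[OF reverse_surface a] by (simp add: unstable_manifold_reverse)
  show "u t = a" if "integral_curve M X u" "(u \<longlongrightarrow> a) at_bot"
    using surface_flow.index_2_stable(2)[OF reverse_surface a integral_curve_reverse[OF that(1)], of "- t"] that(2)
    by (simp add: filterlim_at_bot_mirror)
qed

lemma index_2_unstable:
  assumes "a \<in> crit" "morse_index M f a = 2" "x \<in> unstable_manifold M X a"
  shows "tangent_space (unstable_manifold M X a) x = tangent_space M x"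
  using surface_flow.index_0_stable[OF reverse_surface, of a x] assms reverse_crit reverse_index
  by (simp add: unstable_manifold_reverse)

lemma index_1_stable:
  assumes "a \<in> crit" "morse_index M f a = 1"
  obtains u v \<tau> where
    "integral_curve M X u" "(u \<longlongrightarrow> a) at_top" "\<And>t. X (u t) \<noteq> 0" "integral_curve M X v" "(v \<longlongrightarrow> a) at_top" "\<And>t. X (v t) \<noteq> 0"
    "\<And>s t. u s \<noteq> v t"
    "\<And>w. integral_curve M X w \<Longrightarrow> (w \<longlongrightarrow> a) at_top \<Longrightarrow>
      (\<forall>t. w t = a) \<or> (\<exists>s. \<forall>t. w t = u (s + t)) \<or> (\<exists>s. \<forall>t. w t = v (s + t))"
    "continuous_on (stable_manifold M X a) \<tau>" "\<And>y. y \<in> stable_manifold M X a \<Longrightarrow> norm (\<tau> y) = 1"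
    "\<And>y. y \<in> stable_manifold M X a \<Longrightarrow> tangent_space (stable_manifold M X a) y = span {\<tau> y}"
    "\<And>t. X (u t) = - norm (X (u t)) *\<^sub>R \<tau> (u t)" "\<And>t. X (v t) = norm (X (v t)) *\<^sub>R \<tau> (v t)"
proof -
  obtain V Em Ep \<psi> U \<phi> where c: "gradient_chart M f f' X a V Em Ep \<psi> U \<phi>" "dim Em = morse_index M f a" "dim Em + dim Ep = 2"
    by (rule crit_chart[OF assms(1)])
  interpret gradient_chart M f f' X a V Em Ep \<psi> U \<phi> by fact
  have "dim Ep = 1" using c assms(2) by simp
  then obtain e where "stable_branch M f f' X a V Em Ep \<psi> U \<phi> e" by (rule stable_branch_exists)
  then interpret stable_branch M f f' X a V Em Ep \<psi> U \<phi> e .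
  show thesis
    by (rule that[OF curve_up up_limit X_up curve_um um_limit X_um up_neq_um convergent_curve_cases
          continuous_tang norm_tang tangent_stable X_tang_up X_tang_um])
qed

lemma index_1_tangent:
  assumes "a \<in> crit" "morse_index M f a = 1" "integral_curve M X w" "(w \<longlongrightarrow> a) at_top" "X (w t) \<noteq> 0"
  shows "tangent_space (stable_manifold M X a) (w t) = span {X (w t)}"
proof -
  obtain u v \<tau> where
    "\<And>w. integral_curve M X w \<Longrightarrow> (w \<longlongrightarrow> a) at_top \<Longrightarrow>
      (\<forall>t. w t = a) \<or> (\<exists>s. \<forall>t. w t = u (s + t)) \<or> (\<exists>s. \<forall>t. w t = v (s + t))"
    and \<tau>: "\<And>y. y \<in> stable_manifold M X a \<Longrightarrow> tangent_space (stable_manifold M X a) y = span {\<tau> y}"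
    "\<And>t. X (u t) = - norm (X (u t)) *\<^sub>R \<tau> (u t)" "\<And>t. X (v t) = norm (X (v t)) *\<^sub>R \<tau> (v t)"
  proof (rule index_1_stable[OF assms(1,2)], goal_cases)
    case prems: (1 u v \<tau>)
    show ?case by (rule prems(1)[OF prems(9,12,13,14)])
  qed
  then have "(\<forall>t. w t = a) \<or> (\<exists>s. \<forall>t. w t = u (s + t)) \<or> (\<exists>s. \<forall>t. w t = v (s + t))" using assms(3,4) by blast
  moreover have "X a = 0" using assms(1) by (simp add: crit_def)
  ultimately have "\<exists>c. X (w t) = c *\<^sub>R \<tau> (w t)"
  proof (elim disjE exE)
    assume "\<forall>t. w t = a"
    then show ?thesis using assms(5) \<open>X a = 0\<close> by simp
  next
    fix r assume "\<forall>t. w t = u (r + t)"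
    then show ?thesis using \<tau>(2)[of "r + t"] by metis
  next
    fix r assume "\<forall>t. w t = v (r + t)"
    then show ?thesis using \<tau>(3)[of "r + t"] by metis
  qed
  then obtain c where c: "X (w t) = c *\<^sub>R \<tau> (w t)" "c \<noteq> 0" using assms(5) by auto
  have "span {X (w t)} = span {\<tau> (w t)}"
  proof (rule span_eq[THEN iffD2])
    have "inverse c *\<^sub>R X (w t) \<in> span {X (w t)}" by (intro span_scale span_base) simp
    then show "{X (w t)} \<subseteq> span {\<tau> (w t)} \<and> {\<tau> (w t)} \<subseteq> span {X (w t)}"
      using c by (simp add: span_scale span_base)
  qed
  then show ?thesis using \<tau>(1)[OF stable_manifoldI[OF assms(3,4)]] by simp
qed

lemma saddle_backward_limit:
  assumes s: "s \<in> crit" "morse_index M f s = 1" and u: "integral_curve M X u" "(u \<longlongrightarrow> s) at_top" "X (u 0) \<noteq> 0"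
  obtains b where "b \<in> crit" "morse_index M f b = 2" "(u \<longlongrightarrow> b) at_bot"
proof -
  interpret R: surface_flow M "\<lambda>x. - f x" "\<lambda>x. - f' x" "\<lambda>x. - X x" N by (rule reverse_surface)
  note r = integral_curve_reverse[OF u(1)]
  obtain b where b: "((\<lambda>t. u (- t)) \<longlongrightarrow> b) at_top" "b \<in> M" "- X b = 0" by (rule R.curve_converges[OF r])
  then have bc: "b \<in> crit" "(u \<longlongrightarrow> b) at_bot" by (auto simp: crit_def filterlim_at_bot_mirror)
  have "morse_index M f b \<noteq> 0"
  proof
    assume "morse_index M f b = 0"
    then have "u 0 = b" using index_0_unstable(2)[OF bc(1) _ u(1) bc(2)] by blast
    then show False using u(3) b by simp
  qed
  moreover have "morse_index M f b \<noteq> 1"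
  proof
    assume b1: "morse_index M f b = 1"
    have "tangent_space (stable_manifold M (\<lambda>x. - X x) b) (u (- 0)) = span {- X (u (- 0))}"
      by (rule R.index_1_tangent[OF _ _ r b(1)]) (use bc b1 reverse_crit reverse_index u(3) in auto)
    then have 1: "tangent_space (unstable_manifold M X b) (u 0) = span {- X (u 0)}"
      by (simp add: unstable_manifold_reverse)
    have 2: "tangent_space (stable_manifold M X s) (u 0) = span {X (u 0)}"
      by (rule index_1_tangent[OF s u])
    have "tangent_space M (u 0) \<subseteq> {v + w |v w. v \<in> span {- X (u 0)} \<and> w \<in> span {X (u 0)}}"
      using smale[of b s "u 0"] bc s unfolding 1 2 crit_def
      using unstable_manifoldI[OF u(1) bc(2)] stable_manifoldI[OF u(1,2)] by blast
    also have "\<dots> \<subseteq> span {X (u 0)}"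
    proof -
      have "span {- X (u 0)} \<subseteq> span {X (u 0)}" by (intro span_minimal) (auto intro: span_neg span_base)
      then show ?thesis by (auto intro: span_add)
    qed
    finally have "dim (tangent_space M (u 0)) \<le> dim (span {X (u 0)})" by (rule dim_subset)
    also have "\<dots> \<le> 1" using dim_le_card[of "{X (u 0)}" "{X (u 0)}"] by (simp add: span_superset)
    finally show False using tangent_dim[OF integral_curve_in[OF u(1)]] by simp
  qed
  ultimately have "morse_index M f b = 2" using index_le_2[OF bc(1)] by linarith
  then show thesis using that bc by blast
qed

lemma saddle_complement:
  assumes "s \<in> crit" "morse_index M f s = 1"
  shows "compl_in (tangent_space M s) (tangent_space (unstable_manifold M X s) s) (tangent_space (stable_manifold M X s) s)"
proof -
  obtain V Em Ep \<psi> U \<phi> where c: "gradient_chart M f f' X s V Em Ep \<psi> U \<phi>" "dim Em = morse_index M f s" "dim Em + dim Ep = 2"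
    by (rule crit_chart[OF assms(1)])
  interpret gradient_chart M f f' X s V Em Ep \<psi> U \<phi> by fact
  interpret R: gradient_chart M "\<lambda>x. - f x" "\<lambda>x. - f' x" "\<lambda>x. - X x" s V Ep Em \<psi> U \<phi> by (rule reverse_chart)
  have lin: "linear (D 0)" and inj: "inj (D 0)" using linear_D inj_D zero by auto
  have sp: "D 0 ` span {e} = span {D 0 e}" for e using linear_span_image[OF lin, of "{e}"] by simp
  have "dim Ep = 1" "dim Em = 1" using c assms(2) by auto
  obtain e where e: "stable_branch M f f' X s V Em Ep \<psi> U \<phi> e" by (rule stable_branch_exists[OF \<open>dim Ep = 1\<close>])
  obtain e' where e': "stable_branch M (\<lambda>x. - f x) (\<lambda>x. - f' x) (\<lambda>x. - X x) s V Ep Em \<psi> U \<phi> e'"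
    by (rule R.stable_branch_exists[OF \<open>dim Em = 1\<close>])
  have W: "tangent_space (stable_manifold M X s) s = D 0 ` Ep"
    using stable_branch.tangent_a[OF e] stable_branch.Ep_span[OF e] sp by simp
  have Uu: "tangent_space (unstable_manifold M X s) s = D 0 ` Em"
    using stable_branch.tangent_a[OF e'] stable_branch.Ep_span[OF e'] sp by (simp add: unstable_manifold_reverse)
  have T: "tangent_space M s = D 0 ` E"
    using tangent_eq[OF zero(1) subspace_0[OF subspace_E]] zero by simp
  show ?thesis unfolding compl_in_def W Uu T
  proof (intro conjI)
    show "subspace (D 0 ` Em)" "subspace (D 0 ` Ep)" using sub lin by (auto intro: linear_subspace_image)
    show "D 0 ` Em \<subseteq> D 0 ` E" using Em_sub by blast
    show "D 0 ` E \<subseteq> {u + w |u w. u \<in> D 0 ` Em \<and> w \<in> D 0 ` Ep}"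
    proof
      fix z assume "z \<in> D 0 ` E"
      then obtain p q where "z = D 0 (p + q)" "p \<in> Em" "q \<in> Ep" unfolding E_def by blast
      then show "z \<in> {u + w |u w. u \<in> D 0 ` Em \<and> w \<in> D 0 ` Ep}" using linear_add[OF lin] by blast
    qed
    show "D 0 ` Em \<inter> D 0 ` Ep \<subseteq> {0}"
    proof
      fix z assume "z \<in> D 0 ` Em \<inter> D 0 ` Ep"
      then obtain p q where pq: "z = D 0 p" "p \<in> Em" "z = D 0 q" "q \<in> Ep" by blast
      then have "p = q" using injD[OF inj] by simp
      then have "inner p p = 0" using orth pq by blast
      then show "z \<in> {0}" using pq linear_0[OF lin] by simp
    qed
  qed
qed

lemma extremum_frame:
  assumes a: "a \<in> crit" "morse_index M f a = 0 \<or> morse_index M f a = 2"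
  obtains As where
    "\<And>x. x \<in> stable_manifold M X a \<Longrightarrow> onframe (tangent_space M x) (tangent_space (stable_manifold M X a) x) (map (\<lambda>e. e x) As)"
    "\<And>e. e \<in> set As \<Longrightarrow> continuous_on (stable_manifold M X a) e"
    "onframe (tangent_space (unstable_manifold M X a) a) {0} (map (\<lambda>e. e a) As)"
    "compl_in (tangent_space M a) (tangent_space (unstable_manifold M X a) a) (tangent_space (stable_manifold M X a) a)"
proof -
  have aM: "a \<in> M" using a by (simp add: crit_def)
  have s0: "subspace {0 :: real ^ 3}" by (simp add: subspace_def)
  show thesis
  proof (cases "morse_index M f a = 0")
    case True
    note S = index_0_stable[OF a(1) True] and U = index_0_unstable(1)[OF a(1) True]
    have SM: "stable_manifold M X a \<subseteq> M" unfolding stable_manifold_def using integral_curve_in by blast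
    show ?thesis
    proof (rule that[of "[]"])
      show "compl_in (tangent_space M a) (tangent_space (unstable_manifold M X a) a) (tangent_space (stable_manifold M X a) a)"
        unfolding U tangent_space_singleton S[OF crit_in_stable[OF a(1)]] compl_in_def
        using s0 tangent_subspace[OF aM] subspace_0[OF tangent_subspace[OF aM]] by auto
      show "onframe (tangent_space (unstable_manifold M X a) a) {0} (map (\<lambda>e. e a) [])"
        unfolding U tangent_space_singleton by (simp add: onframe_trivial)
      fix x assume x: "x \<in> stable_manifold M X a"
      show "onframe (tangent_space M x) (tangent_space (stable_manifold M X a) x) (map (\<lambda>e. e x) [])"
        unfolding S[OF x] using onframe_full tangent_subspace x SM by auto
    qed simp
  next
    case False
    then have 2: "morse_index M f a = 2" using a(2) by simp
    note S = index_2_stable(1)[OF a(1) 2] and U = index_2_unstable[OF a(1) 2 crit_in_unstable[OF a(1)]]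
    obtain A where A: "onframe (tangent_space M a) {0} A" by (rule orthonormal_frame_exists[OF tangent_subspace[OF aM]])
    show ?thesis
    proof (rule that[of "map (\<lambda>v _. v) A"])
      show "compl_in (tangent_space M a) (tangent_space (unstable_manifold M X a) a) (tangent_space (stable_manifold M X a) a)"
        unfolding U S tangent_space_singleton compl_in_def
        using s0 tangent_subspace[OF aM] by auto
      show "onframe (tangent_space (unstable_manifold M X a) a) {0} (map (\<lambda>e. e a) (map (\<lambda>v _. v) A))"
        unfolding U using A by (simp add: comp_def)
      fix x assume "x \<in> stable_manifold M X a"
      then show "onframe (tangent_space M x) (tangent_space (stable_manifold M X a) x) (map (\<lambda>e. e x) (map (\<lambda>v _. v) A))"
        unfolding S using A tangent_space_singleton[of a] by (simp add: comp_def)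
    qed (auto simp: S)
  qed
qed

end

lemma filterlim_reverse: "((\<lambda>t::real. u (- t)) \<longlongrightarrow> a) at_bot \<longleftrightarrow> (u \<longlongrightarrow> a) at_top"
  by (simp add: filterlim_at_bot_mirror)

lemma filterlim_reverse': "((\<lambda>t::real. u (- t)) \<longlongrightarrow> a) at_top \<longleftrightarrow> (u \<longlongrightarrow> a) at_bot"
  by (simp add: filterlim_at_bot_mirror)

lemma flow_line_count_empty: "flow_lines M X \<xi> \<gamma> = {} \<Longrightarrow> flow_line_count M X \<omega> \<xi> \<gamma> = 0"
  unfolding flow_line_count_def by simp

context surface_flow
begin

lemma flow_lines_empty:
  assumes "b \<in> crit" "b' \<in> crit" "b \<noteq> b'" "morse_index M f b = 0 \<or> morse_index M f b' = 2"
  shows "flow_lines M X b b' = {}"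
proof (rule equals0I)
  fix w assume "w \<in> flow_lines M X b b'"
  then have w: "integral_curve M X w" "(w \<longlongrightarrow> b) at_bot" "(w \<longlongrightarrow> b') at_top" unfolding flow_lines_def by auto
  from assms(4) show False
  proof
    assume "morse_index M f b = 0"
    then have "w t = b" for t using index_0_unstable(2)[OF assms(1) _ w(1,2)] by blast
    then have "(w \<longlongrightarrow> b) at_top" by (intro tendsto_eventually always_eventually allI)
    from tendsto_unique[OF _ this w(3)] show False using assms(3) by simp
  next
    assume "morse_index M f b' = 2"
    then have "w t = b'" for t using index_2_stable(2)[OF assms(2) _ w(1,3)] by blast
    then have "(w \<longlongrightarrow> b') at_bot" by (intro tendsto_eventually always_eventually allI)
    from tendsto_unique[OF _ this w(2)] show False using assms(3) by simp
  qed
qed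

end

lemma reverse_flow_lines:
  "u \<in> flow_lines M X a b \<longleftrightarrow> (\<lambda>t. u (- t)) \<in> flow_lines M (\<lambda>x. - X x) b a"
  unfolding flow_lines_def by (simp add: integral_curve_reverse_iff filterlim_reverse filterlim_reverse' conj_commute)

locale surface_product = S1: surface_flow M1 f1 f1' X1 N1 + S2: surface_flow M2 f2 f2' X2 N2
  for M1 f1 f1' X1 N1 and M2 f2 f2' X2 N2 +
  fixes e :: "real ^ 3 \<Rightarrow> real ^ 3"
  assumes extremal: "\<And>a. a \<in> S1.crit \<Longrightarrow> morse_index M1 f1 a = 0 \<or> morse_index M1 f1 a = 2"
    and unique1: "\<And>a a'. a \<in> S1.crit \<Longrightarrow> a' \<in> S1.crit \<Longrightarrow> morse_index M1 f1 a = morse_index M1 f1 a' \<Longrightarrow> a = a'"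
    and unique2: "\<And>b b'. b \<in> S2.crit \<Longrightarrow> b' \<in> S2.crit \<Longrightarrow> morse_index M2 f2 b = morse_index M2 f2 b' \<Longrightarrow>
        morse_index M2 f2 b \<noteq> 1 \<Longrightarrow> b = b'"
    and frame: "continuous_on M2 e" "\<And>y. y \<in> M2 \<Longrightarrow> norm (e y) = 1" "\<And>y. y \<in> M2 \<Longrightarrow> inner (N2 y) (e y) = 0"
begin

definition X where "X = (\<lambda>(x, y). (X1 x, X2 y))"

context
  fixes \<omega>
  assumes \<omega>: "\<And>a b. a \<in> S1.crit \<Longrightarrow> b \<in> S2.crit \<Longrightarrow>
    manifold_orientation (unstable_manifold (M1 \<times> M2) X (a, b)) (\<omega> (a, b))"
begin

lemma max_saddle_count:
  assumes a: "a \<in> S1.crit" and b: "b \<in> S2.crit" "morse_index M2 f2 b = 2" and s: "s \<in> S2.crit" "morse_index M2 f2 s = 1"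
  shows "flow_line_count (M1 \<times> M2) X \<omega> (a, b) (a, s) = 0"
proof -
  obtain As where As:
    "\<And>x. x \<in> stable_manifold M1 X1 a \<Longrightarrow> onframe (tangent_space M1 x) (tangent_space (stable_manifold M1 X1 a) x) (map (\<lambda>e. e x) As)"
    "\<And>e. e \<in> set As \<Longrightarrow> continuous_on (stable_manifold M1 X1 a) e"
    "onframe (tangent_space (unstable_manifold M1 X1 a) a) {0} (map (\<lambda>e. e a) As)"
    "compl_in (tangent_space M1 a) (tangent_space (unstable_manifold M1 X1 a) a) (tangent_space (stable_manifold M1 X1 a) a)"
    using S1.extremum_frame[OF a extremal[OF a]] by metis
  obtain u v \<tau> where u: "integral_curve M2 X2 u" "(u \<longlongrightarrow> s) at_top" "\<And>t. X2 (u t) \<noteq> 0"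
    and v: "integral_curve M2 X2 v" "(v \<longlongrightarrow> s) at_top" "\<And>t. X2 (v t) \<noteq> 0"
    and disj: "\<And>s t. u s \<noteq> v t"
    and cases: "\<And>w. integral_curve M2 X2 w \<Longrightarrow> (w \<longlongrightarrow> s) at_top \<Longrightarrow>
      (\<forall>t. w t = s) \<or> (\<exists>s. \<forall>t. w t = u (s + t)) \<or> (\<exists>s. \<forall>t. w t = v (s + t))"
    and \<tau>: "continuous_on (stable_manifold M2 X2 s) \<tau>" "\<And>y. y \<in> stable_manifold M2 X2 s \<Longrightarrow> norm (\<tau> y) = 1"
      "\<And>y. y \<in> stable_manifold M2 X2 s \<Longrightarrow> tangent_space (stable_manifold M2 X2 s) y = span {\<tau> y}"
      "\<And>t. X2 (u t) = - norm (X2 (u t)) *\<^sub>R \<tau> (u t)" "\<And>t. X2 (v t) = norm (X2 (v t)) *\<^sub>R \<tau> (v t)"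
  proof (rule S2.index_1_stable[OF s], goal_cases)
    case prems: (1 u v \<tau>)
    show ?case by (rule prems(1)[OF prems(2-14)])
  qed
  have lim: "(w \<longlongrightarrow> b) at_bot" if w: "integral_curve M2 X2 w" "(w \<longlongrightarrow> s) at_top" "X2 (w 0) \<noteq> 0" for w
  proof -
    obtain c where "c \<in> S2.crit" "morse_index M2 f2 c = 2" "(w \<longlongrightarrow> c) at_bot"
      by (rule S2.saddle_backward_limit[OF s w])
    then show ?thesis using unique2[of c b] b by simp
  qed
  have bs: "b \<noteq> s" using b s by auto
  have SM: "stable_manifold M2 X2 s \<subseteq> M2" "unstable_manifold M2 X2 b \<subseteq> M2"
    unfolding stable_manifold_def unstable_manifold_def using integral_curve_in by blast+
  have n\<tau>: "inner (N2 y) (\<tau> y) = 0" if y: "y \<in> stable_manifold M2 X2 s" for y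
  proof -
    have "\<tau> y \<in> tangent_space (stable_manifold M2 X2 s) y" using \<tau>(3)[OF y] by (simp add: span_base)
    then have "\<tau> y \<in> tangent_space M2 y" using tangent_space_mono[OF SM(1)] by blast
    then show ?thesis using S2.tangent_plane y SM by auto
  qed
  show ?thesis unfolding X_def
  proof (rule product_count_zero[where As = As and Bs = "[\<lambda>y. cross3 (N2 y) (\<tau> y)]"
      and Es = "[e, \<lambda>y. cross3 (N2 y) (e y)]" and f = \<tau> and ?u1.0 = u and ?u2.0 = v
      and ?c1.0 = "\<lambda>t. - norm (X2 (u t))" and ?c2.0 = "\<lambda>t. norm (X2 (v t))"])
    show "manifold_orientation (unstable_manifold (M1 \<times> M2) (\<lambda>(x, y). (X1 x, X2 y)) (a, b)) (\<omega> (a, b))"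
      "manifold_orientation (unstable_manifold (M1 \<times> M2) (\<lambda>(x, y). (X1 x, X2 y)) (a, s)) (\<omega> (a, s))"
      using \<omega> a b s unfolding X_def by auto
    show "a \<in> M1" "X1 a = 0" using a by (auto simp: S1.crit_def)
    show "a \<in> stable_manifold M1 X1 a" "a \<in> unstable_manifold M1 X1 a"
      by (rule S1.crit_in_stable[OF a] S1.crit_in_unstable[OF a])+
    show "u = (\<lambda>_. a)" if "u \<in> flow_lines M1 X1 a a" for u using that by (rule S1.flow_lines_self)
    show "b \<in> unstable_manifold M2 X2 b" "s \<in> stable_manifold M2 X2 s" "s \<in> unstable_manifold M2 X2 s"
      by (rule S2.crit_in_unstable[OF b(1)] S2.crit_in_stable[OF s(1)] S2.crit_in_unstable[OF s(1)])+
    show "compl_in (tangent_space M2 s) (tangent_space (unstable_manifold M2 X2 s) s) (tangent_space (stable_manifold M2 X2 s) s)"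
      by (rule S2.saddle_complement[OF s])
    show "onframe (tangent_space M2 y) (tangent_space (stable_manifold M2 X2 s) y) (map (\<lambda>e. e y) [\<lambda>y. cross3 (N2 y) (\<tau> y)])"
      if y: "y \<in> stable_manifold M2 X2 s" for y
      unfolding \<tau>(3)[OF y] S2.tangent_plane[OF subsetD[OF SM(1) y]]
      using plane_frame(1)[OF S2.normal_unit \<tau>(2)[OF y] n\<tau>[OF y]] y SM by auto
    show "continuous_on (stable_manifold M2 X2 s) g" if "g \<in> set [\<lambda>y. cross3 (N2 y) (\<tau> y)]" for g
      using that \<tau>(1) continuous_on_subset[OF S2.normal_continuous SM(1)] by (auto intro: continuous_on_cross)
    show "onframe (tangent_space (unstable_manifold M2 X2 b) y) {0} (map (\<lambda>g. g y) [e, \<lambda>y. cross3 (N2 y) (e y)])"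
      if y: "y \<in> unstable_manifold M2 X2 b" for y
      unfolding S2.index_2_unstable[OF b y] S2.tangent_plane[OF subsetD[OF SM(2) y]]
      using plane_frame(2)[OF S2.normal_unit frame(2) frame(3)] y SM by auto
    show "continuous_on (unstable_manifold M2 X2 b) g" if "g \<in> set [e, \<lambda>y. cross3 (N2 y) (e y)]" for g
      using that continuous_on_subset[OF frame(1) SM(2)] continuous_on_subset[OF S2.normal_continuous SM(2)]
      by (auto intro: continuous_on_cross)
    show "onframe (tangent_space (unstable_manifold M2 X2 b) y) {0} (\<tau> y # map (\<lambda>e. e y) [\<lambda>y. cross3 (N2 y) (\<tau> y)])"
      if "y \<in> unstable_manifold M2 X2 b \<inter> stable_manifold M2 X2 s" for y
    proof -
      have y: "y \<in> unstable_manifold M2 X2 b" "y \<in> stable_manifold M2 X2 s" using that by auto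
      show ?thesis
        unfolding S2.index_2_unstable[OF b y(1)] S2.tangent_plane[OF subsetD[OF SM(2) y(1)]]
        using plane_frame(2)[OF S2.normal_unit \<tau>(2) n\<tau>] y SM by auto
    qed
    show "Determinant.det (cmat (map (\<lambda>g. g y) [e, \<lambda>y. cross3 (N2 y) (e y)]) (\<tau> y # map (\<lambda>e. e y) [\<lambda>y. cross3 (N2 y) (\<tau> y)])) = 1"
      if "y \<in> unstable_manifold M2 X2 b \<inter> stable_manifold M2 X2 s" for y
      using plane_det[OF S2.normal_unit \<tau>(2) n\<tau> frame(2) frame(3)] that SM by auto
    show "u \<in> flow_lines M2 X2 b s" "v \<in> flow_lines M2 X2 b s"
      unfolding flow_lines_def using u v lim by auto
    show "(\<exists>r. w = (\<lambda>t. u (r + t))) \<or> (\<exists>r. w = (\<lambda>t. v (r + t)))" if "w \<in> flow_lines M2 X2 b s" for w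
    proof -
      have w: "integral_curve M2 X2 w" "(w \<longlongrightarrow> b) at_bot" "(w \<longlongrightarrow> s) at_top" using that unfolding flow_lines_def by auto
      have "\<not> (\<forall>t. w t = s)"
      proof
        assume "\<forall>t. w t = s"
        then have "(w \<longlongrightarrow> s) at_bot" by (intro tendsto_eventually always_eventually)
        from tendsto_unique[OF _ this w(2)] show False using bs by simp
      qed
      then show ?thesis using cases[OF w(1,3)] by (metis ext)
    qed
    show "u r \<noteq> v t" for r t by (rule disj)
    show "- norm (X2 (u t)) < 0" "norm (X2 (v t)) > 0" for t using u(3) v(3) by auto
    show "X2 (u t) = - norm (X2 (u t)) *\<^sub>R \<tau> (u t)" "X2 (v t) = norm (X2 (v t)) *\<^sub>R \<tau> (v t)" for t by (rule \<tau>(4) \<tau>(5))+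
  qed (fact As)+
qed

lemma saddle_min_count:
  assumes a: "a \<in> S1.crit" and s: "s \<in> S2.crit" "morse_index M2 f2 s = 1" and m: "m \<in> S2.crit" "morse_index M2 f2 m = 0"
  shows "flow_line_count (M1 \<times> M2) X \<omega> (a, s) (a, m) = 0"
proof -
  interpret R: surface_flow M2 "\<lambda>x. - f2 x" "\<lambda>x. - f2' x" "\<lambda>x. - X2 x" N2 by (rule S2.reverse_surface)
  have sR: "s \<in> R.crit" "morse_index M2 (\<lambda>x. - f2 x) s = 1" using s S2.reverse_crit S2.reverse_index by auto
  obtain As where As:
    "\<And>x. x \<in> stable_manifold M1 X1 a \<Longrightarrow> onframe (tangent_space M1 x) (tangent_space (stable_manifold M1 X1 a) x) (map (\<lambda>e. e x) As)"
    "\<And>e. e \<in> set As \<Longrightarrow> continuous_on (stable_manifold M1 X1 a) e"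
    "onframe (tangent_space (unstable_manifold M1 X1 a) a) {0} (map (\<lambda>e. e a) As)"
    "compl_in (tangent_space M1 a) (tangent_space (unstable_manifold M1 X1 a) a) (tangent_space (stable_manifold M1 X1 a) a)"
    using S1.extremum_frame[OF a extremal[OF a]] by metis
  obtain u v \<tau> where u: "integral_curve M2 (\<lambda>x. - X2 x) u" "(u \<longlongrightarrow> s) at_top" "\<And>t. - X2 (u t) \<noteq> 0"
    and v: "integral_curve M2 (\<lambda>x. - X2 x) v" "(v \<longlongrightarrow> s) at_top" "\<And>t. - X2 (v t) \<noteq> 0"
    and disj: "\<And>s t. u s \<noteq> v t"
    and cases: "\<And>w. integral_curve M2 (\<lambda>x. - X2 x) w \<Longrightarrow> (w \<longlongrightarrow> s) at_top \<Longrightarrow>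
      (\<forall>t. w t = s) \<or> (\<exists>s. \<forall>t. w t = u (s + t)) \<or> (\<exists>s. \<forall>t. w t = v (s + t))"
    and \<tau>: "continuous_on (stable_manifold M2 (\<lambda>x. - X2 x) s) \<tau>" "\<And>y. y \<in> stable_manifold M2 (\<lambda>x. - X2 x) s \<Longrightarrow> norm (\<tau> y) = 1"
      "\<And>y. y \<in> stable_manifold M2 (\<lambda>x. - X2 x) s \<Longrightarrow> tangent_space (stable_manifold M2 (\<lambda>x. - X2 x) s) y = span {\<tau> y}"
      "\<And>t. - X2 (u t) = - norm (- X2 (u t)) *\<^sub>R \<tau> (u t)" "\<And>t. - X2 (v t) = norm (- X2 (v t)) *\<^sub>R \<tau> (v t)"
  proof (rule R.index_1_stable[OF sR], goal_cases)
    case prems: (1 u v \<tau>)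
    show ?case by (rule prems(1)[OF prems(2-14)])
  qed
  note \<tau>' = \<tau>(1-3)[folded unstable_manifold_reverse]
  have lim: "(w \<longlongrightarrow> m) at_bot" if w: "integral_curve M2 (\<lambda>x. - X2 x) w" "(w \<longlongrightarrow> s) at_top" "- X2 (w 0) \<noteq> 0" for w
  proof -
    obtain c where c: "c \<in> R.crit" "morse_index M2 (\<lambda>x. - f2 x) c = 2" "(w \<longlongrightarrow> c) at_bot"
      by (rule R.saddle_backward_limit[OF sR w])
    then have "c \<in> S2.crit" "morse_index M2 f2 c = 0" using S2.reverse_crit S2.reverse_index[of c] by auto
    then show ?thesis using unique2[of c m] m c by simp
  qed
  have ms: "m \<noteq> s" using m s by auto
  have SM: "stable_manifold M2 X2 m \<subseteq> M2"
    unfolding stable_manifold_def using integral_curve_in by blast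
  note Sm = S2.index_0_stable[OF m] and Um = S2.index_0_unstable(1)[OF m]
  have mM: "m \<in> M2" using m by (simp add: S2.crit_def)
  show ?thesis unfolding X_def
  proof (rule product_count_zero[where As = As and Bs = "[]" and Es = "[\<tau>]" and f = \<tau>
      and ?u1.0 = "\<lambda>t. v (- t)" and ?u2.0 = "\<lambda>t. u (- t)"
      and ?c1.0 = "\<lambda>t. - norm (X2 (v (- t)))" and ?c2.0 = "\<lambda>t. norm (X2 (u (- t)))"])
    show "manifold_orientation (unstable_manifold (M1 \<times> M2) (\<lambda>(x, y). (X1 x, X2 y)) (a, s)) (\<omega> (a, s))"
      "manifold_orientation (unstable_manifold (M1 \<times> M2) (\<lambda>(x, y). (X1 x, X2 y)) (a, m)) (\<omega> (a, m))"
      using \<omega> a m s unfolding X_def by auto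
    show "a \<in> M1" "X1 a = 0" using a by (auto simp: S1.crit_def)
    show "a \<in> stable_manifold M1 X1 a" "a \<in> unstable_manifold M1 X1 a"
      by (rule S1.crit_in_stable[OF a] S1.crit_in_unstable[OF a])+
    show "u = (\<lambda>_. a)" if "u \<in> flow_lines M1 X1 a a" for u using that by (rule S1.flow_lines_self)
    show "s \<in> unstable_manifold M2 X2 s" "m \<in> stable_manifold M2 X2 m" "m \<in> unstable_manifold M2 X2 m"
      by (rule S2.crit_in_unstable[OF m(1)] S2.crit_in_stable[OF m(1)] S2.crit_in_unstable[OF s(1)])+
    show "compl_in (tangent_space M2 m) (tangent_space (unstable_manifold M2 X2 m) m) (tangent_space (stable_manifold M2 X2 m) m)"
      unfolding Um tangent_space_singleton Sm[OF S2.crit_in_stable[OF m(1)]] compl_in_def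
      using S2.tangent_subspace[OF mM] subspace_0[OF S2.tangent_subspace[OF mM]] by auto
    show "onframe (tangent_space M2 y) (tangent_space (stable_manifold M2 X2 m) y) (map (\<lambda>e. e y) [])"
      if y: "y \<in> stable_manifold M2 X2 m" for y
      unfolding Sm[OF y] using onframe_full[OF S2.tangent_subspace] y SM by auto
    show "onframe (tangent_space (unstable_manifold M2 X2 s) y) {0} (map (\<lambda>g. g y) [\<tau>])"
      if y: "y \<in> unstable_manifold M2 X2 s" for y
      unfolding \<tau>'(3)[OF y] using onframe_single[OF \<tau>'(2)[OF y]] by simp
    show "continuous_on (unstable_manifold M2 X2 s) g" if "g \<in> set [\<tau>]" for g
      using that \<tau>'(1) by simp
    show "onframe (tangent_space (unstable_manifold M2 X2 s) y) {0} (\<tau> y # map (\<lambda>e. e y) [])"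
      if "y \<in> unstable_manifold M2 X2 s \<inter> stable_manifold M2 X2 m" for y
      using \<tau>'(3)[of y] onframe_single[OF \<tau>'(2)[of y]] that by simp
    show "Determinant.det (cmat (map (\<lambda>g. g y) [\<tau>]) (\<tau> y # map (\<lambda>e. e y) [])) = 1"
      if "y \<in> unstable_manifold M2 X2 s \<inter> stable_manifold M2 X2 m" for y
      using cmat_self[OF onframe_single[OF \<tau>'(2)[of y]]] that by simp
    show "(\<lambda>t. v (- t)) \<in> flow_lines M2 X2 s m" "(\<lambda>t. u (- t)) \<in> flow_lines M2 X2 s m"
      unfolding reverse_flow_lines[of _ M2 X2] using u v lim by (auto simp: flow_lines_def)
    show "(\<exists>r. w = (\<lambda>t. v (- (r + t)))) \<or> (\<exists>r. w = (\<lambda>t. u (- (r + t))))" if "w \<in> flow_lines M2 X2 s m" for w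
    proof -
      have w: "integral_curve M2 (\<lambda>x. - X2 x) (\<lambda>t. w (- t))" "((\<lambda>t. w (- t)) \<longlongrightarrow> s) at_top" "(w \<longlongrightarrow> m) at_top"
        using that unfolding flow_lines_def by (auto simp: integral_curve_reverse filterlim_reverse')
      have "\<not> (\<forall>t. w (- t) = s)"
      proof
        assume "\<forall>t. w (- t) = s"
        then have "w t = s" for t by (metis minus_minus)
        then have "(w \<longlongrightarrow> s) at_top" by (intro tendsto_eventually always_eventually allI)
        from tendsto_unique[OF _ this w(3)] show False using ms by simp
      qed
      then consider r where "\<forall>t. w (- t) = u (r + t)" | r where "\<forall>t. w (- t) = v (r + t)"
        using cases[OF w(1,2)] by blast
      then show ?thesis
      proof cases
        case (1 r)
        have "w = (\<lambda>t. u (- (- r + t)))" using 1[rule_format, of "- t" for t] by (auto simp: fun_eq_iff)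
        then show ?thesis by blast
      next
        case (2 r)
        have "w = (\<lambda>t. v (- (- r + t)))" using 2[rule_format, of "- t" for t] by (auto simp: fun_eq_iff)
        then show ?thesis by blast
      qed
    qed
    show "v (- r) \<noteq> u (- t)" for r t using disj[of "- t" "- r"] by simp
    show "- norm (X2 (v (- t))) < 0" "norm (X2 (u (- t))) > 0" for t using u(3) v(3) by auto
    show "X2 (v (- t)) = - norm (X2 (v (- t))) *\<^sub>R \<tau> (v (- t))" "X2 (u (- t)) = norm (X2 (u (- t))) *\<^sub>R \<tau> (u (- t))" for t
      using \<tau>(4)[of "- t"] \<tau>(5)[of "- t"] by (simp_all add: minus_equation_iff[of "X2 _"])
  qed (use As in auto)
qed

lemma flow_line_count_eq_0:
  assumes "a \<in> S1.crit" "b \<in> S2.crit" "a' \<in> S1.crit" "b' \<in> S2.crit"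
    and "morse_index M1 f1 a + morse_index M2 f2 b = morse_index M1 f1 a' + morse_index M2 f2 b' + 1"
  shows "flow_line_count (M1 \<times> M2) X \<omega> (a, b) (a', b') = 0"
proof -
  have le: "morse_index M2 f2 b \<le> 2" "morse_index M2 f2 b' \<le> 2" using assms S2.index_le_2 by auto
  show ?thesis
  proof (cases "morse_index M1 f1 a = morse_index M1 f1 a'")
    case True
    then have a: "a = a'" using unique1 assms by blast
    have "morse_index M2 f2 b = 2 \<and> morse_index M2 f2 b' = 1 \<or> morse_index M2 f2 b = 1 \<and> morse_index M2 f2 b' = 0"
      using assms(5) True le by auto
    then show ?thesis using max_saddle_count saddle_min_count assms a by blast
  next
    case False
    then have "morse_index M1 f1 a = 2" "morse_index M1 f1 a' = 0"
      using extremal[OF assms(1)] extremal[OF assms(3)] assms(5) le by auto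
    then have b: "morse_index M2 f2 b' = morse_index M2 f2 b + 1" using assms(5) by simp
    then have "b \<noteq> b'" by auto
    moreover have "morse_index M2 f2 b = 0 \<or> morse_index M2 f2 b' = 2" using b le by auto
    ultimately have "flow_lines M2 X2 b b' = {}" using S2.flow_lines_empty assms by blast
    then have "flow_lines (M1 \<times> M2) X (a, b) (a', b') = {}"
      unfolding X_def using flow_lines_Times[of _ M1 M2 X1 X2 a b a' b'] by blast
    then show ?thesis by (rule flow_line_count_empty)
  qed
qed

end

end

section \<open>Homology of a complex with vanishing differential\<close>

lemma tensor_product_integer_group: "tensor_product integer_group integer_group \<cong> integer_group"
proof -
  define F :: "(int \<times> int \<Rightarrow>\<^sub>0 int) monoid" where "F = free_Abelian_group UNIV"
  define R where "R = generate F (tensor_relations integer_group integer_group)"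
  define h where "h c = Poly_Mapping.lookup (frag_extend (\<lambda>p. frag_cmul (fst p * snd p) (frag_of ())) c) ()"
    for c :: "int \<times> int \<Rightarrow>\<^sub>0 int"
  have h_of: "h (frag_of (x, y)) = x * y" for x y by (simp add: h_def)
  have h_add: "h (c + d) = h c + h d" and h_diff: "h (c - d) = h c - h d" and h_0: "h 0 = 0" for c d
    by (simp_all add: h_def frag_extend_add frag_extend_diff lookup_add lookup_minus)
  have F: "group F" "carrier F = UNIV" "\<one>\<^bsub>F\<^esub> = 0" "\<And>x y. x \<otimes>\<^bsub>F\<^esub> y = x + y" "\<And>x. inv\<^bsub>F\<^esub> x = - x"
    unfolding F_def by (auto simp: carrier_free_Abelian_group_iff set_eq_iff)
  interpret F: group F by (rule F(1))
  interpret h: group_hom F integer_group h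
    by (intro group_hom.intro group_hom_axioms.intro F) (auto simp: hom_def F h_add)
  have sub: "subgroup R F" unfolding R_def by (rule F.generate_is_subgroup) (simp add: F)
  have R0: "0 \<in> R" and Radd: "x \<in> R \<Longrightarrow> y \<in> R \<Longrightarrow> x + y \<in> R" and Rneg: "x \<in> R \<Longrightarrow> - x \<in> R" for x y
    using subgroup.one_closed[OF sub] subgroup.m_closed[OF sub, of x y] subgroup.m_inv_closed[OF sub, of x] by (simp_all add: F)
  have Rdiff: "x - y \<in> R" if "x \<in> R" "y \<in> R" for x y using Radd[OF that(1) Rneg[OF that(2)]] by simp
  have rel1: "frag_of (x + x', y) - frag_of (x, y) - frag_of (x', y) \<in> R" for x x' y
    unfolding R_def tensor_relations_def by (rule generate.incl, rule UnI1) force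
  have rel2: "frag_of (x, y + y') - frag_of (x, y) - frag_of (x, y') \<in> R" for x y y'
    unfolding R_def tensor_relations_def by (rule generate.incl, rule UnI2) force
  have cmul_add: "frag_cmul (i + j) a = frag_cmul i a + frag_cmul j a"
    and cmul_diff: "frag_cmul (i - j) a = frag_cmul i a - frag_cmul j a"
    and cmul_right: "frag_cmul i (a - b) = frag_cmul i a - frag_cmul i b"
    for i j and a b :: "int \<times> int \<Rightarrow>\<^sub>0 int"
    by (rule poly_mapping_eqI; simp add: lookup_minus lookup_add algebra_simps)+
  have Rcmul: "frag_cmul n r \<in> R" if r: "r \<in> R" for n r
  proof (induction n rule: int_induct[where k = 0])
    case (step1 i)
    show ?case unfolding cmul_add using Radd[OF step1(2) r] by simp
  next
    case (step2 i)
    show ?case unfolding cmul_diff using Rdiff[OF step2(2) r] by simp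
  qed (simp add: R0)
  have additive: "g n - frag_cmul n (g 1) \<in> R"
    if g: "\<And>m n. g (m + n) - g m - g n \<in> R" for g :: "int \<Rightarrow> int \<times> int \<Rightarrow>\<^sub>0 int" and n
  proof (induction n rule: int_induct[where k = 0])
    case base
    then show ?case using Rneg[OF g[of 0 0]] by simp
  next
    case (step1 i)
    have "g (i + 1) - frag_cmul (i + 1) (g 1) = (g (i + 1) - g i - g 1) + (g i - frag_cmul i (g 1))"
      unfolding cmul_add by (simp only: frag_cmul_one) (rule poly_mapping_eqI, simp add: lookup_add lookup_minus)
    then show ?case using Radd[OF g[of i 1] step1(2)] by (simp only:)
  next
    case (step2 i)
    have "g (i - 1) - frag_cmul (i - 1) (g 1) = (g i - frag_cmul i (g 1)) - (g ((i - 1) + 1) - g (i - 1) - g 1)"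
      unfolding cmul_diff by (simp only: frag_cmul_one diff_add_cancel) (rule poly_mapping_eqI, simp add: lookup_add lookup_minus)
    then show ?case using Rdiff[OF step2(2) g[of "i - 1" 1]] by (simp only:)
  qed
  have gen: "frag_of (x, y) - frag_cmul (x * y) (frag_of (1, 1)) \<in> R" for x y
  proof -
    have "frag_of (x, y) - frag_cmul x (frag_of (1, y)) \<in> R" by (rule additive[of "\<lambda>x. frag_of (x, y)"]) (rule rel1)
    moreover have "frag_of (1, y) - frag_cmul y (frag_of (1, 1)) \<in> R" by (rule additive[of "\<lambda>y. frag_of (1, y)"]) (rule rel2)
    ultimately have "(frag_of (x, y) - frag_cmul x (frag_of (1, y))) +
        frag_cmul x (frag_of (1, y) - frag_cmul y (frag_of (1, 1))) \<in> R"
      by (intro Radd Rcmul)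
    moreover have "(frag_of (x, y) - frag_cmul x (frag_of (1, y))) +
        frag_cmul x (frag_of (1, y) - frag_cmul y (frag_of (1, 1))) = frag_of (x, y) - frag_cmul (x * y) (frag_of (1, 1))"
      by (rule poly_mapping_eqI) (simp add: lookup_add lookup_minus algebra_simps)
    ultimately show ?thesis by (simp only:)
  qed
  have all: "c - frag_cmul (h c) (frag_of (1, 1)) \<in> R" for c
    using subset_UNIV
  proof (induction c rule: frag_induction)
    case zero
    then show ?case by (simp add: h_0 R0)
  next
    case (one p)
    obtain x y where p: "p = (x, y)" by (cases p)
    show ?case unfolding p h_of by (rule gen)
  next
    case (diff a b)
    have "a - b - frag_cmul (h (a - b)) (frag_of (1, 1)) =
        (a - frag_cmul (h a) (frag_of (1, 1))) - (b - frag_cmul (h b) (frag_of (1, 1)))"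
      unfolding h_diff cmul_diff by (rule poly_mapping_eqI) (simp add: lookup_add lookup_minus)
    then show ?case using Rdiff[OF diff(1,2)] by (simp only:)
  qed
  have "R = kernel F integer_group h"
  proof
    show "R \<subseteq> kernel F integer_group h" unfolding R_def
    proof (rule F.generate_subgroup_incl[OF _ h.subgroup_kernel])
      show "tensor_relations integer_group integer_group \<subseteq> kernel F integer_group h"
      proof
        fix c :: "int \<times> int \<Rightarrow>\<^sub>0 int" assume "c \<in> tensor_relations integer_group integer_group"
        then have "(\<exists>x x' y. c = frag_of (x + x', y) - frag_of (x, y) - frag_of (x', y)) \<or>
            (\<exists>x y y'. c = frag_of (x, y + y') - frag_of (x, y) - frag_of (x, y'))"
          unfolding tensor_relations_def by force
        then have "h c = 0"
          by (elim disjE exE) (simp_all only: h_diff h_of, simp_all add: algebra_simps)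
        then show "c \<in> kernel F integer_group h" unfolding kernel_def F by simp
      qed
    qed
    show "kernel F integer_group h \<subseteq> R"
    proof
      fix c assume "c \<in> kernel F integer_group h"
      then have "h c = 0" by (simp add: kernel_def)
      have "c = c - frag_cmul (h c) (frag_of (1, 1))" unfolding \<open>h c = 0\<close> by simp
      then show "c \<in> R" using all[of c] by (simp only:)
    qed
  qed
  moreover have "h ` carrier F = carrier integer_group"
  proof -
    have "n \<in> range h" for n using rangeI[of h "frag_of (n, 1)"] unfolding h_of by simp
    then show ?thesis by (auto simp: F)
  qed
  ultimately have "F Mod R \<cong> integer_group" using h.FactGroup_iso by simp
  then show ?thesis unfolding tensor_product_def R_def F_def by simp
qed

lemma free_Abelian_group_pair:
  assumes "x \<noteq> y"
  shows "free_Abelian_group {x, y} \<cong> integer_group \<times>\<times> integer_group"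
proof -
  have "(\<lambda>c. (Poly_Mapping.lookup c x, Poly_Mapping.lookup c y)) \<in> iso (free_Abelian_group {x, y}) (integer_group \<times>\<times> integer_group)"
  proof (rule isoI[OF homI])
    show "bij_betw (\<lambda>c. (Poly_Mapping.lookup c x, Poly_Mapping.lookup c y))
       (carrier (free_Abelian_group {x, y})) (carrier (integer_group \<times>\<times> integer_group))"
    proof (rule bij_betwI[where g = "\<lambda>(m, n). frag_cmul m (frag_of x) + frag_cmul n (frag_of y)"])
      show "(\<lambda>(m, n). frag_cmul m (frag_of x) + frag_cmul n (frag_of y)) \<in>
          carrier (integer_group \<times>\<times> integer_group) \<rightarrow> carrier (free_Abelian_group {x, y})"
      proof (clarify, unfold carrier_free_Abelian_group_iff)
        fix m n :: int
        have "Poly_Mapping.keys (frag_cmul m (frag_of x) + frag_cmul n (frag_of y)) \<subseteq>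
            Poly_Mapping.keys (frag_cmul m (frag_of x)) \<union> Poly_Mapping.keys (frag_cmul n (frag_of y))" by (rule keys_add)
        also have "\<dots> \<subseteq> {x, y}" by (auto simp: in_keys_iff lookup_single when_def split: if_splits)
        finally show "Poly_Mapping.keys (frag_cmul m (frag_of x) + frag_cmul n (frag_of y)) \<subseteq> {x, y}" .
      qed
      show "(case (Poly_Mapping.lookup c x, Poly_Mapping.lookup c y) of
          (m, n) \<Rightarrow> frag_cmul m (frag_of x) + frag_cmul n (frag_of y)) = c"
        if "c \<in> carrier (free_Abelian_group {x, y})" for c
        using that assms by (intro poly_mapping_eqI) (auto simp: lookup_add lookup_single when_def in_keys_iff)
    qed (use assms in \<open>auto simp: lookup_add lookup_single when_def\<close>)
  qed (auto simp: lookup_add)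
  then show ?thesis unfolding is_iso_def by blast
qed

lemma morse_homology_zero_boundary:
  assumes "\<And>\<xi> \<gamma>. \<xi> \<in> crit_index M f k \<Longrightarrow> \<gamma> \<in> crit_index M f (k - 1) \<Longrightarrow> flow_line_count M X \<omega> \<xi> \<gamma> = 0"
    and "\<And>\<xi> \<gamma>. \<xi> \<in> crit_index M f (k + 1) \<Longrightarrow> \<gamma> \<in> crit_index M f k \<Longrightarrow> flow_line_count M X \<omega> \<xi> \<gamma> = 0"
  shows "morse_homology M f X \<omega> k \<cong> free_Abelian_group (crit_index M f k)"
    "group (morse_homology M f X \<omega> k)"
proof -
  let ?C = "free_Abelian_group (crit_index M f k)"
  have d0: "morse_boundary M f X \<omega> j c = 0"
    if "\<And>\<xi> \<gamma>. \<xi> \<in> crit_index M f j \<Longrightarrow> \<gamma> \<in> crit_index M f (j - 1) \<Longrightarrow> flow_line_count M X \<omega> \<xi> \<gamma> = 0"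
      "c \<in> carrier (morse_chain_group M f j)" for j c
    unfolding morse_boundary_def
    by (rule frag_extend_eq_0) (use that in \<open>auto simp: morse_chain_group_def intro!: sum.neutral\<close>)
  have "kernel (morse_chain_group M f k) (morse_chain_group M f (k - 1)) (morse_boundary M f X \<omega> k) =
      carrier (morse_chain_group M f k)"
    using d0[OF assms(1)] by (auto simp: kernel_def morse_chain_group_def)
  moreover have "morse_boundary M f X \<omega> (k + 1) ` carrier (morse_chain_group M f (k + 1)) = {0}"
  proof -
    have "morse_boundary M f X \<omega> (k + 1) c = 0" if "c \<in> carrier (morse_chain_group M f (k + 1))" for c
      using d0[OF _ that] assms(2) by simp
    moreover have "0 \<in> carrier (morse_chain_group M f (k + 1))" by (simp add: morse_chain_group_def)
    ultimately show ?thesis by (auto simp: image_iff)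
  qed
  ultimately have eq: "morse_homology M f X \<omega> k = ?C Mod {\<one>\<^bsub>?C\<^esub>}"
    unfolding morse_homology_def by (simp add: morse_chain_group_def)
  interpret C: group ?C by (rule group_free_Abelian_group)
  show "morse_homology M f X \<omega> k \<cong> ?C"
    unfolding eq using C.trivial_factor_iso unfolding is_iso_def by blast
  have "normal {\<one>\<^bsub>?C\<^esub>} ?C" by (rule C.one_is_normal)
  then show "group (morse_homology M f X \<omega> k)"
    unfolding eq by (rule normal.factorgroup_is_group)
qed

lemma morse_homology_ranks:
  assumes zero: "\<And>j \<xi> \<gamma>. \<xi> \<in> crit_index M f j \<Longrightarrow> \<gamma> \<in> crit_index M f (j - 1) \<Longrightarrow> flow_line_count M X \<omega> \<xi> \<gamma> = 0"
  shows "card (crit_index M f k) = 1 \<Longrightarrow> morse_homology M f X \<omega> k \<cong> tensor_product integer_group integer_group"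
    and "card (crit_index M f k) = 2 \<Longrightarrow> morse_homology M f X \<omega> k \<cong>
      tensor_product integer_group integer_group \<times>\<times> tensor_product integer_group integer_group"
    and "crit_index M f k = {} \<Longrightarrow> trivial_group (morse_homology M f X \<omega> k)"
proof -
  let ?H = "morse_homology M f X \<omega> k" and ?T = "tensor_product integer_group integer_group"
  have H: "?H \<cong> free_Abelian_group (crit_index M f k)" "group ?H"
    using morse_homology_zero_boundary[of M f k X \<omega>] zero[of _ k] zero[of _ "k + 1"] by auto
  have T: "integer_group \<cong> ?T" if "group ?T"
    using group.iso_sym[OF that tensor_product_integer_group] .
  have gT: "group ?T"
    unfolding tensor_product_def
  proof (rule normal.factorgroup_is_group, rule comm_group.normal_iff_subgroup[THEN iffD2])
    let ?F = "free_Abelian_group (carrier integer_group \<times> carrier integer_group)"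
    show "comm_group ?F" by (rule abelian_free_Abelian_group)
    show "subgroup (generate ?F (tensor_relations integer_group integer_group)) ?F"
      by (rule group.generate_is_subgroup[OF group_free_Abelian_group]) auto
  qed
  show "?H \<cong> ?T" if c: "card (crit_index M f k) = 1"
  proof -
    obtain x where "crit_index M f k = {x}" using c by (rule card_1_singletonE)
    then have "free_Abelian_group (crit_index M f k) \<cong> integer_group"
      using group.iso_sym[OF group_integer_group isomorphic_group_integer_free_Abelian_group_singleton[of x]] by simp
    then show ?thesis by (rule iso_trans[OF iso_trans[OF H(1)] T[OF gT]])
  qed
  show "?H \<cong> ?T \<times>\<times> ?T" if c: "card (crit_index M f k) = 2"
  proof -
    obtain x y where C: "crit_index M f k = {x, y}" "x \<noteq> y" using c unfolding card_2_iff by (elim exE conjE)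
    have "free_Abelian_group (crit_index M f k) \<cong> integer_group \<times>\<times> integer_group"
      unfolding C(1) by (rule free_Abelian_group_pair[OF C(2)])
    moreover have "integer_group \<times>\<times> integer_group \<cong> ?T \<times>\<times> ?T"
      by (rule group.DirProd_iso_trans[OF group_integer_group T[OF gT] T[OF gT]])
    ultimately show ?thesis by (rule iso_trans[OF iso_trans[OF H(1)]])
  qed
  show "trivial_group ?H" if "crit_index M f k = {}"
  proof -
    let ?C = "free_Abelian_group (crit_index M f k)"
    have "carrier ?C = {\<one>\<^bsub>?C\<^esub>}"
    proof (intro Set.set_eqI iffI)
      fix c assume "c \<in> carrier ?C"
      then have "Poly_Mapping.keys c = {}" unfolding carrier_free_Abelian_group_iff \<open>crit_index M f k = {}\<close> by (rule subset_empty[THEN iffD1])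
      then show "c \<in> {\<one>\<^bsub>?C\<^esub>}" by simp
    qed (simp only: singleton_iff monoid.one_closed[OF group.is_monoid[OF group_free_Abelian_group]])
    then have "trivial_group ?C" unfolding trivial_group_def by (rule conjI[OF group_free_Abelian_group])
    then show ?thesis using isomorphic_group_triviality[OF H(1) H(2) group_free_Abelian_group] by (simp only:)
  qed
qed

section \<open>Surfaces with an adapted pseudo-gradient\<close>

lemma (in flow_chart) zero_isolated:
  assumes "x \<in> M" "x \<in> U" "X x = 0"
  shows "x = a"
proof -
  have "\<phi> x \<in> E" "\<phi> x \<in> V" "\<psi> (\<phi> x) = x" using phi_in_E inverses assms by auto
  then obtain u v where uv: "u \<in> Em" "v \<in> Ep" "\<phi> x = u + v" unfolding E_def by blast
  have V: "u + v \<in> V" using uv \<open>\<phi> x \<in> V\<close> by simp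
  have "D (u + v) (2 *\<^sub>R u - 2 *\<^sub>R v) = 0"
    using X_chart[OF uv(1,2) V] uv(3) \<open>\<psi> (\<phi> x) = x\<close> assms(3) by simp
  then have "2 *\<^sub>R u - 2 *\<^sub>R v = 0"
    using linear_injective_0[OF linear_D[OF V]] inj_D[OF V] by blast
  then have "u = v" by simp
  then have "u = 0" using orth[OF uv(1,2)] by simp
  then show ?thesis using \<open>u = v\<close> uv(3) \<open>\<psi> (\<phi> x) = x\<close> zero(2) by simp
qed

lemma adapted_critical_points:
  assumes "adapted_pseudo_gradient M f X" and "\<And>x. (f has_derivative inner (f' x)) (at x)"
  shows "critical_points M f = {x \<in> M. X x = 0}"
proof (intro equalityI subsetI)
  fix x assume x: "x \<in> critical_points M f"
  then obtain V Em Ep \<psi> where c: "morse_chart M f x V Em Ep \<psi>"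
    and X: "\<And>u v. u \<in> Em \<Longrightarrow> v \<in> Ep \<Longrightarrow> u + v \<in> V \<Longrightarrow> X (\<psi> (u + v)) = frechet_derivative \<psi> (at (u + v)) (2 *\<^sub>R u - 2 *\<^sub>R v)"
    using assms(1) unfolding adapted_pseudo_gradient_def by blast
  obtain U \<phi> where "morse_chart_at M f x V Em Ep \<psi> U \<phi>" using c unfolding morse_chart_iff by blast
  then interpret morse_chart_at M f x V Em Ep \<psi> U \<phi> .
  have "X x = D 0 0" using X[of 0 0] zero sub subspace_0 by auto
  also have "\<dots> = 0" using linear_0[OF linear_D[OF zero(1)]] .
  finally show "x \<in> {x \<in> M. X x = 0}" using a_in by simp
next
  fix x assume x: "x \<in> {x \<in> M. X x = 0}"
  then have "0 \<in> tangent_space M x" using zero_in_tangent_space by blast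
  then have "differential M f x (X x) = 0" using x differential_eq[OF assms(2), of 0 M x] by simp
  then show "x \<in> critical_points M f" using x assms(1) unfolding adapted_pseudo_gradient_def by blast
qed

lemma critical_points_eq:
  assumes "\<And>x. (f has_derivative inner (f' x)) (at x)"
  shows "critical_points M f = {x \<in> M. \<forall>v\<in>tangent_space M x. inner (f' x) v = 0}"
  unfolding critical_points_def using differential_eq[OF assms] by auto

lemma adapted_flow_chart:
  fixes M :: "'a::euclidean_space set"
  assumes "adapted_pseudo_gradient M f X" "a \<in> critical_points M f"
  shows "\<exists>(V :: 'a set) Em Ep \<psi> U \<phi>. flow_chart M f X a V Em Ep \<psi> U \<phi>"
proof -
  obtain V Em Ep \<psi> where c: "morse_chart M f a V Em Ep \<psi>"
    and X: "\<And>u v. u \<in> Em \<Longrightarrow> v \<in> Ep \<Longrightarrow> u + v \<in> V \<Longrightarrow> X (\<psi> (u + v)) = frechet_derivative \<psi> (at (u + v)) (2 *\<^sub>R u - 2 *\<^sub>R v)"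
    using assms unfolding adapted_pseudo_gradient_def by blast
  obtain U \<phi> where m: "morse_chart_at M f a V Em Ep \<psi> U \<phi>" using c unfolding morse_chart_iff by blast
  have "flow_chart M f X a V Em Ep \<psi> U \<phi>"
    by (rule flow_chart.intro[OF m flow_chart_axioms.intro]) (rule X)
  then show ?thesis by blast
qed

lemma finite_critical_points:
  fixes M :: "'a::euclidean_space set"
  assumes "compact M" "adapted_pseudo_gradient M f X" and f': "\<And>x. (f has_derivative inner (f' x)) (at x)"
  shows "finite (critical_points M f)"
proof (rule ccontr)
  assume inf: "infinite (critical_points M f)"
  note eq = adapted_critical_points[OF assms(2) f']
  have "smooth_map_on M X" using assms(2) unfolding adapted_pseudo_gradient_def by blast
  then obtain L where "L \<ge> 0" and L: "\<And>x y. x \<in> M \<Longrightarrow> y \<in> M \<Longrightarrow> norm (X x - X y) \<le> L * norm (x - y)"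
    by (rule lipschitz_on_compact[OF assms(1)]) auto
  then have "continuous_on M X"
    by (intro lipschitz_on_continuous_on[of L] lipschitz_onI) (auto simp: dist_norm)
  then have "closed {x \<in> M. X x = 0}"
    using continuous_closed_preimage_constant compact_imp_closed[OF assms(1)] by blast
  obtain a where a: "a \<in> M" "a islimpt critical_points M f"
    using Heine_Borel_imp_Bolzano_Weierstrass[OF assms(1) inf] unfolding critical_points_def by blast
  then have ac: "a \<in> critical_points M f"
    using \<open>closed {x \<in> M. X x = 0}\<close> unfolding eq closed_limpt by blast
  then obtain V :: "'a set" and Em Ep \<psi> U \<phi> where "flow_chart M f X a V Em Ep \<psi> U \<phi>"
    using adapted_flow_chart[OF assms(2)] by blast
  then interpret flow_chart M f X a V Em Ep \<psi> U \<phi> .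
  obtain x where "x \<in> critical_points M f" "x \<in> U" "x \<noteq> a"
    using a(2) a_in(1) opens(2) unfolding islimpt_def by blast
  then show False using zero_isolated unfolding eq by blast
qed

lemma adapted_surface_flow:
  fixes M :: "(real ^ 3) set"
  assumes "compact M" "adapted_pseudo_gradient M f X" "smale_condition M f X"
    and f': "\<And>x. (f has_derivative inner (f' x)) (at x)"
    and "\<And>x. x \<in> M \<Longrightarrow> \<exists>u. integral_curve M X u \<and> u 0 = x"
    and "continuous_on M N" "\<And>x. x \<in> M \<Longrightarrow> norm (N x) = 1" "\<And>x. x \<in> M \<Longrightarrow> tangent_space M x = {v. inner (N x) v = 0}"
  shows "surface_flow M f f' X N"
proof -
  note eq = adapted_critical_points[OF assms(2) f']
  note ad = assms(2)[unfolded adapted_pseudo_gradient_def]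
  have d: "differential M f x (X x) = inner (f' x) (X x)" if "x \<in> M" for x
    using ad that by (intro differential_eq f') blast
  show ?thesis
  proof (rule surface_flow.intro[OF gradient_flow.intro surface_flow_axioms.intro])
    show "finite {x \<in> M. X x = 0}" using finite_critical_points[OF assms(1,2) f'] unfolding eq .
    show "inner (f' x) (X x) \<le> 0" if "x \<in> M" for x using d[OF that] ad that by (metis)
    show "X x = 0" if "x \<in> M" "inner (f' x) (X x) = 0" for x
    proof -
      have "x \<in> critical_points M f" using d[OF that(1)] ad that by metis
      then show ?thesis unfolding eq by blast
    qed
    show "\<exists>(V :: (real ^ 3) set) Em Ep \<psi> U \<phi>. flow_chart M f X x V Em Ep \<psi> U \<phi>" if "x \<in> M" "X x = 0" for x
      by (rule adapted_flow_chart[OF assms(2)]) (use that eq in blast)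
    show "tangent_space M x \<subseteq> {v + w |v w. v \<in> tangent_space (unstable_manifold M X a) x \<and>
                     w \<in> tangent_space (stable_manifold M X b) x}"
      if "a \<in> M" "X a = 0" "b \<in> M" "X b = 0" "x \<in> unstable_manifold M X a" "x \<in> stable_manifold M X b" for a b x
    proof -
      have "a \<in> critical_points M f" "b \<in> critical_points M f" unfolding eq using that by blast+
      then have "{v + w |v w. v \<in> tangent_space (unstable_manifold M X a) x \<and>
                     w \<in> tangent_space (stable_manifold M X b) x} = tangent_space M x"
        using assms(3) that(5,6) unfolding smale_condition_def by blast
      then show ?thesis by simp
    qed
  qed (use assms ad in auto)
qed

context surface_flow
begin

lemma index_minimum:
  assumes "a \<in> crit" "\<And>x. x \<in> M \<Longrightarrow> f a \<le> f x"
  shows "morse_index M f a = 0"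
proof -
  obtain V Em Ep \<psi> U \<phi> where c: "gradient_chart M f f' X a V Em Ep \<psi> U \<phi>" "dim Em = morse_index M f a" "dim Em + dim Ep = 2"
    by (rule crit_chart[OF assms(1)])
  interpret gradient_chart M f f' X a V Em Ep \<psi> U \<phi> by (rule c(1))
  show ?thesis using local_min_Em[OF assms(2)] c(2) by simp
qed

lemma index_maximum:
  assumes "a \<in> crit" "\<And>x. x \<in> M \<Longrightarrow> f x \<le> f a"
  shows "morse_index M f a = 2"
proof -
  obtain V Em Ep \<psi> U \<phi> where c: "gradient_chart M f f' X a V Em Ep \<psi> U \<phi>" "dim Em = morse_index M f a" "dim Em + dim Ep = 2"
    by (rule crit_chart[OF assms(1)])
  interpret gradient_chart M f f' X a V Em Ep \<psi> U \<phi> by (rule c(1))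
  interpret R: morse_chart_at M "\<lambda>x. - f x" a V Ep Em \<psi> U \<phi> by (rule morse_chart_at_uminus[OF morse_chart_at_axioms])
  have "Ep = {0}" by (rule R.local_min_Em) (use assms(2) in auto)
  then show ?thesis using c(2,3) by simp
qed

lemma index_saddle:
  assumes "a \<in> crit" "\<And>e. e > 0 \<Longrightarrow> \<exists>x\<in>M. dist x a < e \<and> f x > f a" "\<And>e. e > 0 \<Longrightarrow> \<exists>x\<in>M. dist x a < e \<and> f x < f a"
  shows "morse_index M f a = 1"
proof -
  obtain V Em Ep \<psi> U \<phi> where c: "gradient_chart M f f' X a V Em Ep \<psi> U \<phi>" "dim Em = morse_index M f a" "dim Em + dim Ep = 2"
    by (rule crit_chart[OF assms(1)])
  interpret gradient_chart M f f' X a V Em Ep \<psi> U \<phi> by (rule c(1))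
  interpret R: morse_chart_at M "\<lambda>x. - f x" a V Ep Em \<psi> U \<phi> by (rule morse_chart_at_uminus[OF morse_chart_at_axioms])
  have "Ep \<noteq> {0}" by (rule higher_points_Ep[OF assms(2)])
  moreover have "Em \<noteq> {0}" by (rule R.higher_points_Ep) (use assms(3) in auto)
  moreover have "S = {0}" if "dim S = 0" "subspace S" for S :: "(real ^ 3) set"
    using that subspace_0[OF that(2)] by auto
  ultimately have "dim Ep \<noteq> 0" "dim Em \<noteq> 0" using sub by blast+
  then show ?thesis using c(2,3) by linarith
qed

end

section \<open>The sphere and the torus\<close>

definition hor :: "real \<Rightarrow> real ^ 3" where "hor \<phi> = cos \<phi> *\<^sub>R axis 1 1 + sin \<phi> *\<^sub>R axis 2 1"
definition hor' :: "real \<Rightarrow> real ^ 3" where "hor' \<phi> = cos \<phi> *\<^sub>R axis 2 1 - sin \<phi> *\<^sub>R axis 1 1"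
definition ver :: "real ^ 3" where "ver = axis 3 1"

lemma nth_frame [simp]: "hor \<phi> $ 1 = cos \<phi>" "hor \<phi> $ 2 = sin \<phi>" "hor \<phi> $ 3 = 0"
  "hor' \<phi> $ 1 = - sin \<phi>" "hor' \<phi> $ 2 = cos \<phi>" "hor' \<phi> $ 3 = 0" "ver $ 1 = 0" "ver $ 2 = 0" "ver $ 3 = 1"
  by (simp_all add: hor_def hor'_def ver_def axis_def)

lemma inner_3: "inner x y = x $ 1 * y $ 1 + x $ 2 * y $ 2 + x $ 3 * y $ 3" for x y :: "real ^ 3"
  by (simp add: inner_vec_def sum_3)

lemma sin_cos_square [simp]: "cos \<phi> * cos \<phi> + sin \<phi> * sin \<phi> = (1::real)" "sin \<phi> * sin \<phi> + cos \<phi> * cos \<phi> = (1::real)"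
  using sin_cos_squared_add[of \<phi>] by (simp_all add: power2_eq_square)

lemma inner_frame [simp]: "inner (hor \<phi>) (hor \<phi>) = 1" "inner (hor \<phi>) (hor' \<phi>) = 0" "inner (hor' \<phi>) (hor \<phi>) = 0"
  "inner (hor' \<phi>) (hor' \<phi>) = 1" "inner (hor \<phi>) ver = 0" "inner (hor' \<phi>) ver = 0" "inner ver ver = 1"
  "inner ver (hor \<phi>) = 0" "inner ver (hor' \<phi>) = 0"
  by (simp_all add: inner_3)

lemma derivative_hor: "(hor has_vector_derivative hor' \<phi>) (at \<phi>)"
  unfolding hor_def[abs_def] hor'_def[abs_def] has_vector_derivative_def
  by (auto intro!: derivative_eq_intros simp: fun_eq_iff algebra_simps)

lemma smooth_hor: "smooth_on UNIV hor"
  unfolding hor_def[abs_def] by (intro smooth_on_add smooth_on_scaleR smooth_on_const smooth_on_sin_cos) auto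

lemma hor_add_pi: "hor (\<phi> + pi) = - hor \<phi>" "hor' (\<phi> + pi) = - hor' \<phi>"
  by (simp_all add: Finite_Cartesian_Product.vec_eq_iff forall_3)

lemma hor_add: "hor (\<phi> + t) = cos t *\<^sub>R hor \<phi> + sin t *\<^sub>R hor' \<phi>"
  by (simp add: Finite_Cartesian_Product.vec_eq_iff forall_3 cos_add sin_add mult.commute)

lemma inj_on_hor: "inj_on hor {0..pi}"
proof (rule inj_onI)
  fix x y assume "x \<in> {0..pi}" "y \<in> {0..pi}" "hor x = hor y"
  moreover from this have "cos x = cos y" by (metis nth_frame(1))
  ultimately show "x = y" using cos_inj_pi[of x y] by simp
qed

lemma polar_nonneg:
  fixes x y :: real
  obtains \<rho> \<theta> where "\<rho> \<ge> 0" "x = \<rho> * cos \<theta>" "y = \<rho> * sin \<theta>"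
proof -
  obtain \<rho> \<theta> where *: "x = \<rho> * cos \<theta>" "y = \<rho> * sin \<theta>" using polar_Ex by metis
  show thesis
  proof (cases "\<rho> \<ge> 0")
    case True
    then show ?thesis using that * by blast
  next
    case False
    then show ?thesis using that[of "- \<rho>" "\<theta> + pi"] * by simp
  qed
qed

lemma derivative_norm_square:
  "((\<lambda>x. (norm (x - p))\<^sup>2) has_derivative inner (2 *\<^sub>R (x - p))) (at x)" for p :: "'a::real_inner"
  unfolding power2_norm_eq_inner
  by (auto intro!: derivative_eq_intros simp: fun_eq_iff inner_commute algebra_simps)

subsection \<open>The sphere\<close>

lemma tangent_space_sphere:
  fixes x :: "'a::euclidean_space"
  assumes x: "x \<in> sphere 0 1"
  shows "tangent_space (sphere 0 1) x = {v. inner x v = 0}"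
proof (intro equalityI subsetI)
  fix v assume v: "v \<in> tangent_space (sphere 0 1) x"
  have "inner (2 *\<^sub>R (x - 0)) v = 0"
  proof (rule tangent_space_kernel[OF v])
    show "((\<lambda>x. (norm (x - 0))\<^sup>2 - 1) has_derivative inner (2 *\<^sub>R (x - 0))) (at x)"
      by (rule has_derivative_eq_rhs[OF has_derivative_diff[OF derivative_norm_square has_derivative_const]]) (simp add: fun_eq_iff)
  qed auto
  then show "v \<in> {v. inner x v = 0}" by simp
next
  fix v assume "v \<in> {v. inner x v = 0}"
  then have v: "inner x v = 0" "inner v x = 0" by (auto simp: inner_commute)
  have xx: "inner x x = 1" using x by (simp add: norm_eq_1)
  show "v \<in> tangent_space (sphere 0 1) x"
  proof (cases "v = 0")
    case True
    then show ?thesis using zero_in_tangent_space[OF x] by simp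
  next
    case False
    define e where "e = v /\<^sub>R norm v"
    define c where "c t = cos (norm v * t) *\<^sub>R x + sin (norm v * t) *\<^sub>R e" for t
    have vv: "inner e e = 1" "inner x e = 0" "inner e x = 0" "norm v *\<^sub>R e = v"
      unfolding e_def using False v by (simp_all add: dot_square_norm power2_eq_square)
    have "inner (c t) (c t) = 1" for t
      unfolding c_def inner_add_left inner_add_right inner_scaleR_left inner_scaleR_right vv xx by simp
    then have "c t \<in> sphere 0 1" for t by (simp add: norm_eq_1)
    moreover have "smooth_on {-1<..<1} c"
    proof -
      have m: "smooth_on UNIV (\<lambda>t. norm v * t)" by (intro smooth_on_bounded_linear bounded_linear_mult_right) auto
      have "smooth_on UNIV c" unfolding c_def
        by (intro smooth_on_add smooth_on_scaleR smooth_on_const smooth_on_compose[OF _ open_UNIV _ m smooth_on_sin_cos(1)]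
          smooth_on_compose[OF _ open_UNIV _ m smooth_on_sin_cos(2)]) auto
      then show ?thesis by (rule smooth_on_subset) simp
    qed
    moreover have "(c has_vector_derivative v) (at 0)"
      unfolding c_def[abs_def] has_vector_derivative_def
      by (subst (2) vv(4)[symmetric]) (auto intro!: derivative_eq_intros simp: fun_eq_iff)
    moreover have "c 0 = x" by (simp add: c_def)
    ultimately have "curve_in (sphere 0 1) x v c" unfolding curve_in_def by (auto intro!: exI[of _ 1])
    then show ?thesis unfolding tangent_space_def by blast
  qed
qed

lemma sphere_integral_curve:
  fixes X :: "'a::euclidean_space \<Rightarrow> 'a"
  assumes X: "smooth_map_on (sphere 0 1) X" "\<And>x. x \<in> sphere 0 1 \<Longrightarrow> inner x (X x) = 0" and x: "x \<in> sphere 0 1"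
  shows "\<exists>u. integral_curve (sphere 0 1) X u \<and> u 0 = x"
proof -
  obtain L where L: "L \<ge> 0" "\<And>x y. x \<in> sphere 0 1 \<Longrightarrow> y \<in> sphere 0 1 \<Longrightarrow> norm (X x - X y) \<le> L * norm (x - y)"
    by (rule lipschitz_on_compact[OF compact_sphere X(1)]) auto
  define B where "B = norm (X x) + 2 * L"
  have B: "norm (X y) \<le> B" if y: "y \<in> sphere 0 1" for y
  proof -
    have "norm (X y) \<le> norm (X x) + norm (X y - X x)" by norm
    also have "\<dots> \<le> norm (X x) + L * norm (y - x)" using L(2)[OF y x] by simp
    also have "\<dots> \<le> B" unfolding B_def using mult_left_mono[OF norm_triangle_ineq4[of y x] L(1)] x y by simp
    finally show ?thesis .
  qed
  have "B \<ge> 0" using B[OF x] norm_ge_zero order_trans by blast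
  \<comment> \<open>A globally Lipschitz extension of \<open>X\<close> that is tangent to all concentric spheres.\<close>
  define F where "F y = norm y *\<^sub>R X (y /\<^sub>R norm y)" for y
  have F0: "norm (F y - F 0) \<le> (2 * L + B) * norm (y - 0)" for y
  proof (cases "y = 0")
    case False
    then have "norm (F y - F 0) \<le> norm y * B" using B[of "y /\<^sub>R norm y"] by (simp add: F_def mult_left_mono)
    also have "\<dots> \<le> (2 * L + B) * norm (y - 0)" using L(1) by (simp add: algebra_simps)
    finally show ?thesis .
  qed simp
  have "norm (F y - F z) \<le> (2 * L + B) * norm (y - z)" for y z
  proof (cases "y = 0 \<or> z = 0")
    case True
    then show ?thesis using F0[of y] F0[of z] norm_minus_commute[of "F 0" "F z"] by auto
  next
    case False
    let ?y = "y /\<^sub>R norm y" and ?z = "z /\<^sub>R norm z"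
    have s: "?y \<in> sphere 0 1" "?z \<in> sphere 0 1" using False by auto
    then have nz: "norm ?z = 1" by simp
    have 1: "norm y * norm (?y - ?z) \<le> 2 * norm (y - z)"
    proof -
      have "norm y * norm (?y - ?z) = norm (norm y *\<^sub>R (?y - ?z))" by simp
      also have "norm y *\<^sub>R (?y - ?z) = (y - z) + (norm z - norm y) *\<^sub>R ?z"
        using False by (simp add: algebra_simps)
      also have "norm \<dots> \<le> norm (y - z) + \<bar>norm z - norm y\<bar> * norm ?z"
        using norm_triangle_ineq[of "y - z" "(norm z - norm y) *\<^sub>R ?z"] unfolding norm_scaleR .
      also have "\<dots> \<le> norm (y - z) + norm (y - z)"
        unfolding nz using norm_triangle_ineq3[of z y] by (simp add: norm_minus_commute)
      finally show ?thesis by simp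
    qed
    have "F y - F z = norm y *\<^sub>R (X ?y - X ?z) + (norm y - norm z) *\<^sub>R X ?z"
      unfolding F_def by (simp add: algebra_simps)
    also have "norm \<dots> \<le> norm y * norm (X ?y - X ?z) + \<bar>norm y - norm z\<bar> * norm (X ?z)"
      using norm_triangle_ineq[of "norm y *\<^sub>R (X ?y - X ?z)" "(norm y - norm z) *\<^sub>R X ?z"] by (simp only: norm_scaleR abs_norm_cancel)
    also have "\<dots> \<le> norm y * (L * norm (?y - ?z)) + norm (y - z) * B"
      by (intro add_mono mult_mono L(2) s B norm_triangle_ineq3) auto
    also have "norm y * (L * norm (?y - ?z)) = L * (norm y * norm (?y - ?z))" by simp
    also have "\<dots> \<le> L * (2 * norm (y - z))" by (intro mult_left_mono 1 L(1))
    finally show ?thesis by (simp add: algebra_simps)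
  qed
  then obtain u where u: "u 0 = x" "\<And>t. (u has_vector_derivative F (u t)) (at t)"
    using picard_lindelof[of F "2 * L + B" x] by blast
  have "inner y (F y) = 0" for y
  proof (cases "y = 0")
    case False
    then have "inner (y /\<^sub>R norm y) (X (y /\<^sub>R norm y)) = 0" by (intro X(2)) simp
    then show ?thesis using False by (simp add: F_def)
  qed simp
  then have d: "((\<lambda>t. inner (u t) (u t)) has_vector_derivative 0) (at t)" for t
    using bounded_bilinear.has_vector_derivative[OF bounded_bilinear_inner u(2) u(2), of t]
    by (simp add: inner_commute)
  obtain c where "\<And>t. t \<in> UNIV \<Longrightarrow> inner (u t) (u t) = c"
    by (rule has_vector_derivative_zero_constant[OF convex_UNIV d]) auto
  then have "inner (u t) (u t) = inner (u 0) (u 0)" for t by simp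
  then have n: "norm (u t) = 1" for t using u(1) x by (simp add: norm_eq_sqrt_inner)
  have "integral_curve (sphere 0 1) X u"
    unfolding integral_curve_def using u(2) n by (simp add: F_def)
  then show ?thesis using u(1) by blast
qed

lemma sphere_critical_points:
  fixes p :: "real ^ 3"
  assumes "adapted_pseudo_gradient (sphere 0 1) (\<lambda>x. (norm (x - p))\<^sup>2) X"
    and "smale_condition (sphere 0 1) (\<lambda>x. (norm (x - p))\<^sup>2) X"
  obtains a b where "surface_flow (sphere 0 1) (\<lambda>x. (norm (x - p))\<^sup>2) (\<lambda>x. 2 *\<^sub>R (x - p)) X (\<lambda>x. x)"
    "critical_points (sphere 0 1) (\<lambda>x. (norm (x - p))\<^sup>2) = {a, b}"
    "morse_index (sphere 0 1) (\<lambda>x. (norm (x - p))\<^sup>2) a = 0" "morse_index (sphere 0 1) (\<lambda>x. (norm (x - p))\<^sup>2) b = 2"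
proof -
  let ?M = "sphere 0 1 :: (real ^ 3) set" and ?f = "\<lambda>x. (norm (x - p))\<^sup>2"
  note ad = assms(1)[unfolded adapted_pseudo_gradient_def]
  have T: "tangent_space ?M x = {v. inner x v = 0}" if "x \<in> ?M" for x by (rule tangent_space_sphere[OF that])
  have S: "surface_flow ?M ?f (\<lambda>x. 2 *\<^sub>R (x - p)) X (\<lambda>x. x)"
  proof (rule adapted_surface_flow[OF compact_sphere assms derivative_norm_square _ continuous_on_id])
    show "\<exists>u. integral_curve ?M X u \<and> u 0 = x" if "x \<in> ?M" for x
    proof (rule sphere_integral_curve[OF _ _ that])
      show "smooth_map_on ?M X" using ad by (rule conjunct1)
      show "inner y (X y) = 0" if "y \<in> ?M" for y
      proof -
        have "X y \<in> tangent_space ?M y" using ad that by blast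
        then show ?thesis unfolding T[OF that] by blast
      qed
    qed
  qed (auto simp only: T mem_sphere dist_0_norm)
  interpret surface_flow ?M ?f "\<lambda>x. 2 *\<^sub>R (x - p)" X "\<lambda>x. x" by (rule S)
  have crit: "critical_points ?M ?f = {x \<in> ?M. \<forall>v. inner x v = 0 \<longrightarrow> inner p v = 0}"
    unfolding critical_points_eq[OF derivative_norm_square]
  proof (rule Collect_cong, rule conj_cong[OF refl])
    fix x assume x: "x \<in> ?M"
    show "(\<forall>v\<in>tangent_space ?M x. inner (2 *\<^sub>R (x - p)) v = 0) \<longleftrightarrow> (\<forall>v. inner x v = 0 \<longrightarrow> inner p v = 0)"
      unfolding T[OF x] by (auto simp: inner_diff_left)
  qed
  have p: "p \<noteq> 0"
  proof
    assume "p = 0"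
    then have "hor ` {0..pi} \<subseteq> critical_points ?M ?f" unfolding crit by (auto simp: norm_eq_1)
    moreover have "infinite (hor ` {0..pi})" using finite_imageD[OF _ inj_on_hor] infinite_Icc[OF pi_gt_zero] by blast
    ultimately show False
      using finite_critical_points[OF compact_sphere assms(1) derivative_norm_square] finite_subset by blast
  qed
  define a where "a = p /\<^sub>R norm p"
  have a: "norm a = 1" "p = norm p *\<^sub>R a" "inner a a = 1" unfolding a_def using p by (simp_all add: norm_eq_1 dot_square_norm power2_eq_square)
  have C: "critical_points ?M ?f = {a, - a}"
  proof (intro equalityI subsetI)
    fix x assume "x \<in> critical_points ?M ?f"
    then have x: "norm x = 1" "inner x x = 1" "\<And>v. inner x v = 0 \<Longrightarrow> inner p v = 0" unfolding crit by (auto simp: norm_eq_1)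
    have "inner x (p - inner x p *\<^sub>R x) = 0" using x(2) by (simp add: inner_diff_right)
    then have "inner (p - inner x p *\<^sub>R x) (p - inner x p *\<^sub>R x) = 0"
      using x(3) by (simp add: inner_diff_left)
    then have px: "p = inner x p *\<^sub>R x" by simp
    define k where "k = inner x p"
    have pk: "p = k *\<^sub>R x" unfolding k_def by (rule px)
    then have "k \<noteq> 0" "norm p = \<bar>k\<bar>" using p x(1) by auto
    then have "a = x \<or> a = - x" unfolding a_def using pk by (cases "k > 0") auto
    then show "x \<in> {a, - a}" by auto
  next
    fix x assume "x \<in> {a, - a}"
    then have x: "norm x = 1" "inner x v = inner a v \<or> inner x v = - inner a v" for v using a(1) by auto
    have pv: "inner p v = norm p * inner a v" for v by (subst a(2)) simp
    have "inner p v = 0" if "inner x v = 0" for v using that x(2)[of v] pv[of v] by auto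
    then show "x \<in> critical_points ?M ?f" unfolding crit using x by auto
  qed
  have f: "?f x = 1 + (norm p)\<^sup>2 - 2 * norm p * inner x a" if "x \<in> ?M" for x
  proof -
    have "inner x x = 1" using that by (simp add: norm_eq_1)
    moreover have "inner x p = norm p * inner x a" by (subst a(2)) simp
    ultimately show ?thesis by (simp add: power2_norm_eq_inner inner_diff_left inner_diff_right inner_commute[of p x])
  qed
  have cs: "\<bar>inner x a\<bar> \<le> 1" if "x \<in> ?M" for x using Cauchy_Schwarz_ineq2[of x a] a that by simp
  have ca: "a \<in> crit" "- a \<in> crit"
    using C adapted_critical_points[OF assms(1) derivative_norm_square] unfolding crit_def by blast+
  have "?f a \<le> ?f x" "?f x \<le> ?f (- a)" if "x \<in> ?M" for x
    using f[OF that] f[of a] f[of "- a"] cs[OF that] a mult_left_mono[of "inner x a" 1 "norm p"] mult_left_mono[of "- 1" "inner x a" "norm p"]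
    by (auto simp: abs_le_iff)
  then show thesis using that[OF S C index_minimum[OF ca(1)] index_maximum[OF ca(2)]] by blast
qed

subsection \<open>The torus\<close>

lemma derivative_hor_comp:
  assumes "(\<phi> has_real_derivative b) (at t)"
  shows "((\<lambda>t. hor (\<phi> t)) has_vector_derivative b *\<^sub>R hor' (\<phi> t)) (at t)"
  using vector_diff_chain_at[OF assms[unfolded has_real_derivative_iff_has_vector_derivative] derivative_hor]
  by (simp add: o_def)

lemma hor'_add: "hor' (\<phi> + t) = cos t *\<^sub>R hor' \<phi> - sin t *\<^sub>R hor \<phi>"
  by (simp add: Finite_Cartesian_Product.vec_eq_iff forall_3 cos_add sin_add algebra_simps)

definition nrm :: "real \<Rightarrow> real \<Rightarrow> real ^ 3" where "nrm \<theta> \<phi> = cos \<theta> *\<^sub>R hor \<phi> + sin \<theta> *\<^sub>R ver"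
definition nrm' :: "real \<Rightarrow> real \<Rightarrow> real ^ 3" where "nrm' \<theta> \<phi> = cos \<theta> *\<^sub>R ver - sin \<theta> *\<^sub>R hor \<phi>"

lemma inner_nrm [simp]: "inner (nrm \<theta> \<phi>) (nrm \<theta> \<phi>) = 1" "inner (nrm' \<theta> \<phi>) (nrm' \<theta> \<phi>) = 1"
  "inner (nrm \<theta> \<phi>) (nrm' \<theta> \<phi>) = 0" "inner (nrm' \<theta> \<phi>) (nrm \<theta> \<phi>) = 0"
  "inner (nrm \<theta> \<phi>) (hor' \<phi>) = 0" "inner (hor' \<phi>) (nrm \<theta> \<phi>) = 0"
  "inner (nrm' \<theta> \<phi>) (hor' \<phi>) = 0" "inner (hor' \<phi>) (nrm' \<theta> \<phi>) = 0"
  by (simp_all add: nrm_def nrm'_def inner_simps)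

lemma norm_nrm [simp]: "norm (nrm \<theta> \<phi>) = 1" "norm (nrm' \<theta> \<phi>) = 1" "norm (hor \<phi>) = 1" "norm (hor' \<phi>) = 1"
  by (simp_all add: norm_eq_1)

lemma nrm_add: "nrm (\<theta> + t) \<phi> = cos t *\<^sub>R nrm \<theta> \<phi> + sin t *\<^sub>R nrm' \<theta> \<phi>"
  unfolding nrm_def nrm'_def cos_add sin_add by (simp add: algebra_simps)

lemma frame_decomposition:
  "v = inner v (hor \<phi>) *\<^sub>R hor \<phi> + inner v (hor' \<phi>) *\<^sub>R hor' \<phi> + (v $ 3) *\<^sub>R ver"
proof -
  have c: "cos \<phi> * (cos \<phi> * a) + sin \<phi> * (sin \<phi> * a) = a" for a
    using sin_cos_square(1)[of \<phi>] by (metis distrib_right mult.assoc mult_1)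
  show ?thesis
    by (simp add: Finite_Cartesian_Product.vec_eq_iff forall_3 inner_3 algebra_simps)
      (metis c add.commute mult.left_commute)
qed

lemma normal_frame_decomposition:
  "v = inner v (nrm \<theta> \<phi>) *\<^sub>R nrm \<theta> \<phi> + inner v (nrm' \<theta> \<phi>) *\<^sub>R nrm' \<theta> \<phi> + inner v (hor' \<phi>) *\<^sub>R hor' \<phi>"
proof -
  have n: "inner v (nrm \<theta> \<phi>) = cos \<theta> * inner v (hor \<phi>) + sin \<theta> * (v $ 3)"
    "inner v (nrm' \<theta> \<phi>) = cos \<theta> * (v $ 3) - sin \<theta> * inner v (hor \<phi>)"
    by (simp_all add: nrm_def nrm'_def inner_simps inner_3[of v ver])
  have "c * (c * a + s * b) - s * (c * b - s * a) = (c * c + s * s) * a"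
    "s * (c * a + s * b) + c * (c * b - s * a) = (c * c + s * s) * b" for c s a b :: real
    by (simp_all add: algebra_simps)
  then have 1: "cos \<theta> * (cos \<theta> * a + sin \<theta> * b) - sin \<theta> * (cos \<theta> * b - sin \<theta> * a) = a"
    "sin \<theta> * (cos \<theta> * a + sin \<theta> * b) + cos \<theta> * (cos \<theta> * b - sin \<theta> * a) = b" for a b
    by (simp_all only: sin_cos_square mult_1)
  have "inner v (nrm \<theta> \<phi>) *\<^sub>R nrm \<theta> \<phi> + inner v (nrm' \<theta> \<phi>) *\<^sub>R nrm' \<theta> \<phi> =
      (cos \<theta> * inner v (nrm \<theta> \<phi>) - sin \<theta> * inner v (nrm' \<theta> \<phi>)) *\<^sub>R hor \<phi> +
      (sin \<theta> * inner v (nrm \<theta> \<phi>) + cos \<theta> * inner v (nrm' \<theta> \<phi>)) *\<^sub>R ver"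
    unfolding nrm_def[of \<theta> \<phi>] nrm'_def[of \<theta> \<phi>]
    by (simp add: algebra_simps)
  also have "\<dots> = inner v (hor \<phi>) *\<^sub>R hor \<phi> + (v $ 3) *\<^sub>R ver" unfolding n 1 ..
  finally show ?thesis by (subst frame_decomposition[of v \<phi>]) (simp add: add.assoc add.commute[of "(v $ 3) *\<^sub>R ver"])
qed

lemma polar_square: "(a * cos \<phi>)\<^sup>2 + (a * sin \<phi>)\<^sup>2 = (a::real)\<^sup>2"
  unfolding power_mult_distrib distrib_left[symmetric] by simp

definition rad :: "real ^ 3 \<Rightarrow> real" where "rad y = sqrt ((y $ 1)\<^sup>2 + (y $ 2)\<^sup>2)"

lemma rad_eq: "inner y (hor' \<phi>) = 0 \<Longrightarrow> rad y = \<bar>inner y (hor \<phi>)\<bar>"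
proof -
  assume "inner y (hor' \<phi>) = 0"
  then have y: "y = inner y (hor \<phi>) *\<^sub>R hor \<phi> + (y $ 3) *\<^sub>R ver" using frame_decomposition[of y \<phi>] by simp
  have "y $ 1 = inner y (hor \<phi>) * cos \<phi>" "y $ 2 = inner y (hor \<phi>) * sin \<phi>"
    using arg_cong[OF y, of "\<lambda>v. v $ 1"] arg_cong[OF y, of "\<lambda>v. v $ 2"] by simp_all
  then have "(y $ 1)\<^sup>2 + (y $ 2)\<^sup>2 = (inner y (hor \<phi>))\<^sup>2" by (simp only: polar_square)
  then show ?thesis unfolding rad_def by simp
qed

locale torus =
  fixes R r :: real
  assumes r: "0 < r" "r < R"
begin

abbreviation "T \<equiv> standard_torus R r"

definition P :: "real \<Rightarrow> real \<Rightarrow> real ^ 3" where "P \<theta> \<phi> = R *\<^sub>R hor \<phi> + r *\<^sub>R nrm \<theta> \<phi>"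

definition N :: "real ^ 3 \<Rightarrow> real ^ 3" where "N y = (1 / r) *\<^sub>R (y - (R / rad y) *\<^sub>R (y - (y $ 3) *\<^sub>R ver))"

definition e :: "real ^ 3 \<Rightarrow> real ^ 3" where "e y = (1 / rad y) *\<^sub>R ((y $ 1) *\<^sub>R axis 2 1 - (y $ 2) *\<^sub>R axis 1 1)"

lemma pos: "R + r * cos \<theta> > 0"
proof -
  have "r * (- 1) \<le> r * cos \<theta>" using r by (intro mult_left_mono) auto
  then show ?thesis using r by simp
qed

lemma P_eq: "P \<theta> \<phi> = (R + r * cos \<theta>) *\<^sub>R hor \<phi> + (r * sin \<theta>) *\<^sub>R ver"
  unfolding P_def nrm_def by (simp add: algebra_simps)

lemma nth_P: "P \<theta> \<phi> $ 1 = (R + r * cos \<theta>) * cos \<phi>" "P \<theta> \<phi> $ 2 = (R + r * cos \<theta>) * sin \<phi>" "P \<theta> \<phi> $ 3 = r * sin \<theta>"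
  unfolding P_eq by simp_all

lemma rad_P: "rad (P \<theta> \<phi>) = R + r * cos \<theta>"
proof -
  have "inner (P \<theta> \<phi>) (hor' \<phi>) = 0" "inner (P \<theta> \<phi>) (hor \<phi>) = R + r * cos \<theta>" unfolding P_eq by (simp_all add: inner_simps)
  then show ?thesis using rad_eq[of "P \<theta> \<phi>" \<phi>] pos[of \<theta>] by simp
qed

lemma inner_P: "inner (P \<theta> \<phi>) (P \<theta> \<phi>) = 2 * R * (R + r * cos \<theta>) - R\<^sup>2 + r\<^sup>2"
proof -
  have "inner (P \<theta> \<phi>) (P \<theta> \<phi>) = R * R + 2 * R * r * cos \<theta> + (r * cos \<theta>)\<^sup>2 + (r * sin \<theta>)\<^sup>2"
    unfolding P_eq by (simp add: inner_simps power2_eq_square algebra_simps)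
  then show ?thesis using polar_square[of r \<theta>] by (simp add: power2_eq_square algebra_simps)
qed

lemma torus_iff: "y \<in> T \<longleftrightarrow> (\<exists>\<theta> \<phi>. y = P \<theta> \<phi>)"
proof
  assume "y \<in> T"
  then have y: "(rad y - R)\<^sup>2 + (y $ 3)\<^sup>2 = r\<^sup>2" unfolding standard_torus_def rad_def by simp
  obtain \<rho> \<phi> where \<rho>: "\<rho> \<ge> 0" "y $ 1 = \<rho> * cos \<phi>" "y $ 2 = \<rho> * sin \<phi>" by (rule polar_nonneg)
  have "(y $ 1)\<^sup>2 + (y $ 2)\<^sup>2 = \<rho>\<^sup>2" unfolding \<rho> by (rule polar_square)
  then have rad: "rad y = \<rho>" using \<rho> unfolding rad_def by simp
  obtain s \<theta> where s: "s \<ge> 0" "rad y - R = s * cos \<theta>" "y $ 3 = s * sin \<theta>" by (rule polar_nonneg)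
  have "s\<^sup>2 = r\<^sup>2" using y unfolding s polar_square .
  then have "s = r" using s(1) r power2_eq_iff_nonneg by force
  then have "\<rho> = R + r * cos \<theta>" "y $ 3 = r * sin \<theta>" using s rad by auto
  then have "y = P \<theta> \<phi>" using \<rho> by (simp add: Finite_Cartesian_Product.vec_eq_iff forall_3 nth_P)
  then show "\<exists>\<theta> \<phi>. y = P \<theta> \<phi>" by blast
next
  assume "\<exists>\<theta> \<phi>. y = P \<theta> \<phi>"
  then obtain \<theta> \<phi> where y: "y = P \<theta> \<phi>" by blast
  have "(rad y - R)\<^sup>2 + (y $ 3)\<^sup>2 = r\<^sup>2" using polar_square[of r \<theta>] unfolding y rad_P nth_P by simp
  then show "y \<in> T" unfolding standard_torus_def rad_def by simp
qed

lemma P_in: "P \<theta> \<phi> \<in> T" using torus_iff by blast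

lemma N_P: "N (P \<theta> \<phi>) = nrm \<theta> \<phi>"
proof -
  have "P \<theta> \<phi> - (P \<theta> \<phi> $ 3) *\<^sub>R ver = (R + r * cos \<theta>) *\<^sub>R hor \<phi>" unfolding nth_P P_eq by simp
  then have "(R / rad (P \<theta> \<phi>)) *\<^sub>R (P \<theta> \<phi> - (P \<theta> \<phi> $ 3) *\<^sub>R ver) = R *\<^sub>R hor \<phi>" using pos[of \<theta>] unfolding rad_P by simp
  then show ?thesis unfolding N_def using r(1) by (simp add: P_def)
qed

lemma e_P: "e (P \<theta> \<phi>) = hor' \<phi>"
  unfolding e_def rad_P nth_P hor'_def using pos[of \<theta>] by (simp add: scaleR_diff_right)

lemma rad_torus: "y \<in> T \<Longrightarrow> rad y \<noteq> 0"
  using rad_P pos torus_iff by (metis less_irrefl)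

lemma continuous_rad: "continuous_on S rad"
  unfolding rad_def by (intro continuous_intros)

lemma continuous_N: "continuous_on T N" and continuous_e: "continuous_on T e"
  unfolding N_def e_def using rad_torus r(1) by (auto intro!: continuous_intros continuous_rad)

lemma compact_torus: "compact T"
proof -
  have "norm (P \<theta> \<phi>) \<le> R + r" for \<theta> \<phi>
    unfolding P_def using norm_triangle_ineq[of "R *\<^sub>R hor \<phi>" "r *\<^sub>R nrm \<theta> \<phi>"] r by simp
  then have "bounded T" by (intro boundedI[of _ "R + r"]) (auto simp: torus_iff)
  moreover have "closed T"
    unfolding standard_torus_def by (intro closed_Collect_eq continuous_intros)
  ultimately show ?thesis by (simp add: compact_eq_bounded_closed)
qed

lemma derivative_P:
  assumes "(\<alpha> has_real_derivative a) (at t)" "(\<beta> has_real_derivative b) (at t)"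
  shows "((\<lambda>t. P (\<alpha> t) (\<beta> t)) has_vector_derivative (a * r) *\<^sub>R nrm' (\<alpha> t) (\<beta> t) + (b * (R + r * cos (\<alpha> t))) *\<^sub>R hor' (\<beta> t)) (at t)"
proof -
  have 1: "((\<lambda>t. R + r * cos (\<alpha> t)) has_real_derivative - r * sin (\<alpha> t) * a) (at t)"
    "((\<lambda>t. r * sin (\<alpha> t)) has_real_derivative r * cos (\<alpha> t) * a) (at t)"
    using assms by (auto intro!: derivative_eq_intros)
  have "((\<lambda>t. (R + r * cos (\<alpha> t)) *\<^sub>R hor (\<beta> t) + (r * sin (\<alpha> t)) *\<^sub>R ver) has_vector_derivative
      ((R + r * cos (\<alpha> t)) *\<^sub>R (b *\<^sub>R hor' (\<beta> t)) + (- r * sin (\<alpha> t) * a) *\<^sub>R hor (\<beta> t)) +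
      ((r * sin (\<alpha> t)) *\<^sub>R 0 + (r * cos (\<alpha> t) * a) *\<^sub>R ver)) (at t)"
    by (intro has_vector_derivative_add has_vector_derivative_scaleR 1 derivative_hor_comp assms has_vector_derivative_const)
  then show ?thesis unfolding P_eq nrm'_def by (simp add: algebra_simps)
qed

lemma tangent_space_torus: "tangent_space T (P \<theta> \<phi>) = {v. inner (nrm \<theta> \<phi>) v = 0}"
proof (intro equalityI subsetI)
  fix v assume v: "v \<in> tangent_space T (P \<theta> \<phi>)"
  define g :: "real ^ 3 \<Rightarrow> real" where "g y = (inner y y + R\<^sup>2 - r\<^sup>2)\<^sup>2 - 4 * R\<^sup>2 * ((y $ 1)\<^sup>2 + (y $ 2)\<^sup>2)" for y
  have g0: "g y = 0" if y: "y \<in> T" for y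
  proof -
    obtain \<alpha> \<beta> where y: "y = P \<alpha> \<beta>" using y torus_iff by blast
    show ?thesis unfolding y g_def inner_P nth_P polar_square by (simp add: power2_eq_square algebra_simps)
  qed
  let ?y = "P \<theta> \<phi>"
  define g' where "g' h = 4 * (inner ?y ?y + R\<^sup>2 - r\<^sup>2) * inner ?y h - 8 * R\<^sup>2 * (?y $ 1 * h $ 1 + ?y $ 2 * h $ 2)" for h
  have "(g has_derivative g') (at ?y)"
    unfolding g_def[abs_def] g'_def[abs_def]
    by (auto intro!: derivative_eq_intros bounded_linear.has_derivative[OF bounded_linear_vec_nth] simp: fun_eq_iff inner_commute algebra_simps)
  then have "g' v = 0" using tangent_space_kernel[OF v] g0 by blast
  moreover have "g' v = 8 * R * (R + r * cos \<theta>) * r * inner (nrm \<theta> \<phi>) v"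
    unfolding g'_def inner_P nth_P unfolding inner_3 nth_P nrm_def by (simp add: power2_eq_square algebra_simps)
  ultimately show "v \<in> {v. inner (nrm \<theta> \<phi>) v = 0}" using r pos[of \<theta>] by simp
next
  fix v assume "v \<in> {v. inner (nrm \<theta> \<phi>) v = 0}"
  then have v: "v = inner v (nrm' \<theta> \<phi>) *\<^sub>R nrm' \<theta> \<phi> + inner v (hor' \<phi>) *\<^sub>R hor' \<phi>"
    using normal_frame_decomposition[of v \<theta> \<phi>] by (simp add: inner_commute)
  define a b where "a = inner v (nrm' \<theta> \<phi>) / r" and "b = inner v (hor' \<phi>) / (R + r * cos \<theta>)"
  define c where "c t = P (\<theta> + a * t) (\<phi> + b * t)" for t
  have "(c has_vector_derivative (a * r) *\<^sub>R nrm' (\<theta> + a * 0) (\<phi> + b * 0) + (b * (R + r * cos (\<theta> + a * 0))) *\<^sub>R hor' (\<phi> + b * 0)) (at 0)"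
    unfolding c_def[abs_def] by (rule derivative_P) (auto intro!: derivative_eq_intros)
  also have "(a * r) *\<^sub>R nrm' (\<theta> + a * 0) (\<phi> + b * 0) + (b * (R + r * cos (\<theta> + a * 0))) *\<^sub>R hor' (\<phi> + b * 0) = v"
    unfolding a_def b_def using r pos[of \<theta>] by (subst (3) v) simp
  finally have "(c has_vector_derivative v) (at 0)" .
  moreover have "smooth_on {-1<..<1} c"
  proof -
    have lin: "smooth_on UNIV (\<lambda>t::real. x + y * t)" for x y :: real
      by (intro smooth_on_add smooth_on_const smooth_on_bounded_linear bounded_linear_mult_right) auto
    have "smooth_on UNIV c" unfolding c_def[abs_def] P_eq
      by (intro smooth_on_add smooth_on_scaleR smooth_on_const smooth_on_mult smooth_on_compose[OF _ open_UNIV _ lin smooth_on_sin_cos(1)]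
          smooth_on_compose[OF _ open_UNIV _ lin smooth_on_sin_cos(2)] smooth_on_compose[OF _ open_UNIV _ lin smooth_hor]) auto
    then show ?thesis by (rule smooth_on_subset) simp
  qed
  ultimately have "curve_in T (P \<theta> \<phi>) v c" unfolding curve_in_def using P_in by (auto intro!: exI[of _ 1] simp: c_def)
  then show "v \<in> tangent_space T (P \<theta> \<phi>)" unfolding tangent_space_def by blast
qed

end

definition bounded_lipschitz :: "('a::real_normed_vector \<Rightarrow> 'b::real_normed_vector) \<Rightarrow> bool" where
  "bounded_lipschitz f \<longleftrightarrow> (\<exists>B L. \<forall>x y. norm (f x) \<le> B \<and> norm (f x - f y) \<le> L * norm (x - y))"

lemma bounded_lipschitzI: "(\<And>x. norm (f x) \<le> B) \<Longrightarrow> (\<And>x y. norm (f x - f y) \<le> L * norm (x - y)) \<Longrightarrow> bounded_lipschitz f"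
  unfolding bounded_lipschitz_def by blast

lemma bounded_lipschitzD:
  assumes "bounded_lipschitz f"
  shows "\<exists>B L. 0 \<le> B \<and> 0 \<le> L \<and> (\<forall>x. norm (f x) \<le> B) \<and> (\<forall>x y. norm (f x - f y) \<le> L * norm (x - y))"
proof -
  obtain B L where *: "\<And>x y. norm (f x) \<le> B \<and> norm (f x - f y) \<le> L * norm (x - y)"
    using assms unfolding bounded_lipschitz_def by blast
  have "0 \<le> B" using *[of undefined undefined] norm_ge_zero[of "f undefined"] by linarith
  moreover have "norm (f x - f y) \<le> \<bar>L\<bar> * norm (x - y)" for x y
    using *[of x y] mult_right_mono[of L "\<bar>L\<bar>" "norm (x - y)"] by (meson abs_ge_self norm_ge_zero order_trans)
  ultimately show ?thesis using * by (intro exI[of _ B] exI[of _ "\<bar>L\<bar>"]) auto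
qed

lemma bounded_lipschitz_add:
  assumes "bounded_lipschitz f" "bounded_lipschitz g"
  shows "bounded_lipschitz (\<lambda>x. f x + g x)"
proof -
  obtain B L where f: "\<And>x. norm (f x) \<le> B" "\<And>x y. norm (f x - f y) \<le> L * norm (x - y)"
    using bounded_lipschitzD[OF assms(1)] by blast
  obtain C K where g: "\<And>x. norm (g x) \<le> C" "\<And>x y. norm (g x - g y) \<le> K * norm (x - y)"
    using bounded_lipschitzD[OF assms(2)] by blast
  show ?thesis
  proof (rule bounded_lipschitzI[of _ "B + C" "L + K"])
    show "norm (f x + g x) \<le> B + C" for x using norm_triangle_le[of "f x" "g x" "B + C"] f(1)[of x] g(1)[of x] by simp
    show "norm (f x + g x - (f y + g y)) \<le> (L + K) * norm (x - y)" for x y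
    proof -
      have "norm (f x + g x - (f y + g y)) \<le> norm (f x - f y) + norm (g x - g y)" by norm
      then show ?thesis using f(2)[of x y] g(2)[of x y] by (simp add: distrib_right)
    qed
  qed
qed

lemma bounded_lipschitz_bilinear:
  assumes B: "bounded_bilinear B" and fg: "bounded_lipschitz f" "bounded_lipschitz g"
  shows "bounded_lipschitz (\<lambda>x. B (f x) (g x))"
proof -
  obtain b L where f: "b \<ge> 0" "L \<ge> 0" "\<And>x. norm (f x) \<le> b" "\<And>x y. norm (f x - f y) \<le> L * norm (x - y)"
    using bounded_lipschitzD[OF fg(1)] by blast
  obtain c K where g: "c \<ge> 0" "K \<ge> 0" "\<And>x. norm (g x) \<le> c" "\<And>x y. norm (g x - g y) \<le> K * norm (x - y)"
    using bounded_lipschitzD[OF fg(2)] by blast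
  obtain M where M: "M \<ge> 0" "\<And>x y. norm (B x y) \<le> norm x * norm y * M"
    using bounded_bilinear.nonneg_bounded[OF B] by blast
  show ?thesis
  proof (rule bounded_lipschitzI[of _ "b * c * M" "(L * c + b * K) * M"])
    show "norm (B (f x) (g x)) \<le> b * c * M" for x
      by (rule order_trans[OF M(2)]) (intro mult_right_mono mult_mono f g M; simp)
    show "norm (B (f x) (g x) - B (f y) (g y)) \<le> (L * c + b * K) * M * norm (x - y)" for x y
    proof -
      have "B (f x) (g x) - B (f y) (g y) = B (f x - f y) (g x) + B (f y) (g x - g y)"
        by (simp add: bounded_bilinear.diff_left[OF B] bounded_bilinear.diff_right[OF B])
      also have "norm \<dots> \<le> norm (f x - f y) * norm (g x) * M + norm (f y) * norm (g x - g y) * M"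
        by (rule norm_triangle_le[OF add_mono[OF M(2) M(2)]])
      also have "\<dots> \<le> (L * norm (x - y)) * c * M + b * (K * norm (x - y)) * M"
        by (intro add_mono mult_right_mono mult_mono f g M) (auto simp: f g)
      finally show ?thesis by (simp add: algebra_simps)
    qed
  qed
qed

lemma bounded_lipschitz_const: "bounded_lipschitz (\<lambda>x. c)"
  by (rule bounded_lipschitzI[of _ "norm c" 0]) auto

lemma bounded_lipschitz_sin_cos:
  fixes l :: "'a::real_normed_vector \<Rightarrow> real"
  assumes "\<And>x y. \<bar>l x - l y\<bar> \<le> norm (x - y)"
  shows "bounded_lipschitz (\<lambda>x. sin (l x))" "bounded_lipschitz (\<lambda>x. cos (l x))"
proof -
  have s: "\<bar>sin a - sin b\<bar> \<le> \<bar>a - b\<bar>" for a b :: real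
    using field_differentiable_bound[of UNIV sin cos 1 a b] DERIV_sin by auto
  show 1: "bounded_lipschitz (\<lambda>x. sin (l x))"
    using order_trans[OF s assms] by (intro bounded_lipschitzI[of _ 1 1]) auto
  have c: "\<bar>cos a - cos b\<bar> \<le> \<bar>a - b\<bar>" for a b :: real using s[of "pi / 2 - a" "pi / 2 - b"] by (simp add: sin_diff)
  show "bounded_lipschitz (\<lambda>x. cos (l x))"
    using order_trans[OF c assms] by (intro bounded_lipschitzI[of _ 1 1]) auto
qed

lemma bounded_lipschitz_inverse:
  fixes f :: "'a::real_normed_vector \<Rightarrow> real"
  assumes "bounded_lipschitz f" "d > 0" "\<And>x. d \<le> f x"
  shows "bounded_lipschitz (\<lambda>x. inverse (f x))"
proof -
  obtain B L where f: "B \<ge> 0" "L \<ge> 0" "\<And>x. norm (f x) \<le> B" "\<And>x y. norm (f x - f y) \<le> L * norm (x - y)"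
    using bounded_lipschitzD[OF assms(1)] by blast
  have i: "\<bar>inverse (f x)\<bar> \<le> inverse d" for x
    using assms(2) assms(3)[of x] by (simp add: le_imp_inverse_le)
  show ?thesis
  proof (rule bounded_lipschitzI[of _ "inverse d" "inverse d * L * inverse d"])
    show "norm (inverse (f x)) \<le> inverse d" for x using i[of x] by simp
    show "norm (inverse (f x) - inverse (f y)) \<le> inverse d * L * inverse d * norm (x - y)" for x y
    proof -
      have "f x \<noteq> 0" "f y \<noteq> 0" using assms(2) assms(3)[of x] assms(3)[of y] by auto
      then have "inverse (f x) - inverse (f y) = - (inverse (f x) * (f x - f y) * inverse (f y))"
        by (rule inverse_diff_inverse)
      then have "norm (inverse (f x) - inverse (f y)) = \<bar>inverse (f x)\<bar> * norm (f x - f y) * \<bar>inverse (f y)\<bar>"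
        by (simp add: abs_mult)
      also have "\<dots> \<le> inverse d * (L * norm (x - y)) * inverse d"
        by (intro mult_mono i f) (use assms(2) f in auto)
      finally show ?thesis by (simp add: algebra_simps)
    qed
  qed
qed

context torus
begin

lemma torus_integral_curve:
  assumes X: "smooth_map_on T X" "\<And>x. x \<in> T \<Longrightarrow> inner (N x) (X x) = 0" and x: "x \<in> T"
  shows "\<exists>u. integral_curve T X u \<and> u 0 = x"
proof -
  note bl = bounded_lipschitz_add bounded_lipschitz_const bounded_lipschitz_bilinear[OF bounded_bilinear_scaleR]
    bounded_lipschitz_bilinear[OF bounded_bilinear_mult] bounded_lipschitz_bilinear[OF bounded_bilinear_inner]
  obtain L where L: "L \<ge> 0" "\<And>x y. x \<in> T \<Longrightarrow> y \<in> T \<Longrightarrow> norm (X x - X y) \<le> L * norm (x - y)"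
    by (rule lipschitz_on_compact[OF compact_torus X(1)]) auto
  have "continuous_on T X"
    by (intro lipschitz_on_continuous_on[of L] lipschitz_onI) (use L in \<open>auto simp: dist_norm\<close>)
  then have "bounded (X ` T)" using compact_torus compact_continuous_image compact_imp_bounded by blast
  then obtain B where B: "\<And>x. x \<in> T \<Longrightarrow> norm (X x) \<le> B" unfolding bounded_iff by blast
  have fs: "\<bar>fst z - fst y\<bar> \<le> norm (z - y)" "\<bar>snd z - snd y\<bar> \<le> norm (z - y)" for z y :: "real \<times> real"
    by (cases z; cases y; use norm_fst_le[of "fst z - fst y" "snd z - snd y"] norm_snd_le[of "snd z - snd y" "fst z - fst y"] in auto)+
  have t: "bounded_lipschitz (\<lambda>z::real \<times> real. sin (fst z))" "bounded_lipschitz (\<lambda>z::real \<times> real. cos (fst z))"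
    "bounded_lipschitz (\<lambda>z::real \<times> real. sin (snd z))" "bounded_lipschitz (\<lambda>z::real \<times> real. cos (snd z))"
    by (rule bounded_lipschitz_sin_cos; rule fs)+
  have w: "bounded_lipschitz (\<lambda>z::real \<times> real. R + r * cos (fst z))" by (intro bl t)
  have h: "bounded_lipschitz (\<lambda>z::real \<times> real. hor (snd z))" unfolding hor_def by (intro bl t)
  have "bounded_lipschitz (\<lambda>z::real \<times> real. cos (snd z) *\<^sub>R axis 2 1 + sin (snd z) *\<^sub>R (- axis 1 1) :: real ^ 3)" by (intro bl t)
  then have h': "bounded_lipschitz (\<lambda>z::real \<times> real. hor' (snd z))" unfolding hor'_def by simp
  have "bounded_lipschitz (\<lambda>z::real \<times> real. cos (fst z) *\<^sub>R ver + sin (fst z) *\<^sub>R ((- 1) *\<^sub>R hor (snd z)))" by (intro bl t h)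
  then have m: "bounded_lipschitz (\<lambda>z::real \<times> real. nrm' (fst z) (snd z))" unfolding nrm'_def by simp
  have "bounded_lipschitz (\<lambda>z::real \<times> real. P (fst z) (snd z))" unfolding P_eq by (intro bl t h w)
  then obtain C K where K: "\<And>z y :: real \<times> real. norm (P (fst z) (snd z) - P (fst y) (snd y)) \<le> K * norm (z - y)"
    using bounded_lipschitzD by blast
  have XP: "bounded_lipschitz (\<lambda>z. X (P (fst z) (snd z)))"
  proof (rule bounded_lipschitzI[of _ B "L * K"])
    show "norm (X (P (fst z) (snd z))) \<le> B" for z by (rule B[OF P_in])
    show "norm (X (P (fst z) (snd z)) - X (P (fst y) (snd y))) \<le> L * K * norm (z - y)" for z y
      unfolding mult.assoc by (rule order_trans[OF L(2)[OF P_in P_in] mult_left_mono[OF K L(1)]])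
  qed
  \<comment> \<open>The lift of \<open>X\<close> to the plane of the two angles, which is globally Lipschitz.\<close>
  define F1 F2 where "F1 z = inner (X (P (fst z) (snd z))) (nrm' (fst z) (snd z)) * (1 / r)"
    and "F2 z = inner (X (P (fst z) (snd z))) (hor' (snd z)) * inverse (R + r * cos (fst z))" for z :: "real \<times> real"
  have "R - r \<le> R + r * cos \<theta>" for \<theta> using r mult_left_mono[of "- 1" "cos \<theta>" r] by simp
  then have "bounded_lipschitz (\<lambda>z::real \<times> real. inverse (R + r * cos (fst z)))"
    by (intro bounded_lipschitz_inverse[OF w, of "R - r"]) (use r in auto)
  then have F: "bounded_lipschitz F1" "bounded_lipschitz F2" unfolding F1_def F2_def by (intro bl t XP m h'; assumption)+
  obtain L1 where L1: "\<And>z y. norm (F1 z - F1 y) \<le> L1 * norm (z - y)" using bounded_lipschitzD[OF F(1)] by blast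
  obtain L2 where L2: "\<And>z y. norm (F2 z - F2 y) \<le> L2 * norm (z - y)" using bounded_lipschitzD[OF F(2)] by blast
  have "norm ((F1 z, F2 z) - (F1 y, F2 y)) \<le> (L1 + L2) * norm (z - y)" for z y
    using norm_Pair_le[of "F1 z - F1 y" "F2 z - F2 y"] L1[of z y] L2[of z y] by (simp add: distrib_right)
  obtain \<theta> \<phi> where x: "x = P \<theta> \<phi>" using x torus_iff by blast
  obtain z where z: "z 0 = (\<theta>, \<phi>)" "\<And>t. (z has_vector_derivative (F1 (z t), F2 (z t))) (at t)"
    using picard_lindelof[of "\<lambda>z. (F1 z, F2 z)" "L1 + L2" "(\<theta>, \<phi>)"]
      \<open>\<And>y z. norm ((F1 z, F2 z) - (F1 y, F2 y)) \<le> (L1 + L2) * norm (z - y)\<close> by blast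
  define u where "u t = P (fst (z t)) (snd (z t))" for t
  have "(u has_vector_derivative X (u t)) (at t)" for t
  proof -
    let ?\<theta> = "fst (z t)" and ?\<phi> = "snd (z t)"
    have "((\<lambda>t. fst (z t)) has_real_derivative F1 (z t)) (at t)" "((\<lambda>t. snd (z t)) has_real_derivative F2 (z t)) (at t)"
      unfolding has_real_derivative_iff_has_vector_derivative
      using bounded_linear.has_vector_derivative[OF bounded_linear_fst z(2)] bounded_linear.has_vector_derivative[OF bounded_linear_snd z(2)] by simp_all
    then have "(u has_vector_derivative (F1 (z t) * r) *\<^sub>R nrm' ?\<theta> ?\<phi> + (F2 (z t) * (R + r * cos ?\<theta>)) *\<^sub>R hor' ?\<phi>) (at t)"
      unfolding u_def[abs_def] by (rule derivative_P)
    moreover have "F1 (z t) * r = inner (X (u t)) (nrm' ?\<theta> ?\<phi>)" "F2 (z t) * (R + r * cos ?\<theta>) = inner (X (u t)) (hor' ?\<phi>)"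
      unfolding F1_def F2_def u_def using r pos[of ?\<theta>] by simp_all
    moreover have "inner (X (u t)) (nrm' ?\<theta> ?\<phi>) *\<^sub>R nrm' ?\<theta> ?\<phi> + inner (X (u t)) (hor' ?\<phi>) *\<^sub>R hor' ?\<phi> = X (u t)"
      using normal_frame_decomposition[of "X (u t)" ?\<theta> ?\<phi>] X(2)[OF P_in, of ?\<theta> ?\<phi>] N_P[of ?\<theta> ?\<phi>]
      unfolding u_def by (simp add: inner_commute)
    ultimately show ?thesis by (simp only:)
  qed
  then have "integral_curve T X u" unfolding integral_curve_def using P_in by (simp add: u_def)
  moreover have "u 0 = x" unfolding u_def z(1) x by simp
  ultimately show ?thesis by blast
qed

end

locale torus_distance = torus +
  fixes p :: "real ^ 3" and X
  assumes adapted: "adapted_pseudo_gradient (standard_torus R r) (\<lambda>y. (norm (y - p))\<^sup>2) X"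
    and smale_cond: "smale_condition (standard_torus R r) (\<lambda>y. (norm (y - p))\<^sup>2) X"
begin

definition f where "f y = (norm (y - p))\<^sup>2" for y

lemma f_derivative': "(f has_derivative inner (2 *\<^sub>R (y - p))) (at y)"
  unfolding f_def[abs_def] by (rule derivative_norm_square)

lemma adapted_f: "adapted_pseudo_gradient T f X" "smale_condition T f X"
  using adapted smale_cond unfolding f_def[abs_def] .

lemma surface_flow: "surface_flow T f (\<lambda>y. 2 *\<^sub>R (y - p)) X N"
proof -
  have tan: "tangent_space T y = {v. inner (N y) v = 0}" if "y \<in> T" for y
    using that tangent_space_torus N_P unfolding torus_iff by auto
  show ?thesis
  proof (rule adapted_surface_flow[OF compact_torus adapted_f f_derivative' _ continuous_N _ tan])
    show "\<exists>u. integral_curve T X u \<and> u 0 = y" if "y \<in> T" for y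
    proof (rule torus_integral_curve[OF _ _ that])
      show "smooth_map_on T X" using adapted_f(1) unfolding adapted_pseudo_gradient_def by (rule conjunct1)
      show "inner (N y) (X y) = 0" if "y \<in> T" for y
      proof -
        have "X y \<in> tangent_space T y" using adapted_f(1) that unfolding adapted_pseudo_gradient_def by blast
        then show ?thesis unfolding tan[OF that] by blast
      qed
    qed
    show "norm (N y) = 1" if "y \<in> T" for y using that N_P unfolding torus_iff by auto
  qed
qed

sublocale surface_flow T f "\<lambda>y. 2 *\<^sub>R (y - p)" X N by (rule surface_flow)

lemma crit_eq: "crit = critical_points T f"
  unfolding crit_def adapted_critical_points[OF adapted_f(1) f_derivative'] ..

lemma finite_crit: "finite crit"
  unfolding crit_def by (rule finite_zeros)

lemma crit_iff: "P \<theta> \<phi> \<in> crit \<longleftrightarrow> inner p (hor' \<phi>) = 0 \<and> inner (p - R *\<^sub>R hor \<phi>) (nrm' \<theta> \<phi>) = 0"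
proof -
  let ?d = "P \<theta> \<phi> - p"
  have "P \<theta> \<phi> \<in> crit \<longleftrightarrow> (\<forall>v. inner (nrm \<theta> \<phi>) v = 0 \<longrightarrow> inner ?d v = 0)"
    unfolding crit_eq critical_points_eq[OF f_derivative'] tangent_space_torus using P_in
    by (simp add: tangent_space_torus)
  also have "\<dots> \<longleftrightarrow> inner ?d (hor' \<phi>) = 0 \<and> inner ?d (nrm' \<theta> \<phi>) = 0"
  proof
    assume *: "inner ?d (hor' \<phi>) = 0 \<and> inner ?d (nrm' \<theta> \<phi>) = 0"
    show "\<forall>v. inner (nrm \<theta> \<phi>) v = 0 \<longrightarrow> inner ?d v = 0"
    proof (intro allI impI)
      fix v assume "inner (nrm \<theta> \<phi>) v = 0"
      then have "v = inner v (nrm' \<theta> \<phi>) *\<^sub>R nrm' \<theta> \<phi> + inner v (hor' \<phi>) *\<^sub>R hor' \<phi>"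
        using normal_frame_decomposition[of v \<theta> \<phi>] by (simp add: inner_commute)
      then have "inner ?d v = inner ?d (inner v (nrm' \<theta> \<phi>) *\<^sub>R nrm' \<theta> \<phi> + inner v (hor' \<phi>) *\<^sub>R hor' \<phi>)" by (rule arg_cong)
      then show "inner ?d v = 0" using * by (simp only: inner_add_right inner_scaleR_right)
    qed
  qed auto
  also have "inner ?d (hor' \<phi>) = - inner p (hor' \<phi>)" by (simp add: P_def inner_simps)
  also have "inner ?d (nrm' \<theta> \<phi>) = - inner (p - R *\<^sub>R hor \<phi>) (nrm' \<theta> \<phi>)" by (simp add: P_def inner_simps)
  finally show ?thesis by simp
qed

text \<open>If \<open>p\<close> lay on the axis or on the core circle, there would be a whole circle of critical points,
  but critical points are isolated.\<close>

lemma crit_off_axis: "P \<theta> \<phi> \<in> crit \<Longrightarrow> inner p (hor \<phi>) \<noteq> 0"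
proof
  assume c: "P \<theta> \<phi> \<in> crit" and 0: "inner p (hor \<phi>) = 0"
  have h: "inner p (hor \<psi>) = 0" "inner p (hor' \<psi>) = 0" for \<psi>
    using c 0 unfolding crit_iff hor_add[of \<phi> "\<psi> - \<phi>", simplified] hor'_add[of \<phi> "\<psi> - \<phi>", simplified]
    by (simp_all add: inner_simps)
  have n: "inner (p - R *\<^sub>R hor \<psi>) (nrm' \<theta> \<psi>) = cos \<theta> * inner p ver + R * sin \<theta>" for \<psi>
    unfolding nrm'_def by (simp add: inner_simps h)
  have "P \<theta> \<psi> \<in> crit" for \<psi> using c unfolding crit_iff n h(2) by blast
  then have "finite (P \<theta> ` {0..pi})" by (intro finite_subset[OF _ finite_crit]) blast
  moreover have "inj_on (P \<theta>) {0..pi}"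
  proof (rule inj_onI)
    fix a b assume ab: "a \<in> {0..pi}" "b \<in> {0..pi}" "P \<theta> a = P \<theta> b"
    have "cos a = cos b" using arg_cong[OF ab(3), of "\<lambda>v. v $ 1"] pos[of \<theta>] unfolding nth_P by simp
    then show "a = b" using ab cos_inj_pi[of a b] by simp
  qed
  ultimately show False using finite_imageD infinite_Icc[OF pi_gt_zero] by blast
qed

lemma crit_off_core: "P \<theta> \<phi> \<in> crit \<Longrightarrow> inner (p - R *\<^sub>R hor \<phi>) (nrm \<theta> \<phi>) \<noteq> 0"
proof
  assume c: "P \<theta> \<phi> \<in> crit" and 0: "inner (p - R *\<^sub>R hor \<phi>) (nrm \<theta> \<phi>) = 0"
  have "inner (p - R *\<^sub>R hor \<phi>) (hor' \<phi>) = 0" using c unfolding crit_iff by (simp add: inner_simps)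
  then have "p - R *\<^sub>R hor \<phi> = 0"
    using normal_frame_decomposition[of "p - R *\<^sub>R hor \<phi>" \<theta> \<phi>] c 0 unfolding crit_iff by simp
  then have "P \<alpha> \<phi> \<in> crit" for \<alpha> using c unfolding crit_iff by simp
  then have "finite ((\<lambda>\<alpha>. P \<alpha> \<phi>) ` {- (pi / 2)..pi / 2})" by (intro finite_subset[OF _ finite_crit]) blast
  moreover have "inj_on (\<lambda>\<alpha>. P \<alpha> \<phi>) {- (pi / 2)..pi / 2}"
  proof (rule inj_onI)
    fix a b assume ab: "a \<in> {- (pi / 2)..pi / 2}" "b \<in> {- (pi / 2)..pi / 2}" "P a \<phi> = P b \<phi>"
    have "sin a = sin b" using arg_cong[OF ab(3), of "\<lambda>v. v $ 3"] r unfolding nth_P by simp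
    then show "a = b" using ab sin_inj_pi[of a b] by simp
  qed
  ultimately show False using finite_imageD infinite_Icc[of "- (pi / 2)" "pi / 2"] by fastforce
qed

text \<open>The plane through \<open>p\<close> and the axis cuts the core circle in the two points \<open>core c\<close> and the torus in
  the circles around them; \<open>c = 1\<close> means the side of \<open>p\<close>. On each of these circles the nearest (\<open>s = 1\<close>)
  and the farthest (\<open>s = - 1\<close>) point from \<open>p\<close> are critical.\<close>

definition core where "core c = (c * R / rad p) *\<^sub>R (p - (p $ 3) *\<^sub>R ver)"

definition pt where "pt c s = core c + (s * r / norm (p - core c)) *\<^sub>R (p - core c)"

definition type where "type c s \<theta> \<phi> \<longleftrightarrow> P \<theta> \<phi> \<in> crit \<and> sgn (inner p (hor \<phi>)) = c \<and>
  sgn (inner (p - R *\<^sub>R hor \<phi>) (nrm \<theta> \<phi>)) = s"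

lemma type_core:
  assumes "type c s \<theta> \<phi>"
  shows "R *\<^sub>R hor \<phi> = core c" "p - core c = (s * norm (p - core c)) *\<^sub>R nrm \<theta> \<phi>" "norm (p - core c) > 0"
    "inner p (hor \<phi>) = c * rad p" "rad p > 0"
proof -
  let ?k = "inner p (hor \<phi>)" and ?l = "inner (p - R *\<^sub>R hor \<phi>) (nrm \<theta> \<phi>)"
  have t: "P \<theta> \<phi> \<in> crit" "sgn ?k = c" "sgn ?l = s" using assms unfolding type_def by auto
  note c = t(1)[unfolded crit_iff]
  have rad: "rad p = \<bar>?k\<bar>" using rad_eq c by blast
  have k: "?k \<noteq> 0" using crit_off_axis[OF t(1)] .
  show "rad p > 0" "inner p (hor \<phi>) = c * rad p" using rad k t(2) by (auto simp: sgn_mult_abs)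
  have "p - (p $ 3) *\<^sub>R ver = ?k *\<^sub>R hor \<phi>" using frame_decomposition[of p \<phi>] c by (simp add: algebra_simps)
  then have "core c = (c * R / rad p * ?k) *\<^sub>R hor \<phi>" unfolding core_def by simp
  also have "c * R / rad p * ?k = R" using k unfolding rad t(2)[symmetric] by (simp add: sgn_if)
  finally show core: "R *\<^sub>R hor \<phi> = core c" ..
  have "inner (p - R *\<^sub>R hor \<phi>) (hor' \<phi>) = 0" using c by (simp add: inner_simps)
  then have d: "p - R *\<^sub>R hor \<phi> = ?l *\<^sub>R nrm \<theta> \<phi>"
    using normal_frame_decomposition[of "p - R *\<^sub>R hor \<phi>" \<theta> \<phi>] c by simp
  then have "norm (p - R *\<^sub>R hor \<phi>) = \<bar>?l\<bar>" by (metis norm_scaleR norm_nrm(1) mult.right_neutral)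
  then have n: "norm (p - core c) = \<bar>?l\<bar>" unfolding core .
  show "norm (p - core c) > 0" unfolding n using crit_off_core[OF t(1)] by simp
  have "s * norm (p - core c) = ?l" unfolding n t(3)[symmetric] by (rule sgn_mult_abs)
  then show "p - core c = (s * norm (p - core c)) *\<^sub>R nrm \<theta> \<phi>" using d unfolding core by simp
qed

lemma sgn_cases: "x \<noteq> 0 \<Longrightarrow> sgn x = 1 \<or> sgn x = (- 1 :: real)"
  by (simp add: sgn_if)

lemma type_pt:
  assumes "type c s \<theta> \<phi>"
  shows "P \<theta> \<phi> = pt c s"
proof -
  have "s = 1 \<or> s = - 1" using assms crit_off_core sgn_cases unfolding type_def by metis
  then have "s * s = 1" by auto
  have "pt c s = R *\<^sub>R hor \<phi> + (s * r / norm (p - core c) * (s * norm (p - core c))) *\<^sub>R nrm \<theta> \<phi>"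
    unfolding pt_def type_core(1)[OF assms] by (subst (2) type_core(2)[OF assms]) simp
  also have "s * r / norm (p - core c) * (s * norm (p - core c)) = s * s * r" using type_core(3)[OF assms] by simp
  finally show ?thesis using \<open>s * s = 1\<close> unfolding P_def by simp
qed

lemma type_exists:
  assumes cs: "c = 1 \<or> c = - 1" "s = 1 \<or> s = - 1"
  shows "\<exists>\<theta> \<phi>. type c s \<theta> \<phi>"
proof -
  obtain \<rho> \<phi>0 where \<rho>: "\<rho> \<ge> 0" "p $ 1 = \<rho> * cos \<phi>0" "p $ 2 = \<rho> * sin \<phi>0" by (rule polar_nonneg)
  have "\<exists>\<phi>. hor \<phi> = c *\<^sub>R hor \<phi>0" using cs(1) hor_add_pi(1)[of \<phi>0] by (elim disjE) auto
  then obtain \<phi> where \<phi>: "hor \<phi> = c *\<^sub>R hor \<phi>0" ..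
  have p0: "p = \<rho> *\<^sub>R hor \<phi>0 + (p $ 3) *\<^sub>R ver" using \<rho> by (simp add: Finite_Cartesian_Product.vec_eq_iff forall_3)
  have p: "p = (c * \<rho>) *\<^sub>R hor \<phi> + (p $ 3) *\<^sub>R ver" using cs(1) by (subst p0) (auto simp: \<phi>)
  obtain d \<theta>0 where d: "d \<ge> 0" "c * \<rho> - R = d * cos \<theta>0" "p $ 3 = d * sin \<theta>0" by (rule polar_nonneg)
  have "\<exists>\<theta>. cos \<theta> = s * cos \<theta>0 \<and> sin \<theta> = s * sin \<theta>0"
    using cs(2) by (elim disjE) (auto intro: exI[of _ \<theta>0] exI[of _ "\<theta>0 + pi"])
  then obtain \<theta> where \<theta>: "cos \<theta> = s * cos \<theta>0" "sin \<theta> = s * sin \<theta>0" by blast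
  have ss: "s * s = 1" "s * (s * x) = x" for x using cs(2) by auto
  have "c * \<rho> - R = s * d * cos \<theta>" "p $ 3 = s * d * sin \<theta>" unfolding d(2,3) \<theta> using cs(2) by auto
  then have n: "p - R *\<^sub>R hor \<phi> = (s * d) *\<^sub>R nrm \<theta> \<phi>"
    by (subst p) (simp add: nrm_def scaleR_add_right flip: scaleR_diff_left)
  have k: "inner p (hor \<phi>) = c * \<rho>" "inner p (hor' \<phi>) = 0" by (subst p, simp add: inner_simps)+
  have c: "P \<theta> \<phi> \<in> crit" unfolding crit_iff n k(2) by simp
  have "c * \<rho> \<noteq> 0" using crit_off_axis[OF c] unfolding k .
  moreover have "s * d \<noteq> 0" using crit_off_core[OF c] unfolding n by simp
  ultimately have "sgn (inner p (hor \<phi>)) = c" "sgn (inner (p - R *\<^sub>R hor \<phi>) (nrm \<theta> \<phi>)) = s"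
    unfolding k n using cs \<rho>(1) d(1) by (auto simp: sgn_mult)
  then show ?thesis using c unfolding type_def by blast
qed

lemma crit_types: "crit = {pt 1 1, pt 1 (- 1), pt (- 1) 1, pt (- 1) (- 1)}"
proof (intro equalityI subsetI)
  fix y assume y: "y \<in> crit"
  then obtain \<theta> \<phi> where P: "y = P \<theta> \<phi>" unfolding crit_def torus_iff by blast
  let ?c = "sgn (inner p (hor \<phi>))" and ?s = "sgn (inner (p - R *\<^sub>R hor \<phi>) (nrm \<theta> \<phi>))"
  have "type ?c ?s \<theta> \<phi>" using y unfolding P type_def by simp
  then have "y = pt ?c ?s" unfolding P by (rule type_pt)
  moreover have "?c = 1 \<or> ?c = - 1" using crit_off_axis y P sgn_cases by blast
  moreover have "?s = 1 \<or> ?s = - 1" using crit_off_core y P sgn_cases by blast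
  ultimately show "y \<in> {pt 1 1, pt 1 (- 1), pt (- 1) 1, pt (- 1) (- 1)}" by auto
next
  have "pt c s \<in> crit" if cs: "c = 1 \<or> c = - 1" "s = 1 \<or> s = - 1" for c s
  proof -
    obtain \<theta> \<phi> where t: "type c s \<theta> \<phi>" using type_exists[OF cs] by blast
    show ?thesis using t unfolding type_pt[OF t, symmetric] type_def by blast
  qed
  then show "y \<in> crit" if "y \<in> {pt 1 1, pt 1 (- 1), pt (- 1) 1, pt (- 1) (- 1)}" for y using that by auto
qed

end

context torus_distance
begin

lemma f_rotate:
  assumes "P \<theta> \<phi> \<in> crit"
  shows "f (P \<theta> (\<phi> + t)) = f (P \<theta> \<phi>) + 2 * (R + r * cos \<theta>) * inner p (hor \<phi>) * (1 - cos t)"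
proof -
  have 0: "inner p (hor' \<phi>) = 0" using assms unfolding crit_iff by blast
  have e: "f (P \<theta> \<psi>) = inner (P \<theta> \<psi>) (P \<theta> \<psi>) + inner p p - 2 * inner p (P \<theta> \<psi>)" for \<psi>
    unfolding f_def power2_norm_eq_inner by (simp add: inner_diff_left inner_diff_right inner_commute)
  have i: "inner p (P \<theta> \<psi>) = (R + r * cos \<theta>) * inner p (hor \<psi>) + r * sin \<theta> * inner p ver" for \<psi>
    unfolding P_eq by (simp add: inner_simps)
  show ?thesis unfolding e inner_P i hor_add by (simp add: inner_simps 0 algebra_simps)
qed

lemma f_P: "f (P \<theta> \<phi>) = (norm (p - R *\<^sub>R hor \<phi>))\<^sup>2 + r\<^sup>2 - 2 * r * inner (p - R *\<^sub>R hor \<phi>) (nrm \<theta> \<phi>)"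
proof -
  have P: "P \<theta> \<phi> - p = r *\<^sub>R nrm \<theta> \<phi> - (p - R *\<^sub>R hor \<phi>)" unfolding P_def by simp
  have *: "(norm (a - d))\<^sup>2 = (norm d)\<^sup>2 + (norm a)\<^sup>2 - 2 * inner d a" for a d :: "real ^ 3"
    unfolding power2_norm_eq_inner by (simp add: inner_diff_left inner_diff_right inner_commute)
  show ?thesis unfolding f_def P * by simp
qed

lemma f_tilt:
  assumes "P \<theta> \<phi> \<in> crit"
  shows "f (P (\<theta> + t) \<phi>) = f (P \<theta> \<phi>) + 2 * r * inner (p - R *\<^sub>R hor \<phi>) (nrm \<theta> \<phi>) * (1 - cos t)"
  using assms unfolding f_P nrm_add inner_add_right inner_scaleR_right crit_iff by (simp add: algebra_simps)

lemma small_step: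
  fixes g :: "real \<Rightarrow> real ^ 3"
  assumes "isCont g 0" "\<delta> > 0"
  shows "\<exists>t. 0 < 1 - cos t \<and> dist (g t) (g 0) < \<delta>"
proof -
  have "\<forall>\<^sub>F t in at_right 0. dist (g t) (g 0) < \<delta>"
    using tendstoD[OF assms(1)[unfolded isCont_def] assms(2)] by (rule filter_leD[OF at_le, rotated]) simp
  moreover have "\<forall>\<^sub>F t::real in at_right 0. t < pi" by (rule eventually_at_rightI[of 0 pi]) auto
  moreover have "\<forall>\<^sub>F t::real in at_right 0. t > 0" by (rule eventually_at_right_less)
  ultimately have "\<forall>\<^sub>F t in at_right 0. 0 < t \<and> t < pi \<and> dist (g t) (g 0) < \<delta>" by eventually_elim auto
  then obtain t where t: "0 < t" "t < pi" "dist (g t) (g 0) < \<delta>"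
    using eventually_happens'[OF trivial_limit_at_right_real] by blast
  then have "cos t < 1" using cos_monotone_0_pi[of 0 t] by simp
  then show ?thesis using t by force
qed

lemma continuous_P: "isCont (\<lambda>t. P \<theta> (\<phi> + t)) 0" "isCont (\<lambda>t. P (\<theta> + t) \<phi>) 0"
  unfolding P_eq hor_def by (intro continuous_intros)+

lemma saddle_index:
  assumes t: "type c s \<theta> \<phi>" and cs: "c = 1 \<and> s = - 1 \<or> c = - 1 \<and> s = 1"
  shows "morse_index T f (pt c s) = 1"
proof -
  let ?k = "inner p (hor \<phi>)" and ?l = "inner (p - R *\<^sub>R hor \<phi>) (nrm \<theta> \<phi>)"
  have c: "P \<theta> \<phi> \<in> crit" "sgn ?k = c" "sgn ?l = s" using t unfolding type_def by auto
  have rot: "\<exists>y\<in>T. dist y (P \<theta> \<phi>) < e \<and> (?k > 0 \<longrightarrow> f y > f (P \<theta> \<phi>)) \<and> (?k < 0 \<longrightarrow> f y < f (P \<theta> \<phi>))" if "e > 0" for e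
  proof -
    obtain t where t: "0 < 1 - cos t" "dist (P \<theta> (\<phi> + t)) (P \<theta> \<phi>) < e" using small_step[OF continuous_P(1) \<open>e > 0\<close>, of \<theta> \<phi>] by auto
    have "0 < 2 * (R + r * cos \<theta>) * (1 - cos t)" using pos[of \<theta>] t(1) by simp
    then have "?k > 0 \<longrightarrow> 2 * (R + r * cos \<theta>) * (1 - cos t) * ?k > 0" "?k < 0 \<longrightarrow> 2 * (R + r * cos \<theta>) * (1 - cos t) * ?k < 0"
      by (simp_all only: zero_less_mult_iff mult_less_0_iff) auto
    then show ?thesis using t(2) P_in[of \<theta> "\<phi> + t"] by (intro bexI[of _ "P \<theta> (\<phi> + t)"]) (auto simp: f_rotate[OF c(1)] mult.assoc mult.commute[of ?k])
  qed
  have tilt: "\<exists>y\<in>T. dist y (P \<theta> \<phi>) < e \<and> (?l > 0 \<longrightarrow> f y > f (P \<theta> \<phi>)) \<and> (?l < 0 \<longrightarrow> f y < f (P \<theta> \<phi>))" if "e > 0" for e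
  proof -
    obtain t where t: "0 < 1 - cos t" "dist (P (\<theta> + t) \<phi>) (P \<theta> \<phi>) < e" using small_step[OF continuous_P(2) \<open>e > 0\<close>, of \<theta> \<phi>] by auto
    have "0 < 2 * r * (1 - cos t)" using r t(1) by simp
    then have "?l > 0 \<longrightarrow> 2 * r * (1 - cos t) * ?l > 0" "?l < 0 \<longrightarrow> 2 * r * (1 - cos t) * ?l < 0"
      by (simp_all only: zero_less_mult_iff mult_less_0_iff) auto
    then show ?thesis using t(2) P_in[of "\<theta> + t" \<phi>] by (intro bexI[of _ "P (\<theta> + t) \<phi>"]) (auto simp: f_tilt[OF c(1)] mult.assoc mult.commute[of ?l])
  qed
  have "?k > 0 \<and> ?l < 0 \<or> ?k < 0 \<and> ?l > 0" using cs c(2,3) by (metis sgn_1_neg sgn_1_pos)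
  then have "morse_index T f (P \<theta> \<phi>) = 1"
    by (intro index_saddle[OF c(1)]) (meson rot tilt)+
  then show ?thesis unfolding type_pt[OF t] .
qed

lemma inner_hor_le: "inner p (hor \<phi>) \<le> rad p" "- rad p \<le> inner p (hor \<phi>)"
proof -
  define q where "q = p - (p $ 3) *\<^sub>R ver"
  have "inner p (hor \<phi>) = inner q (hor \<phi>)" unfolding q_def by (simp add: inner_simps)
  moreover have "norm q = rad p" unfolding rad_def norm_eq_sqrt_inner q_def by (simp add: inner_3 power2_eq_square)
  ultimately show "inner p (hor \<phi>) \<le> rad p" "- rad p \<le> inner p (hor \<phi>)"
    using Cauchy_Schwarz_ineq2[of q "hor \<phi>"] by auto
qed

lemma core_dist: "(norm (p - R *\<^sub>R hor \<phi>))\<^sup>2 = (norm p)\<^sup>2 + R\<^sup>2 - 2 * R * inner p (hor \<phi>)"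
  unfolding power2_norm_eq_inner by (simp add: inner_diff_left inner_diff_right inner_commute power2_eq_square)

lemma norm_P: "f (P \<theta> \<phi>) = (norm (P \<theta> \<phi> - p))\<^sup>2" "norm (P \<theta> \<phi> - p) \<le> norm (p - R *\<^sub>R hor \<phi>) + r"
  "norm (p - R *\<^sub>R hor \<phi>) - r \<le> norm (P \<theta> \<phi> - p)"
proof -
  show "f (P \<theta> \<phi>) = (norm (P \<theta> \<phi> - p))\<^sup>2" by (simp add: f_def)
  have "P \<theta> \<phi> - p = r *\<^sub>R nrm \<theta> \<phi> - (p - R *\<^sub>R hor \<phi>)" unfolding P_def by simp
  moreover have "norm (r *\<^sub>R nrm \<theta> \<phi>) = r" using r by simp
  ultimately show "norm (P \<theta> \<phi> - p) \<le> norm (p - R *\<^sub>R hor \<phi>) + r" "norm (p - R *\<^sub>R hor \<phi>) - r \<le> norm (P \<theta> \<phi> - p)"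
    using norm_triangle_ineq4[of "r *\<^sub>R nrm \<theta> \<phi>" "p - R *\<^sub>R hor \<phi>"] norm_triangle_ineq2[of "p - R *\<^sub>R hor \<phi>" "r *\<^sub>R nrm \<theta> \<phi>"]
    by (simp_all only: norm_minus_commute[of "p - R *\<^sub>R hor \<phi>"])
qed

lemma core_gap: "r \<le> norm (P \<theta> \<phi> - R *\<^sub>R hor \<psi>)"
proof (rule power2_le_imp_le)
  have i: "inner (hor \<phi>) (hor \<psi>) \<le> 1" using Cauchy_Schwarz_ineq2[of "hor \<phi>" "hor \<psi>"] by simp
  have "inner (P \<theta> \<phi>) (hor \<psi>) = (R + r * cos \<theta>) * inner (hor \<phi>) (hor \<psi>)" unfolding P_eq by (simp add: inner_simps)
  then have "(norm (P \<theta> \<phi> - R *\<^sub>R hor \<psi>))\<^sup>2 = r\<^sup>2 + 2 * R * (R + r * cos \<theta>) * (1 - inner (hor \<phi>) (hor \<psi>))"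
    unfolding power2_norm_eq_inner
    by (simp add: inner_diff_left inner_diff_right inner_commute[of "hor \<psi>"] inner_P power2_eq_square algebra_simps)
  moreover have "0 \<le> 2 * R * (R + r * cos \<theta>) * (1 - inner (hor \<phi>) (hor \<psi>))"
    using i pos[of \<theta>] r by (intro mult_nonneg_nonneg) auto
  ultimately show "r\<^sup>2 \<le> (norm (P \<theta> \<phi> - R *\<^sub>R hor \<psi>))\<^sup>2" by simp
qed simp

lemma minimum_index:
  assumes t: "type 1 1 \<theta> \<phi>"
  shows "morse_index T f (pt 1 1) = 0"
proof -
  let ?D = "norm (p - core 1)"
  have c: "P \<theta> \<phi> \<in> crit" using t unfolding type_def by auto
  have v: "f (P \<theta> \<phi>) = (?D - r)\<^sup>2"
  proof -
    have "inner (p - core 1) (nrm \<theta> \<phi>) = ?D" by (subst type_core(2)[OF t]) simp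
    then show ?thesis unfolding f_P type_core(1)[OF t] by (simp add: power2_diff)
  qed
  have "f (P \<theta> \<phi>) \<le> f y" if "y \<in> T" for y
  proof -
    obtain \<alpha> \<beta> where y: "y = P \<alpha> \<beta>" using \<open>y \<in> T\<close> torus_iff by blast
    have "?D\<^sup>2 \<le> (norm (p - R *\<^sub>R hor \<beta>))\<^sup>2"
      using inner_hor_le(1)[of \<beta>] type_core(4)[OF t] r
      unfolding type_core(1)[OF t, symmetric] core_dist by simp
    then have "?D \<le> norm (p - R *\<^sub>R hor \<beta>)" by (rule power2_le_imp_le) simp
    then have 1: "?D - r \<le> norm (y - p)" using norm_P(3)[of \<beta> \<alpha>] unfolding y by simp
    have "r \<le> norm (y - core 1)" unfolding y type_core(1)[OF t, symmetric] by (rule core_gap)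
    also have "\<dots> \<le> norm (y - p) + ?D" using norm_triangle_ineq[of "y - p" "p - core 1"] by simp
    finally have "\<bar>?D - r\<bar> \<le> \<bar>norm (y - p)\<bar>" using 1 by simp
    then show ?thesis unfolding v unfolding f_def by (rule abs_le_square_iff[THEN iffD1])
  qed
  then show ?thesis using index_minimum[OF c] unfolding type_pt[OF t] by blast
qed

lemma maximum_index:
  assumes t: "type (- 1) (- 1) \<theta> \<phi>"
  shows "morse_index T f (pt (- 1) (- 1)) = 2"
proof -
  let ?D = "norm (p - core (- 1))"
  have c: "P \<theta> \<phi> \<in> crit" using t unfolding type_def by auto
  have v: "f (P \<theta> \<phi>) = (?D + r)\<^sup>2"
  proof -
    have "inner (p - core (- 1)) (nrm \<theta> \<phi>) = - ?D" by (subst type_core(2)[OF t]) simp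
    then show ?thesis unfolding f_P type_core(1)[OF t] by (simp add: power2_sum)
  qed
  have "f y \<le> f (P \<theta> \<phi>)" if "y \<in> T" for y
  proof -
    obtain \<alpha> \<beta> where y: "y = P \<alpha> \<beta>" using \<open>y \<in> T\<close> torus_iff by blast
    have "(norm (p - R *\<^sub>R hor \<beta>))\<^sup>2 \<le> ?D\<^sup>2"
      using mult_left_mono[OF inner_hor_le(2)[of \<beta>], of R] type_core(4)[OF t] r
      unfolding type_core(1)[OF t, symmetric] core_dist by simp
    then have "norm (p - R *\<^sub>R hor \<beta>) \<le> ?D" by (rule power2_le_imp_le) simp
    then have "norm (y - p) \<le> ?D + r" using norm_P(2)[of \<alpha> \<beta>] unfolding y by simp
    then show ?thesis unfolding v unfolding f_def by (intro power_mono) auto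
  qed
  then show ?thesis using index_maximum[OF c] unfolding type_pt[OF t] by blast
qed

lemma critical_points_torus:
  obtains m s s' M where "critical_points T f = {m, s, s', M}" "s \<noteq> s'"
    "morse_index T f m = 0" "morse_index T f s = 1" "morse_index T f s' = 1" "morse_index T f M = 2"
proof (rule that)
  show "critical_points T f = {pt 1 1, pt 1 (- 1), pt (- 1) 1, pt (- 1) (- 1)}" using crit_types unfolding crit_eq .
  obtain \<theta> \<phi> \<theta>' \<phi>' where t: "type 1 (- 1) \<theta> \<phi>" "type (- 1) 1 \<theta>' \<phi>'"
    using type_exists[of 1 "- 1"] type_exists[of "- 1" 1] by blast
  have i: "inner p (P \<theta> \<phi>) = (R + r * cos \<theta>) * (c * rad p) + r * sin \<theta> * inner p ver" if "type c s \<theta> \<phi>" for c s \<theta> \<phi>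
    unfolding P_eq type_core(4)[OF that, symmetric] by (simp add: inner_simps)
  show "pt 1 (- 1) \<noteq> pt (- 1) 1"
  proof
    assume "pt 1 (- 1) = pt (- 1) 1"
    then have eq: "P \<theta> \<phi> = P \<theta>' \<phi>'" unfolding type_pt[OF t(1)] type_pt[OF t(2)] .
    have s: "r * sin \<theta> = r * sin \<theta>'" using arg_cong[OF eq, of "\<lambda>v. v $ 3"] unfolding nth_P .
    have "(R + r * cos \<theta>) * (1 * rad p) + r * sin \<theta> * inner p ver = (R + r * cos \<theta>') * (- 1 * rad p) + r * sin \<theta>' * inner p ver"
      using eq i[OF t(1)] i[OF t(2)] by simp
    then have "(R + r * cos \<theta>) * rad p + (R + r * cos \<theta>') * rad p = 0" unfolding s by simp
    then show False using pos[of \<theta>] pos[of \<theta>'] type_core(5)[OF t(1)] by (metis add_pos_pos less_irrefl mult_pos_pos)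
  qed
  show "morse_index T f (pt 1 (- 1)) = 1" "morse_index T f (pt (- 1) 1) = 1"
    using saddle_index[OF t(1)] saddle_index[OF t(2)] by simp_all
  show "morse_index T f (pt 1 1) = 0" using type_exists[of 1 1] minimum_index by blast
  show "morse_index T f (pt (- 1) (- 1)) = 2" using type_exists[of "- 1" "- 1"] maximum_index by blast
qed

end

lemma critical_points_Times:
  assumes "\<And>x. (f has_derivative inner (f' x)) (at x)" "\<And>y. (g has_derivative inner (g' y)) (at y)"
  shows "critical_points (A \<times> B) (\<lambda>(x, y). f x + g y) = critical_points A f \<times> critical_points B g"
proof -
  have d: "((\<lambda>(x, y). f x + g y) has_derivative inner ((\<lambda>(x, y). (f' x, g' y)) z)) (at z)" for z
  proof -
    have "((\<lambda>z. f (fst z)) has_derivative (\<lambda>h. inner (f' (fst z)) (fst h))) (at z)"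
      by (rule has_derivative_compose[OF has_derivative_fst[OF has_derivative_ident] assms(1)])
    moreover have "((\<lambda>z. g (snd z)) has_derivative (\<lambda>h. inner (g' (snd z)) (snd h))) (at z)"
      by (rule has_derivative_compose[OF has_derivative_snd[OF has_derivative_ident] assms(2)])
    ultimately have "((\<lambda>z. f (fst z) + g (snd z)) has_derivative (\<lambda>h. inner (f' (fst z)) (fst h) + inner (g' (snd z)) (snd h))) (at z)"
      by (rule has_derivative_add)
    moreover have "inner ((\<lambda>(x, y). (f' x, g' y)) z) = (\<lambda>h. inner (f' (fst z)) (fst h) + inner (g' (snd z)) (snd h))"
      by (simp add: fun_eq_iff inner_prod_def case_prod_beta)
    moreover have "(\<lambda>(x, y). f x + g y) = (\<lambda>z. f (fst z) + g (snd z))" by (simp add: fun_eq_iff)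
    ultimately show ?thesis by (simp only:)
  qed
  show ?thesis
    unfolding critical_points_eq[OF d] critical_points_eq[OF assms(1)] critical_points_eq[OF assms(2)]
  proof (intro Set.set_eqI iffI; clarsimp simp: tangent_space_Times)
    fix x y assume *: "x \<in> A" "y \<in> B"
      "\<forall>v\<in>tangent_space A x. \<forall>w\<in>tangent_space B y. inner (f' x) v + inner (g' y) w = 0"
    have "inner (f' x) v = 0" if "v \<in> tangent_space A x" for v
      using *(3) that zero_in_tangent_space[OF *(2)] by force
    moreover have "inner (g' y) w = 0" if "w \<in> tangent_space B y" for w
      using *(3) that zero_in_tangent_space[OF *(1)] by force
    ultimately show "(\<forall>v\<in>tangent_space A x. inner (f' x) v = 0) \<and> (\<forall>w\<in>tangent_space B y. inner (g' y) w = 0)" by blast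
  qed
qed

lemma morse_index_Times:
  fixes A :: "'a::euclidean_space set" and B :: "'b::euclidean_space set"
  assumes "adapted_pseudo_gradient A f X" "a \<in> critical_points A f"
    and "adapted_pseudo_gradient B g Y" "b \<in> critical_points B g"
  shows "morse_index (A \<times> B) (\<lambda>(x, y). f x + g y) (a, b) = morse_index A f a + morse_index B g b"
proof -
  obtain V :: "'a set" and Em Ep \<psi> U \<phi> where 1: "flow_chart A f X a V Em Ep \<psi> U \<phi>"
    using adapted_flow_chart[OF assms(1,2)] by blast
  obtain V' :: "'b set" and Em' Ep' \<psi>' U' \<phi>' where 2: "flow_chart B g Y b V' Em' Ep' \<psi>' U' \<phi>'"
    using adapted_flow_chart[OF assms(3,4)] by blast
  interpret C1: flow_chart A f X a V Em Ep \<psi> U \<phi> by (rule 1)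
  interpret C2: flow_chart B g Y b V' Em' Ep' \<psi>' U' \<phi>' by (rule 2)
  have "morse_index (A \<times> B) (\<lambda>(x, y). f x + g y) (a, b) = dim (Em \<times> Em')"
    by (rule morse_chart_at.morse_index_eq[OF morse_chart_Times[OF C1.morse_chart_at_axioms C2.morse_chart_at_axioms]])
  then show ?thesis unfolding C1.morse_index_eq C2.morse_index_eq dim_Times[OF C1.sub(1) C2.sub(1)] .
qed

theorem mainTheorem3:
  fixes R r :: real and p :: "real ^ 3"
    and X1 X2 :: "real ^ 3 \<Rightarrow> real ^ 3"
    and \<omega> :: "(real ^ 3) \<times> (real ^ 3) \<Rightarrow> (real ^ 3) \<times> (real ^ 3) \<Rightarrow> ((real ^ 3) \<times> (real ^ 3)) list \<Rightarrow> int"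
    and k :: int
  defines "S2 \<equiv> standard_sphere" and "T2 \<equiv> standard_torus R r"
    and "f1 \<equiv> \<lambda>x. (norm (x - p))\<^sup>2" and "f2 \<equiv> \<lambda>y. (norm (y - p))\<^sup>2"
  defines "f \<equiv> \<lambda>(x, y). f1 x + f2 y" and "X \<equiv> \<lambda>(x, y). (X1 x, X2 y)"
  assumes "0 < r" and "r < R"
    and "p \<notin> S2 \<union> inside S2" and "p \<notin> T2 \<union> inside T2"
    and "morse_function S2 f1" and "morse_function T2 f2"
    and "adapted_pseudo_gradient S2 f1 X1" and "smale_condition S2 f1 X1"
    and "adapted_pseudo_gradient T2 f2 X2" and "smale_condition T2 f2 X2"
    and "\<forall>\<xi>\<in>critical_points (S2 \<times> T2) f.
           manifold_orientation (unstable_manifold (S2 \<times> T2) X \<xi>) (\<omega> \<xi>)"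
  shows "(k \<in> {0, 4} \<longrightarrow>
            morse_homology (S2 \<times> T2) f X \<omega> k \<cong> tensor_product integer_group integer_group) \<and>
         (k \<in> {1, 2, 3} \<longrightarrow>
            morse_homology (S2 \<times> T2) f X \<omega> k \<cong>
              tensor_product integer_group integer_group \<times>\<times>
              tensor_product integer_group integer_group) \<and>
         (k \<notin> {0, 1, 2, 3, 4} \<longrightarrow> trivial_group (morse_homology (S2 \<times> T2) f X \<omega> k))"
proof -
  interpret T: torus_distance R r p X2
    using assms unfolding T2_def f2_def by unfold_locales auto
  have S2: "S2 = sphere 0 1" unfolding S2_def standard_sphere_def ..
  have f: "(f1 has_derivative inner (2 *\<^sub>R (x - p))) (at x)" "(f2 has_derivative inner (2 *\<^sub>R (x - p))) (at x)" for x
    unfolding f1_def f2_def by (rule derivative_norm_square)+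
  have f2: "T.f = f2" unfolding f2_def T.f_def[abs_def] ..
  obtain a c where a: "surface_flow S2 f1 (\<lambda>x. 2 *\<^sub>R (x - p)) X1 (\<lambda>x. x)" "critical_points S2 f1 = {a, c}"
    "morse_index S2 f1 a = 0" "morse_index S2 f1 c = 2"
    using sphere_critical_points[of p X1] assms(13,14) unfolding S2 f1_def by metis
  obtain m s s' M where T: "critical_points T2 f2 = {m, s, s', M}" "s \<noteq> s'"
    "morse_index T2 f2 m = 0" "morse_index T2 f2 s = 1" "morse_index T2 f2 s' = 1" "morse_index T2 f2 M = 2"
    using T.critical_points_torus unfolding f2 T2_def by metis
  have ad: "adapted_pseudo_gradient S2 f1 X1" "adapted_pseudo_gradient T2 f2 X2" by fact+
  interpret S1: surface_flow S2 f1 "\<lambda>x. 2 *\<^sub>R (x - p)" X1 "\<lambda>x. x" by (rule a(1))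
  interpret S2: surface_flow T2 f2 "\<lambda>x. 2 *\<^sub>R (x - p)" X2 T.N using T.surface_flow unfolding f2 T2_def .
  have crit: "S1.crit = {a, c}" "S2.crit = {m, s, s', M}"
    unfolding S1.crit_def S2.crit_def a(2)[symmetric] T(1)[symmetric]
    unfolding adapted_critical_points[OF ad(1) f(1)] adapted_critical_points[OF ad(2) f(2)] by (rule refl)+
  have e: "continuous_on T2 T.e" "\<And>y. y \<in> T2 \<Longrightarrow> norm (T.e y) = 1" "\<And>y. y \<in> T2 \<Longrightarrow> inner (T.N y) (T.e y) = 0"
    unfolding T2_def using T.continuous_e by (auto simp: T.torus_iff T.e_P T.N_P)
  interpret SP: surface_product S2 f1 "\<lambda>x. 2 *\<^sub>R (x - p)" X1 "\<lambda>x. x" T2 f2 "\<lambda>x. 2 *\<^sub>R (x - p)" X2 T.N T.e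
    by (unfold_locales; (unfold crit)?) (use a T e in auto)
  have X: "X = SP.X" unfolding X_def SP.X_def ..
  have C: "critical_points (S2 \<times> T2) f = {a, c} \<times> {m, s, s', M}"
    unfolding f_def critical_points_Times[OF f] a(2) T(1) ..
  have I: "morse_index (S2 \<times> T2) f (x, y) = morse_index S2 f1 x + morse_index T2 f2 y" if "x \<in> {a, c}" "y \<in> {m, s, s', M}" for x y
    unfolding f_def by (rule morse_index_Times[OF ad(1) _ ad(2)]) (use that a(2) T(1) in blast)+
  have zero: "flow_line_count (S2 \<times> T2) X \<omega> \<xi> \<gamma> = 0"
    if "\<xi> \<in> crit_index (S2 \<times> T2) f j" "\<gamma> \<in> crit_index (S2 \<times> T2) f (j - 1)" for j \<xi> \<gamma>
  proof -
    obtain x y x' y' where xy: "\<xi> = (x, y)" "\<gamma> = (x', y')" by (metis prod.exhaust)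
    have in_C: "x \<in> {a, c}" "y \<in> {m, s, s', M}" "x' \<in> {a, c}" "y' \<in> {m, s, s', M}"
      using that unfolding xy crit_index_def C by blast+
    have "int (morse_index (S2 \<times> T2) f (x, y)) = int (morse_index (S2 \<times> T2) f (x', y')) + 1"
      using that unfolding xy crit_index_def by simp
    then have sum: "morse_index S2 f1 x + morse_index T2 f2 y = morse_index S2 f1 x' + morse_index T2 f2 y' + 1"
      unfolding I[OF in_C(1,2)] I[OF in_C(3,4)] by linarith
    show ?thesis unfolding xy X
    proof (rule SP.flow_line_count_eq_0[OF _ _ _ _ _ sum])
      show "manifold_orientation (unstable_manifold (S2 \<times> T2) SP.X (x, y)) (\<omega> (x, y))" if "x \<in> S1.crit" "y \<in> S2.crit" for x y
        using assms(17) that unfolding X[symmetric] C crit by blast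
    qed (use in_C crit in blast)+
  qed
  have CI: "crit_index (S2 \<times> T2) f k = {(x, y). x \<in> {a, c} \<and> y \<in> {m, s, s', M} \<and> int (morse_index S2 f1 x + morse_index T2 f2 y) = k}"
    unfolding crit_index_def C using I by auto
  have ne: "a \<noteq> c" "m \<noteq> s" "m \<noteq> s'" "M \<noteq> s" "M \<noteq> s'" "m \<noteq> M" using a T by auto
  have 1: "k \<in> {0, 4} \<Longrightarrow> card (crit_index (S2 \<times> T2) f k) = 1"
  proof -
    assume "k \<in> {0, 4}"
    then have "crit_index (S2 \<times> T2) f k = (if k = 0 then {(a, m)} else {(c, M)})" unfolding CI using a T ne by auto
    then show ?thesis by simp
  qed
  have 2: "k \<in> {1, 2, 3} \<Longrightarrow> card (crit_index (S2 \<times> T2) f k) = 2"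
  proof -
    assume "k \<in> {1, 2, 3}"
    then have "crit_index (S2 \<times> T2) f k = (if k = 1 then {(a, s), (a, s')} else if k = 2 then {(a, M), (c, m)} else {(c, s), (c, s')})"
      unfolding CI using a T ne by auto
    then show ?thesis using ne T(2) by simp
  qed
  have 3: "k \<notin> {0, 1, 2, 3, 4} \<Longrightarrow> crit_index (S2 \<times> T2) f k = {}" unfolding CI using a T by auto
  show ?thesis
    by (intro conjI impI; rule morse_homology_ranks; (rule zero, assumption+)?; erule 1 2 3)
qed

end
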